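(* For all $k \geq 1$, the product $h_0 h_2 \cdot h_2 g^k$ in degree $(20k+6, 4k+3, 12k+4)$ is non-zero in $H^{***}\mathcal{A}$.
   Context: Let $\mathcal{A}$ be the $\mathbb{C}$-motivic mod $2$ Steenrod algebra; $H^{***}\mathcal{A} = \mathrm{Ext}_{\mathcal{A}}(\mathbb{F}_2[\tau],\mathbb{F}_2[\tau])$ is its cohomology, graded by $(s,f,w)$ = (stem, Adams filtration, motivic weight). The Chow degree is $s+f-2w$. The elements $h_0$ and $h_j$ ($j\geq 1$) are the standard generators in degrees $(0,1,0)$ and $(2^j-1,1,2^{j-1})$. Let $H^{**}\mathcal{A}^{\mathrm{cl}}$ be the cohomology of the classical mod $2$ Steenrod algebra, graded by (stem, Adams filtration). There is an isomorphism from $H^{**}\mathcal{A}^{\mathrm{cl}}$ to the part of $H^{***}\mathcal{A}$ in Chow degree zero, compatible with products, squaring operations, and Massey products, taking degree $(s,f)$ to degree $(2s+f,f,s+f)$ and taking $h_j$ to $h_{j+1}$. Under it, $h_2g^k$ in degree $(20k+3,4k+1,12k+2)$ is the element corresponding to $P^kh_1$, where $P^k$ is the $k$-fold iterate of the classical Adams periodicity operator $P$ of degree $(8,4)$. *)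

theory Defs
  imports
    "HOL-Library.Poly_Mapping"
    "HOL-Library.Z2"
    "HOL-Library.Product_Plus"
begin

section \<open>Polynomials over the field with two elements\<close>

type_synonym 'v fpoly = "('v \<Rightarrow>\<^sub>0 nat) \<Rightarrow>\<^sub>0 bit"

definition pvar :: "'v \<Rightarrow> 'v fpoly" where
  "pvar v = Poly_Mapping.single (Poly_Mapping.single v 1) 1"

text \<open>The algebra homomorphism determined by the images of the variables.\<close>

definition psubst :: "('v \<Rightarrow> 'w fpoly) \<Rightarrow> 'v fpoly \<Rightarrow> 'w fpoly" where
  "psubst \<sigma> p =
     (\<Sum>m\<in>Poly_Mapping.keys p. Poly_Mapping.single 0 (Poly_Mapping.lookup p m) *
        (\<Prod>v\<in>Poly_Mapping.keys m. \<sigma> v ^ Poly_Mapping.lookup m v))"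

definition mdegree :: "('v \<Rightarrow> 'g::comm_monoid_add) \<Rightarrow> ('v \<Rightarrow>\<^sub>0 nat) \<Rightarrow> 'g" where
  "mdegree deg m = (\<Sum>v\<in>Poly_Mapping.keys m. \<Sum>_<Poly_Mapping.lookup m v. deg v)"

text \<open>Written \<open>\<Sum>\<^sub>r c\<^sub>r r\<close> over a finite set of generators.\<close>

definition ideal_generated :: "'r::comm_ring_1 set \<Rightarrow> 'r set" where
  "ideal_generated R = {\<Sum>r\<in>F. c r * r | F c. finite F \<and> F \<subseteq> R}"


section \<open>Cohomology of a commutative Hopf algebra by the cobar complex\<close>

text \<open>
  A graded commutative (in characteristic 2) Hopf algebra \<open>\<Gamma>\<close> over a polynomial ring
  \<open>K = F\<^sub>2[scalars]\<close>, given by algebra generators over \<open>K\<close>, relations, internal degrees and the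
  coproduct on generators.  Left and right unit \<open>K \<rightarrow> \<Gamma>\<close> agree, and all tensor powers are formed
  over \<open>K\<close>.  When \<open>\<Gamma>\<close> is free of finite type over \<open>K\<close> with dual algebra \<open>A\<close>, the cobar complex of \<open>\<Gamma>\<close>
  is the complex of (sums of homogeneous) \<open>A\<close>-linear maps from the unnormalized bar resolution
  of \<open>K\<close> over \<open>A\<close> to \<open>K\<close>, so its cohomology is \<open>Ext\<^sub>A(K, K)\<close>, with concatenation of cochains as the
  product.

  The \<open>f\<close>-fold tensor power of \<open>\<Gamma>\<close> over \<open>K\<close> is again a polynomial ring modulo relations:
  \<open>Factor p a\<close> stands for \<open>1 \<otimes> \<dots> \<otimes> a \<otimes> \<dots> \<otimes> 1\<close> with \<open>a\<close> in the tensor factor number \<open>p\<close>,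
  where factors are numbered from \<open>0\<close> to \<open>f - 1\<close>.  Relations are written in factor \<open>0\<close>,
  coproducts in factors \<open>0\<close> and \<open>1\<close>.
\<close>

datatype ('s, 'a) tvar = Scalar 's | Factor nat 'a

record ('s, 'a, 'g) hopf =
  scalars :: "'s set"
  gens :: "'a set"
  rels :: "('s, 'a) tvar fpoly set"
  sdeg :: "'s \<Rightarrow> 'g"
  gdeg :: "'a \<Rightarrow> 'g"
  coprod :: "'a \<Rightarrow> ('s, 'a) tvar fpoly"

fun vdeg :: "('s, 'a, 'g) hopf \<Rightarrow> ('s, 'a) tvar \<Rightarrow> 'g" where
  "vdeg H (Scalar s) = sdeg H s"
| "vdeg H (Factor p a) = gdeg H a"

fun shift_var :: "nat \<Rightarrow> ('s, 'a) tvar \<Rightarrow> ('s, 'a) tvar fpoly" where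
  "shift_var n (Scalar s) = pvar (Scalar s)"
| "shift_var n (Factor p a) = pvar (Factor (n + p) a)"

text \<open>
  Representatives of the homogeneous elements of internal degree \<open>t\<close> in the \<open>f\<close>-fold tensor
  power, and the ideal of polynomials representing zero there.
\<close>

definition cochains :: "('s, 'a, 'g::comm_monoid_add) hopf \<Rightarrow> nat \<Rightarrow> 'g \<Rightarrow> ('s, 'a) tvar fpoly set" where
  "cochains H f t = {x. \<forall>m\<in>Poly_Mapping.keys x.
     Poly_Mapping.keys m \<subseteq> Scalar ` scalars H \<union> {Factor p a | p a. p < f \<and> a \<in> gens H} \<and>
     mdegree (vdeg H) m = t}"

definition null :: "('s, 'a, 'g) hopf \<Rightarrow> nat \<Rightarrow> ('s, 'a) tvar fpoly set" where
  "null H f = ideal_generated {psubst (shift_var p) r | p r. p < f \<and> r \<in> rels H}"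

text \<open>
  The cobar differential is the alternating (here: unsigned) sum of the maps \<open>\<delta>\<^sup>0, \<dots>, \<delta>\<^sup>f\<^sup>+\<^sup>1\<close>
  from the \<open>f\<close>-fold to the \<open>(f+1)\<close>-fold tensor power: \<open>\<delta>\<^sup>0 x = 1 \<otimes> x\<close>, \<open>\<delta>\<^sup>f\<^sup>+\<^sup>1 x = x \<otimes> 1\<close>, and for
  \<open>1 \<le> i \<le> f\<close> the map \<open>\<delta>\<^sup>i\<close> applies the coproduct to the \<open>i\<close>-th factor, which has number \<open>i - 1\<close>.
\<close>

fun coface_var :: "('s, 'a, 'g) hopf \<Rightarrow> nat \<Rightarrow> ('s, 'a) tvar \<Rightarrow> ('s, 'a) tvar fpoly" where
  "coface_var H i (Scalar s) = pvar (Scalar s)"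
| "coface_var H i (Factor p a) =
     (if p + 1 < i then pvar (Factor p a)
      else if p + 1 = i then psubst (shift_var p) (coprod H a)
      else pvar (Factor (p + 1) a))"

definition cobar_d :: "('s, 'a, 'g) hopf \<Rightarrow> nat \<Rightarrow> ('s, 'a) tvar fpoly \<Rightarrow> ('s, 'a) tvar fpoly" where
  "cobar_d H f x = (\<Sum>i\<le>f + 1. psubst (coface_var H i) x)"

text \<open>Concatenation \<open>x \<otimes> y\<close>, for \<open>x\<close> in the \<open>f\<close>-fold tensor power.\<close>

definition cup :: "nat \<Rightarrow> ('s, 'a) tvar fpoly \<Rightarrow> ('s, 'a) tvar fpoly \<Rightarrow> ('s, 'a) tvar fpoly" where
  "cup f x y = x * psubst (shift_var f) y"

definition cocycles :: "('s, 'a, 'g::comm_monoid_add) hopf \<Rightarrow> nat \<Rightarrow> 'g \<Rightarrow> ('s, 'a) tvar fpoly set" where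
  "cocycles H f t = {z \<in> cochains H f t. cobar_d H f z \<in> null H (f + 1)}"

definition coboundaries :: "('s, 'a, 'g::comm_monoid_add) hopf \<Rightarrow> nat \<Rightarrow> 'g \<Rightarrow> ('s, 'a) tvar fpoly set" where
  "coboundaries H f t = {z \<in> cochains H f t.
     case f of 0 \<Rightarrow> z \<in> null H 0
     | Suc e \<Rightarrow> \<exists>y\<in>cochains H e t. z - cobar_d H e y \<in> null H f}"

text \<open>
  A homogeneous cohomology class is a triple of its cohomological degree (Adams filtration)
  \<open>f\<close>, its internal degree \<open>t\<close>, and a coset of the coboundaries in the cocycles.
\<close>

type_synonym ('s, 'a, 'g) ext = "nat \<times> 'g \<times> ('s, 'a) tvar fpoly set"

definition ext_class ::
  "('s, 'a, 'g::comm_monoid_add) hopf \<Rightarrow> nat \<Rightarrow> 'g \<Rightarrow> ('s, 'a) tvar fpoly \<Rightarrow> ('s, 'a, 'g) ext" where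
  "ext_class H f t z = (f, t, {z' \<in> cochains H f t. z' - z \<in> coboundaries H f t})"

definition ext_group :: "('s, 'a, 'g::comm_monoid_add) hopf \<Rightarrow> nat \<Rightarrow> 'g \<Rightarrow> ('s, 'a, 'g) ext set" where
  "ext_group H f t = ext_class H f t ` cocycles H f t"

fun ext_mult :: "('s, 'a, 'g::comm_monoid_add) hopf \<Rightarrow> ('s, 'a, 'g) ext \<Rightarrow> ('s, 'a, 'g) ext \<Rightarrow> ('s, 'a, 'g) ext" where
  "ext_mult H (f, t, a) (g, u, b) =
     (f + g, t + u, {z \<in> cochains H (f + g) (t + u).
        \<exists>x\<in>a. \<exists>y\<in>b. z - cup f x y \<in> coboundaries H (f + g) (t + u)})"

text \<open>
  The Massey product \<open>\<langle>a, b, c\<rangle>\<close> as the set of all its values; it is nonempty only if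
  \<open>a b = 0 = b c\<close>.  All filtrations are assumed to be positive.
\<close>

fun massey ::
  "('s, 'a, 'g::comm_monoid_add) hopf \<Rightarrow> ('s, 'a, 'g) ext \<Rightarrow> ('s, 'a, 'g) ext \<Rightarrow> ('s, 'a, 'g) ext
     \<Rightarrow> ('s, 'a, 'g) ext set" where
  "massey H (f, t, a) (g, u, b) (h, v, c) =
     {ext_class H (f + g + h - 1) (t + u + v) (cup (f + g - 1) p z + cup f x q) | x y z p q.
        x \<in> a \<and> y \<in> b \<and> z \<in> c \<and>
        p \<in> cochains H (f + g - 1) (t + u) \<and> cobar_d H (f + g - 1) p - cup f x y \<in> null H (f + g) \<and>
        q \<in> cochains H (g + h - 1) (u + v) \<and> cobar_d H (g + h - 1) q - cup g y z \<in> null H (g + h)}"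


section \<open>The classical Steenrod algebra\<close>

text \<open>
  Milnor's dual Steenrod algebra \<open>F\<^sub>2[\<xi>\<^sub>1, \<xi>\<^sub>2, \<dots>]\<close> with
  \<open>\<Delta>(\<xi>\<^sub>n) = \<Sum>\<^sub>k \<xi>\<^sub>n\<^sub>-\<^sub>k\<^bsup>2^k\<^esup> \<otimes> \<xi>\<^sub>k\<close>, \<open>\<xi>\<^sub>0 = 1\<close>.  There are no scalar variables; \<^typ>\<open>unit\<close> only fills the
  type argument.
\<close>

definition cl_xi :: "nat \<Rightarrow> nat \<Rightarrow> (unit, nat) tvar fpoly" where
  "cl_xi p n = (if n = 0 then 1 else pvar (Factor p n))"

definition cl_steenrod :: "(unit, nat, int) hopf" where
  "cl_steenrod = \<lparr>
     scalars = {},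
     gens = {1..},
     rels = {},
     sdeg = (\<lambda>_. 0),
     gdeg = (\<lambda>n. 2 ^ n - 1),
     coprod = (\<lambda>n. \<Sum>k\<le>n. cl_xi 0 (n - k) ^ (2 ^ k) * cl_xi 1 k)\<rparr>"

definition cl_h :: "nat \<Rightarrow> (unit, nat, int) ext" where
  "cl_h j = ext_class cl_steenrod 1 (2 ^ j) (cl_xi 0 1 ^ (2 ^ j))"

definition cl_h0_4 :: "(unit, nat, int) ext" where
  "cl_h0_4 = ext_mult cl_steenrod (cl_h 0)
     (ext_mult cl_steenrod (cl_h 0) (ext_mult cl_steenrod (cl_h 0) (cl_h 0)))"

text \<open>
  The Adams periodicity operator \<open>P x = \<langle>x, h\<^sub>0\<^sup>4, h\<^sub>3\<rangle>\<close>, as an element whenever the Massey product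
  is defined and has no indeterminacy.  This is the case along the iterates \<open>P\<^sup>k h\<^sub>1\<close>: the
  indeterminacy of \<open>P (P\<^sup>k h\<^sub>1)\<close> is \<open>P\<^sup>k h\<^sub>1\<close> times the group in (stem, filtration) \<open>(8, 4)\<close> plus
  \<open>h\<^sub>3\<close> times the group in \<open>(8k+2, 4k+4)\<close>, and both groups vanish.
\<close>

definition adams_P :: "(unit, nat, int) ext \<Rightarrow> (unit, nat, int) ext" where
  "adams_P x = (THE y. massey cl_steenrod x cl_h0_4 (cl_h 3) = {y})"


section \<open>The motivic Steenrod algebra over the complex numbers\<close>

text \<open>
  Voevodsky's dual motivic Steenrod algebra
  \<open>F\<^sub>2[\<tau>][\<tau>\<^sub>0, \<tau>\<^sub>1, \<dots>, \<xi>\<^sub>1, \<xi>\<^sub>2, \<dots>] / (\<tau>\<^sub>n\<^sup>2 = \<tau> \<xi>\<^sub>n\<^sub>+\<^sub>1)\<close> with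
  \<open>\<Delta>(\<xi>\<^sub>n) = \<Sum>\<^sub>k \<xi>\<^sub>n\<^sub>-\<^sub>k\<^bsup>2^k\<^esup> \<otimes> \<xi>\<^sub>k\<close> and \<open>\<Delta>(\<tau>\<^sub>n) = \<tau>\<^sub>n \<otimes> 1 + \<Sum>\<^sub>k \<xi>\<^sub>n\<^sub>-\<^sub>k\<^bsup>2^k\<^esup> \<otimes> \<tau>\<^sub>k\<close>.
  Degrees are pairs (internal degree, weight), with \<open>\<tau>\<close> in its homological degree \<open>(0, -1)\<close>.
\<close>

datatype mgen = Tau nat | Xi nat

definition mot_xi :: "nat \<Rightarrow> nat \<Rightarrow> (unit, mgen) tvar fpoly" where
  "mot_xi p n = (if n = 0 then 1 else pvar (Factor p (Xi n)))"

definition mot_tau :: "nat \<Rightarrow> nat \<Rightarrow> (unit, mgen) tvar fpoly" where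
  "mot_tau p n = pvar (Factor p (Tau n))"

fun mot_gdeg :: "mgen \<Rightarrow> int \<times> int" where
  "mot_gdeg (Tau n) = (2 ^ (n + 1) - 1, 2 ^ n - 1)"
| "mot_gdeg (Xi n) = (2 ^ (n + 1) - 2, 2 ^ n - 1)"

fun mot_coprod :: "mgen \<Rightarrow> (unit, mgen) tvar fpoly" where
  "mot_coprod (Tau n) = mot_tau 0 n + (\<Sum>k\<le>n. mot_xi 0 (n - k) ^ (2 ^ k) * mot_tau 1 k)"
| "mot_coprod (Xi n) = (\<Sum>k\<le>n. mot_xi 0 (n - k) ^ (2 ^ k) * mot_xi 1 k)"

definition mot_steenrod :: "(unit, mgen, int \<times> int) hopf" where
  "mot_steenrod = \<lparr>
     scalars = {()},
     gens = range Tau \<union> Xi ` {1..},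
     rels = {mot_tau 0 n ^ 2 - pvar (Scalar ()) * mot_xi 0 (n + 1) | n. True},
     sdeg = (\<lambda>_. (0, -1)),
     gdeg = mot_gdeg,
     coprod = mot_coprod\<rparr>"

text \<open>Grading by (stem, Adams filtration, weight), where stem = internal degree - filtration.\<close>

definition mot_ext :: "int \<Rightarrow> nat \<Rightarrow> int \<Rightarrow> (unit, mgen, int \<times> int) ext set" where
  "mot_ext s f w = ext_group mot_steenrod f (s + int f, w)"

definition mot_zero :: "int \<Rightarrow> nat \<Rightarrow> int \<Rightarrow> (unit, mgen, int \<times> int) ext" where
  "mot_zero s f w = ext_class mot_steenrod f (s + int f, w) 0"

abbreviation mot_mult (infixl "\<odot>" 70) where
  "x \<odot> y \<equiv> ext_mult mot_steenrod x y"

definition mot_h :: "nat \<Rightarrow> (unit, mgen, int \<times> int) ext" where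
  "mot_h j = (if j = 0 then ext_class mot_steenrod 1 (1, 0) (mot_tau 0 0)
     else ext_class mot_steenrod 1 (2 ^ j, 2 ^ (j - 1)) (mot_xi 0 1 ^ (2 ^ (j - 1))))"

text \<open>
  The isomorphism from classical cohomology onto the Chow degree zero part.  A monomial of
  internal degree \<open>t\<close> and weight \<open>w\<close> has Chow degree \<open>t - 2w\<close>, which is \<open>0\<close> for \<open>\<xi>\<^sub>n\<close>, \<open>1\<close> for \<open>\<tau>\<^sub>n\<close>
  and \<open>2\<close> for \<open>\<tau>\<close>.  Hence the Chow degree zero part of the motivic cobar complex is the classical
  cobar complex on the motivic \<open>\<xi>\<^sub>n\<close>, and the isomorphism is induced by \<open>\<xi>\<^sub>n \<mapsto> \<xi>\<^sub>n\<close>.  It doubles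
  internal degrees, i.e. takes (stem, filtration) \<open>(s, f)\<close> to \<open>(2s + f, f, s + f)\<close>.
\<close>

fun chow_var :: "(unit, nat) tvar \<Rightarrow> (unit, mgen) tvar fpoly" where
  "chow_var (Scalar u) = pvar (Scalar u)"
| "chow_var (Factor p n) = pvar (Factor p (Xi n))"

fun chow_iso :: "(unit, nat, int) ext \<Rightarrow> (unit, mgen, int \<times> int) ext" where
  "chow_iso (f, t, a) = (f, (2 * t, t), {z \<in> cochains mot_steenrod f (2 * t, t).
     \<exists>x\<in>a. z - psubst chow_var x \<in> coboundaries mot_steenrod f (2 * t, t)})"

definition mot_h2g :: "nat \<Rightarrow> (unit, mgen, int \<times> int) ext" where
  "mot_h2g k = chow_iso ((adams_P ^^ k) (cl_h 1))"

end

theory Submission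
  imports Defs
begin

text \<open>
  The product is \<open>h\<^sub>0\<close> times the image of the classical element \<open>h\<^sub>1 \<cdot> P\<^sup>k h\<^sub>1\<close> under the isomorphism
  onto Chow degree zero.  So the question lives in Chow degree one, where every monomial of the
  motivic cobar complex contains exactly one \<open>\<tau>\<^sub>n\<close> and no \<open>\<tau>\<close>, and where distinct polynomials stay distinct
  modulo the relations, which have Chow degree two (\<open>rigid_mot\<close>).  A contraction of the cofaces beyond a given
  position moves \<open>\<tau>\<^sub>n\<close> to the last tensor factor (\<open>push_tau\<close>).  What remains is the classical cobar complex with
  coefficients in the comodule spanned by \<open>\<tau>\<^sub>0, \<tau>\<^sub>1, \<dots>\<close>, where \<open>\<tau>\<^sub>n\<close> coacts by
  \<open>\<Sum>\<^sub>k \<xi>\<^sub>n\<^sub>-\<^sub>k\<^bsup>2^k\<^esup> \<otimes> \<tau>\<^sub>k\<close>.  If \<open>h\<^sub>0\<close> times the class of \<open>X\<close> vanished, there would be classical cochains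
  \<open>y\<^sub>n\<close> with \<open>X = d y\<^sub>0 + \<Sum>\<^sub>n y\<^sub>n \<otimes> \<xi>\<^sub>n\<close> and similar equations for the \<open>d y\<^sub>n\<close>.  For
  \<open>X = h\<^sub>1 P\<^sup>k h\<^sub>1\<close> the \<open>y\<^sub>n\<close> with \<open>n \<ge> 2\<close> lie in bidegrees where the classical cohomology vanishes and can be
  removed from the top, which leaves \<open>X\<close> cohomologous to \<open>y\<^sub>1 h\<^sub>0\<close> for a cocycle \<open>y\<^sub>1\<close> of stem \<open>8k + 2\<close>
  and filtration \<open>4k + 1\<close> (\<open>h0_divisible\<close>).

  This is impossible already over the subalgebra \<open>A(1)\<close> generated by \<open>Sq1\<close> and \<open>Sq2\<close>.  Its
  cohomology is computed by the cobar complex with coefficients in the common kernel \<open>D1\<close> of \<open>Sq1\<close>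
  and \<open>Sq2\<close> on the dual Steenrod algebra \<open>\<Gamma>\<close>, and is four-periodic because of an exact sequence
  \<open>0 \<rightarrow> D1 \<rightarrow> D \<rightarrow> \<Gamma> \<rightarrow> \<Gamma> \<rightarrow> D \<rightarrow> D1 \<rightarrow> 0\<close>, where \<open>D\<close> is the kernel of \<open>Sq1\<close> (\<open>periodicity\<close>).
  On the one hand the group that contains \<open>y\<^sub>1\<close> is zero (\<open>exact_KD1_stem_2\<close>).  On the other hand
  \<open>h\<^sub>1 P\<^sup>k h\<^sub>1\<close> stays nonzero (\<open>periodic_h1_nonzero\<close>): over \<open>A(1)\<close> the product \<open>h\<^sub>3 h\<^sub>0\<^sup>4\<close>
  is the coboundary of \<open>\<xi>\<^sub>1\<^sup>8 h\<^sub>0\<^sup>4\<close> as well as of the cochain \<open>q\<close> that enters the Massey product,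
  so that the operator \<open>P\<close> becomes multiplication by the class \<open>\<xi>\<^sub>1\<^sup>8 h\<^sub>0\<^sup>4 + q\<close>.  The connecting
  homomorphisms of that sequence send this class to \<open>1\<close>, hence undo the
  multiplication (\<open>period_mult_injective\<close>).  In \<open>P\<close> the null homotopies multiply from the right, while the coefficients sit on
  the left; reversal of the tensor factors, combined with the antipode, exchanges the two sides.

  The vanishing results for the Steenrod algebra, of which the determinacy of the Massey products
  \<open>\<langle>P\<^sup>k h\<^sub>1, h\<^sub>0\<^sup>4, h\<^sub>3\<rangle>\<close> is a second use, come from the same periodicity.  It gives a vanishing line
  over \<open>A(1)\<close> for coefficients in the Moore comodule \<open>{1, \<xi>\<^sub>1}\<close>.  The comodules \<open>D1\<close>, \<open>D\<close> and \<open>\<Gamma>\<close>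
  are filtered by cells that are shifted copies of small comodules, and attaching the cells one
  after the other transports the line to Moore coefficients over the whole algebra and then to
  trivial coefficients (\<open>EZ_line\<close>, \<open>E_line\<close>, \<open>H_line\<close>, \<open>H_edge\<close>).
\<close>

section \<open>Polynomials over the field with two elements\<close>

abbreviation "keys \<equiv> Poly_Mapping.keys"
abbreviation "lookup \<equiv> Poly_Mapping.lookup"

type_synonym 'v mon = "'v \<Rightarrow>\<^sub>0 nat"

abbreviation mo :: "'v mon \<Rightarrow> 'v fpoly" where
  "mo m \<equiv> Poly_Mapping.single m 1"

lemma fpoly_add_self [simp]: "(p :: 'v fpoly) + p = 0"
proof (rule poly_mapping_eqI)
  fix m
  have "b + b = 0" for b :: bit by (cases b) simp_all
  then show "lookup (p + p) m = lookup 0 m" by (simp only: lookup_add lookup_zero)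
qed

lemma fpoly_add_self_left [simp]: "(p :: 'v fpoly) + (p + q) = q"
  by (simp add: add.assoc[symmetric])

lemma fpoly_uminus [simp]: "- (p :: 'v fpoly) = p"
  using fpoly_add_self[of p] by (metis add_eq_0_iff)

lemma fpoly_diff [simp]: "(p :: 'v fpoly) - q = p + q"
  by (simp only: diff_conv_add_uminus fpoly_uminus)

lemma fpoly_two [simp]: "(2 :: 'v fpoly) = 0"
  using fpoly_add_self[of "1 :: 'v fpoly"] by (simp only: one_add_one)

lemma fpoly_add_eq_0_iff: "(p :: 'v fpoly) + q = 0 \<longleftrightarrow> p = q"
  by (metis add_0_right fpoly_add_self fpoly_add_self_left)

lemma fpoly_square_add: "((p :: 'v fpoly) + q) ^ 2 = p ^ 2 + q ^ 2"
  by (simp add: power2_sum)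

lemma fpoly_frobenius: "((p :: 'v fpoly) + q) ^ (2 ^ k) = p ^ (2 ^ k) + q ^ (2 ^ k)"
proof (induction k)
  case (Suc k)
  have "(r :: 'v fpoly) ^ (2 ^ Suc k) = (r ^ (2 ^ k)) ^ 2" for r
    by (metis power_Suc2 power_mult)
  then show ?case using Suc by (simp add: fpoly_square_add)
qed simp

lemma fpoly_frobenius_sum:
  "(\<Sum>i\<in>I. (p i :: 'v fpoly)) ^ (2 ^ k) = (\<Sum>i\<in>I. p i ^ (2 ^ k))"
  by (induction I rule: infinite_finite_induct) (auto simp: fpoly_frobenius power_0_left)

lemma bit_lookup: "lookup (p :: 'v fpoly) m = (if m \<in> keys p then 1 else 0)"
  by (cases "lookup p m") (auto simp: in_keys_iff)

lemma fpoly_keys_eqI: "keys (p :: 'v fpoly) = keys q \<Longrightarrow> p = q"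
  by (rule poly_mapping_eqI) (simp add: bit_lookup)

lemma fpoly_expand: "(p :: 'v fpoly) = (\<Sum>m\<in>keys p. mo m)"
proof (rule poly_mapping_eqI)
  fix k
  have "lookup (\<Sum>m\<in>keys p. mo m) k = (if k \<in> keys p then 1 else 0)"
    by (simp only: lookup_sum) (simp add: lookup_single when_def)
  then show "lookup p k = lookup (\<Sum>m\<in>keys p. mo m) k" by (simp only: bit_lookup)
qed

lemma mo_mult: "mo m * mo n = mo (m + n)"
  by (simp add: mult_single)

lemma mo_0 [simp]: "mo 0 = 1"
  by simp

lemma fpoly_induct [case_names zero add]:
  assumes "P 0" "\<And>m p. m \<notin> keys p \<Longrightarrow> P p \<Longrightarrow> P (mo m + p)"
  shows "P (p :: 'v fpoly)"
proof -
  have "P (\<Sum>m\<in>A. mo m)" if "finite A" for A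
    using that
  proof (induction A)
    case (insert a A)
    have "keys (\<Sum>m\<in>A. mo m) \<subseteq> A"
      using Poly_Mapping.keys_sum[of mo A] by auto
    then show ?case using insert assms(2) by auto
  qed (simp add: assms)
  then show ?thesis using fpoly_expand[of p] by (metis finite_keys)
qed

lemma mon_induct [case_names zero var add]:
  assumes "P 0" "\<And>v. P (Poly_Mapping.single v (1::nat))" "\<And>m n. P m \<Longrightarrow> P n \<Longrightarrow> P (m + n)"
  shows "P (m :: 'v mon)"
proof -
  have single: "P (Poly_Mapping.single k n)" for k n
  proof (induction n)
    case (Suc n)
    then show ?case using assms(3)[OF assms(2)[of k] Suc] by (simp add: single_add[symmetric])
  qed (use assms in simp)
  have "P m" if "keys m \<subseteq> A" "finite A" for A m
    using that(2,1)
  proof (induction A arbitrary: m rule: finite_induct)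
    case (insert a A)
    define m' where "m' = m - Poly_Mapping.single a (lookup m a)"
    have m: "m = Poly_Mapping.single a (lookup m a) + m'"
      by (rule poly_mapping_eqI) (auto simp: m'_def lookup_add lookup_minus lookup_single when_def)
    have "keys m' \<subseteq> A"
    proof
      fix x assume "x \<in> keys m'"
      then have "x \<in> keys m" "x \<noteq> a"
        by (auto simp: m'_def in_keys_iff lookup_minus lookup_single when_def split: if_splits)
      then show "x \<in> A" using insert.prems by auto
    qed
    then have "P m'" by (rule insert.IH)
    then show ?case using assms(3)[OF single] m by metis
  qed (use assms in auto)
  from this[OF subset_refl finite_keys] show ?thesis .
qed


subsection \<open>Additive maps given on monomials\<close>

definition lin :: "('v mon \<Rightarrow> 'w fpoly) \<Rightarrow> 'v fpoly \<Rightarrow> 'w fpoly" where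
  "lin g p = (\<Sum>m\<in>keys p. g m)"

lemma lin_superset:
  assumes "finite A" "keys p \<subseteq> A"
  shows "lin g p = (\<Sum>m\<in>A. if m \<in> keys p then g m else 0)"
  unfolding lin_def using assms by (intro sum.mono_neutral_cong_left) auto

lemma lin_0 [simp]: "lin g 0 = 0"
  by (simp add: lin_def)

lemma lin_mo [simp]: "lin g (mo m) = g m"
  by (simp add: lin_def)

lemma keys_add_fpoly:
  "keys ((p :: 'v fpoly) + q)
     = (keys p - keys q) \<union> (keys q - keys p)"
proof -
  have "x \<in> keys (p + q) \<longleftrightarrow> (x \<in> keys p) \<noteq> (x \<in> keys q)" for x
    by (subst in_keys_iff, subst lookup_add) (simp add: bit_lookup)
  then show ?thesis by auto
qed

lemma lin_add: "lin g (p + q) = lin g p + lin g q"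
proof -
  let ?A = "keys p \<union> keys q"
  have "lin g (p + q) = (\<Sum>m\<in>?A. if m \<in> keys (p + q) then g m else 0)"
    by (rule lin_superset) (auto simp: keys_add_fpoly)
  also have "\<dots> = (\<Sum>m\<in>?A. (if m \<in> keys p then g m else 0)
                       + (if m \<in> keys q then g m else 0))"
    by (rule sum.cong) (auto simp: keys_add_fpoly)
  also have "\<dots> = lin g p + lin g q"
    by (subst (1 2) lin_superset[of ?A]) (auto simp: sum.distrib)
  finally show ?thesis .
qed

text \<open>An additive map is determined by its values on monomials, and a biadditive identity can be
  checked on them.\<close>

definition additive :: "('a::ab_group_add \<Rightarrow> 'b::ab_group_add) \<Rightarrow> bool" where
  "additive h \<longleftrightarrow> (\<forall>p q. h (p + q) = h p + h q)"

lemma additiveD: "additive h \<Longrightarrow> h (p + q) = h p + h q"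
  by (simp add: additive_def)

lemma additive_0: "additive h \<Longrightarrow> h 0 = 0"
  by (metis add_cancel_right_right additiveD)

lemma additive_sum: "additive h \<Longrightarrow> h (\<Sum>i\<in>I. p i) = (\<Sum>i\<in>I. h (p i))"
  by (induction I rule: infinite_finite_induct) (auto simp: additiveD additive_0)

lemma additive_lin: "additive (lin g)"
  by (simp add: additive_def lin_add)

lemma additive_eqI:
  assumes "additive g" "additive h" "\<And>m. m \<in> keys p \<Longrightarrow> g (mo m) = h (mo m)"
  shows "g (p :: 'v fpoly) = h p"
  using assms(3)
  by (subst (1 2) fpoly_expand[of p], subst additive_sum[OF assms(1)],
      subst additive_sum[OF assms(2)]) (auto intro: sum.cong)

lemma biadditive_eqI:
  fixes F G :: "'v fpoly \<Rightarrow> 'w fpoly \<Rightarrow> 'b::ab_group_add"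
  assumes "\<And>q. additive (\<lambda>p. F p q)" "\<And>p. additive (F p)"
    and "\<And>q. additive (\<lambda>p. G p q)" "\<And>p. additive (G p)"
    and "\<And>m n. F (mo m) (mo n) = G (mo m) (mo n)"
  shows "F p q = G p q"
proof -
  have "F (mo m) q = G (mo m) q" for m
    using additive_eqI[of "F (mo m)" "G (mo m)"] assms by blast
  then show ?thesis
    using additive_eqI[of "\<lambda>p. F p q" "\<lambda>p. G p q"] assms by blast
qed


subsection \<open>Ring homomorphisms\<close>

definition rhom :: "('v fpoly \<Rightarrow> 'w fpoly) \<Rightarrow> bool" where
  "rhom h \<longleftrightarrow> h 1 = 1 \<and> (\<forall>p q. h (p + q) = h p + h q) \<and> (\<forall>p q. h (p * q) = h p * h q)"

lemma rhom_1: "rhom h \<Longrightarrow> h 1 = 1"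
  and rhom_add: "rhom h \<Longrightarrow> h (p + q) = h p + h q"
  and rhom_mult: "rhom h \<Longrightarrow> h (p * q) = h p * h q"
  by (auto simp: rhom_def)

lemma rhom_additive: "rhom h \<Longrightarrow> additive h"
  by (simp add: additive_def rhom_add)

lemmas rhom_0 = additive_0[OF rhom_additive]
lemmas rhom_sum = additive_sum[OF rhom_additive]

lemma rhom_power: "rhom h \<Longrightarrow> h (p ^ n) = h p ^ n"
  by (induction n) (auto simp: rhom_1 rhom_mult)

lemma rhom_comp: "rhom g \<Longrightarrow> rhom h \<Longrightarrow> rhom (\<lambda>p. g (h p))"
  by (auto simp: rhom_def)

lemma rhom_id: "rhom (\<lambda>p. p)"
  by (auto simp: rhom_def)

lemma mo_var: "mo (Poly_Mapping.single v 1) = pvar v"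
  by (simp add: pvar_def)

lemma mo_single: "mo (Poly_Mapping.single v n) = pvar v ^ n"
proof (induction n)
  case (Suc n)
  have "Poly_Mapping.single v (Suc n) = Poly_Mapping.single v 1 + Poly_Mapping.single v n"
    by (simp flip: single_add)
  then show ?case using Suc by (simp only: mo_mult[symmetric] mo_var power_Suc)
qed simp

definition vars_in :: "'v set \<Rightarrow> 'v fpoly set" where
  "vars_in V = {p. \<forall>m\<in>keys p. keys m \<subseteq> V}"

lemma keys_add_mon: "keys ((m::'v mon) + n) = keys m \<union> keys n"
  by (auto simp: in_keys_iff lookup_add)

lemma rhom_eq_mo:
  assumes "rhom g" "rhom h" "\<And>v. v \<in> keys m \<Longrightarrow> g (pvar v) = h (pvar v)"
  shows "g (mo m) = h (mo m)"
  using assms(3)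
proof (induction m rule: mon_induct)
  case (add m n)
  then show ?case by (simp add: mo_mult[symmetric] rhom_mult assms keys_add_mon)
next
  case zero
  then show ?case using rhom_1 assms by (metis mo_0)
qed (auto simp: mo_var[symmetric])

lemma rhom_eq_on:
  assumes "rhom g" "rhom h" "p \<in> vars_in V" "\<And>v. v \<in> V \<Longrightarrow> g (pvar v) = h (pvar v)"
  shows "g p = h p"
proof (rule additive_eqI[OF rhom_additive[OF assms(1)] rhom_additive[OF assms(2)]])
  fix m assume "m \<in> keys p"
  then have "keys m \<subseteq> V" using assms(3) by (auto simp: vars_in_def)
  then show "g (mo m) = h (mo m)" using assms(4) by (intro rhom_eq_mo[OF assms(1,2)]) auto
qed

lemma rhom_eqI:
  assumes "rhom g" "rhom h" "\<And>v. g (pvar v) = h (pvar v)"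
  shows "g p = h p"
  by (rule rhom_eq_on[OF assms(1,2), of _ UNIV]) (auto simp: vars_in_def assms(3))

definition mev :: "('v \<Rightarrow> 'w fpoly) \<Rightarrow> 'v mon \<Rightarrow> 'w fpoly" where
  "mev \<sigma> m = (\<Prod>v\<in>keys m. \<sigma> v ^ lookup m v)"

lemma mev_superset:
  assumes "finite A" "keys m \<subseteq> A"
  shows "mev \<sigma> m = (\<Prod>v\<in>A. \<sigma> v ^ lookup m v)"
  unfolding mev_def using assms
  by (intro prod.mono_neutral_cong_left) (auto simp: in_keys_iff)

lemma mev_add: "mev \<sigma> (m + n) = mev \<sigma> m * mev \<sigma> n"
  by (subst (1 2 3) mev_superset[of "keys m \<union> keys n"])
    (auto simp: keys_add_mon lookup_add power_add prod.distrib)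

lemma psubst_lin: "psubst \<sigma> p = lin (mev \<sigma>) p"
  unfolding psubst_def lin_def mev_def by (rule sum.cong) (auto simp: bit_lookup)

lemma lin_mult:
  assumes "\<And>m n. g (m + n) = g m * g n"
  shows "lin g (p * q) = lin g p * lin g q"
  by (rule biadditive_eqI[where F = "\<lambda>p q. lin g (p * q)" and G = "\<lambda>p q. lin g p * lin g q"])
    (auto simp: additive_def algebra_simps lin_add mo_mult assms)

lemma rhom_psubst: "rhom (psubst \<sigma>)"
  unfolding rhom_def
proof (intro conjI allI)
  show "psubst \<sigma> 1 = 1"
    by (simp add: psubst_lin mev_def lin_def)
  show "psubst \<sigma> (p + q) = psubst \<sigma> p + psubst \<sigma> q" for p q
    by (simp add: psubst_lin lin_add)
  show "psubst \<sigma> (p * q) = psubst \<sigma> p * psubst \<sigma> q" for p q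
    by (simp add: psubst_lin lin_mult mev_add)
qed

lemma psubst_pvar [simp]: "psubst \<sigma> (pvar v) = \<sigma> v"
  by (simp add: psubst_lin pvar_def mev_def)

lemmas psubst_add = rhom_add[OF rhom_psubst]
lemmas psubst_mult = rhom_mult[OF rhom_psubst]
lemmas psubst_0 [simp] = rhom_0[OF rhom_psubst]
lemmas psubst_1 [simp] = rhom_1[OF rhom_psubst]
lemmas psubst_sum = rhom_sum[OF rhom_psubst]
lemmas psubst_power = rhom_power[OF rhom_psubst]


subsection \<open>Spans of monomials and degrees\<close>

definition sp :: "'v mon set \<Rightarrow> 'v fpoly set" where
  "sp A = {p. keys p \<subseteq> A}"

lemma sp_0 [simp]: "0 \<in> sp A"
  by (simp add: sp_def)

lemma sp_add: "p \<in> sp A \<Longrightarrow> q \<in> sp A \<Longrightarrow> p + q \<in> sp A"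
  by (auto simp: sp_def keys_add_fpoly)

lemma sp_sum: "(\<And>i. i \<in> I \<Longrightarrow> p i \<in> sp A) \<Longrightarrow> (\<Sum>i\<in>I. p i) \<in> sp A"
  by (induction I rule: infinite_finite_induct) (auto simp: sp_add)

lemma sp_mo [simp]: "mo m \<in> sp A \<longleftrightarrow> m \<in> A"
  by (simp add: sp_def)

lemma sp_mult:
  assumes "p \<in> sp A" "q \<in> sp B" "\<And>a b. a \<in> A \<Longrightarrow> b \<in> B \<Longrightarrow> a + b \<in> C"
  shows "p * q \<in> sp C"
  using assms keys_mult[of p q] by (fastforce simp: sp_def)

lemma sp_lin: "p \<in> sp A \<Longrightarrow> (\<And>m. m \<in> A \<Longrightarrow> g m \<in> sp B) \<Longrightarrow> lin g p \<in> sp B"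
  unfolding lin_def by (rule sp_sum) (auto simp: sp_def)

lemma sp_additive:
  assumes "additive g" "p \<in> sp A" "\<And>m. m \<in> A \<Longrightarrow> g (mo m) \<in> sp B"
  shows "g p \<in> sp B"
proof -
  have "g p = (\<Sum>m\<in>keys p. g (mo m))"
    using additive_sum[OF assms(1), of mo "keys p"] fpoly_expand[of p] by simp
  then show ?thesis using assms(2,3) by (auto simp: sp_def[of A] intro!: sp_sum)
qed

lemma sp_mono: "p \<in> sp A \<Longrightarrow> A \<subseteq> B \<Longrightarrow> p \<in> sp B"
  by (auto simp: sp_def)

lemma sp_Int: "p \<in> sp (A \<inter> B) \<longleftrightarrow> p \<in> sp A \<and> p \<in> sp B"
  by (auto simp: sp_def)

lemma sp_empty: "p \<in> sp {} \<longleftrightarrow> p = 0"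
  by (auto simp: sp_def)

lemma vars_in_sp: "vars_in V = sp {m. keys m \<subseteq> V}"
  by (auto simp: vars_in_def sp_def)

lemma mdegree_superset:
  assumes "finite A" "keys m \<subseteq> A"
  shows "mdegree d m = (\<Sum>v\<in>A. \<Sum>_<lookup m v. d v)"
  unfolding mdegree_def using assms
  by (intro sum.mono_neutral_left) (auto simp: in_keys_iff)

lemma mdegree_add: "mdegree d (m + n) = mdegree d m + mdegree d n"
proof -
  have *: "(\<Sum>_<i + j. a) = (\<Sum>_<i. a) + (\<Sum>_<j. a)" for i j :: nat and a :: 'a
    by (induction j) (auto simp: add.assoc)
  show ?thesis
    by (subst (1 2 3) mdegree_superset[of "keys m \<union> keys n"])
      (auto simp: keys_add_mon lookup_add * sum.distrib)
qed

lemma mdegree_0 [simp]: "mdegree d 0 = 0"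
  by (simp add: mdegree_def)

lemma mdegree_single: "mdegree d (Poly_Mapping.single v n) = (\<Sum>_<n. d v)"
  by (simp add: mdegree_def)

lemma mdegree_nonneg: "(\<And>v. v \<in> keys m \<Longrightarrow> d v \<ge> (0::int)) \<Longrightarrow> mdegree d m \<ge> 0"
  by (auto simp: mdegree_def intro!: sum_nonneg)

section \<open>Cobar complexes of bialgebras\<close>

abbreviation "CF H i \<equiv> psubst (coface_var H i)"
abbreviation "SH n \<equiv> psubst (shift_var n)"

definition below :: "nat \<Rightarrow> ('s, 'a) tvar set" where
  "below f = range Scalar \<union> {Factor p a | p a. p < f}"

text \<open>Strict coassociativity already in the polynomial ring, before dividing by the relations: this
  makes all cosimplicial identities hold on the nose.\<close>

definition bialg :: "('s, 'a, 'g::comm_monoid_add) hopf \<Rightarrow> bool" where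
  "bialg H \<longleftrightarrow> (\<forall>a. coprod H a \<in> vars_in (below 2)) \<and>
     (\<forall>a. CF H 1 (coprod H a) = CF H 2 (coprod H a)) \<and>
     (\<forall>a\<in>gens H. coprod H a \<in> cochains H 2 (gdeg H a))"

lemma in_below [simp]: "Scalar s \<in> below f" "Factor p a \<in> below f \<longleftrightarrow> p < f"
  by (auto simp: below_def)

lemma SH_SH: "SH m (SH n z) = SH (m + n) z"
proof (rule rhom_eqI[OF rhom_comp[OF rhom_psubst rhom_psubst] rhom_psubst])
  fix v :: "('a, 'b) tvar"
  show "SH m (SH n (pvar v)) = SH (m + n) (pvar v)"
    by (cases v) (auto simp: add.assoc)
qed

lemma SH_0 [simp]: "SH 0 z = z"
proof (rule rhom_eqI[OF rhom_psubst rhom_id])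
  fix v :: "('a, 'b) tvar"
  show "SH 0 (pvar v) = pvar v" by (cases v) auto
qed

lemma CF_0: "CF H 0 z = SH 1 z"
proof (rule rhom_eqI[OF rhom_psubst rhom_psubst])
  fix v :: "('a, 'b) tvar"
  show "CF H 0 (pvar v) = SH 1 (pvar v)" by (cases v) auto
qed

lemma CF_SH: "j \<ge> 1 \<Longrightarrow> CF H (p + j) (SH p z) = SH p (CF H j z)"
proof (rule rhom_eqI[OF rhom_comp[OF rhom_psubst rhom_psubst] rhom_comp[OF rhom_psubst rhom_psubst]])
  fix v :: "('a, 'b) tvar"
  assume "j \<ge> 1"
  then show "CF H (p + j) (SH p (pvar v)) = SH p (CF H j (pvar v))"
    by (cases v) (auto simp: SH_SH)
qed

lemma CF_SH_le: "j \<le> p \<Longrightarrow> CF H j (SH p z) = SH (Suc p) z"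
proof (rule rhom_eqI[OF rhom_comp[OF rhom_psubst rhom_psubst] rhom_psubst])
  fix v :: "('a, 'b) tvar"
  assume "j \<le> p"
  then show "CF H j (SH p (pvar v)) = SH (Suc p) (pvar v)"
    by (cases v) auto
qed

lemma CF_fix: "z \<in> vars_in (below f) \<Longrightarrow> f < j \<Longrightarrow> CF H j z = z"
proof (rule rhom_eq_on[OF rhom_psubst rhom_id, of _ "below f"])
  fix v :: "('a, 'b) tvar"
  assume "f < j" "v \<in> below f"
  then show "CF H j (pvar v) = pvar v"
    by (cases v) auto
qed

text \<open>The cosimplicial identities; for \<open>i = j\<close> this is coassociativity.\<close>

lemma CF_CF:
  assumes H: "bialg H" and ij: "i \<le> j"
  shows "CF H (Suc j) (CF H i z) = CF H i (CF H j z)"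
proof (rule rhom_eqI[OF rhom_comp[OF rhom_psubst rhom_psubst] rhom_comp[OF rhom_psubst rhom_psubst]])
  fix v :: "('a, 'b) tvar"
  show "CF H (Suc j) (CF H i (pvar v)) = CF H i (CF H j (pvar v))"
  proof (cases v)
    case (Factor p a)
    let ?D = "coprod H a"
    have D2: "?D \<in> vars_in (below 2)" and co: "CF H 1 ?D = CF H 2 ?D"
      using H by (auto simp: bialg_def)
    have fix2: "CF H k (SH p ?D) = SH p ?D" if "p + 2 < k" for k
    proof -
      have "CF H (p + (k - p)) (SH p ?D) = SH p (CF H (k - p) ?D)"
        using that by (intro CF_SH) simp
      then show ?thesis using that CF_fix[OF D2, of "k - p" H] by simp
    qed
    consider "p + 1 < i" | "p + 1 = i" "j = i" | "p + 1 = i" "j > i" | "p + 1 > i" "p + 1 < j"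
      | "p + 1 > i" "p + 1 = j" | "p + 1 > i" "p + 1 > j"
      using ij by linarith
    then show ?thesis
    proof cases
      case 2
      have "CF H (p + 2) (SH p ?D) = CF H (p + 1) (SH p ?D)"
        by (simp only: CF_SH one_le_numeral le_refl co)
      then show ?thesis using 2 Factor by simp
    next
      case 3
      then show ?thesis using Factor by (auto simp: fix2)
    next
      case 5
      then show ?thesis using Factor by (auto simp: CF_SH_le)
    qed (use Factor ij in auto)
  qed auto
qed

text \<open>Truncated cobar differentials.  The cobar differential itself is the case \<open>l = 0\<close>; the case
  \<open>l = 1\<close> is the differential with coefficients in the leading factor, and larger \<open>l\<close> leave the first
  \<open>l - 1\<close> factors alone.\<close>

definition DD :: "('s, 'a, 'g) hopf \<Rightarrow> nat \<Rightarrow> nat \<Rightarrow> ('s, 'a) tvar fpoly \<Rightarrow> ('s, 'a) tvar fpoly" where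
  "DD H l n z = (\<Sum>i\<in>{l..Suc n}. CF H i z)"

lemma cobar_d_DD: "cobar_d H f = DD H 0 f"
  by (simp add: fun_eq_iff cobar_d_def DD_def atLeast0AtMost)

lemma DD_add: "DD H l n (x + y) = DD H l n x + DD H l n y"
  by (simp add: DD_def psubst_add sum.distrib)

lemma DD_0 [simp]: "DD H l n 0 = 0"
  by (simp add: DD_def)

lemma additive_DD: "additive (DD H l n)"
  by (simp add: additive_def DD_add)

text \<open>The terms cancel in pairs by the cosimplicial identities, for any truncation.\<close>

lemma DD_DD:
  assumes "bialg H"
  shows "DD H l (Suc n) (DD H l n z) = 0"
proof -
  let ?g = "\<lambda>(j, i). CF H j (CF H i z)"
  let ?A = "{l..Suc (Suc n)} \<times> {l..Suc n}"
  let ?B = "{(j, i) \<in> ?A. i < j}" and ?C = "{(j, i) \<in> ?A. j \<le> i}"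
  have "DD H l (Suc n) (DD H l n z) = sum ?g ?A"
    by (simp only: DD_def psubst_sum sum.cartesian_product)
  also have "\<dots> = sum ?g ?B + sum ?g ?C"
  proof -
    have "?A = ?B \<union> ?C" by (auto simp: not_less)
    moreover have "?B \<inter> ?C = {}" by auto
    moreover have "finite ?B" "finite ?C" by (rule finite_subset[of _ ?A]; auto)+
    ultimately show ?thesis by (metis (no_types, lifting) sum.union_disjoint)
  qed
  also have "sum ?g ?B = sum ?g ?C"
  proof (rule sum.reindex_bij_witness[of _ "\<lambda>(j, i). (Suc i, j)" "\<lambda>(j, i). (i, j - 1)"])
    fix a assume "a \<in> ?B"
    then obtain j i where a: "a = (Suc j, i)" "i \<le> j"
      by (cases a; cases "fst a") auto
    then show "?g (case a of (j, i) \<Rightarrow> (i, j - 1)) = ?g a"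
      using CF_CF[OF assms, of i j z] by simp
  qed auto
  finally show ?thesis by simp
qed

lemma cobar_d_cobar_d: "bialg H \<Longrightarrow> cobar_d H (Suc f) (cobar_d H f z) = 0"
  by (simp add: cobar_d_DD DD_DD)


subsection \<open>Cochains\<close>

definition cmons :: "('s, 'a, 'g::comm_monoid_add) hopf \<Rightarrow> nat \<Rightarrow> 'g \<Rightarrow> ('s, 'a) tvar mon set" where
  "cmons H f t = {m. keys m \<subseteq> Scalar ` scalars H \<union> {Factor p a | p a. p < f \<and> a \<in> gens H} \<and>
     mdegree (vdeg H) m = t}"

lemma cochains_sp: "cochains H f t = sp (cmons H f t)"
  by (auto simp: cochains_def sp_def cmons_def)

lemma cochains_0 [simp]: "0 \<in> cochains H f t"
  by (simp add: cochains_sp)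

lemma cochains_add: "x \<in> cochains H f t \<Longrightarrow> y \<in> cochains H f t \<Longrightarrow> x + y \<in> cochains H f t"
  unfolding cochains_sp by (rule sp_add)

lemma cochains_sum: "(\<And>i. i \<in> I \<Longrightarrow> p i \<in> cochains H f t) \<Longrightarrow> (\<Sum>i\<in>I. p i) \<in> cochains H f t"
  unfolding cochains_sp by (rule sp_sum)

lemma cmons_add: "m \<in> cmons H f s \<Longrightarrow> n \<in> cmons H f t \<Longrightarrow> m + n \<in> cmons H f (s + t)"
  by (auto simp: cmons_def mdegree_add keys_add_mon)

lemma cochains_mult: "x \<in> cochains H f s \<Longrightarrow> y \<in> cochains H f t \<Longrightarrow> x * y \<in> cochains H f (s + t)"
  unfolding cochains_sp by (rule sp_mult) (auto intro: cmons_add)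

lemma cochains_1 [simp]: "1 \<in> cochains H f 0"
proof -
  have "mo 0 \<in> cochains H f 0" unfolding cochains_sp sp_mo by (simp add: cmons_def)
  then show ?thesis by simp
qed

lemma cochains_power: "x \<in> cochains H f s \<Longrightarrow> x ^ n \<in> cochains H f (\<Sum>_<n. s)"
  by (induction n) (auto simp: add.commute dest: cochains_mult)

lemma cochains_pvar: "p < f \<Longrightarrow> a \<in> gens H \<Longrightarrow> pvar (Factor p a) \<in> cochains H f (gdeg H a)"
  by (simp add: cochains_sp cmons_def mdegree_single pvar_def)

lemma cochains_scalar: "s \<in> scalars H \<Longrightarrow> pvar (Scalar s) \<in> cochains H f (sdeg H s)"
  by (auto simp: cochains_sp cmons_def mdegree_single pvar_def)

lemma cochains_mono: "x \<in> cochains H f t \<Longrightarrow> f \<le> g \<Longrightarrow> x \<in> cochains H g t"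
  unfolding cochains_sp by (erule sp_mono) (fastforce simp: cmons_def)

lemma cochains_below: "x \<in> cochains H f t \<Longrightarrow> x \<in> vars_in (below f)"
  unfolding vars_in_sp cochains_sp by (erule sp_mono) (fastforce simp: cmons_def)

text \<open>Homogeneity of the values of a ring homomorphism is decided on variables; \<open>D\<close> is its effect on
  degrees.\<close>

lemma rhom_cochains:
  assumes h: "rhom h" and x: "x \<in> cochains H f t"
    and s: "\<And>s. s \<in> scalars H \<Longrightarrow> h (pvar (Scalar s)) \<in> cochains H' g (D (sdeg H s))"
    and v: "\<And>p a. p < f \<Longrightarrow> a \<in> gens H \<Longrightarrow> h (pvar (Factor p a)) \<in> cochains H' g (D (gdeg H a))"
    and D: "D 0 = 0" "\<And>a b. D (a + b) = D a + D b"
  shows "h x \<in> cochains H' g (D t)"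
proof -
  have m: "h (mo m) \<in> cochains H' g (D (mdegree (vdeg H) m))"
    if "keys m \<subseteq> Scalar ` scalars H \<union> {Factor p a | p a. p < f \<and> a \<in> gens H}" for m
    using that
  proof (induction m rule: mon_induct)
    case zero
    then show ?case using rhom_1[OF h] D by simp
  next
    case (var u)
    then show ?case using s v by (auto simp: mo_var[simplified] mdegree_single)
  next
    case (add m n)
    then show ?case
      by (auto simp: mo_mult[symmetric] rhom_mult[OF h] mdegree_add D keys_add_mon
          intro: cochains_mult)
  qed
  show ?thesis using x unfolding cochains_sp
    by (rule sp_additive[OF rhom_additive[OF h]])
      (use m in \<open>auto simp: cmons_def cochains_sp\<close>)
qed

lemma SH_cochains: "x \<in> cochains H f t \<Longrightarrow> p + f \<le> g \<Longrightarrow> SH p x \<in> cochains H g t"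
  by (rule rhom_cochains[OF rhom_psubst, where D = "\<lambda>x. x"])
    (auto intro!: cochains_pvar cochains_scalar)

lemma CF_cochains:
  assumes "bialg H" "x \<in> cochains H f t"
  shows "CF H i x \<in> cochains H (Suc f) t"
proof (rule rhom_cochains[OF rhom_psubst assms(2), where D = "\<lambda>x. x"])
  fix p a assume pa: "p < f" "a \<in> gens H"
  have "SH p (coprod H a) \<in> cochains H (Suc f) (gdeg H a)"
    using assms(1) pa by (intro SH_cochains[of _ _ 2]) (auto simp: bialg_def)
  then show "CF H i (pvar (Factor p a)) \<in> cochains H (Suc f) (gdeg H a)"
    using pa by (auto intro!: cochains_pvar)
qed (auto intro!: cochains_scalar)

lemma DD_cochains: "bialg H \<Longrightarrow> x \<in> cochains H f t \<Longrightarrow> DD H l n x \<in> cochains H (Suc f) t"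
  unfolding DD_def by (intro cochains_sum CF_cochains)

lemma cobar_d_cochains: "bialg H \<Longrightarrow> x \<in> cochains H f t \<Longrightarrow> cobar_d H f x \<in> cochains H (Suc f) t"
  by (simp add: cobar_d_DD DD_cochains)

lemma cup_cochains:
  "x \<in> cochains H f s \<Longrightarrow> y \<in> cochains H g t \<Longrightarrow> cup f x y \<in> cochains H (f + g) (s + t)"
  unfolding cup_def by (intro cochains_mult) (auto intro: cochains_mono SH_cochains)

lemma cup_add: "cup f (x + x') y = cup f x y + cup f x' y" "cup f x (y + y') = cup f x y + cup f x y'"
  by (simp_all add: cup_def psubst_add algebra_simps)

lemma cup_0 [simp]: "cup f 0 y = 0" "cup f x 0 = 0"
  by (simp_all add: cup_def)

lemma cup_assoc: "cup (f + g) (cup f x y) z = cup f x (cup g y z)"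
  by (simp add: cup_def psubst_mult SH_SH mult.assoc)

lemma DD_cup:
  assumes x: "x \<in> vars_in (below f)" and l: "l \<le> f"
  shows "DD H l (f + g) (cup f x y) = cup (Suc f) (DD H l f x) y + cup f x (cobar_d H g y)"
proof -
  have 1: "CF H i (cup f x y) = CF H i x * SH (Suc f) y" if "i \<le> f" for i
    using that by (simp add: cup_def psubst_mult CF_SH_le)
  have 2: "CF H (f + j) (cup f x y) = x * SH f (CF H j y)" if "1 \<le> j" for j
    using that by (simp add: cup_def psubst_mult CF_SH CF_fix[OF x])
  have "DD H l (f + g) (cup f x y)
      = (\<Sum>i\<in>{l..f}. CF H i (cup f x y)) + (\<Sum>i\<in>{f + 1..f + (g + 1)}. CF H i (cup f x y))"
  proof -
    have "{l..Suc (f + g)} = {l..f} \<union> {f + 1..f + (g + 1)}" using l by auto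
    moreover have "{l..f} \<inter> {f + 1..f + (g + 1)} = {}" by auto
    ultimately show ?thesis by (simp only: DD_def sum.union_disjoint finite_atLeastAtMost)
  qed
  also have "(\<Sum>i\<in>{f + 1..f + (g + 1)}. CF H i (cup f x y)) = (\<Sum>j\<in>{1..g + 1}. CF H (f + j) (cup f x y))"
    by (rule sum.reindex_bij_witness[of _ "\<lambda>j. f + j" "\<lambda>i. i - f"]) auto
  also have "\<dots> = (\<Sum>j\<in>{1..g + 1}. x * SH f (CF H j y))"
    by (intro sum.cong) (auto simp: 2)
  also have "(\<Sum>i\<in>{l..f}. CF H i (cup f x y)) = (\<Sum>i\<in>{l..f}. CF H i x * SH (Suc f) y)"
    by (intro sum.cong) (auto simp: 1)
  finally have *: "DD H l (f + g) (cup f x y)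
      = (\<Sum>i\<in>{l..f}. CF H i x * SH (Suc f) y) + (\<Sum>j\<in>{1..g + 1}. x * SH f (CF H j y))" .
  have "cup (Suc f) (DD H l f x) y = (\<Sum>i\<in>{l..f}. CF H i x * SH (Suc f) y) + x * SH (Suc f) y"
    using l by (simp add: cup_def DD_def sum_distrib_right CF_fix[OF x] add.commute distrib_right)
  moreover have "cup f x (cobar_d H g y) = x * SH (Suc f) y + (\<Sum>j\<in>{1..g + 1}. x * SH f (CF H j y))"
    by (simp add: cup_def cobar_d_DD DD_def sum_distrib_left psubst_sum psubst_add distrib_left CF_0 SH_SH
        sum.atLeast_Suc_atMost)
  ultimately show ?thesis using *
    by (simp add: add.assoc[symmetric])
qed

lemma cobar_d_cup:
  "x \<in> vars_in (below f) \<Longrightarrow>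
    cobar_d H (f + g) (cup f x y) = cup (Suc f) (cobar_d H f x) y + cup f x (cobar_d H g y)"
  by (simp add: DD_cup cobar_d_DD)

text \<open>Left and right multiplication by a primitive element are chain homotopic; the homotopy
  multiplies by the sum of the element over all tensor factors.\<close>

lemma cobar_d_primitive_sum:
  assumes a: "coprod H a = pvar (Factor 0 a) + pvar (Factor 1 a)"
    and x: "x \<in> vars_in (below f)"
  shows "cobar_d H f ((\<Sum>p<f. pvar (Factor p a)) * x)
     = (\<Sum>p<Suc f. pvar (Factor p a)) * cobar_d H f x
       + cup 1 (pvar (Factor 0 a)) x + cup f x (pvar (Factor 0 a))"
proof -
  let ?v = "\<lambda>p. pvar (Factor p a)"
  let ?T = "\<lambda>f. \<Sum>p<f. ?v p"
  have T: "CF H i (?T f) = ?T (Suc f) + (if i = 0 then ?v 0 else 0) + (if i = Suc f then ?v f else 0)"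
    if "i \<le> Suc f" for i
    using that
  proof (induction f)
    case 0
    then show ?case by (cases i) auto
  next
    case (Suc f)
    show ?case
    proof (cases "i = Suc (Suc f)")
      case True
      have "CF H i (?T (Suc f)) = ?T (Suc f)"
        by (rule CF_fix[of _ "Suc f"])
          (use True in \<open>auto simp: vars_in_sp pvar_def intro!: sp_add sp_sum\<close>)
      then show ?thesis using True by (simp add: add.assoc)
    next
      case False
      then show ?thesis using Suc by (auto simp: psubst_add psubst_sum a add_ac)
    qed
  qed
  have "cobar_d H f (?T f * x) = (\<Sum>i\<le>f + 1. CF H i (?T f) * CF H i x)"
    by (simp add: cobar_d_def psubst_mult)
  also have "\<dots> = (\<Sum>i\<le>f + 1. ?T (Suc f) * CF H i x + ((if i = 0 then ?v 0 * CF H i x else 0)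
      + (if i = Suc f then ?v f * CF H i x else 0)))"
    by (intro sum.cong) (auto simp: T algebra_simps)
  also have "\<dots> = ?T (Suc f) * cobar_d H f x + (?v 0 * CF H 0 x + ?v f * CF H (Suc f) x)"
    by (simp only: sum.distrib sum_distrib_left cobar_d_def) (simp add: sum.delta)
  finally show ?thesis
    using CF_fix[OF x, of "Suc f" H] by (simp add: cup_def CF_0 mult.commute add.assoc)
qed


subsection \<open>Classes in degrees without relations\<close>

text \<open>Degrees in which only the zero polynomial represents zero.  There a class is a cocycle modulo
  coboundaries of polynomials, with no relations in between.\<close>

definition rigid :: "('s, 'a, 'g::comm_monoid_add) hopf \<Rightarrow> 'g \<Rightarrow> bool" where
  "rigid H t \<longleftrightarrow> (\<forall>f. null H f \<inter> cochains H f t \<subseteq> {0})"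

lemma null_0 [simp]: "0 \<in> null H f"
  unfolding null_def ideal_generated_def by (auto intro!: exI[of _ "{}"])

lemma cocycles_rigid:
  assumes "bialg H" "rigid H t"
  shows "cocycles H f t = {z \<in> cochains H f t. cobar_d H f z = 0}"
  using assms cobar_d_cochains[of H _ f t] unfolding cocycles_def rigid_def by auto

definition bdry :: "('s, 'a, 'g::comm_monoid_add) hopf \<Rightarrow> nat \<Rightarrow> 'g \<Rightarrow> ('s, 'a) tvar fpoly \<Rightarrow> bool" where
  "bdry H f t z \<longleftrightarrow> (if f = 0 then z = 0 else \<exists>y\<in>cochains H (f - 1) t. z = cobar_d H (f - 1) y)"

lemma bdry_cochains: "bialg H \<Longrightarrow> bdry H f t z \<Longrightarrow> z \<in> cochains H f t"
  using cobar_d_cochains[of H _ "f - 1" t] by (cases f) (auto simp: bdry_def)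

lemma coboundaries_rigid:
  assumes "bialg H" "rigid H t"
  shows "coboundaries H f t = {z. bdry H f t z}"
proof (cases f)
  case 0
  then show ?thesis using assms unfolding coboundaries_def rigid_def bdry_def by auto
next
  case (Suc e)
  have "z = cobar_d H e y" if "z \<in> cochains H f t" "y \<in> cochains H e t" "z - cobar_d H e y \<in> null H f"
    for y z
  proof -
    have "z - cobar_d H e y \<in> cochains H f t"
      using that Suc cobar_d_cochains[OF assms(1) that(2)] by (auto intro: cochains_add)
    then have "z - cobar_d H e y = 0" using that assms(2) by (auto simp: rigid_def)
    then show ?thesis by (simp add: fpoly_add_eq_0_iff)
  qed
  note * = this
  show ?thesis
  proof (intro set_eqI iffI)
    fix z assume "z \<in> coboundaries H f t"
    then obtain y where "z \<in> cochains H f t" "y \<in> cochains H e t" "z - cobar_d H e y \<in> null H f"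
      unfolding coboundaries_def Suc by auto
    then have "y \<in> cochains H e t" "z = cobar_d H e y" using *[of z y] by blast+
    then show "z \<in> {z. bdry H f t z}" unfolding bdry_def Suc by auto
  next
    fix z assume "z \<in> {z. bdry H f t z}"
    then have z: "bdry H f t z" by simp
    then obtain y where y: "y \<in> cochains H e t" "z = cobar_d H e y"
      unfolding bdry_def Suc by auto
    have "z - cobar_d H e y \<in> null H f" using y by simp
    then show "z \<in> coboundaries H f t"
      unfolding coboundaries_def using bdry_cochains[OF assms(1) z] y(1) Suc by auto
  qed
qed

lemma bdry_0 [simp]: "bdry H f t 0"
  by (auto simp: bdry_def cobar_d_DD intro!: bexI[of _ 0])

lemma bdry_add: "bdry H f t x \<Longrightarrow> bdry H f t y \<Longrightarrow> bdry H f t (x + y)"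
  unfolding bdry_def cobar_d_DD
  by (auto split: if_splits simp: DD_add[symmetric] intro!: bexI[of _ "_ + _"] cochains_add)

lemma bdry_add_iff: "bdry H f t x \<Longrightarrow> bdry H f t (x + y) \<longleftrightarrow> bdry H f t y"
  using bdry_add[of H f t x] by (metis fpoly_add_self_left)

lemma bdry_d: "y \<in> cochains H f t \<Longrightarrow> bdry H (Suc f) t (cobar_d H f y)"
  by (auto simp: bdry_def)

lemma ext_class_rigid:
  assumes "bialg H" "rigid H t" "z \<in> cochains H f t"
  shows "ext_class H f t z = (f, t, {z'. bdry H f t (z' + z)})"
proof -
  have "z' \<in> cochains H f t" if "bdry H f t (z' + z)" for z'
  proof -
    have "(z' + z) + z \<in> cochains H f t"
      using bdry_cochains[OF assms(1) that] assms(3) by (rule cochains_add)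
    then show ?thesis by (simp add: add.assoc)
  qed
  then show ?thesis by (auto simp: ext_class_def coboundaries_rigid[OF assms(1,2)])
qed

lemma ext_class_eq_iff:
  assumes "bialg H" "rigid H t" "z \<in> cochains H f t" "z' \<in> cochains H f t"
  shows "ext_class H f t z = ext_class H f t z' \<longleftrightarrow> bdry H f t (z + z')"
proof
  assume "ext_class H f t z = ext_class H f t z'"
  then have "{w. bdry H f t (w + z)} = {w. bdry H f t (w + z')}"
    unfolding ext_class_rigid[OF assms(1-3)] ext_class_rigid[OF assms(1,2,4)] by simp
  moreover have "z \<in> {w. bdry H f t (w + z)}" by simp
  ultimately have "z \<in> {w. bdry H f t (w + z')}" by blast
  then show "bdry H f t (z + z')" by simp
next
  assume *: "bdry H f t (z + z')"
  have "bdry H f t (w + z) \<longleftrightarrow> bdry H f t (w + z')" for w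
    using bdry_add_iff[OF *, of "w + z'"]
    by (simp add: add.assoc add.commute add.left_commute)
  then show "ext_class H f t z = ext_class H f t z'"
    using assms by (simp add: ext_class_rigid)
qed

lemma bdry_cup_left:
  assumes "bialg H" "bdry H f t x" "y \<in> cochains H g u" "cobar_d H g y = 0"
  shows "bdry H (f + g) (t + u) (cup f x y)"
proof (cases f)
  case (Suc e)
  then obtain w where w: "w \<in> cochains H e t" "x = cobar_d H e w"
    using assms by (auto simp: bdry_def)
  have "cobar_d H (e + g) (cup e w y) = cup f x y"
    using cobar_d_cup[OF cochains_below[OF w(1)], of H g y] assms Suc w by simp
  then show ?thesis
    using Suc bdry_d[OF cup_cochains[OF w(1) assms(3)]] by simp
next
  case 0
  then have "x = 0" using assms(2) by (simp add: bdry_def)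
  then show ?thesis by simp
qed

lemma bdry_cup_right:
  assumes "bialg H" "bdry H g u y" "x \<in> cochains H f t" "cobar_d H f x = 0"
  shows "bdry H (f + g) (t + u) (cup f x y)"
proof (cases g)
  case (Suc e)
  then obtain w where w: "w \<in> cochains H e u" "y = cobar_d H e w"
    using assms by (auto simp: bdry_def)
  have "cobar_d H (f + e) (cup f x w) = cup f x y"
    using cobar_d_cup[OF cochains_below[OF assms(3)], of H e w] assms Suc w by simp
  then show ?thesis
    using Suc bdry_d[OF cup_cochains[OF assms(3) w(1)]] by simp
next
  case 0
  then have "y = 0" using assms(2) by (simp add: bdry_def)
  then show ?thesis by simp
qed

lemma bdry_closed: "bialg H \<Longrightarrow> bdry H f t x \<Longrightarrow> cobar_d H f x = 0"
  by (cases f) (auto simp: bdry_def cobar_d_cobar_d cobar_d_DD[of H 0] simp del: One_nat_def)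

lemma ext_mult_class:
  assumes H: "bialg H" "rigid H t" "rigid H u" "rigid H (t + u)"
    and x: "x \<in> cochains H f t" "cobar_d H f x = 0"
    and y: "y \<in> cochains H g u" "cobar_d H g y = 0"
  shows "ext_mult H (ext_class H f t x) (ext_class H g u y)
     = ext_class H (f + g) (t + u) (cup f x y)"
proof -
  have key: "bdry H (f + g) (t + u) (cup f x' y' + cup f x y)"
    if "bdry H f t (x' + x)" "bdry H g u (y' + y)" for x' y'
  proof -
    have "cobar_d H g y' = 0" "y' \<in> cochains H g u"
    proof -
      show "cobar_d H g y' = 0"
        using bdry_closed[OF H(1) that(2)] y by (simp add: cobar_d_DD DD_add)
      have "(y' + y) + y \<in> cochains H g u"
        using bdry_cochains[OF H(1) that(2)] y(1) by (rule cochains_add)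
      then show "y' \<in> cochains H g u" by (simp add: add.assoc)
    qed
    then have "bdry H (f + g) (t + u) (cup f (x' + x) y' + cup f x (y' + y))"
      using bdry_add[OF bdry_cup_left[OF H(1) that(1)] bdry_cup_right[OF H(1) that(2) x]] by blast
    then show ?thesis by (simp add: cup_add algebra_simps)
  qed
  have "(\<exists>x'\<in>{x'. bdry H f t (x' + x)}. \<exists>y'\<in>{y'. bdry H g u (y' + y)}.
          z - cup f x' y' \<in> coboundaries H (f + g) (t + u))
        \<longleftrightarrow> bdry H (f + g) (t + u) (z + cup f x y)" (is "?L \<longleftrightarrow> ?R") for z
  proof
    assume ?L
    then obtain x' y' where "bdry H f t (x' + x)" "bdry H g u (y' + y)"
      "bdry H (f + g) (t + u) (z + cup f x' y')"
      by (auto simp: coboundaries_rigid H)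
    then have "bdry H (f + g) (t + u) ((z + cup f x' y') + (cup f x' y' + cup f x y))"
      using bdry_add[OF _ key] by blast
    then show ?R by (simp add: algebra_simps)
  next
    assume ?R
    then show ?L using H by (intro bexI[of _ x] bexI[of _ y]) (auto simp: coboundaries_rigid)
  qed
  moreover have "z \<in> cochains H (f + g) (t + u)" if "bdry H (f + g) (t + u) (z + cup f x y)" for z
  proof -
    have "(z + cup f x y) + cup f x y \<in> cochains H (f + g) (t + u)"
      using bdry_cochains[OF H(1) that] cup_cochains[OF x(1) y(1)] by (rule cochains_add)
    then show ?thesis by (simp add: add.assoc)
  qed
  ultimately show ?thesis
    using H x y cup_cochains[OF x(1) y(1)]
    by (auto simp: ext_class_rigid)
qed

lemma cup_cocycle:
  assumes "x \<in> cochains H f t" "cobar_d H f x = 0" "cobar_d H g y = 0"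
  shows "cobar_d H (f + g) (cup f x y) = 0"
  using cobar_d_cup[OF cochains_below[OF assms(1)], of H g y] assms by simp

section \<open>The classical dual Steenrod algebra and the operations Sq1, Sq2 on it\<close>

abbreviation "cl \<equiv> cl_steenrod"
abbreviation "cc \<equiv> cochains cl"

lemma triangle_sum:
  "(\<Sum>k\<le>n. \<Sum>j\<le>n - k. g k j) = (\<Sum>m\<le>n. \<Sum>k\<le>m. g k (m - k))" for g :: "nat \<Rightarrow> nat \<Rightarrow> 'a::comm_monoid_add"
proof -
  have "(\<Sum>k\<le>n. \<Sum>j\<le>n - k. g k j) = (\<Sum>(k, j)\<in>(SIGMA k:{..n}. {..n - k}). g k j)"
    by (simp add: sum.Sigma)
  also have "(SIGMA k:{..n}. {..n - k}) = {(i, j). i + j \<le> n}" by auto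
  finally show ?thesis by (simp add: sum.triangle_reindex_eq)
qed

lemma cl_simps [simp]:
  "scalars cl = {}" "gens cl = {1..}" "rels cl = {}" "sdeg cl s = 0" "gdeg cl n = 2 ^ n - 1"
  "coprod cl n = (\<Sum>k\<le>n. cl_xi 0 (n - k) ^ (2 ^ k) * cl_xi 1 k)"
  by (auto simp: cl_steenrod_def)

lemma cl_xi_0 [simp]: "cl_xi p 0 = 1"
  by (simp add: cl_xi_def)

lemma SH_cl_xi [simp]: "SH q (cl_xi p n) = cl_xi (q + p) n"
  by (simp add: cl_xi_def)

text \<open>The coproduct of the generator \<open>n\<close> in the factor \<open>p\<close>, spread over the factors \<open>p\<close> and \<open>p + 1\<close>.\<close>

definition cop :: "nat \<Rightarrow> nat \<Rightarrow> (unit, nat) tvar fpoly" where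
  "cop p n = (\<Sum>k\<le>n. cl_xi p (n - k) ^ (2 ^ k) * cl_xi (Suc p) k)"

lemma SH_coprod: "SH p (coprod cl n) = cop p n"
  by (simp add: cop_def psubst_sum psubst_mult psubst_power)

lemma cop_0 [simp]: "cop p 0 = 1"
  by (simp add: cop_def)

lemma CF_pvar:
  "CF cl i (pvar (Factor p n)) = (if p + 1 < i then pvar (Factor p n)
     else if p + 1 = i then cop p n else pvar (Factor (Suc p) n))"
  by (simp add: SH_coprod[symmetric])

lemma CF_xi:
  "CF cl i (cl_xi p n) = (if p + 1 < i then cl_xi p n
     else if p + 1 = i then cop p n else cl_xi (Suc p) n)"
  by (cases "n = 0") (auto simp: CF_pvar cl_xi_def simp del: psubst_pvar)

lemma cop_coassoc: "CF cl (Suc p) (cop p n) = CF cl (Suc (Suc p)) (cop p n)"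
proof -
  let ?g = "\<lambda>k j. cl_xi p (n - k - j) ^ (2 ^ (j + k)) * cl_xi (Suc p) j ^ (2 ^ k) * cl_xi (Suc (Suc p)) k"
  have "CF cl (Suc p) (cop p n) = (\<Sum>k\<le>n. \<Sum>j\<le>n - k. ?g k j)"
    by (simp add: cop_def psubst_sum psubst_mult psubst_power CF_xi fpoly_frobenius_sum
        sum_distrib_right power_mult_distrib power_mult[symmetric] power_add)
  also have "\<dots> = (\<Sum>m\<le>n. \<Sum>k\<le>m. ?g k (m - k))"
    by (rule triangle_sum)
  also have "\<dots> = CF cl (Suc (Suc p)) (cop p n)"
    by (simp add: cop_def psubst_sum psubst_mult psubst_power CF_xi
        sum_distrib_left mult.assoc)
  finally show ?thesis .
qed

lemma cl_xi_cochain: "p < f \<Longrightarrow> cl_xi p n \<in> cc f (2 ^ n - 1)"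
  using cochains_pvar[of p f n cl] by (cases "n = 0") (auto simp: cl_xi_def)

lemma cc_power: "x \<in> cc f s \<Longrightarrow> x ^ n \<in> cc f (int n * s)"
  using cochains_power[of x cl f s n] by simp

lemma cop_cochain: "Suc p < f \<Longrightarrow> cop p n \<in> cc f (2 ^ n - 1)"
  unfolding cop_def
proof (intro cochains_sum)
  fix k assume f: "Suc p < f" and k: "k \<in> {..n}"
  have "cl_xi p (n - k) ^ (2 ^ k) * cl_xi (Suc p) k
      \<in> cc f (int (2 ^ k) * (2 ^ (n - k) - 1) + (2 ^ k - 1))"
    using f by (intro cochains_mult cc_power cl_xi_cochain) auto
  moreover have "int (2 ^ k) * (2 ^ (n - k) - 1) + (2 ^ k - 1) = 2 ^ n - 1"
    using k by (simp add: right_diff_distrib flip: power_add)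
  ultimately show "cl_xi p (n - k) ^ (2 ^ k) * cl_xi (Suc p) k \<in> cc f (2 ^ n - 1)" by metis
qed

lemma bialg_cl: "bialg cl"
proof -
  have D: "coprod cl a = cop 0 a" for a using SH_coprod[of 0 a] by simp
  have "cop 0 a \<in> vars_in (below 2)" for a
    using cochains_below[OF cop_cochain[of 0 2 a]] by simp
  moreover have "CF cl 1 (cop 0 a) = CF cl 2 (cop 0 a)" for a
    using cop_coassoc[of 0 a] by (simp add: numeral_2_eq_2)
  moreover have "cop 0 a \<in> cc 2 (gdeg cl a)" for a
    using cop_cochain[of 0 2 a] by simp
  ultimately show ?thesis unfolding bialg_def D by blast
qed

lemma rigid_cl: "rigid cl t"
  by (auto simp: rigid_def null_def ideal_generated_def)

lemma cc_nonneg: "x \<in> cc f t \<Longrightarrow> t < 0 \<Longrightarrow> x = 0"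
proof -
  assume x: "x \<in> cc f t" and t: "t < 0"
  have "cmons cl f t = {}"
  proof -
    have "mdegree (vdeg cl) m \<ge> 0" if "keys m \<subseteq> {Factor p a | p a. p < f \<and> a \<in> {1..}}" for m
      using that by (intro mdegree_nonneg) (auto dest!: subsetD)
    then show ?thesis using t by (fastforce simp: cmons_def)
  qed
  then show "x = 0" using x by (simp add: cochains_sp sp_empty)
qed


subsection \<open>Left operations on the leading factor\<close>

text \<open>Left multiplication by elements of the Steenrod algebra acts on the leading tensor factor and
  commutes with the right coaction.  On the dual Steenrod algebra \<open>Sq1\<close> is the derivation
  \<open>\<partial>/\<partial>\<xi>\<^sub>1\<close>; together with \<open>Sq2\<close> it satisfies the Cartan formula, and \<open>Sq2\<close> takes \<open>\<xi>\<^sub>2\<close> to \<open>\<xi>\<^sub>1\<close>.\<close>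

abbreviation "vX \<equiv> Poly_Mapping.single (Factor 0 1 :: (unit, nat) tvar) (1::nat)"
abbreviation "vY \<equiv> Poly_Mapping.single (Factor 0 2 :: (unit, nat) tvar) (1::nat)"
abbreviation xx :: "(unit, nat) tvar fpoly" where "xx \<equiv> pvar (Factor 0 (Suc 0))"
abbreviation yy :: "(unit, nat) tvar fpoly" where "yy \<equiv> pvar (Factor 0 2)"

definition Sq1m :: "(unit, nat) tvar mon \<Rightarrow> (unit, nat) tvar fpoly" where
  "Sq1m m = (if odd (lookup m (Factor 0 1)) then mo (m - vX) else 0)"

definition Sq2x :: "(unit, nat) tvar mon \<Rightarrow> (unit, nat) tvar fpoly" where
  "Sq2x m = (if odd (lookup m (Factor 0 1) choose 2) then mo (m - (vX + vX)) else 0)"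

definition Sq2y :: "(unit, nat) tvar mon \<Rightarrow> (unit, nat) tvar fpoly" where
  "Sq2y m = (if odd (lookup m (Factor 0 2)) then mo (m - vY + vX) else 0)"

definition Sq1 :: "(unit, nat) tvar fpoly \<Rightarrow> (unit, nat) tvar fpoly" where
  "Sq1 = lin Sq1m"

definition Sq2 :: "(unit, nat) tvar fpoly \<Rightarrow> (unit, nat) tvar fpoly" where
  "Sq2 = lin (\<lambda>m. Sq2x m + Sq2y m)"

lemma mon_minus_add:
  assumes "\<And>v. lookup k v \<le> lookup m v"
  shows "(m :: 'v mon) - k + n = m + n - k" "n + (m - k) = n + m - k"
  using assms by (auto intro!: poly_mapping_eqI simp: lookup_add lookup_minus)

lemma mon_minus_minus: "(m :: 'v mon) - k - l = m - (k + l)"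
  by (auto intro!: poly_mapping_eqI simp: lookup_add lookup_minus)

lemma vX_le: "lookup m (Factor 0 1) > 0 \<Longrightarrow> lookup vX v \<le> lookup m v"
  by (auto simp: lookup_single when_def)

lemma vXX_le: "lookup m (Factor 0 1) > 1 \<Longrightarrow> lookup (vX + vX) v \<le> lookup m v"
  by (auto simp: lookup_single when_def lookup_add)

lemma vY_le: "lookup m (Factor 0 2) > 0 \<Longrightarrow> lookup vY v \<le> lookup m v"
  by (auto simp: lookup_single when_def)

lemma choose_two_add: "(e + f) choose 2 = (e choose 2) + e * f + (f choose 2)"
proof (induction f)
  case (Suc f)
  have "Suc n choose 2 = n + (n choose 2)" for n
    by (simp add: numeral_2_eq_2)
  then show ?case using Suc by simp
qed simp

lemma odd_choose_two: "odd (e choose 2) \<Longrightarrow> e > 1"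
  by (rule ccontr) (auto simp: not_less le_Suc_eq binomial_eq_0)

lemma Sq1m_add: "Sq1m (m + n) = Sq1m m * mo n + mo m * Sq1m n"
proof -
  let ?e = "lookup m (Factor 0 1)" and ?f = "lookup n (Factor 0 1)"
  have 1: "m - vX + n = m + n - vX" if "odd ?e"
    using that by (intro mon_minus_add vX_le) (auto elim: oddE)
  have 2: "m + (n - vX) = m + n - vX" if "odd ?f"
    using that by (intro mon_minus_add vX_le) (auto elim: oddE)
  show ?thesis using 1 2 by (auto simp: Sq1m_def lookup_add mo_mult)
qed

lemma Sq2x_add: "Sq2x (m + n) = Sq2x m * mo n + Sq1m m * Sq1m n + mo m * Sq2x n"
proof -
  let ?e = "lookup m (Factor 0 1)" and ?f = "lookup n (Factor 0 1)"
  have 1: "m - (vX + vX) + n = m + n - (vX + vX)" if "odd (?e choose 2)"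
    using odd_choose_two[OF that] by (intro mon_minus_add vXX_le)
  have 2: "m + (n - (vX + vX)) = m + n - (vX + vX)" if "odd (?f choose 2)"
    using odd_choose_two[OF that] by (intro mon_minus_add vXX_le)
  have 3: "(m - vX) + (n - vX) = m + n - (vX + vX)" if "odd ?e" "odd ?f"
  proof -
    have "(m - vX) + (n - vX) = m + (n - vX) - vX"
      using that by (intro mon_minus_add vX_le) (auto elim: oddE)
    also have "m + (n - vX) = m + n - vX"
      using that by (intro mon_minus_add vX_le) (auto elim: oddE)
    finally show ?thesis by (simp add: mon_minus_minus)
  qed
  have odd: "odd ((?e + ?f) choose 2) \<longleftrightarrow> (odd (?e choose 2) \<noteq> ((odd ?e \<and> odd ?f) \<noteq> odd (?f choose 2)))"
    by (auto simp: choose_two_add)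
  show ?thesis
    unfolding Sq2x_def Sq1m_def lookup_add odd using 1 2 3
    by (cases "odd (?e choose 2)"; cases "odd (?f choose 2)"; cases "odd ?e"; cases "odd ?f")
      (simp_all only: mo_mult if_True if_False simp_thms mult_zero_left mult_zero_right
        add_0_left add_0_right fpoly_add_self fpoly_add_self_left)
qed

lemma Sq2y_add: "Sq2y (m + n) = Sq2y m * mo n + mo m * Sq2y n"
proof -
  let ?e = "lookup m (Factor 0 2)" and ?f = "lookup n (Factor 0 2)"
  have 1: "m - vY + vX + n = m + n - vY + vX" if "odd ?e"
  proof -
    have "m - vY + n = m + n - vY"
      using that by (intro mon_minus_add vY_le) (auto elim: oddE)
    then show ?thesis by (metis add.commute add.left_commute)
  qed
  have 2: "m + (n - vY + vX) = m + n - vY + vX" if "odd ?f"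
  proof -
    have "m + (n - vY) = m + n - vY"
      using that by (intro mon_minus_add vY_le) (auto elim: oddE)
    then show ?thesis by (simp only: add.assoc[symmetric])
  qed
  show ?thesis unfolding Sq2y_def lookup_add using 1 2
    by (cases "odd ?e"; cases "odd ?f")
      (simp_all only: mo_mult if_True if_False simp_thms mult_zero_left mult_zero_right
        even_add add_0_left add_0_right fpoly_add_self fpoly_add_self_left)
qed

lemma Sq1_add: "Sq1 (p + q) = Sq1 p + Sq1 q"
  and Sq2_add: "Sq2 (p + q) = Sq2 p + Sq2 q"
  by (simp_all add: Sq1_def Sq2_def lin_add)

lemma Sq_0 [simp]: "Sq1 0 = 0" "Sq2 0 = 0"
  by (simp_all add: Sq1_def Sq2_def)

lemma additive_Sq: "additive Sq1" "additive Sq2"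
  by (simp_all add: additive_def Sq1_add Sq2_add)

lemma Sq1_mult: "Sq1 (p * q) = Sq1 p * q + p * Sq1 q"
  by (rule biadditive_eqI[where F = "\<lambda>p q. Sq1 (p * q)" and G = "\<lambda>p q. Sq1 p * q + p * Sq1 q"])
    (simp_all add: additive_def distrib_left distrib_right Sq1_add add_ac,
     simp only: mo_mult Sq1_def lin_mo Sq1m_add add_ac)

lemma Sq2_mult: "Sq2 (p * q) = Sq2 p * q + Sq1 p * Sq1 q + p * Sq2 q"
  by (rule biadditive_eqI[where F = "\<lambda>p q. Sq2 (p * q)"
        and G = "\<lambda>p q. Sq2 p * q + Sq1 p * Sq1 q + p * Sq2 q"])
    (simp_all add: additive_def distrib_left distrib_right Sq1_add Sq2_add add_ac,
     simp only: mo_mult Sq1_def Sq2_def lin_mo Sq2x_add Sq2y_add distrib_left distrib_right add_ac)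

lemma Sq_pvar: "Sq1 (pvar v) = (if v = Factor 0 (Suc 0) then 1 else 0)"
  "Sq2 (pvar v) = (if v = Factor 0 2 then xx else 0)"
  by (auto simp: Sq1_def Sq2_def Sq1m_def Sq2x_def Sq2y_def pvar_def lookup_single when_def binomial_eq_0)

text \<open>A pair of maps satisfying the Cartan formula over a ring homomorphism is determined by its
  values on the variables.\<close>

definition jet :: "('v fpoly \<Rightarrow> 'w fpoly) \<Rightarrow> ('v fpoly \<Rightarrow> 'w fpoly) \<Rightarrow> ('v fpoly \<Rightarrow> 'w fpoly) \<Rightarrow> bool" where
  "jet h D T \<longleftrightarrow> rhom h \<and> additive D \<and> additive T \<and>
     (\<forall>p q. D (p * q) = D p * h q + h p * D q) \<and>
     (\<forall>p q. T (p * q) = T p * h q + D p * D q + h p * T q)"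

lemma jet_eqI:
  assumes 1: "jet h D T" and 2: "jet h D' T'"
    and v: "\<And>v. D (pvar v) = D' (pvar v)" "\<And>v. T (pvar v) = T' (pvar v)"
  shows "D p = D' p \<and> T p = T' p"
proof -
  have D1: "D 1 = 0" "T 1 = 0" if "jet h D T" for D T
  proof -
    have h1: "h 1 = 1" using that by (simp add: jet_def rhom_1)
    have "D (1 * 1) = D 1 * h 1 + h 1 * D 1" "T (1 * 1) = T 1 * h 1 + D 1 * D 1 + h 1 * T 1"
      using that unfolding jet_def by blast+
    then show "D 1 = 0" "T 1 = 0" by (simp_all add: h1)
  qed
  have mo: "D (mo m) = D' (mo m) \<and> T (mo m) = T' (mo m)" for m
  proof (induction m rule: mon_induct)
    case zero
    then show ?case using D1[OF 1] D1[OF 2] by simp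
  next
    case (var w)
    then show ?case using v by (simp only: mo_var)
  next
    case (add m n)
    have "D (mo m * mo n) = D' (mo m * mo n)" "T (mo m * mo n) = T' (mo m * mo n)"
      using 1 2 add unfolding jet_def by simp_all
    then show ?case by (simp only: mo_mult)
  qed
  have "additive D" "additive D'" "additive T" "additive T'" using 1 2 by (auto simp: jet_def)
  then show ?thesis using mo additive_eqI[of D D' p] additive_eqI[of T T' p] by blast
qed

lemma jet_Sq_comp: "rhom h \<Longrightarrow> jet h (\<lambda>p. Sq1 (h p)) (\<lambda>p. Sq2 (h p))"
  and jet_comp_Sq: "rhom h \<Longrightarrow> jet h (\<lambda>p. h (Sq1 p)) (\<lambda>p. h (Sq2 p))"
  by (auto simp: jet_def rhom_add rhom_mult Sq1_add Sq2_add Sq1_mult Sq2_mult additive_def)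

lemma Sq_SH [simp]: "Sq1 (SH (Suc p) z) = 0" "Sq2 (SH (Suc p) z) = 0"
proof -
  have j: "jet (SH (Suc p)) (\<lambda>_. 0) (\<lambda>_. 0)" by (simp add: jet_def rhom_psubst additive_def)
  have "Sq1 (SH (Suc p) (pvar v)) = 0 \<and> Sq2 (SH (Suc p) (pvar v)) = 0"
    for v :: "(unit, nat) tvar"
    by (cases v) (auto simp: Sq_pvar)
  then show "Sq1 (SH (Suc p) z) = 0" "Sq2 (SH (Suc p) z) = 0"
    using jet_eqI[OF jet_Sq_comp[OF rhom_psubst] j] by blast+
qed

lemma Sq_xi [simp]: "Sq1 (cl_xi (Suc p) n) = 0" "Sq2 (cl_xi (Suc p) n) = 0"
  using Sq_SH[of p "cl_xi 0 n"] by simp_all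

lemma Sq_1 [simp]: "Sq1 1 = 0" "Sq2 1 = 0"
  using Sq_SH[of 0 1] by simp_all

lemma Sq_square: "Sq1 (p ^ 2) = 0" "Sq2 (p ^ 2) = Sq1 p ^ 2"
  by (simp_all add: power2_eq_square Sq1_mult Sq2_mult algebra_simps)

lemma Sq_xi0: "Sq1 (cl_xi 0 n) = (if n = 1 then 1 else 0)" "Sq2 (cl_xi 0 n) = (if n = 2 then xx else 0)"
  by (auto simp: cl_xi_def Sq_pvar)

lemma Sq_xi0_power:
  "Sq1 (cl_xi 0 n ^ (2 ^ k)) = (if k = 0 \<and> n = 1 then 1 else 0)"
  "Sq2 (cl_xi 0 n ^ (2 ^ k)) = (if k = 0 \<and> n = 2 then xx else if k = 1 \<and> n = 1 then 1 else 0)"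
proof -
  have sq: "p ^ (2 ^ Suc k) = (p ^ (2 ^ k)) ^ 2" for p :: "(unit, nat) tvar fpoly" and k
    by (metis power_Suc2 power_mult)
  show 1: "Sq1 (cl_xi 0 n ^ (2 ^ k)) = (if k = 0 \<and> n = 1 then 1 else 0)" for k
    by (cases k) (auto simp: Sq_xi0 sq Sq_square simp del: power_Suc)
  show "Sq2 (cl_xi 0 n ^ (2 ^ k)) = (if k = 0 \<and> n = 2 then xx else if k = 1 \<and> n = 1 then 1 else 0)"
    by (cases k) (auto simp: Sq_xi0 sq Sq_square 1 simp del: power_Suc)
qed

lemma Sq_cop: "Sq1 (cop 0 n) = (if n = 1 then 1 else 0)"
  "Sq2 (cop 0 n) = (if n = 2 then cop 0 1 else 0)"
proof -
  have "Sq1 (cop 0 n) = (\<Sum>k\<le>n. if k = 0 then (if n = 1 then 1 else 0) else 0)"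
    unfolding cop_def additive_sum[OF additive_Sq(1)]
    by (intro sum.cong) (auto simp: Sq1_mult Sq_xi0_power)
  then show "Sq1 (cop 0 n) = (if n = 1 then 1 else 0)" by simp
  have "Sq2 (cop 0 n) = (\<Sum>k\<le>n. (if k = 0 then (if n = 2 then xx else 0) else 0)
      + (if k = 1 then (if n = 2 then cl_xi 1 1 else 0) else 0))"
    unfolding cop_def additive_sum[OF additive_Sq(2)]
    by (intro sum.cong) (auto simp: Sq2_mult Sq_xi0_power)
  then show "Sq2 (cop 0 n) = (if n = 2 then cop 0 1 else 0)"
    by (auto simp: sum.distrib cop_def cl_xi_def)
qed

lemma Sq_CF: "i \<ge> 1 \<Longrightarrow> Sq1 (CF cl i z) = CF cl i (Sq1 z)"
  "i \<ge> 1 \<Longrightarrow> Sq2 (CF cl i z) = CF cl i (Sq2 z)"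
proof -
  have "Sq1 (CF cl i (pvar v)) = CF cl i (Sq1 (pvar v)) \<and> Sq2 (CF cl i (pvar v)) = CF cl i (Sq2 (pvar v))"
    if "i \<ge> 1" for v
  proof (cases v)
    case (Factor p n)
    show ?thesis
    proof (cases p)
      case 0
      then show ?thesis using Factor that
        by (auto simp: CF_pvar Sq_cop Sq_pvar simp del: psubst_pvar)
    next
      case (Suc q)
      have "cop p n = SH (Suc q) (cop 0 n)"
        using SH_coprod[of p n] SH_coprod[of 0 n] Suc by simp
      then have "Sq1 (cop p n) = 0" "Sq2 (cop p n) = 0" by simp_all
      then show ?thesis using Factor Suc that
        by (auto simp: CF_pvar Sq_pvar simp del: psubst_pvar)
    qed
  qed (auto simp: Sq_pvar)
  then show "i \<ge> 1 \<Longrightarrow> Sq1 (CF cl i z) = CF cl i (Sq1 z)"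
    "i \<ge> 1 \<Longrightarrow> Sq2 (CF cl i z) = CF cl i (Sq2 z)"
    using jet_eqI[OF jet_Sq_comp jet_comp_Sq, OF rhom_psubst rhom_psubst] by blast+
qed

lemma derivation_0:
  fixes D :: "'v fpoly \<Rightarrow> 'v fpoly"
  assumes "additive D" "\<And>p q. D (p * q) = D p * q + p * D q" "\<And>v. D (pvar v) = 0"
  shows "D p = 0"
proof -
  have 1: "D 1 = 0" using assms(2)[of 1 1] by simp
  have "D (mo m) = 0" for m
  proof (induction m rule: mon_induct)
    case (var w)
    then show ?case using assms(3) by (simp only: mo_var)
  next
    case (add m n)
    then show ?case using assms(2)[of "mo m" "mo n"] by (simp add: mo_mult)
  qed (simp add: 1)
  then show ?thesis using additive_eqI[OF assms(1), of "\<lambda>_. 0" p] by (simp add: additive_def)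
qed

lemma Sq1_Sq1 [simp]: "Sq1 (Sq1 z) = 0"
  by (rule derivation_0[where D = "\<lambda>z. Sq1 (Sq1 z)"])
    (auto simp: additive_def Sq1_add Sq1_mult Sq_pvar algebra_simps)

text \<open>The Adem relation \<open>Sq2 Sq2 = Sq3 Sq1\<close>.\<close>

lemma Sq2_Sq2: "Sq2 (Sq2 z) = Sq1 (Sq2 (Sq1 z))"
proof -
  define D where "D z = Sq2 (Sq2 z) + Sq1 (Sq2 (Sq1 z))" for z
  have "D z = 0"
  proof (rule derivation_0[of D])
    show "additive D" by (auto simp: additive_def D_def Sq1_add Sq2_add algebra_simps)
    show "D (p * q) = D p * q + p * D q" for p q
      by (simp add: D_def Sq1_add Sq2_add Sq1_mult Sq2_mult algebra_simps)
    show "D (pvar v) = 0" for v by (auto simp: D_def Sq_pvar)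
  qed
  then show ?thesis by (simp add: D_def fpoly_add_eq_0_iff)
qed

lemma Sq_xx_mult: "Sq1 (xx * z) = z + xx * Sq1 z" "Sq2 (xx * z) = Sq1 z + xx * Sq2 z"
  and Sq_yy_mult: "Sq1 (yy * z) = yy * Sq1 z" "Sq2 (yy * z) = xx * z + yy * Sq2 z"
  by (simp_all add: Sq1_mult Sq2_mult Sq_pvar)

lemmas Sq_expand = Sq_xx_mult Sq_yy_mult Sq1_add Sq2_add distrib_left distrib_right

text \<open>Explicit preimages that prove the exactness of the periodic sequence
  \<open>D1 \<rightarrow> D \<rightarrow> \<Gamma> \<rightarrow> \<Gamma> \<rightarrow> D \<rightarrow> D1\<close> with maps inclusion, \<open>Sq2\<close>, \<open>Sq2\<close>, \<open>Sq1 Sq2\<close> and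
  \<open>Sq2 Sq1 Sq2\<close>, where \<open>D\<close> is the kernel of \<open>Sq1\<close> and \<open>D1\<close> that of \<open>Sq1\<close> and \<open>Sq2\<close>.  As \<open>\<Gamma>\<close> is free over
  \<open>D1\<close> on the monomials \<open>\<xi>\<^sub>1\<^sup>a \<xi>\<^sub>2\<^sup>b\<close> with \<open>a \<le> 3\<close> and \<open>b \<le> 1\<close>, the operations recover the coordinates of an
  element, and the preimage can be written down coordinate by coordinate.\<close>

definition pre_Sq2 where
  "pre_Sq2 z = xx * (xx * z) + xx * (xx * (xx * Sq1 z)) + yy * Sq1 z + xx * (xx * (yy * Sq2 (Sq1 z)))"

lemma pre_Sq2:
  assumes "Sq2 z = 0"
  shows "Sq1 (pre_Sq2 z) = 0" "Sq2 (pre_Sq2 z) = z"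
proof -
  define b e where "b = Sq1 z" and "e = Sq2 b"
  have f: "Sq1 z = b" "Sq2 z = 0" "Sq1 b = 0" "Sq2 b = e" "Sq1 e = 0" "Sq2 e = 0"
    using Sq2_Sq2[of z] Sq2_Sq2[of b] assms by (auto simp: b_def e_def)
  show "Sq1 (pre_Sq2 z) = 0" "Sq2 (pre_Sq2 z) = z"
    unfolding pre_Sq2_def f by (simp_all only: Sq_expand f Sq_0 mult_zero_right add_0_left add_0_right)
      (simp_all add: ac_simps)
qed

definition pre_Sq2' where
  "pre_Sq2' z = (let b = Sq1 z; c = Sq2 z; e = Sq2 b; k = Sq2 c; c20 = c + xx * (xx * k);
     c01 = e + xx * k; c10 = b + xx * (xx * c01) + yy * k;
     c00 = z + xx * c10 + xx * (xx * c20) + yy * c01 + xx * (xx * (xx * c01)) + xx * (yy * k)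
     in xx * (xx * c00) + xx * (xx * (xx * c10)) + xx * (yy * c20) + xx * (xx * (yy * c01))
       + xx * (xx * (xx * (yy * k))) + xx * (xx * (xx * (xx * (xx * (xx * k))))))"

lemma pre_Sq2':
  assumes "Sq1 (Sq2 z) = 0"
  shows "Sq2 (pre_Sq2' z) = z"
proof -
  define b c e k where "b = Sq1 z" and "c = Sq2 z" and "e = Sq2 b" and "k = Sq2 c"
  have f: "Sq1 z = b" "Sq2 z = c" "Sq1 b = 0" "Sq2 b = e" "Sq1 c = 0" "Sq2 c = k"
    "Sq1 e = k" "Sq2 e = 0" "Sq1 k = 0" "Sq2 k = 0"
    using Sq2_Sq2[of z] Sq2_Sq2[of b] Sq2_Sq2[of c] assms by (auto simp: b_def c_def e_def k_def)
  show ?thesis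
    unfolding pre_Sq2'_def f Let_def by (simp only: Sq_expand f Sq_0 mult_zero_right add_0_left add_0_right)
      (simp add: ac_simps)
qed

definition pre_Sq3 where
  "pre_Sq3 z = (let c = Sq2 z; k = Sq1 c; c20 = c + xx * k; c00 = z + xx * (xx * c20) + yy * k
     in xx * (xx * (xx * c00)) + xx * (xx * (yy * c20)) + xx * (xx * (xx * (yy * k))))"

lemma pre_Sq3:
  assumes "Sq1 z = 0" "Sq2 (Sq1 (Sq2 z)) = 0"
  shows "Sq1 (Sq2 (pre_Sq3 z)) = z"
proof -
  define c k where "c = Sq2 z" and "k = Sq1 c"
  have f: "Sq1 z = 0" "Sq2 z = c" "Sq1 c = k" "Sq2 c = 0" "Sq1 k = 0" "Sq2 k = 0"
    using Sq2_Sq2[of z] assms by (auto simp: c_def k_def)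
  show ?thesis
    unfolding pre_Sq3_def f Let_def by (simp only: Sq_expand f Sq_0 mult_zero_right add_0_left add_0_right)
      (simp add: ac_simps)
qed

lemma pre_Sq5:
  assumes "Sq1 z = 0" "Sq2 z = 0"
  shows "Sq1 (xx * (xx * (yy * z))) = 0" "Sq2 (Sq1 (Sq2 (xx * (xx * (yy * z))))) = z"
  by (simp_all only: Sq_expand assms Sq_0 mult_zero_right add_0_left add_0_right)
    (simp_all add: ac_simps)

lemma Sq_cochains:
  assumes "z \<in> cc f t" "f \<ge> 1"
  shows "Sq1 z \<in> cc f (t - 1)" "Sq2 z \<in> cc f (t - 2)"
proof -
  have x: "vX \<in> cmons cl f 1" and y: "vY \<in> cmons cl f 3"
    using assms(2) by (auto simp: cmons_def mdegree_single)
  have minus: "m - k \<in> cmons cl f (t - s)"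
    if "m \<in> cmons cl f t" "\<And>v. lookup k v \<le> lookup m v" "k \<in> cmons cl f s" for m k s
  proof -
    have "m - k + k = m" using that(2) by (auto intro!: poly_mapping_eqI simp: lookup_add lookup_minus)
    then have "mdegree (vdeg cl) m = mdegree (vdeg cl) (m - k) + mdegree (vdeg cl) k"
      by (metis mdegree_add)
    moreover have "keys (m - k) \<subseteq> keys m" by (auto simp: in_keys_iff lookup_minus)
    ultimately show ?thesis using that by (auto simp: cmons_def)
  qed
  have 1: "Sq1m m \<in> sp (cmons cl f (t - 1))" if "m \<in> cmons cl f t" for m
    using minus[OF that vX_le x] by (auto simp: Sq1m_def elim: oddE)
  have 2: "Sq2x m \<in> sp (cmons cl f (t - 2))" if "m \<in> cmons cl f t" for m
    using minus[OF that vXX_le, of 2] cmons_add[OF x x] odd_choose_two by (auto simp: Sq2x_def)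
  have 3: "Sq2y m \<in> sp (cmons cl f (t - 2))" if "m \<in> cmons cl f t" for m
  proof (cases "odd (lookup m (Factor 0 2))")
    case True
    then have "m - vY \<in> cmons cl f (t - 3)"
      using minus[OF that vY_le y] by (auto elim: oddE)
    from cmons_add[OF this x] show ?thesis using True by (simp add: Sq2y_def)
  qed (simp add: Sq2y_def)
  show "Sq1 z \<in> cc f (t - 1)" "Sq2 z \<in> cc f (t - 2)"
    using assms(1) 1 2 3 unfolding cochains_sp Sq1_def Sq2_def
    by (auto intro!: sp_lin[of z "cmons cl f t"] sp_add)
qed

section \<open>Relative exactness of filtered complexes\<close>

text \<open>A complex is given by a differential and by its groups in each cohomological degree and
  internal degree.  Relative exactness means that the cohomology of the quotient by the subcomplex
  vanishes in the given bidegree.\<close>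

definition rel_exact ::
  "(nat \<Rightarrow> 'm \<Rightarrow> 'm::ab_group_add) \<Rightarrow> (nat \<Rightarrow> int \<Rightarrow> 'm set) \<Rightarrow> (nat \<Rightarrow> int \<Rightarrow> 'm set) \<Rightarrow> nat \<Rightarrow> int \<Rightarrow> bool" where
  "rel_exact d L K f t \<longleftrightarrow> (\<forall>z\<in>K f t. d f z \<in> L (Suc f) t \<longrightarrow>
     (if f = 0 then z \<in> L 0 t else \<exists>y\<in>K (f - 1) t. z - d (f - 1) y \<in> L f t))"

abbreviation "exact d K \<equiv> rel_exact d (\<lambda>_ _. {0}) K"

lemma rel_exact_0:
  "rel_exact d L K 0 t \<longleftrightarrow> (\<forall>z\<in>K 0 t. d 0 z \<in> L 1 t \<longrightarrow> z \<in> L 0 t)"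
  by (simp add: rel_exact_def)

lemma rel_exact_Suc:
  "rel_exact d L K (Suc f) t \<longleftrightarrow>
     (\<forall>z\<in>K (Suc f) t. d (Suc f) z \<in> L (Suc (Suc f)) t \<longrightarrow> (\<exists>y\<in>K f t. z - d f y \<in> L (Suc f) t))"
  by (simp add: rel_exact_def)

lemma exact_SucD:
  assumes "exact d K (Suc f) t" "z \<in> K (Suc f) t" "d (Suc f) z = 0"
  obtains y where "y \<in> K f t" "z = d f y"
  using assms unfolding rel_exact_Suc by force

text \<open>Dimension shifting along a short exact sequence \<open>0 \<rightarrow> X \<rightarrow> Y \<rightarrow> Z \<rightarrow> 0\<close>.\<close>

lemma exact_shift:
  fixes d :: "nat \<Rightarrow> 'm \<Rightarrow> 'm::ab_group_add"
  assumes d: "\<And>f. additive (d f)" "\<And>f z. d (Suc f) (d f z) = 0" and \<theta>: "additive \<theta>"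
    and X: "\<And>f. X f t = {z \<in> Y f t. \<theta> z = 0}"
    and Z: "\<And>f z. z \<in> Y f t \<Longrightarrow> \<theta> z \<in> Z f (t - c)"
    and onto: "\<And>f z. z \<in> Z f (t - c) \<Longrightarrow> \<exists>y\<in>Y f t. \<theta> y = z"
    and comm: "\<And>f z. z \<in> Y f t \<Longrightarrow> \<theta> (d f z) = d f (\<theta> z)"
    and Y: "\<And>f y y'. y \<in> Y f t \<Longrightarrow> y' \<in> Y f t \<Longrightarrow> y - y' \<in> Y f t"
      "\<And>f y. y \<in> Y f t \<Longrightarrow> d f y \<in> Y (Suc f) t"
    and ex: "exact d Y f t" "f \<ge> 1 \<Longrightarrow> exact d Z (f - 1) (t - c)"
  shows "exact d X f t"
proof -
  have minus: "h (a - b) = h a - h b" if "additive h" for h :: "'m \<Rightarrow> 'm" and a b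
    using additiveD[OF that, of "a - b" b] by (simp add: algebra_simps)
  show ?thesis
  proof (cases f)
    case 0
    then show ?thesis using ex(1) X by (auto simp: rel_exact_0)
  next
    case (Suc e)
    have "\<exists>y\<in>X e t. z - d e y = 0" if z: "z \<in> X (Suc e) t" "d (Suc e) z = 0" for z
    proof -
      obtain y where y: "y \<in> Y e t" "z = d e y"
        using exact_SucD[OF ex(1)[unfolded Suc]] z X by blast
      have cyc: "\<theta> y \<in> Z e (t - c)" "d e (\<theta> y) = 0"
        using Z[OF y(1)] comm[OF y(1)] y(2) z X by auto
      show ?thesis
      proof (cases e)
        case 0
        then have "\<theta> y = 0" using ex(2) Suc cyc by (auto simp: rel_exact_0)
        then show ?thesis using y X by (intro bexI[of _ y]) auto
      next
        case (Suc e')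
        then obtain v where v: "v \<in> Z e' (t - c)" "\<theta> y = d e' v"
          using exact_SucD[of d Z e' "t - c" "\<theta> y"] ex(2) \<open>f = Suc e\<close> cyc by auto
        obtain v' where v': "v' \<in> Y e' t" "\<theta> v' = v" using onto[OF v(1)] by blast
        have "y - d e' v' \<in> Y e t" using Y(1)[OF y(1)] Y(2)[OF v'(1)] Suc by simp
        moreover have "\<theta> (y - d e' v') = 0"
          using minus[OF \<theta>] comm[OF v'(1)] v v' by simp
        moreover have "d e (y - d e' v') = z"
          using minus[OF d(1)] d(2) y(2) Suc by simp
        ultimately show ?thesis using X by (intro bexI[of _ "y - d e' v'"]) auto
      qed
    qed
    then show ?thesis using Suc by (simp add: rel_exact_Suc)
  qed
qed

text \<open>Complexes over the subalgebra generated by \<open>Sq1\<close> and \<open>Sq2\<close>, and their periodic resolution.\<close>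

locale A1_complex =
  fixes d :: "nat \<Rightarrow> 'm \<Rightarrow> 'm::ab_group_add" and G :: "nat \<Rightarrow> int \<Rightarrow> 'm set" and s1 s2 :: "'m \<Rightarrow> 'm"
  assumes add_d: "\<And>f. additive (d f)" and add_s: "additive s1" "additive s2"
    and dd: "\<And>f z. d (Suc f) (d f z) = 0"
    and s_d: "\<And>f z. s1 (d f z) = d f (s1 z)" "\<And>f z. s2 (d f z) = d f (s2 z)"
    and s1s1: "\<And>z. s1 (s1 z) = 0" and s2s2: "\<And>z. s2 (s2 z) = s1 (s2 (s1 z))"
    and G_minus: "\<And>f t y y'. y \<in> G f t \<Longrightarrow> y' \<in> G f t \<Longrightarrow> y - y' \<in> G f t"
    and G_d: "\<And>f t y. y \<in> G f t \<Longrightarrow> d f y \<in> G (Suc f) t"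
    and G_s: "\<And>f t y. y \<in> G f t \<Longrightarrow> s1 y \<in> G f (t - 1)" "\<And>f t y. y \<in> G f t \<Longrightarrow> s2 y \<in> G f (t - 2)"
    and pre2: "\<And>f t z. z \<in> G f t \<Longrightarrow> s2 z = 0 \<Longrightarrow> \<exists>y\<in>G f (t + 2). s1 y = 0 \<and> s2 y = z"
    and pre2': "\<And>f t z. z \<in> G f t \<Longrightarrow> s1 (s2 z) = 0 \<Longrightarrow> \<exists>y\<in>G f (t + 2). s2 y = z"
    and pre3: "\<And>f t z. z \<in> G f t \<Longrightarrow> s1 z = 0 \<Longrightarrow> s2 (s1 (s2 z)) = 0 \<Longrightarrow> \<exists>y\<in>G f (t + 3). s1 (s2 y) = z"
    and pre5: "\<And>f t z. z \<in> G f t \<Longrightarrow> s1 z = 0 \<Longrightarrow> s2 z = 0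
      \<Longrightarrow> \<exists>y\<in>G f (t + 5). s1 y = 0 \<and> s2 (s1 (s2 y)) = z"
begin

definition "D f t = {z \<in> G f t. s1 z = 0}"
definition "D1 f t = {z \<in> G f t. s1 z = 0 \<and> s2 z = 0}"

lemma s_0 [simp]: "s1 0 = 0" "s2 0 = 0"
  using add_s by (auto simp: additive_0)

lemma s_minus: "s1 (a - b) = s1 a - s1 b" "s2 (a - b) = s2 a - s2 b"
  using additiveD[OF add_s(1), of "a - b" b] additiveD[OF add_s(2), of "a - b" b]
  by (simp_all add: algebra_simps)

lemma d_0 [simp]: "d f 0 = 0"
  using add_d by (auto simp: additive_0)

lemma s2s2_D: "s1 z = 0 \<Longrightarrow> s2 (s2 z) = 0"
  by (simp add: s2s2)

lemma s1s2s2: "s1 (s2 (s2 z)) = 0"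
  by (simp add: s2s2 s1s1)

lemma s5_s3: "s2 (s1 (s2 (s1 (s2 z)))) = 0"
proof -
  have "s2 (s1 (s2 (s1 (s2 z)))) = s2 (s2 (s2 (s2 z)))" by (simp only: s2s2[of "s2 z"])
  also have "\<dots> = 0" using s1s2s2[of z] s2s2[of "s2 (s2 z)"] by simp
  finally show ?thesis .
qed

lemma s5_D1: "s1 z = 0 \<Longrightarrow> s1 (s2 (s1 (s2 z))) = 0" "s2 (s2 (s1 (s2 z))) = 0"
proof -
  show "s1 z = 0 \<Longrightarrow> s1 (s2 (s1 (s2 z))) = 0"
    using s2s2_D[of z] s2s2[of "s2 z"] by simp
  show "s2 (s2 (s1 (s2 z))) = 0" by (simp add: s2s2 s1s1)
qed

lemma additive_s_comp: "additive (\<lambda>z. s1 (s2 z))" "additive (\<lambda>z. s2 (s1 (s2 z)))"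
  using add_s by (auto simp: additive_def)

text \<open>Four dimension shifts, along the short exact sequences into which the periodic sequence
  decomposes; the intermediate terms are the kernels of \<open>s2\<close>, of \<open>s1 s2\<close>, and of \<open>s2 s1 s2\<close> on \<open>D\<close>.\<close>

theorem periodicity:
  assumes "exact d D f t" "f \<ge> 1 \<Longrightarrow> exact d G (f - 1) (t - 2)"
    "f \<ge> 2 \<Longrightarrow> exact d G (f - 2) (t - 4)" "f \<ge> 3 \<Longrightarrow> exact d D (f - 3) (t - 7)"
    "f \<ge> 4 \<Longrightarrow> exact d D1 (f - 4) (t - 12)"
  shows "exact d D1 f t"
proof -
  let ?Z1 = "\<lambda>f t. {z \<in> G f t. s2 z = 0}"
  let ?Z2 = "\<lambda>f t. {z \<in> G f t. s1 (s2 z) = 0}"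
  let ?Z3 = "\<lambda>f t. {z \<in> G f t. s1 z = 0 \<and> s2 (s1 (s2 z)) = 0}"
  have Z3: "exact d ?Z3 (f - 3) (t - 7)" if f: "f \<ge> 3"
  proof (rule exact_shift[where Y = D and Z = D1 and \<theta> = "\<lambda>z. s2 (s1 (s2 z))" and c = 5])
    show "exact d D (f - 3) (t - 7)" using assms f by simp
    show "exact d D1 (f - 3 - 1) (t - 7 - 5)" if "f - 3 \<ge> 1"
      using assms(5) f that by (simp add: numeral_eq_Suc)
    show "\<exists>y\<in>D f' (t - 7). s2 (s1 (s2 y)) = z" if "z \<in> D1 f' (t - 7 - 5)" for f' z
      using that pre5[of z f' "t - 7 - 5"] by (auto simp: D_def D1_def)
    show "s2 (s1 (s2 z)) \<in> D1 f' (t - 7 - 5)" if "z \<in> D f' (t - 7)" for f' z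
      using that G_s(2)[OF G_s(1)[OF G_s(2)], of z f' "t - 7"] s5_D1 by (auto simp: D_def D1_def)
  qed (use add_d dd additive_s_comp in \<open>auto simp: D_def s_d G_minus G_d s_minus\<close>)
  have Z2: "exact d ?Z2 (f - 2) (t - 4)" if f: "f \<ge> 2"
  proof (rule exact_shift[where Y = G and Z = ?Z3 and \<theta> = "\<lambda>z. s1 (s2 z)" and c = 3])
    show "exact d G (f - 2) (t - 4)" using assms f by simp
    show "exact d ?Z3 (f - 2 - 1) (t - 4 - 3)" if "f - 2 \<ge> 1"
      using Z3 f that by (simp add: numeral_eq_Suc)
    show "\<exists>y\<in>G f' (t - 4). s1 (s2 y) = z" if "z \<in> ?Z3 f' (t - 4 - 3)" for f' z
      using that pre3[of z f' "t - 4 - 3"] by auto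
    show "s1 (s2 z) \<in> ?Z3 f' (t - 4 - 3)" if "z \<in> G f' (t - 4)" for f' z
      using that G_s(1)[OF G_s(2), of z f' "t - 4"] by (auto simp: s1s1 s5_s3)
  qed (use add_d dd additive_s_comp in \<open>auto simp: s_d G_minus G_d\<close>)
  have Z1: "exact d ?Z1 (f - 1) (t - 2)" if f: "f \<ge> 1"
  proof (rule exact_shift[where Y = G and Z = ?Z2 and \<theta> = s2 and c = 2])
    show "exact d G (f - 1) (t - 2)" using assms f by simp
    show "exact d ?Z2 (f - 1 - 1) (t - 2 - 2)" if "f - 1 \<ge> 1"
      using Z2 f that by (simp add: numeral_eq_Suc)
    show "\<exists>y\<in>G f' (t - 2). s2 y = z" if "z \<in> ?Z2 f' (t - 2 - 2)" for f' z
      using that pre2'[of z f' "t - 2 - 2"] by auto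
    show "s2 z \<in> ?Z2 f' (t - 2 - 2)" if "z \<in> G f' (t - 2)" for f' z
      using that G_s(2)[of z f' "t - 2"] by (auto simp: s1s2s2)
  qed (use add_d dd add_s in \<open>auto simp: s_d G_minus G_d\<close>)
  show ?thesis
  proof (rule exact_shift[where Y = D and Z = ?Z1 and \<theta> = s2 and c = 2])
    show "exact d ?Z1 (f - 1) (t - 2)" if "f \<ge> 1" using Z1 that .
    show "\<exists>y\<in>D f' t. s2 y = z" if "z \<in> ?Z1 f' (t - 2)" for f' z
      using that pre2[of z f' "t - 2"] by (auto simp: D_def)
    show "s2 z \<in> ?Z1 f' (t - 2)" if "z \<in> D f' t" for f' z
      using that G_s(2)[of z f' t] by (auto simp: D_def s2s2_D)
  qed (use assms add_d dd add_s in \<open>auto simp: D_def D1_def s_d G_minus G_d s_minus\<close>)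
qed

end


declare psubst_pvar [simp del]

lemma CF_scalar [simp]: "CF H i (pvar (Scalar s)) = pvar (Scalar s)"
  by (simp add: psubst_pvar)

section \<open>Cobar complexes with coefficients, and the exactness of cofree coefficients\<close>

text \<open>The complex with coefficients in a subcomodule of \<open>\<Gamma>\<close> lives in one more tensor factor; its
  differential is the cobar differential without the coface that inserts a leading \<open>1\<close>.\<close>

definition dd :: "nat \<Rightarrow> (unit, nat) tvar fpoly \<Rightarrow> (unit, nat) tvar fpoly" where
  "dd f = DD cl 1 (Suc f)"

definition KG :: "nat \<Rightarrow> int \<Rightarrow> (unit, nat) tvar fpoly set" where
  "KG f t = cc (Suc f) t"

definition KD :: "nat \<Rightarrow> int \<Rightarrow> (unit, nat) tvar fpoly set" where
  "KD f t = {z \<in> KG f t. Sq1 z = 0}"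

definition KD1 :: "nat \<Rightarrow> int \<Rightarrow> (unit, nat) tvar fpoly set" where
  "KD1 f t = {z \<in> KG f t. Sq1 z = 0 \<and> Sq2 z = 0}"

lemma dd_dd: "dd (Suc f) (dd f z) = 0"
  by (simp add: dd_def DD_DD bialg_cl)

lemma additive_dd: "additive (dd f)"
  by (simp add: dd_def additive_DD)

lemmas dd_add = additiveD[OF additive_dd]

lemma dd_0 [simp]: "dd f 0 = 0"
  by (simp add: dd_def)

lemma KG_dd: "z \<in> KG f t \<Longrightarrow> dd f z \<in> KG (Suc f) t"
  by (simp add: KG_def dd_def DD_cochains bialg_cl)

lemma KG_add: "z \<in> KG f t \<Longrightarrow> z' \<in> KG f t \<Longrightarrow> z + z' \<in> KG f t"
  by (simp add: KG_def cochains_add)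

lemma Sq_dd: "Sq1 (dd f z) = dd f (Sq1 z)" "Sq2 (dd f z) = dd f (Sq2 z)"
  by (simp_all only: dd_def DD_def additive_sum[OF additive_Sq(1)] additive_sum[OF additive_Sq(2)])
    (auto intro!: sum.cong simp: Sq_CF)

fun counit_var :: "(unit, nat) tvar \<Rightarrow> (unit, nat) tvar fpoly" where
  "counit_var (Scalar s) = pvar (Scalar s)"
| "counit_var (Factor 0 n) = 0"
| "counit_var (Factor (Suc p) n) = pvar (Factor p n)"

text \<open>The counit applied to the leading factor contracts the complex with coefficients in \<open>\<Gamma>\<close>.\<close>

abbreviation "counit \<equiv> psubst counit_var"

lemma counit_pvar [simp]: "counit (pvar (Factor 0 n)) = 0"
  "counit (pvar (Factor (Suc p) n)) = pvar (Factor p n)" "counit (pvar (Scalar s)) = pvar (Scalar s)"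
  by (simp_all add: psubst_pvar)

lemma counit_xi: "counit (cl_xi 0 n) = (if n = 0 then 1 else 0)" "counit (cl_xi (Suc p) n) = cl_xi p n"
  by (auto simp: cl_xi_def)

lemma counit_cop: "counit (cop 0 n) = cl_xi 0 n" "counit (cop (Suc p) n) = cop p n"
proof -
  have "counit (cop 0 n) = (\<Sum>k\<le>n. if k = n then cl_xi 0 k else 0)"
    unfolding cop_def psubst_sum
    by (rule sum.cong) (auto simp: psubst_mult psubst_power counit_xi power_0_left)
  then show "counit (cop 0 n) = cl_xi 0 n" by simp
  show "counit (cop (Suc p) n) = cop p n"
    by (simp add: cop_def psubst_sum psubst_mult psubst_power counit_xi)
qed

lemma counit_cc: "z \<in> cc (Suc f) t \<Longrightarrow> counit z \<in> cc f t"
proof (rule rhom_cochains[OF rhom_psubst, where D = "\<lambda>x. x"])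
  fix p a assume "p < Suc f" "a \<in> gens cl"
  then show "counit (pvar (Factor p a)) \<in> cc f (gdeg cl a)"
    using cochains_pvar[of "p - 1" f a cl] by (cases p) (auto simp del: cl_simps)
qed auto

lemma cc_vars: "z \<in> cc f t \<Longrightarrow> z \<in> vars_in {Factor p n | p n. p < f \<and> n \<ge> 1}"
  by (auto simp: cochains_def vars_in_def)

lemma counit_CF1: "z \<in> cc f t \<Longrightarrow> counit (CF cl 1 z) = z"
proof -
  assume z: "z \<in> cc f t"
  have "counit (CF cl 1 (pvar (Factor p n))) = pvar (Factor p n)" if "n \<ge> 1" for p n
    using that by (cases p) (auto simp: CF_pvar counit_cop cl_xi_def)
  then show ?thesis
    by (intro rhom_eq_on[OF rhom_comp[OF rhom_psubst rhom_psubst] rhom_id cc_vars[OF z]]) blast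
qed

lemma counit_CF: "i \<ge> 1 \<Longrightarrow> counit (CF cl (Suc i) z) = CF cl i (counit z)"
proof (rule rhom_eqI[OF rhom_comp[OF rhom_psubst rhom_psubst] rhom_comp[OF rhom_psubst rhom_psubst]])
  fix v assume i: "i \<ge> 1"
  show "counit (CF cl (Suc i) (pvar v)) = CF cl i (counit (pvar v))"
  proof (cases v)
    case (Factor p n)
    then show ?thesis using i
      by (cases p) (auto simp: CF_pvar counit_cop)
  qed (simp add: CF_scalar)
qed

lemma exact_KG: "f \<ge> 1 \<or> t \<noteq> 0 \<Longrightarrow> exact dd KG f t"
proof -
  assume ft: "f \<ge> 1 \<or> t \<noteq> 0"
  have eq: "z = (\<Sum>i\<in>{1..Suc f}. CF cl i (counit z))" if "z \<in> cc (Suc f) t" "dd f z = 0" for z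
  proof -
    have "0 = counit (dd f z)" using that by simp
    also have "\<dots> = (\<Sum>i\<in>{1..Suc (Suc f)}. counit (CF cl i z))"
      by (simp only: dd_def DD_def psubst_sum)
    also have "\<dots> = counit (CF cl 1 z) + (\<Sum>i\<in>{Suc 1..Suc (Suc f)}. counit (CF cl i z))"
      by (subst sum.atLeast_Suc_atMost) auto
    also have "(\<Sum>i\<in>{Suc 1..Suc (Suc f)}. counit (CF cl i z)) = (\<Sum>i\<in>{1..Suc f}. CF cl i (counit z))"
      by (subst sum.atLeast_Suc_atMost_Suc_shift) (auto intro!: sum.cong simp: counit_CF)
    finally show ?thesis using counit_CF1[OF that(1)] by (simp add: fpoly_add_eq_0_iff)
  qed
  show ?thesis
  proof (cases f)
    case (Suc e)
    have "\<exists>y\<in>KG e t. z - dd e y = 0" if "z \<in> KG (Suc e) t" "dd (Suc e) z = 0" for z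
    proof (intro bexI)
      show "z - dd e (counit z) = 0"
        using eq[of z] that Suc by (simp add: KG_def dd_def DD_def fpoly_add_eq_0_iff)
      show "counit z \<in> KG e t" using that counit_cc by (simp add: KG_def)
    qed
    then show ?thesis using Suc by (simp add: rel_exact_Suc)
  next
    case 0
    have "z = 0" if "z \<in> KG 0 t" "dd 0 z = 0" for z
    proof -
      have c: "counit z \<in> cc 0 t" using that counit_cc by (simp add: KG_def)
      moreover have "cmons cl 0 t = {}" using ft 0 by (auto simp: cmons_def)
      ultimately have "counit z = 0" by (simp add: cochains_sp sp_empty)
      then show ?thesis using eq[of z] that 0 by (simp add: KG_def)
    qed
    then show ?thesis using 0 by (simp add: rel_exact_0)
  qed
qed

lemma cc_xx: "z \<in> cc f (t - 1) \<Longrightarrow> f \<ge> 1 \<Longrightarrow> xx * z \<in> cc f t"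
  using cochains_mult[OF cochains_pvar[of 0 f 1 cl], of z "t - 1"] by simp

lemma cc_yy: "z \<in> cc f (t - 3) \<Longrightarrow> f \<ge> 1 \<Longrightarrow> yy * z \<in> cc f t"
  using cochains_mult[OF cochains_pvar[of 0 f 2 cl], of z "t - 3"] by simp

lemma cc_Sq: "z \<in> cc f (t + 1) \<Longrightarrow> f \<ge> 1 \<Longrightarrow> Sq1 z \<in> cc f t"
  "z \<in> cc f (t + 2) \<Longrightarrow> f \<ge> 1 \<Longrightarrow> Sq2 z \<in> cc f t"
  using Sq_cochains[of z f "t + 1"] Sq_cochains[of z f "t + 2"] by simp_all

lemmas cc_intros = cc_xx cc_yy cc_Sq cochains_add

lemma pre_cc:
  assumes "z \<in> KG f t"
  shows "pre_Sq2 z \<in> KG f (t + 2)" "pre_Sq2' z \<in> KG f (t + 2)" "pre_Sq3 z \<in> KG f (t + 3)"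
    "xx * (xx * (yy * z)) \<in> KG f (t + 5)"
  using assms unfolding pre_Sq2_def pre_Sq2'_def pre_Sq3_def Let_def KG_def
  by (intro cc_intros; simp)+

interpretation F: A1_complex dd KG Sq1 Sq2
  rewrites "F.D = KD" and "F.D1 = KD1"
proof -
  show F: "A1_complex dd KG Sq1 Sq2"
  proof
    fix f t z
    assume z: "z \<in> KG f t"
    show "Sq1 z \<in> KG f (t - 1)" "Sq2 z \<in> KG f (t - 2)"
      using z Sq_cochains by (simp_all add: KG_def)
    show "\<exists>y\<in>KG f (t + 2). Sq1 y = 0 \<and> Sq2 y = z" if "Sq2 z = 0"
      using pre_cc[OF z] pre_Sq2[OF that] by blast
    show "\<exists>y\<in>KG f (t + 2). Sq2 y = z" if "Sq1 (Sq2 z) = 0"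
      using pre_cc[OF z] pre_Sq2'[OF that] by blast
    show "\<exists>y\<in>KG f (t + 3). Sq1 (Sq2 y) = z" if "Sq1 z = 0" "Sq2 (Sq1 (Sq2 z)) = 0"
      using pre_cc[OF z] pre_Sq3[OF that] by blast
    show "\<exists>y\<in>KG f (t + 5). Sq1 y = 0 \<and> Sq2 (Sq1 (Sq2 y)) = z" if "Sq1 z = 0" "Sq2 z = 0"
      using pre_cc[OF z] pre_Sq5[OF that] by blast
  qed (auto simp: additive_dd additive_Sq dd_dd Sq_dd Sq2_Sq2 KG_add KG_dd)
  show "A1_complex.D KG Sq1 = KD"
    by (simp add: fun_eq_iff A1_complex.D_def[OF F] KD_def)
  show "A1_complex.D1 KG Sq1 Sq2 = KD1"
    by (simp add: fun_eq_iff A1_complex.D1_def[OF F] KD1_def)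
qed

text \<open>Dimension shifting along \<open>0 \<rightarrow> D \<rightarrow> \<Gamma> \<rightarrow> D \<rightarrow> 0\<close> with the map \<open>Sq1\<close>: the cohomology with
  coefficients in \<open>D\<close> consists of the powers of \<open>h\<^sub>0\<close>, which have \<open>t = f\<close>.\<close>

lemma exact_KD: "t \<noteq> int f \<Longrightarrow> exact dd KD f t"
proof (induction f arbitrary: t)
  case (0 t)
  then have "exact dd KG 0 t" by (simp add: exact_KG)
  then show ?case by (auto simp: rel_exact_0 KD_def)
next
  case (Suc f)
  show ?case
  proof (rule exact_shift[where Y = KG and Z = KD and \<theta> = Sq1 and c = 1])
    show "exact dd KD (Suc f - 1) (t - 1)" using Suc by simp
    show "\<exists>y\<in>KG f' t. Sq1 y = z" if "z \<in> KD f' (t - 1)" for f' z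
      using that by (intro bexI[of _ "xx * z"]) (auto simp: KD_def KG_def cc_xx Sq_expand)
    show "Sq1 z \<in> KD f' (t - 1)" if "z \<in> KG f' t" for f' z
      using that F.G_s(1) by (simp add: KD_def)
  qed (auto simp: additive_dd dd_dd additive_Sq KD_def Sq_dd KG_add KG_dd exact_KG)
qed

text \<open>The cohomology of \<open>A(1)\<close> consists of the powers of \<open>h\<^sub>0\<close>, of \<open>h\<^sub>1\<close> and \<open>h\<^sub>1\<^sup>2\<close>, and of a tower in stem \<open>4\<close>,
  and then repeats with period \<open>(4, 12)\<close>; these are the exceptions.\<close>

lemma exact_KD1:
  assumes "t \<noteq> int f" "(f, t) \<noteq> (1, 2)" "(f, t) \<noteq> (2, 4)" "f \<ge> 3 \<Longrightarrow> t \<noteq> int f + 4"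
    "f \<ge> 4 \<Longrightarrow> exact dd KD1 (f - 4) (t - 12)"
  shows "exact dd KD1 f t"
proof (rule F.periodicity)
  show "exact dd KD f t" using assms by (simp add: exact_KD)
  show "f \<ge> 1 \<Longrightarrow> exact dd KG (f - 1) (t - 2)" using assms by (intro exact_KG) (cases f; auto)
  show "f \<ge> 2 \<Longrightarrow> exact dd KG (f - 2) (t - 4)"
    using assms by (intro exact_KG) (cases "f = 2"; auto)
  show "f \<ge> 3 \<Longrightarrow> exact dd KD (f - 3) (t - 7)" using assms by (intro exact_KD) auto
qed (use assms in auto)

text \<open>This group of stem \<open>8k + 2\<close> is where a quotient of \<open>h\<^sub>1 P\<^sup>k h\<^sub>1\<close> by \<open>h\<^sub>0\<close> would have to live.\<close>

lemma exact_KD1_stem_2: "exact dd KD1 (4 * k + 1) (12 * int k + 3)"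
proof (induction k)
  case (Suc k)
  have "exact dd KD1 (4 * Suc k + 1 - 4) (12 * int (Suc k) + 3 - 12)"
    using Suc by (simp add: algebra_simps)
  then show ?case by - (rule exact_KD1; auto)
next
  case 0
  show ?case by (rule exact_KD1) auto
qed


subsection \<open>Coefficients tensored with the mod 2 Moore comodule\<close>

text \<open>A pair \<open>(a, b)\<close> stands for \<open>1 \<otimes> a + e \<otimes> b\<close>, where \<open>e\<close> of degree \<open>1\<close> has coaction
  \<open>e \<otimes> 1 + 1 \<otimes> \<xi>\<^sub>1\<close>.\<close>

abbreviation x1 :: "(unit, nat) tvar fpoly" where "x1 \<equiv> pvar (Factor (Suc 0) (Suc 0))"

definition tau :: "(unit, nat) tvar fpoly \<Rightarrow> (unit, nat) tvar fpoly" where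
  "tau b = x1 * CF cl 1 b"

fun dA :: "nat \<Rightarrow> (unit, nat) tvar fpoly \<times> (unit, nat) tvar fpoly
   \<Rightarrow> (unit, nat) tvar fpoly \<times> (unit, nat) tvar fpoly" where
  "dA f (a, b) = (dd f a + tau b, dd f b)"

definition KA :: "(nat \<Rightarrow> int \<Rightarrow> (unit, nat) tvar fpoly set) \<Rightarrow> nat \<Rightarrow> int
   \<Rightarrow> ((unit, nat) tvar fpoly \<times> (unit, nat) tvar fpoly) set" where
  "KA K f t = K f t \<times> K f (t - 1)"

lemma tau_add: "tau (a + b) = tau a + tau b"
  by (simp add: tau_def psubst_add algebra_simps)

lemma tau_0 [simp]: "tau 0 = 0"
  by (simp add: tau_def)

lemma dd_tau: "dd (Suc f) (tau b) = tau (dd f b)"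
proof -
  let ?x2 = "pvar (Factor (Suc (Suc 0)) (Suc 0)) :: (unit, nat) tvar fpoly"
  have c: "CF cl (Suc 0) x1 = ?x2" "CF cl (Suc (Suc 0)) x1 = x1 + ?x2" "\<And>i. i \<ge> 3 \<Longrightarrow> CF cl i x1 = x1"
    by (auto simp: CF_pvar cop_def cl_xi_def numeral_eq_Suc)
  have "dd (Suc f) (tau b) = (\<Sum>i\<in>{1..Suc (Suc (Suc f))}. CF cl i (tau b))"
    by (simp add: dd_def DD_def)
  also have "\<dots> = CF cl 1 (tau b) + (CF cl 2 (tau b) + (\<Sum>i\<in>{3..Suc (Suc (Suc f))}. CF cl i (tau b)))"
    by (subst sum.atLeast_Suc_atMost, simp, subst sum.atLeast_Suc_atMost, simp) (simp add: numeral_eq_Suc)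
  also have "CF cl 1 (tau b) = ?x2 * CF cl 1 (CF cl 1 b)"
    by (simp add: tau_def psubst_mult c)
  also have "CF cl 2 (tau b) = (x1 + ?x2) * CF cl 1 (CF cl 1 b)"
    using CF_CF[OF bialg_cl, of 1 1 b] by (simp add: tau_def psubst_mult c numeral_2_eq_2)
  also have "(\<Sum>i\<in>{3..Suc (Suc (Suc f))}. CF cl i (tau b))
      = (\<Sum>i\<in>{3..Suc (Suc (Suc f))}. x1 * CF cl i (CF cl 1 b))"
    by (intro sum.cong) (auto simp: tau_def psubst_mult c)
  also have "?x2 * CF cl 1 (CF cl 1 b) + ((x1 + ?x2) * CF cl 1 (CF cl 1 b)
      + (\<Sum>i\<in>{3..Suc (Suc (Suc f))}. x1 * CF cl i (CF cl 1 b)))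
      = x1 * CF cl 2 (CF cl 1 b) + (\<Sum>i\<in>{3..Suc (Suc (Suc f))}. x1 * CF cl i (CF cl 1 b))"
    using CF_CF[OF bialg_cl, of 1 1 b] by (simp add: algebra_simps numeral_2_eq_2)
  also have "\<dots> = (\<Sum>i\<in>{Suc 1..Suc (Suc (Suc f))}. x1 * CF cl i (CF cl 1 b))"
    by (subst (2) sum.atLeast_Suc_atMost) (auto simp: numeral_eq_Suc)
  also have "\<dots> = (\<Sum>i\<in>{1..Suc (Suc f)}. x1 * CF cl 1 (CF cl i b))"
    by (subst sum.atLeast_Suc_atMost_Suc_shift) (auto intro!: sum.cong simp: CF_CF[OF bialg_cl])
  also have "\<dots> = tau (dd f b)"
    by (simp only: tau_def dd_def DD_def psubst_sum sum_distrib_left)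
  finally show ?thesis .
qed

lemma KG_tau: "b \<in> KG f (t - 1) \<Longrightarrow> tau b \<in> KG (Suc f) t"
  using cochains_mult[OF cochains_pvar[of 1 "Suc (Suc f)" 1 cl] CF_cochains[OF bialg_cl, of b "Suc f" "t - 1" 1]]
  by (simp add: KG_def tau_def)

lemma Sq_tau: "Sq1 (tau b) = tau (Sq1 b)" "Sq2 (tau b) = tau (Sq2 b)"
  by (simp_all add: tau_def Sq1_mult Sq2_mult Sq_CF Sq_pvar)

lemma exact_KA_KG: "(f, t) \<noteq> (0, 0) \<Longrightarrow> (f, t) \<noteq> (0, 1) \<Longrightarrow> exact dA (KA KG) f t"
proof -
  assume "(f, t) \<noteq> (0, 0)" "(f, t) \<noteq> (0, 1)"
  then have e: "exact dd KG f t" "exact dd KG f (t - 1)" by (auto intro!: exact_KG)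
  show ?thesis
  proof (cases f)
    case 0
    then show ?thesis using e by (auto simp: rel_exact_0 KA_def zero_prod_def)
  next
    case (Suc g)
    have "\<exists>y\<in>KA KG g t. (a, b) - dA g y = 0"
      if ab: "a \<in> KG (Suc g) t" "b \<in> KG (Suc g) (t - 1)" "dd (Suc g) a + tau b = 0" "dd (Suc g) b = 0"
      for a b
    proof -
      obtain b' where b': "b' \<in> KG g (t - 1)" "b = dd g b'"
        using exact_SucD[OF e(2)[unfolded Suc] ab(2,4)] by blast
      have "dd (Suc g) (a + tau b') = 0" using ab b' by (simp add: dd_add dd_tau)
      then obtain a' where a': "a' \<in> KG g t" "a + tau b' = dd g a'"
        using exact_SucD[OF e(1)[unfolded Suc]] KG_add[OF ab(1) KG_tau[OF b'(1)]] by blast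
      show ?thesis
      proof (intro bexI)
        show "(a', b') \<in> KA KG g t" using a' b' by (simp add: KA_def)
        have "dd g a' + tau b' = a" by (simp add: a'(2)[symmetric] add.assoc)
        then show "(a, b) - dA g (a', b') = 0" using b' by (simp add: zero_prod_def)
      qed
    qed
    then show ?thesis using Suc by (fastforce simp: rel_exact_Suc KA_def zero_prod_def)
  qed
qed

lemma dd_xx: "dd f (xx * b) = xx * dd f b + tau b"
proof -
  have c: "CF cl (Suc 0) xx = xx + x1" "\<And>i. i \<ge> 2 \<Longrightarrow> CF cl i xx = xx"
    by (auto simp: CF_pvar cop_def cl_xi_def numeral_eq_Suc)
  have "dd f (xx * b) = CF cl 1 (xx * b) + (\<Sum>i\<in>{2..Suc (Suc f)}. CF cl i (xx * b))"
    unfolding dd_def DD_def by (subst sum.atLeast_Suc_atMost) (auto simp: numeral_2_eq_2)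
  also have "(\<Sum>i\<in>{2..Suc (Suc f)}. CF cl i (xx * b)) = (\<Sum>i\<in>{2..Suc (Suc f)}. xx * CF cl i b)"
    by (intro sum.cong) (auto simp: psubst_mult c)
  also have "CF cl 1 (xx * b) = xx * CF cl 1 b + tau b"
    by (simp add: psubst_mult c tau_def algebra_simps)
  also have "xx * CF cl 1 b + tau b + (\<Sum>i\<in>{2..Suc (Suc f)}. xx * CF cl i b)
      = (\<Sum>i\<in>{1..Suc (Suc f)}. xx * CF cl i b) + tau b"
    by (subst (2) sum.atLeast_Suc_atMost) (auto simp: numeral_2_eq_2)
  finally show ?thesis by (simp only: dd_def DD_def sum_distrib_left)
qed

text \<open>The splitting \<open>\<Gamma> = D \<oplus> \<xi>\<^sub>1 D\<close>.\<close>

lemma KG_split: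
  assumes "g \<in> KG f t"
  shows "g + xx * Sq1 g \<in> KD f t" "Sq1 g \<in> KD f (t - 1)"
proof -
  have "Sq1 g \<in> KG f (t - 1)" using F.G_s(1)[OF assms] .
  moreover from this have "xx * Sq1 g \<in> KG f t" by (simp add: KG_def cc_xx)
  ultimately show "g + xx * Sq1 g \<in> KD f t" "Sq1 g \<in> KD f (t - 1)"
    using assms by (auto simp: KD_def KG_add Sq_expand)
qed

text \<open>The Moore comodule tensored with \<open>D\<close> is \<open>\<Gamma>\<close>, by \<open>(a, b) \<mapsto> a + \<xi>\<^sub>1 b\<close>.\<close>

lemma exact_KA_KD: "(f, t) \<noteq> (0, 0) \<Longrightarrow> exact dA (KA KD) f t"
proof -
  assume "(f, t) \<noteq> (0, 0)"
  then have e: "exact dd KG f t" by (auto intro!: exact_KG)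
  have inj: "a = 0 \<and> b = 0" if "Sq1 a = 0" "Sq1 b = 0" "a + xx * b = 0" for a b
  proof -
    have "Sq1 (a + xx * b) = b" using that(1,2) by (simp add: Sq_expand)
    then have "b = 0" using that(3) by (metis Sq_0(1))
    then show ?thesis using that(3) by simp
  qed
  have cl: "a + xx * b \<in> KG f t" if "a \<in> KD f t" "b \<in> KD f (t - 1)" for a b f
    using that by (auto simp: KD_def KG_def cc_xx cochains_add)
  have d: "dd f (a + xx * b) = (dd f a + tau b) + xx * dd f b" for a b f
    by (simp add: dd_add dd_xx add_ac)
  show ?thesis
  proof (cases f)
    case 0
    have "a = 0 \<and> b = 0" if "a \<in> KD 0 t" "b \<in> KD 0 (t - 1)" "dd 0 a + tau b = 0" "dd 0 b = 0" for a b
    proof -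
      have "a + xx * b = 0"
      proof -
        have "dd 0 (a + xx * b) = 0" by (simp only: d that) simp
        then show ?thesis using e[unfolded 0 rel_exact_0, rule_format, OF cl[OF that(1,2)]] by simp
      qed
      then show ?thesis using that(1,2) by (intro inj) (simp_all add: KD_def)
    qed
    then show ?thesis using 0 by (auto simp: rel_exact_0 KA_def zero_prod_def)
  next
    case (Suc g)
    have "\<exists>y\<in>KA KD g t. (a, b) - dA g y = 0"
      if ab: "a \<in> KD (Suc g) t" "b \<in> KD (Suc g) (t - 1)" "dd (Suc g) a + tau b = 0" "dd (Suc g) b = 0"
      for a b
    proof -
      obtain w where w: "w \<in> KG g t" "a + xx * b = dd g w"
      proof -
        have "dd (Suc g) (a + xx * b) = 0" by (simp only: d ab) simp
        then show ?thesis using exact_SucD[OF e[unfolded Suc] cl[OF ab(1,2)]] that by blast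
      qed
      let ?b = "Sq1 w" and ?a = "w + xx * Sq1 w"
      have ab': "?a \<in> KD g t" "?b \<in> KD g (t - 1)" using KG_split[OF w(1)] by auto
      have "?a + xx * ?b = w" by (simp add: add.assoc)
      then have "dd g w = (dd g ?a + tau ?b) + xx * dd g ?b" using d[of g ?a ?b] by simp
      then have "(a + xx * b) + ((dd g ?a + tau ?b) + xx * dd g ?b) = 0"
        by (simp only: w(2)) (simp only: fpoly_add_self)
      then have *: "(a + (dd g ?a + tau ?b)) + xx * (b + dd g ?b) = 0"
        by (simp only: distrib_left add_ac)
      have "a + (dd g ?a + tau ?b) = 0 \<and> b + dd g ?b = 0"
      proof (rule inj[OF _ _ *])
        have "Sq1 a = 0" "Sq1 b = 0" "Sq1 ?a = 0" using ab(1,2) ab' by (simp_all add: KD_def)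
        then show "Sq1 (a + (dd g ?a + tau ?b)) = 0" "Sq1 (b + dd g ?b) = 0"
          by (simp_all only: Sq1_add Sq_dd Sq_tau Sq1_Sq1 dd_0 tau_0 add_0_left)
      qed
      then show ?thesis using ab' by (intro bexI[of _ "(?a, ?b)"]) (auto simp: KA_def zero_prod_def)
    qed
    then show ?thesis using Suc by (fastforce simp: rel_exact_Suc KA_def zero_prod_def)
  qed
qed

lemma dA_add: "dA f (p + q) = dA f p + dA f q"
  by (cases p; cases q) (simp add: dd_add tau_add add_ac)

interpretation G: A1_complex dA "KA KG" "map_prod Sq1 Sq1" "map_prod Sq2 Sq2"
  rewrites "G.D = KA KD" and "G.D1 = KA KD1"
proof -
  show G: "A1_complex dA (KA KG) (map_prod Sq1 Sq1) (map_prod Sq2 Sq2)"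
  proof
    fix f t and z :: "(unit, nat) tvar fpoly \<times> (unit, nat) tvar fpoly"
    assume z: "z \<in> KA KG f t"
    obtain a b where ab: "z = (a, b)" "a \<in> KG f t" "b \<in> KG f (t - 1)"
      using z by (auto simp: KA_def)
    show "map_prod Sq1 Sq1 z \<in> KA KG f (t - 1)" "map_prod Sq2 Sq2 z \<in> KA KG f (t - 2)"
      using F.G_s[OF ab(2)] F.G_s[OF ab(3)] ab(1) by (auto simp: KA_def algebra_simps)
    show "dA f z \<in> KA KG (Suc f) t"
      using ab by (auto simp: KA_def KG_dd KG_add KG_tau)
    show "\<exists>y\<in>KA KG f (t + 2). map_prod Sq1 Sq1 y = 0 \<and> map_prod Sq2 Sq2 y = z" if "map_prod Sq2 Sq2 z = 0"
      using F.pre2[OF ab(2)] F.pre2[OF ab(3)] that ab(1)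
      by (fastforce simp: KA_def zero_prod_def algebra_simps)
    show "\<exists>y\<in>KA KG f (t + 2). map_prod Sq2 Sq2 y = z" if "map_prod Sq1 Sq1 (map_prod Sq2 Sq2 z) = 0"
      using F.pre2'[OF ab(2)] F.pre2'[OF ab(3)] that ab(1)
      by (fastforce simp: KA_def zero_prod_def algebra_simps)
    show "\<exists>y\<in>KA KG f (t + 3). map_prod Sq1 Sq1 (map_prod Sq2 Sq2 y) = z"
      if "map_prod Sq1 Sq1 z = 0" "map_prod Sq2 Sq2 (map_prod Sq1 Sq1 (map_prod Sq2 Sq2 z)) = 0"
      using F.pre3[OF ab(2)] F.pre3[OF ab(3)] that ab(1)
      by (fastforce simp: KA_def zero_prod_def algebra_simps)
    show "\<exists>y\<in>KA KG f (t + 5). map_prod Sq1 Sq1 y = 0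
        \<and> map_prod Sq2 Sq2 (map_prod Sq1 Sq1 (map_prod Sq2 Sq2 y)) = z"
      if "map_prod Sq1 Sq1 z = 0" "map_prod Sq2 Sq2 z = 0"
      using F.pre5[OF ab(2)] F.pre5[OF ab(3)] that ab(1)
      by (fastforce simp: KA_def zero_prod_def algebra_simps)
  next
    fix f and z :: "(unit, nat) tvar fpoly \<times> (unit, nat) tvar fpoly"
    show "additive (dA f)" by (simp add: additive_def dA_add)
    show "dA (Suc f) (dA f z) = 0"
      by (cases z) (simp add: dd_add dd_dd dd_tau zero_prod_def)
    show "map_prod Sq1 Sq1 (dA f z) = dA f (map_prod Sq1 Sq1 z)"
      "map_prod Sq2 Sq2 (dA f z) = dA f (map_prod Sq2 Sq2 z)"
      by (cases z; simp add: Sq1_add Sq2_add Sq_dd Sq_tau)+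
    show "map_prod Sq1 Sq1 (map_prod Sq1 Sq1 z) = 0"
      "map_prod Sq2 Sq2 (map_prod Sq2 Sq2 z) = map_prod Sq1 Sq1 (map_prod Sq2 Sq2 (map_prod Sq1 Sq1 z))"
      by (cases z; simp add: Sq2_Sq2 zero_prod_def)+
  next
    show "additive (map_prod Sq1 Sq1)" "additive (map_prod Sq2 Sq2)"
      by (auto simp: additive_def Sq1_add Sq2_add)
  qed (auto simp: KA_def KG_add)
  show "A1_complex.D (KA KG) (map_prod Sq1 Sq1) = KA KD"
    by (auto simp: fun_eq_iff A1_complex.D_def[OF G] KD_def KA_def zero_prod_def)
  show "A1_complex.D1 (KA KG) (map_prod Sq1 Sq1) (map_prod Sq2 Sq2) = KA KD1"
    by (auto simp: fun_eq_iff A1_complex.D1_def[OF G] KD1_def KA_def zero_prod_def)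
qed

text \<open>The bottom class of each \<open>h\<^sub>0\<close>-tower of \<open>A(1)\<close> survives on the bottom cell of the Moore comodule, and
  \<open>h\<^sub>1\<close> and \<open>h\<^sub>1\<^sup>2\<close> live on both cells; these are the exceptions.\<close>

lemma exact_KA_KD1:
  assumes "(f, t) \<notin> {(0, 0), (1, 2), (1, 3), (2, 4), (2, 5), (3, 7)}"
    "f \<ge> 4 \<Longrightarrow> exact dA (KA KD1) (f - 4) (t - 12)"
  shows "exact dA (KA KD1) f t"
proof (rule G.periodicity)
  show "exact dA (KA KD) f t" using assms by (intro exact_KA_KD) auto
  show "f \<ge> 1 \<Longrightarrow> exact dA (KA KG) (f - 1) (t - 2)"
    using assms by (intro exact_KA_KG) (cases "f = 1"; auto)+
  show "f \<ge> 2 \<Longrightarrow> exact dA (KA KG) (f - 2) (t - 4)"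
    using assms by (intro exact_KA_KG) (cases "f = 2"; auto)+
  show "f \<ge> 3 \<Longrightarrow> exact dA (KA KD) (f - 3) (t - 7)"
    using assms by (intro exact_KA_KD) (cases "f = 3"; auto)
qed (use assms in auto)

text \<open>With Moore coefficients the \<open>h\<^sub>0\<close>-towers disappear, and periodicity propagates the vanishing in
  the first four filtrations to a line of slope one half.\<close>

lemma exact_KA_KD1_line: "t < 3 * int f - 2 \<Longrightarrow> exact dA (KA KD1) f t"
proof (induction f arbitrary: t rule: less_induct)
  case (less f)
  have "exact dA (KA KD1) (f - 4) (t - 12)" if "f \<ge> 4"
    using less.IH[of "f - 4" "t - 12"] less.prems that by (simp add: of_nat_diff)
  then show ?case using less.prems by - (rule exact_KA_KD1; auto)
qed

section \<open>Cell filtrations of coefficient comodules\<close>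

text \<open>The long exact sequence of a filtration in three stages.\<close>

lemma rel_exact_trans:
  fixes d :: "nat \<Rightarrow> 'm \<Rightarrow> 'm::ab_group_add"
  assumes d: "\<And>f. additive (d f)" "\<And>f z. d (Suc f) (d f z) = 0"
    and sub: "\<And>f. L f t \<subseteq> M f t" "\<And>f. M f t \<subseteq> K f t"
    and K: "\<And>f y y'. y \<in> K f t \<Longrightarrow> y' \<in> K f t \<Longrightarrow> y + y' \<in> K f t"
    and ex: "rel_exact d L M f t" "rel_exact d M K f t"
  shows "rel_exact d L K f t"
proof -
  have minus: "d f (a - b) = d f a - d f b" for f a b
    using additiveD[OF d(1), of f "a - b" b] by (simp add: algebra_simps)
  show ?thesis
  proof (cases f)
    case 0
    show ?thesis using ex sub unfolding 0 rel_exact_0 by blast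
  next
    case (Suc e)
    have "\<exists>y\<in>K e t. z - d e y \<in> L (Suc e) t" if z: "z \<in> K (Suc e) t" "d (Suc e) z \<in> L (Suc (Suc e)) t" for z
    proof -
      obtain y where y: "y \<in> K e t" "z - d e y \<in> M (Suc e) t"
        using ex(2)[unfolded Suc rel_exact_Suc] z sub(1) by blast
      have "d (Suc e) (z - d e y) \<in> L (Suc (Suc e)) t" using z(2) by (simp add: minus d(2))
      then obtain y' where y': "y' \<in> M e t" "z - d e y - d e y' \<in> L (Suc e) t"
        using ex(1)[unfolded Suc rel_exact_Suc] y(2) by blast
      moreover have "y + y' \<in> K e t" using K[OF y(1) subsetD[OF sub(2) y'(1)]] .
      ultimately show ?thesis
        by (intro bexI[of _ "y + y'"]) (simp_all add: additiveD[OF d(1)] algebra_simps)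
    qed
    then show ?thesis using Suc by (simp add: rel_exact_Suc)
  qed
qed

text \<open>The long exact sequence again, used to descend from \<open>K\<close> to its subcomplex \<open>M\<close>.\<close>

lemma rel_exact_sub:
  fixes d :: "nat \<Rightarrow> 'm \<Rightarrow> 'm::ab_group_add"
  assumes d: "\<And>f. additive (d f)" "\<And>f z. d (Suc f) (d f z) = 0"
    and sub: "\<And>f. L f t \<subseteq> M f t" "\<And>f. M f t \<subseteq> K f t"
    and M: "\<And>f y y'. y \<in> M f t \<Longrightarrow> y' \<in> M f t \<Longrightarrow> y - y' \<in> M f t"
    and ex: "rel_exact d L K f t" "f \<ge> 1 \<Longrightarrow> rel_exact d M K (f - 1) t"
  shows "rel_exact d L M f t"
proof (cases f)
  case 0
  show ?thesis using ex(1) sub unfolding 0 rel_exact_0 by blast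
next
  case (Suc e)
  have minus: "d f (a - b) = d f a - d f b" for f a b
    using additiveD[OF d(1), of f "a - b" b] by (simp add: algebra_simps)
  have "\<exists>y\<in>M e t. z - d e y \<in> L (Suc e) t" if z: "z \<in> M (Suc e) t" "d (Suc e) z \<in> L (Suc (Suc e)) t" for z
  proof -
    obtain y where y: "y \<in> K e t" "z - d e y \<in> L (Suc e) t"
      using ex(1)[unfolded Suc rel_exact_Suc] z sub(2) by blast
    have "z - (z - d e y) \<in> M (Suc e) t" using M z(1) y(2) sub(1) by blast
    then have dy: "d e y \<in> M (Suc e) t" by simp
    show ?thesis
    proof (cases e)
      case 0
      then have "y \<in> M e t" using ex(2) Suc y(1) dy by (auto simp: rel_exact_0)
      then show ?thesis using y by blast
    next
      case (Suc e')
      then obtain x where "x \<in> K e' t" "y - d e' x \<in> M e t"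
        using ex(2) \<open>f = Suc e\<close> y(1) dy by (auto simp: rel_exact_Suc)
      moreover have "z - d e (y - d e' x) = z - d e y" using Suc by (simp add: minus d(2))
      ultimately show ?thesis using y(2) by metis
    qed
  qed
  then show ?thesis using Suc by (simp add: rel_exact_Suc)
qed

text \<open>A quotient complex isomorphic, up to a shift \<open>N\<close> of internal degrees, to a complex that is exact.\<close>

lemma rel_exact_cell:
  fixes d :: "nat \<Rightarrow> 'm \<Rightarrow> 'm::ab_group_add"
  assumes d: "\<And>f. additive (d f)" and \<Phi>: "additive \<Phi>"
    and split: "\<And>f z. z \<in> K f t \<Longrightarrow> \<exists>l\<in>L f t. \<exists>b\<in>B f (t - N). z = l + \<Phi> b"
    and inj: "\<And>f b. b \<in> B f (t - N) \<Longrightarrow> \<Phi> b \<in> L f t \<Longrightarrow> b = 0"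
    and comm: "\<And>f b. b \<in> B f (t - N) \<Longrightarrow> d f (\<Phi> b) - \<Phi> (d f b) \<in> L (Suc f) t"
    and L: "\<And>f y y'. y \<in> L f t \<Longrightarrow> y' \<in> L f t \<Longrightarrow> y - y' \<in> L f t"
      "\<And>f y. y \<in> L f t \<Longrightarrow> d f y \<in> L (Suc f) t"
    and BK: "\<And>f b. b \<in> B f (t - N) \<Longrightarrow> \<Phi> b \<in> K f t"
      "\<And>f b. b \<in> B f (t - N) \<Longrightarrow> d f b \<in> B (Suc f) (t - N)"
    and ex: "exact d B f (t - N)"
  shows "rel_exact d L K f t"
proof -
  have sum: "a + b \<in> L f t" if "a \<in> L f t" "b \<in> L f t" for a b f
  proof -
    have "a - ((b - b) - b) \<in> L f t" using that L(1) by blast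
    then show ?thesis by simp
  qed
  have key: "d f b = 0" if "l \<in> L f t" "b \<in> B f (t - N)" "d f (l + \<Phi> b) \<in> L (Suc f) t" for l b f
  proof -
    have "d f (l + \<Phi> b) - d f l - (d f (\<Phi> b) - \<Phi> (d f b)) \<in> L (Suc f) t"
      using that L comm by blast
    then have "\<Phi> (d f b) \<in> L (Suc f) t" by (simp add: additiveD[OF d])
    then show ?thesis using inj BK(2) that by blast
  qed
  show ?thesis
  proof (cases f)
    case 0
    have "z \<in> L 0 t" if z: "z \<in> K 0 t" "d 0 z \<in> L 1 t" for z
    proof -
      obtain l b where lb: "l \<in> L 0 t" "b \<in> B 0 (t - N)" "z = l + \<Phi> b" using split z(1) by blast
      then have "b = 0" using key[of l 0 b] z ex 0 by (auto simp: rel_exact_0)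
      then show ?thesis using lb additive_0[OF \<Phi>] by simp
    qed
    then show ?thesis using 0 by (simp add: rel_exact_0)
  next
    case (Suc e)
    have "\<exists>y\<in>K e t. z - d e y \<in> L (Suc e) t"
      if z: "z \<in> K (Suc e) t" "d (Suc e) z \<in> L (Suc (Suc e)) t" for z
    proof -
      obtain l b where lb: "l \<in> L (Suc e) t" "b \<in> B (Suc e) (t - N)" "z = l + \<Phi> b"
        using split z(1) by blast
      then obtain y where y: "y \<in> B e (t - N)" "b = d e y"
        using key[of l "Suc e" b] z exact_SucD[OF ex[unfolded Suc] lb(2)] by metis
      have "l - (d e (\<Phi> y) - \<Phi> (d e y)) \<in> L (Suc e) t" using L(1) lb(1) comm[OF y(1)] by blast
      then have "z - d e (\<Phi> y) \<in> L (Suc e) t" using lb y by (simp add: algebra_simps)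
      then show ?thesis using BK(1)[OF y(1)] by blast
    qed
    then show ?thesis using Suc by (simp add: rel_exact_Suc)
  qed
qed


subsection \<open>Subcomodules of \<open>\<Gamma>\<close> spanned by monomials\<close>

type_synonym cmon = "(unit, nat) tvar mon"

definition is0 :: "(unit, nat) tvar \<Rightarrow> bool" where
  "is0 v \<longleftrightarrow> (\<exists>n. v = Factor 0 n)"

definition part0 :: "cmon \<Rightarrow> cmon" where
  "part0 m = Abs_poly_mapping (\<lambda>v. if is0 v then lookup m v else 0)"

definition part1 :: "cmon \<Rightarrow> cmon" where
  "part1 m = m - part0 m"

abbreviation dg :: "cmon \<Rightarrow> int" where "dg \<equiv> mdegree (vdeg cl)"
abbreviation v0 :: "nat \<Rightarrow> cmon" where "v0 n \<equiv> Poly_Mapping.single (Factor 0 n) 1"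

definition M0 :: "cmon set" where
  "M0 = {m. keys m \<subseteq> {Factor 0 n | n. n \<ge> 1}}"

definition CS :: "cmon set \<Rightarrow> (unit, nat) tvar fpoly set" where
  "CS S = sp {m. part0 m \<in> S}"

text \<open>The cochains with coefficients in the span of \<open>S\<close>.\<close>

definition CK :: "cmon set \<Rightarrow> nat \<Rightarrow> int \<Rightarrow> (unit, nat) tvar fpoly set" where
  "CK S f t = sp (cmons cl (Suc f) t \<inter> {m. part0 m \<in> S})"

lemma lookup_part0: "lookup (part0 m) v = (if is0 v then lookup m v else 0)"
proof -
  have "finite {v. (if is0 v then lookup m v else 0) \<noteq> 0}"
    by (rule finite_subset[OF _ finite_keys[of m]]) (auto simp: in_keys_iff split: if_splits)
  then show ?thesis by (simp add: part0_def lookup_Abs_poly_mapping)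
qed

lemma lookup_part1: "lookup (part1 m) v = (if is0 v then 0 else lookup m v)"
  by (simp add: part1_def lookup_minus lookup_part0)

lemma part_sum: "part0 m + part1 m = m"
  by (rule poly_mapping_eqI) (simp add: lookup_add lookup_part0 lookup_part1)

lemma part0_add: "part0 (m + n) = part0 m + part0 n"
  by (rule poly_mapping_eqI) (simp add: lookup_add lookup_part0)

lemma part0_M0 [simp]: "m \<in> M0 \<Longrightarrow> part0 m = m"
proof (rule poly_mapping_eqI)
  fix v assume "m \<in> M0"
  then have "lookup m v \<noteq> 0 \<Longrightarrow> is0 v" by (auto simp: M0_def is0_def in_keys_iff subset_eq)
  then show "lookup (part0 m) v = lookup m v" by (auto simp: lookup_part0)
qed

lemma part0_0 [simp]: "part0 0 = 0"
  by (rule poly_mapping_eqI) (simp add: lookup_part0)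

lemma part0_part1 [simp]: "part0 (part1 m) = 0"
  by (rule poly_mapping_eqI) (simp add: lookup_part0 lookup_part1)

lemma part0_part0 [simp]: "part0 (part0 m) = part0 m"
  by (rule poly_mapping_eqI) (simp add: lookup_part0)

lemma M0_0 [simp]: "0 \<in> M0"
  by (simp add: M0_def)

lemma M0_add [simp]: "m + n \<in> M0 \<longleftrightarrow> m \<in> M0 \<and> n \<in> M0"
  by (auto simp: M0_def keys_add_mon)

lemma M0_v0 [simp]: "v0 n \<in> M0 \<longleftrightarrow> n \<ge> 1"
  by (simp add: M0_def)

lemma cmons_part0: "m \<in> cmons cl f t \<Longrightarrow> part0 m \<in> M0"
proof -
  assume "m \<in> cmons cl f t"
  moreover have "keys (part0 m) \<subseteq> {v \<in> keys m. is0 v}"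
    by (auto simp: in_keys_iff lookup_part0 split: if_splits)
  ultimately show ?thesis by (fastforce simp: M0_def cmons_def is0_def)
qed

lemma dg_nonneg: "m \<in> cmons cl f t \<Longrightarrow> keys n \<subseteq> keys m \<Longrightarrow> dg n \<ge> 0"
  by (rule mdegree_nonneg) (auto simp: cmons_def)

lemma dg_M0_nonneg: "m \<in> M0 \<Longrightarrow> dg m \<ge> 0"
  by (rule mdegree_nonneg) (auto simp: M0_def)

lemma dg_v0: "dg (v0 n) = 2 ^ n - 1"
  by (simp add: mdegree_single)

lemma keys_parts: "keys (part0 m) \<subseteq> keys m" "keys (part1 m) \<subseteq> keys m"
  by (auto simp: in_keys_iff lookup_part0 lookup_part1 split: if_splits)

lemma dg_parts: "dg m = dg (part0 m) + dg (part1 m)"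
  by (metis mdegree_add part_sum)

lemma CK_KG: "z \<in> CK S f t \<longleftrightarrow> z \<in> KG f t \<and> z \<in> CS S"
  by (simp add: CK_def KG_def cochains_sp CS_def sp_Int)

lemma CK_M0: "CK M0 f t = KG f t"
  unfolding CK_def KG_def cochains_sp using cmons_part0 by (auto intro!: arg_cong[of _ _ sp])

lemma CK_add: "y \<in> CK S f t \<Longrightarrow> y' \<in> CK S f t \<Longrightarrow> y + y' \<in> CK S f t"
  unfolding CK_def by (rule sp_add)

lemma CK_mono: "S \<subseteq> S' \<Longrightarrow> CK S f t \<subseteq> CK S' f t"
  unfolding CK_def by (auto intro: sp_mono)

lemma CS_mono: "z \<in> CS S \<Longrightarrow> S \<subseteq> S' \<Longrightarrow> z \<in> CS S'"
  unfolding CS_def by (auto intro: sp_mono)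

lemma CS_add: "y \<in> CS S \<Longrightarrow> y' \<in> CS S \<Longrightarrow> y + y' \<in> CS S"
  unfolding CS_def by (rule sp_add)

lemma CS_sum: "(\<And>i. i \<in> I \<Longrightarrow> p i \<in> CS S) \<Longrightarrow> (\<Sum>i\<in>I. p i) \<in> CS S"
  unfolding CS_def by (rule sp_sum)

lemma CS_0 [simp]: "0 \<in> CS S"
  by (simp add: CS_def)

lemma CS_mult:
  assumes "p \<in> CS S" "q \<in> CS T" "\<And>s t. s \<in> S \<Longrightarrow> t \<in> T \<Longrightarrow> s + t \<in> U"
  shows "p * q \<in> CS U"
  unfolding CS_def by (rule sp_mult[OF assms(1,2)[unfolded CS_def]]) (auto simp: part0_add assms(3))

lemma CS_mult_unit: "p \<in> CS S \<Longrightarrow> q \<in> CS {0} \<Longrightarrow> p * q \<in> CS S"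
  by (erule CS_mult) auto

lemma CS_mo: "mo m \<in> CS S \<longleftrightarrow> part0 m \<in> S"
  by (simp add: CS_def)

lemma CS_1 [simp]: "1 \<in> CS {0}"
  using CS_mo[of 0 "{0}"] by simp

lemma CS_power: "p \<in> CS {0} \<Longrightarrow> p ^ n \<in> CS {0}"
  by (induction n) (auto intro: CS_mult_unit)

lemma CS_Int: "p \<in> CS S \<Longrightarrow> p \<in> CS T \<Longrightarrow> p \<in> CS (S \<inter> T)"
  by (auto simp: CS_def sp_def)

lemma sp_induct [consumes 1, case_names zero mo add]:
  assumes "z \<in> sp A" "P 0" "\<And>m. m \<in> A \<Longrightarrow> P (mo m)" "\<And>p q. P p \<Longrightarrow> P q \<Longrightarrow> P (p + q)"
  shows "P z"
  using assms(1)
proof (induction z rule: fpoly_induct)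
  case (add m p)
  then have "keys (mo m + p) = insert m (keys p)" by (auto simp: keys_add_fpoly)
  then show ?case using add assms by (auto simp: sp_def)
qed (rule assms)

lemma SH_CS: "SH (Suc q) z \<in> CS {0}"
  unfolding CS_def
proof (rule sp_additive[OF rhom_additive[OF rhom_psubst], of _ UNIV])
  fix m :: cmon
  have "SH (Suc q) (mo m) \<in> CS {0}"
  proof (induction m rule: mon_induct)
    case (var v)
    have "part0 (Poly_Mapping.single w 1) = 0" if "\<not> is0 w" for w
      using that by (intro poly_mapping_eqI) (auto simp: lookup_part0 lookup_single when_def)
    then have "pvar w \<in> CS {0}" if "\<not> is0 w" for w
      using that by (simp add: pvar_def CS_mo)
    then show ?case by (cases v) (auto simp: mo_var[simplified] psubst_pvar is0_def)
  next
    case (add m n)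
    then show ?case by (simp add: mo_mult[symmetric] psubst_mult CS_mult_unit)
  qed simp
  then show "SH (Suc q) (mo m) \<in> sp {m. part0 m \<in> {0}}" by (simp add: CS_def)
qed (simp add: sp_def)

lemma xi_CS [simp]: "cl_xi (Suc p) n \<in> CS {0}" "cop (Suc p) n \<in> CS {0}"
proof -
  show "cl_xi (Suc p) n \<in> CS {0}" using SH_CS[of p "cl_xi 0 n"] by simp
  have "cop (Suc p) n = SH (Suc p) (cop 0 n)"
    by (simp add: cop_def psubst_sum psubst_mult psubst_power)
  then show "cop (Suc p) n \<in> CS {0}" using SH_CS by metis
qed

lemma CF_unit: "part0 r = 0 \<Longrightarrow> i \<ge> 1 \<Longrightarrow> CF cl i (mo r) \<in> CS {0}"
proof (induction r rule: mon_induct)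
  case (var v)
  have "\<not> is0 v"
  proof
    assume "is0 v"
    then have "lookup (part0 (Poly_Mapping.single v 1)) v = 1" by (simp add: lookup_part0)
    then show False using var by simp
  qed
  then show ?case
  proof (cases v)
    case (Scalar s)
    then show ?thesis using SH_CS[of 0 "pvar (Scalar s)"]
      by (simp add: mo_var[simplified] psubst_pvar)
  next
    case (Factor p n)
    then obtain q where q: "p = Suc q" using \<open>\<not> is0 v\<close> by (cases p) (auto simp: is0_def)
    have "pvar (Factor (Suc p) n) \<in> CS {0}" for p n
      using SH_CS[of p "pvar (Factor 0 n)"] by (simp add: psubst_pvar)
    then show ?thesis using Factor q by (simp add: mo_var[simplified] CF_pvar)
  qed
next
  case (add m n)
  have "part0 m + part0 n = 0" using add.prems by (simp add: part0_add)
  then have "part0 m = 0" "part0 n = 0"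
    by (auto intro!: poly_mapping_eqI simp: poly_mapping_eq_iff fun_eq_iff lookup_add)
  then show ?case using add by (simp add: mo_mult[symmetric] psubst_mult CS_mult_unit)
qed simp

lemma CF_M0: "a \<in> M0 \<Longrightarrow> i \<ge> 2 \<Longrightarrow> CF cl i (mo a) = mo a"
  by (rule CF_fix[of _ 1]) (auto simp: vars_in_def M0_def)

lemma mo_parts: "mo m = mo (part0 m) * mo (part1 m)"
  by (simp add: mo_mult part_sum)

text \<open>The monomials in \<open>S\<close> span a right subcomodule of \<open>\<Gamma>\<close>.\<close>

definition closed :: "cmon set \<Rightarrow> bool" where
  "closed S \<longleftrightarrow> S \<subseteq> M0 \<and> (\<forall>s\<in>S. CF cl 1 (mo s) \<in> CS S)"

lemma closed_CF:
  assumes S: "closed S" and z: "z \<in> CS S" and i: "i \<ge> 1"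
  shows "CF cl i z \<in> CS S"
  using z unfolding CS_def
proof (rule sp_additive[OF rhom_additive[OF rhom_psubst]])
  fix m assume "m \<in> {m. part0 m \<in> S}"
  then have m: "part0 m \<in> S" by simp
  have "CF cl i (mo (part0 m)) \<in> CS S"
  proof (cases "i = 1")
    case True
    then show ?thesis using S m by (simp add: closed_def)
  next
    case False
    then have "CF cl i (mo (part0 m)) = mo (part0 m)"
      using S m i by (intro CF_M0) (auto simp: closed_def)
    then show ?thesis using m by (simp add: CS_mo)
  qed
  then have "CF cl i (mo m) \<in> CS S"
    unfolding mo_parts[of m] psubst_mult using i by (intro CS_mult_unit CF_unit) auto
  then show "CF cl i (mo m) \<in> sp {m. part0 m \<in> S}" by (simp add: CS_def)
qed

lemma closed_dd: "closed S \<Longrightarrow> z \<in> CS S \<Longrightarrow> dd f z \<in> CS S"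
  unfolding dd_def DD_def by (intro CS_sum closed_CF) auto

lemma CK_dd: "closed S \<Longrightarrow> z \<in> CK S f t \<Longrightarrow> dd f z \<in> CK S (Suc f) t"
  by (simp add: CK_KG KG_dd closed_dd)

definition splus :: "cmon set \<Rightarrow> cmon set \<Rightarrow> cmon set" (infixl "\<oplus>" 65) where
  "S \<oplus> T = {s + t | s t. s \<in> S \<and> t \<in> T}"

lemma closed_splus: "closed S \<Longrightarrow> closed T \<Longrightarrow> closed (S \<oplus> T)"
  unfolding closed_def
proof (intro conjI ballI)
  assume *: "S \<subseteq> M0 \<and> (\<forall>s\<in>S. CF cl 1 (mo s) \<in> CS S)" "T \<subseteq> M0 \<and> (\<forall>s\<in>T. CF cl 1 (mo s) \<in> CS T)"
  then show "S \<oplus> T \<subseteq> M0" by (auto simp: splus_def)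
  fix u assume "u \<in> S \<oplus> T"
  then obtain s t where st: "u = s + t" "s \<in> S" "t \<in> T" by (auto simp: splus_def)
  then show "CF cl 1 (mo u) \<in> CS (S \<oplus> T)"
    unfolding st(1) mo_mult[symmetric] psubst_mult using *
    by (intro CS_mult[of _ S _ T]) (auto simp: splus_def)
qed

lemma closed_0: "closed {0}"
  by (simp add: closed_def)

lemma dg_part1_nonneg: "m \<in> cmons cl f t \<Longrightarrow> dg (part1 m) \<ge> 0" "m \<in> cmons cl f t \<Longrightarrow> dg (part0 m) \<ge> 0"
  using dg_nonneg keys_parts by blast+


subsection \<open>Relabelling monomials of the leading factor\<close>

text \<open>Monomials of the leading factor are renamed and the remaining tensor factors kept.  This is how
  a quotient of two subcomodules is compared with a shifted copy of a third one.\<close>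

definition relabel :: "(cmon \<Rightarrow> cmon) \<Rightarrow> (unit, nat) tvar fpoly \<Rightarrow> (unit, nat) tvar fpoly" where
  "relabel \<phi> = lin (\<lambda>m. mo (\<phi> (part0 m) + part1 m))"

lemma relabel_add: "relabel \<phi> (p + q) = relabel \<phi> p + relabel \<phi> q"
  by (simp add: relabel_def lin_add)

lemma relabel_additive: "additive (relabel \<phi>)"
  by (simp add: additive_def relabel_add)

lemma relabel_mo: "relabel \<phi> (mo m) = mo (\<phi> (part0 m)) * mo (part1 m)"
  by (simp add: relabel_def mo_mult)

lemma part1_add: "part1 (m + n) = part1 m + part1 n"
  by (rule poly_mapping_eqI) (simp add: lookup_add lookup_part1)

lemma part1_unit: "part0 r = 0 \<Longrightarrow> part1 r = r"
  by (metis add_0 part_sum)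

lemma part1_M0 [simp]: "a \<in> M0 \<Longrightarrow> part1 a = 0"
  by (metis add_cancel_left_right part0_M0 part_sum)

lemma relabel_mult_unit: "q \<in> CS {0} \<Longrightarrow> relabel \<phi> (p * q) = relabel \<phi> p * q"
proof -
  assume q: "q \<in> CS {0}"
  have 1: "relabel \<phi> (mo m * mo r) = relabel \<phi> (mo m) * mo r" if "part0 r = 0" for m r
    using that by (simp add: mo_mult relabel_def part0_add part1_add part1_unit add.assoc)
  have 2: "relabel \<phi> (mo m * q) = relabel \<phi> (mo m) * q" for m
    by (rule additive_eqI[where p = q])
      (use q in \<open>auto simp: additive_def distrib_left relabel_add CS_def sp_def intro!: 1\<close>)
  show ?thesis
    by (rule additive_eqI[where p = p and g = "\<lambda>p. relabel \<phi> (p * q)" and h = "\<lambda>p. relabel \<phi> p * q"])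
      (auto simp: additive_def distrib_right relabel_add 2)
qed

lemma relabel_M0: "a \<in> M0 \<Longrightarrow> relabel \<phi> (mo a) = mo (\<phi> a)"
  by (simp add: relabel_def)

lemma keys_lin_inj:
  assumes "inj_on g (keys p)"
  shows "keys (lin (\<lambda>m. mo (g m)) p) = g ` keys p"
proof -
  have "keys (\<Sum>m\<in>A. mo (g m)) = g ` A" if "finite A" "inj_on g A" for A
    using that
  proof (induction A)
    case (insert a A)
    then have "g a \<notin> g ` A" by auto
    then show ?case using insert by (auto simp: keys_add_fpoly)
  qed simp
  then show ?thesis using assms by (simp add: lin_def)
qed

lemma mon_parts_eqI: "part0 m = part0 n \<Longrightarrow> part1 m = part1 n \<Longrightarrow> m = n"
  by (metis part_sum)

text \<open>One cell: the quotient of \<open>S \<union> \<phi> B\<close> by \<open>S\<close> is a shifted copy of the comodule spanned by \<open>B\<close>.\<close>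

lemma rel_exact_one_cell:
  assumes S: "closed S" and B: "closed B"
    and \<phi>: "\<And>b. b \<in> B \<Longrightarrow> \<phi> b \<in> M0 - S" "\<And>b. b \<in> B \<Longrightarrow> dg (\<phi> b) = dg b + N" "inj_on \<phi> B"
    and h: "\<And>b. b \<in> B \<Longrightarrow> CF cl 1 (mo (\<phi> b)) + relabel \<phi> (CF cl 1 (mo b)) \<in> CS S"
    and ex: "exact dd (CK B) f (t - N)"
  shows "rel_exact dd (CK S) (CK (S \<union> \<phi> ` B)) f t"
proof (rule rel_exact_cell[where \<Phi> = "relabel \<phi>" and B = "CK B" and N = N])
  have BM: "b \<in> M0" if "b \<in> B" for b using B that by (auto simp: closed_def)
  have cm: "m \<in> cmons cl (Suc f) s \<longleftrightarrow> keys m \<subseteq> {Factor p n | p n. p < Suc f \<and> n \<ge> 1} \<and> dg m = s" for m f s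
    by (auto simp: cmons_def)
  have move: "b + part1 m \<in> cmons cl (Suc f') (s - dg (part0 m) + dg b)"
    if "m \<in> cmons cl (Suc f') s" "b \<in> M0" for m b f' s
  proof -
    have "keys b \<subseteq> {Factor p n | p n. p < Suc f' \<and> n \<ge> 1}" using that(2) by (auto simp: M0_def)
    then show ?thesis using that keys_parts[of m] dg_parts[of m]
      by (auto simp: cm keys_add_mon mdegree_add)
  qed
  have rl: "relabel \<phi> (mo m) = mo (\<phi> (part0 m) + part1 m)" for m by (simp add: relabel_def)
  show "additive (dd f')" for f' by (rule additive_dd)
  show "additive (relabel \<phi>)" by (rule relabel_additive)
  show "\<exists>l\<in>CK S f' t. \<exists>b\<in>CK B f' (t - N). z = l + relabel \<phi> b"
    if "z \<in> CK (S \<union> \<phi> ` B) f' t" for f' z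
    using that unfolding CK_def[of "S \<union> \<phi> ` B"]
  proof (induction z rule: sp_induct)
    case zero
    have "0 = 0 + relabel \<phi> 0" by (simp add: additive_0[OF relabel_additive])
    then show ?case by (metis CK_def sp_0)
  next
    case (mo m)
    show ?case
    proof (cases "part0 m \<in> S")
      case True
      then have "mo m \<in> CK S f' t" using mo by (simp add: CK_def)
      moreover have "mo m = mo m + relabel \<phi> 0" by (simp add: additive_0[OF relabel_additive])
      ultimately show ?thesis by (metis CK_def sp_0)
    next
      case False
      then obtain b where b: "b \<in> B" "part0 m = \<phi> b" using mo by auto
      have "b + part1 m \<in> cmons cl (Suc f') (t - N)"
        using move[of m f' t b] mo b BM[of b] \<phi>(2)[of b] by simp
      then have "mo (b + part1 m) \<in> CK B f' (t - N)" using b BM by (simp add: CK_def part0_add)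
      moreover have "mo m = 0 + relabel \<phi> (mo (b + part1 m))"
        using b BM part_sum[of m] by (simp add: rl part0_add part1_add part1_unit)
      ultimately show ?thesis by (metis CK_def sp_0)
    qed
  next
    case (add p q)
    then obtain l b l' b' where "l \<in> CK S f' t" "b \<in> CK B f' (t - N)" "p = l + relabel \<phi> b"
      "l' \<in> CK S f' t" "b' \<in> CK B f' (t - N)" "q = l' + relabel \<phi> b'" by blast
    then show ?case
      by (intro bexI[of _ "l + l'"] bexI[of _ "b + b'"]) (auto simp: relabel_add CK_add add_ac)
  qed
  show "b = 0" if b: "b \<in> CK B f' (t - N)" "relabel \<phi> b \<in> CK S f' t" for f' b
  proof (rule ccontr)
    assume "b \<noteq> 0"
    then obtain m where m: "m \<in> keys b" by fastforce
    have pB: "part0 m \<in> B" if "m \<in> keys b" for m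
      using that b by (auto simp: CK_def sp_def)
    have p0: "part0 (\<phi> (part0 m) + part1 m) = \<phi> (part0 m)" if "m \<in> keys b" for m
      using \<phi>(1)[OF pB[OF that]] by (simp add: part0_add)
    have p1: "part1 (\<phi> (part0 m) + part1 m) = part1 m" if "m \<in> keys b" for m
      using \<phi>(1)[OF pB[OF that]] by (simp add: part1_add part1_unit)
    have "inj_on (\<lambda>m. \<phi> (part0 m) + part1 m) (keys b)"
    proof (rule inj_onI)
      fix m n assume mn: "m \<in> keys b" "n \<in> keys b" "\<phi> (part0 m) + part1 m = \<phi> (part0 n) + part1 n"
      have "\<phi> (part0 m) = \<phi> (part0 n)" "part1 m = part1 n"
        using p0[OF mn(1)] p0[OF mn(2)] p1[OF mn(1)] p1[OF mn(2)] mn(3) by metis+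
      then show "m = n" using \<phi>(3) pB mn by (metis inj_onD mon_parts_eqI)
    qed
    from keys_lin_inj[OF this] have "\<phi> (part0 m) + part1 m \<in> keys (relabel \<phi> b)"
      using m by (simp add: relabel_def)
    then have "\<phi> (part0 m) \<in> S" using b(2) p0[OF m] by (force simp: CK_def sp_def)
    then show False using \<phi>(1)[OF pB[OF m]] by simp
  qed
  show CKrel: "relabel \<phi> b \<in> CK (S \<union> \<phi> ` B) f' t" if "b \<in> CK B f' (t - N)" for f' b
    using that unfolding CK_def
  proof (rule sp_additive[OF relabel_additive])
    fix m assume m: "m \<in> cmons cl (Suc f') (t - N) \<inter> {m. part0 m \<in> B}"
    then have "\<phi> (part0 m) + part1 m \<in> cmons cl (Suc f') t"
      using move[of m f' "t - N" "\<phi> (part0 m)"] \<phi>(1,2)[of "part0 m"] by simp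
    then show "relabel \<phi> (mo m) \<in> sp (cmons cl (Suc f') t \<inter> {m. part0 m \<in> S \<union> \<phi> ` B})"
      using m \<phi>(1)[of "part0 m"] by (simp add: rl part0_add)
  qed
  show "dd f' y \<in> CK S (Suc f') t" if "y \<in> CK S f' t" for f' y using that S by (rule CK_dd[rotated])
  show CKB: "dd f' b \<in> CK B (Suc f') (t - N)" if "b \<in> CK B f' (t - N)" for f' b
    using that B by (rule CK_dd[rotated])
  show "dd f' (relabel \<phi> b) - relabel \<phi> (dd f' b) \<in> CK S (Suc f') t" if b: "b \<in> CK B f' (t - N)" for f' b
  proof -
    have "CF cl i (relabel \<phi> b) + relabel \<phi> (CF cl i b) \<in> CS S" if i: "i \<ge> 1" for i
      using b unfolding CK_def
    proof (induction b rule: sp_induct)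
      case zero
      then show ?case by (simp add: additive_0[OF relabel_additive])
    next
      case (mo m)
      let ?b = "part0 m"
      let ?r = "CF cl i (mo (part1 m))"
      have bB: "?b \<in> B" using mo by simp
      have r: "?r \<in> CS {0}" using i by (intro CF_unit) auto
      have "CF cl i (relabel \<phi> (mo m)) + relabel \<phi> (CF cl i (mo m))
          = (CF cl i (mo (\<phi> ?b)) + relabel \<phi> (CF cl i (mo ?b))) * ?r"
      proof -
        have "CF cl i (mo m) = CF cl i (mo ?b) * ?r"
          by (subst mo_parts) (simp only: psubst_mult)
        then show ?thesis
          by (simp add: relabel_mo psubst_mult relabel_mult_unit[OF r] distrib_right)
      qed
      moreover have "CF cl i (mo (\<phi> ?b)) + relabel \<phi> (CF cl i (mo ?b)) \<in> CS S"
      proof (cases "i = 1")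
        case False
        then have "CF cl i (mo (\<phi> ?b)) = mo (\<phi> ?b)" "CF cl i (mo ?b) = mo ?b"
          using i \<phi>(1)[OF bB] BM[OF bB] by (auto intro!: CF_M0)
        then show ?thesis using BM[OF bB] by (simp add: relabel_M0)
      qed (use h[OF bB] in simp)
      ultimately show ?case using CS_mult_unit r by simp
    next
      case (add p q)
      then show ?case using CS_add[OF add] by (simp add: psubst_add relabel_add add_ac)
    qed
    then have "(\<Sum>i\<in>{1..Suc (Suc f')}. CF cl i (relabel \<phi> b) + relabel \<phi> (CF cl i b)) \<in> CS S"
      by (intro CS_sum) auto
    then have "dd f' (relabel \<phi> b) + relabel \<phi> (dd f' b) \<in> CS S"
      by (simp only: dd_def DD_def additive_sum[OF relabel_additive] sum.distrib)
    moreover have "dd f' (relabel \<phi> b) + relabel \<phi> (dd f' b) \<in> KG (Suc f') t"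
    proof (intro KG_add KG_dd)
      show "relabel \<phi> b \<in> KG f' t" using CKrel[OF b] by (simp add: CK_KG)
      have "relabel \<phi> (dd f' b) \<in> CK (S \<union> \<phi> ` B) (Suc f') t"
        using CKB[OF b]
        unfolding CK_def
      proof (rule sp_additive[OF relabel_additive])
        fix m assume m: "m \<in> cmons cl (Suc (Suc f')) (t - N) \<inter> {m. part0 m \<in> B}"
        then have "\<phi> (part0 m) + part1 m \<in> cmons cl (Suc (Suc f')) t"
          using move[of m "Suc f'" "t - N" "\<phi> (part0 m)"] \<phi>(1,2)[of "part0 m"] by simp
        then show "relabel \<phi> (mo m) \<in> sp (cmons cl (Suc (Suc f')) t \<inter> {m. part0 m \<in> S \<union> \<phi> ` B})"
          using m \<phi>(1)[of "part0 m"] by (simp add: rl part0_add)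
      qed
      then show "relabel \<phi> (dd f' b) \<in> KG (Suc f') t" by (simp add: CK_KG)
    qed
    ultimately show ?thesis by (simp add: CK_KG)
  qed
qed (use ex in \<open>auto intro: CK_add\<close>)


subsection \<open>Families of cells\<close>

lemma finite_M0_bounded: "finite {m \<in> M0. dg m \<le> t}"
proof -
  define A where "A = (\<lambda>n. Factor 0 n :: (unit, nat) tvar) ` {..nat t}"
  have bound: "int (lookup m (Factor 0 n)) * (2 ^ n - 1) \<le> dg m" if "m \<in> M0" for m n
  proof (cases "Factor 0 n \<in> keys m")
    case True
    have "dg m = (\<Sum>v\<in>keys m. int (lookup m v) * vdeg cl v)" by (simp add: mdegree_def)
    moreover have "int (lookup m (Factor 0 n)) * vdeg cl (Factor 0 n) \<le> \<dots>"
      using that True by (intro member_le_sum[of _ _ "\<lambda>v. int (lookup m v) * vdeg cl v"]) (auto simp: M0_def)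
    ultimately show ?thesis by simp
  qed (use dg_M0_nonneg[OF that] in \<open>simp add: in_keys_iff\<close>)
  have "lookup ` {m \<in> M0. dg m \<le> t} \<subseteq> {g. \<forall>x. (x \<in> A \<longrightarrow> g x \<in> {..nat t}) \<and> (x \<notin> A \<longrightarrow> g x = 0)}"
  proof (clarify, intro conjI impI)
    fix m x assume m: "m \<in> M0" "dg m \<le> t"
    have *: "int n \<le> 2 ^ n - 1" for n
    proof -
      have "int n < int (2 ^ n)" using less_exp[of n] by (simp only: of_nat_less_iff)
      then show ?thesis by simp
    qed
    have ub: "int (lookup m (Factor 0 n)) \<le> t \<and> int n \<le> t" if "lookup m (Factor 0 n) \<noteq> 0" for n
    proof -
      have "Factor 0 n \<in> keys m" using that by (simp add: in_keys_iff)
      then have "n \<ge> 1" using m(1) by (auto simp: M0_def)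
      then have "int (lookup m (Factor 0 n)) * 1 \<le> int (lookup m (Factor 0 n)) * (2 ^ n - 1)"
        using *[of n] by (intro mult_left_mono) auto
      moreover have "1 * (2 ^ n - 1) \<le> int (lookup m (Factor 0 n)) * (2 ^ n - 1)"
        using that by (intro mult_right_mono) auto
      moreover note bound[OF m(1), of n] m(2) *[of n]
      ultimately show ?thesis by (metis (no_types, lifting) mult.right_neutral mult_1 order_trans)
    qed
    show "lookup m x \<in> {..nat t}" if xA: "x \<in> A"
    proof (cases "lookup m x = 0")
      case False
      obtain n where "x = Factor 0 n" using xA unfolding A_def by blast
      then show ?thesis using ub[of n] False nat_mono[of "int (lookup m (Factor 0 n))" t] by simp
    qed simp
    show "lookup m x = 0" if "x \<notin> A"
    proof (rule ccontr)
      assume x: "lookup m x \<noteq> 0"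
      then have "x \<in> keys m" by (simp add: in_keys_iff)
      then obtain n where n: "x = Factor 0 n" using m(1) by (auto simp: M0_def)
      then have "n \<le> nat t" using ub[of n] x nat_mono[of "int n" t] by simp
      then show False using n that by (auto simp: A_def)
    qed
  qed
  then have "finite (lookup ` {m \<in> M0. dg m \<le> t})"
    by (rule finite_subset) (intro finite_set_of_finite_funs, auto simp: A_def)
  moreover have "inj_on lookup {m \<in> M0. dg m \<le> t}"
    by (rule inj_onI) (simp only: poly_mapping.lookup_inject)
  ultimately show ?thesis by (rule finite_imageD)
qed

text \<open>A comodule that is built from \<open>S\<close> by attaching cells \<open>\<phi> i B\<close> in dimensions \<open>N i\<close>, each attached to
  cells of smaller dimension.  In a fixed internal degree only finitely many cells matter.\<close>

lemma rel_exact_cells: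
  assumes S: "closed S" and B: "closed B"
    and \<phi>: "\<And>i b. i \<in> I \<Longrightarrow> b \<in> B \<Longrightarrow> \<phi> i b \<in> M0 - S" "\<And>i b. i \<in> I \<Longrightarrow> b \<in> B \<Longrightarrow> dg (\<phi> i b) = dg b + N i"
      "\<And>i j b b'. i \<in> I \<Longrightarrow> j \<in> I \<Longrightarrow> b \<in> B \<Longrightarrow> b' \<in> B \<Longrightarrow> \<phi> i b = \<phi> j b' \<Longrightarrow> i = j \<and> b = b'"
    and h: "\<And>i b. i \<in> I \<Longrightarrow> b \<in> B \<Longrightarrow> CF cl 1 (mo (\<phi> i b)) + relabel (\<phi> i) (CF cl 1 (mo b))
        \<in> CS (S \<union> (\<Union>j\<in>{j \<in> I. N j < N i}. \<phi> j ` B))"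
    and fin: "finite {i \<in> I. N i \<le> t}"
    and ex: "\<And>i. i \<in> I \<Longrightarrow> N i \<le> t \<Longrightarrow> exact dd (CK B) f (t - N i)"
  shows "rel_exact dd (CK S) (CK (S \<union> (\<Union>i\<in>I. \<phi> i ` B))) f t"
proof -
  let ?S = "\<lambda>J. S \<union> (\<Union>i\<in>J. \<phi> i ` B)"
  have relabelS: "relabel (\<phi> i) p \<in> CS (\<phi> i ` B)" if "i \<in> I" "p \<in> CS B" for i p
    using that(2) unfolding CS_def
    by (rule sp_additive[OF relabel_additive]) (use \<phi>(1)[OF that(1)] in \<open>auto simp: relabel_def part0_add\<close>)
  have clJ: "closed (?S J)" if J: "J \<subseteq> I" "\<And>i j. i \<in> J \<Longrightarrow> j \<in> I \<Longrightarrow> N j < N i \<Longrightarrow> j \<in> J" for J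
    unfolding closed_def
  proof (intro conjI ballI)
    show "?S J \<subseteq> M0" using S \<phi>(1) J by (auto simp: closed_def)
    fix s assume "s \<in> ?S J"
    then consider "s \<in> S" | i b where "i \<in> J" "b \<in> B" "s = \<phi> i b" by auto
    then show "CF cl 1 (mo s) \<in> CS (?S J)"
    proof cases
      case 1
      then show ?thesis using S by (auto simp: closed_def intro: CS_mono)
    next
      case 2
      have "CF cl 1 (mo s) + relabel (\<phi> i) (CF cl 1 (mo b)) \<in> CS (?S J)"
      proof -
        have "{j \<in> I. N j < N i} \<subseteq> J" using J(2)[OF 2(1)] by auto
        then show ?thesis unfolding 2(3) by (intro CS_mono[OF h]) (use 2 J(1) in auto)
      qed
      moreover have "relabel (\<phi> i) (CF cl 1 (mo b)) \<in> CS (?S J)"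
        by (rule CS_mono[OF relabelS]) (use 2 J B in \<open>auto simp: closed_def\<close>)
      ultimately have "(CF cl 1 (mo s) + relabel (\<phi> i) (CF cl 1 (mo b))) + relabel (\<phi> i) (CF cl 1 (mo b)) \<in> CS (?S J)"
        by (rule CS_add)
      then show ?thesis by (simp add: add.assoc)
    qed
  qed
  have fin_case: "rel_exact dd (CK S) (CK (?S J)) f t"
    if "finite J" "J \<subseteq> {i \<in> I. N i \<le> t}" "\<And>i j. i \<in> J \<Longrightarrow> j \<in> I \<Longrightarrow> N j < N i \<Longrightarrow> j \<in> J" for J
    using that
  proof (induction "card J" arbitrary: J)
    case 0
    then have "J = {}" by simp
    then have "?S J = S" by simp
    moreover have "rel_exact dd (CK S) (CK S) f t"
      unfolding rel_exact_def by (auto intro!: bexI[of _ 0]) (simp add: CK_def)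
    ultimately show ?case by (simp only:)
  next
    case (Suc n J)
    then have "J \<noteq> {}" by auto
    then have "Max (N ` J) \<in> N ` J" using Suc by (intro Max_in) auto
    then obtain i where i: "i \<in> J" "N i = Max (N ` J)" by auto
    then have max: "N j \<le> N i" if "j \<in> J" for j using Suc that by simp
    let ?J = "J - {i}"
    have low: "j \<in> ?J" if "k \<in> ?J" "j \<in> I" "N j < N k" for j k
      using Suc.prems(3)[of k j] that max[of k] by auto
    have IH: "rel_exact dd (CK S) (CK (?S ?J)) f t"
    proof (rule Suc.hyps(1))
      show "n = card ?J" using Suc.hyps(2) i(1) Suc.prems(1) by simp
      show "finite ?J" "?J \<subseteq> {i \<in> I. N i \<le> t}" using Suc.prems(1,2) by auto
      show "j \<in> ?J" if "k \<in> ?J" "j \<in> I" "N j < N k" for k j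
        by (rule low[OF that])
    qed
    have iI: "i \<in> I" using i(1) Suc.prems(2) by auto
    have step: "rel_exact dd (CK (?S ?J)) (CK (?S ?J \<union> \<phi> i ` B)) f t"
    proof (rule rel_exact_one_cell[where N = "N i"])
      show "closed (?S ?J)"
      proof (rule clJ)
        show "?J \<subseteq> I" using Suc.prems(2) by auto
        show "j \<in> ?J" if "k \<in> ?J" "j \<in> I" "N j < N k" for k j
          by (rule low[OF that])
      qed
      show "\<phi> i b \<in> M0 - ?S ?J" if "b \<in> B" for b
      proof -
        have "\<phi> i b \<noteq> \<phi> j b'" if "j \<in> ?J" "b' \<in> B" for j b'
          using \<phi>(3)[of i j b b'] i Suc.prems(2) that \<open>b \<in> B\<close> by auto
        then show ?thesis using \<phi>(1)[of i b] i Suc.prems(2) that by auto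
      qed
      show "inj_on (\<phi> i) B" using \<phi>(3)[of i i] i Suc.prems(2) by (auto simp: inj_on_def)
      show "CF cl 1 (mo (\<phi> i b)) + relabel (\<phi> i) (CF cl 1 (mo b)) \<in> CS (?S ?J)" if "b \<in> B" for b
      proof (rule CS_mono[OF h[OF iI that]])
        have "{j \<in> I. N j < N i} \<subseteq> ?J" using Suc.prems(3)[OF i(1)] by auto
        then show "S \<union> (\<Union>j\<in>{j \<in> I. N j < N i}. \<phi> j ` B) \<subseteq> ?S ?J" by blast
      qed
      show "exact dd (CK B) f (t - N i)" using i(1) Suc.prems(2) by (intro ex[OF iI]) auto
      show "dg (\<phi> i b) = dg b + N i" if "b \<in> B" for b by (rule \<phi>(2)[OF iI that])
    qed (rule B)
    have eq: "?S ?J \<union> \<phi> i ` B = ?S J" using i by auto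
    show ?case
    proof (rule rel_exact_trans[OF additive_dd dd_dd _ _ _ IH step[unfolded eq]])
      show "CK S f' t \<subseteq> CK (?S ?J) f' t" "CK (?S ?J) f' t \<subseteq> CK (?S J) f' t" for f'
        by (rule CK_mono; blast)+
    qed (rule CK_add)
  qed
  have "rel_exact dd (CK S) (CK (?S {i \<in> I. N i \<le> t})) f t"
    by (rule fin_case[OF fin]) auto
  moreover have "CK (?S {i \<in> I. N i \<le> t}) f' t = CK (?S I) f' t" for f'
  proof
    show "CK (?S {i \<in> I. N i \<le> t}) f' t \<subseteq> CK (?S I) f' t" by (rule CK_mono) auto
    have "part0 m \<in> ?S {i \<in> I. N i \<le> t}" if m: "m \<in> cmons cl (Suc f') t" "part0 m \<in> ?S I" for m
    proof (cases "part0 m \<in> S")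
      case False
      then obtain i b where ib: "i \<in> I" "b \<in> B" "part0 m = \<phi> i b" using m by auto
      have "dg b \<ge> 0" using ib B by (intro dg_M0_nonneg) (auto simp: closed_def)
      moreover have "dg (part0 m) \<le> t" using m(1) dg_parts[of m] dg_part1_nonneg[OF m(1)] by (simp add: cmons_def)
      ultimately have "N i \<le> t" using \<phi>(2)[OF ib(1,2)] ib(3) by simp
      then show ?thesis using ib by auto
    qed simp
    then show "CK (?S I) f' t \<subseteq> CK (?S {i \<in> I. N i \<le> t}) f' t"
      unfolding CK_def by (intro subsetI) (erule sp_mono, blast)
  qed
  ultimately show ?thesis by (simp only: rel_exact_def)
qed

text \<open>The coaction is unitriangular with respect to the degree of the leading factor.\<close>

lemma CF1_lower: "p \<in> M0 \<Longrightarrow> CF cl 1 (mo p) + mo p \<in> CS {q \<in> M0. dg q < dg p}"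
proof (induction p rule: mon_induct)
  case (var v)
  then obtain n where n: "v = Factor 0 n" "n \<ge> 1" by (auto simp: M0_def)
  have "CF cl 1 (mo (v0 n)) = cop 0 n" by (simp add: mo_var[simplified] CF_pvar)
  also have "\<dots> = cl_xi 0 (n - 0) ^ (2 ^ 0) * cl_xi 1 0 + (\<Sum>k\<in>{Suc 0..n}. cl_xi 0 (n - k) ^ (2 ^ k) * cl_xi 1 k)"
    unfolding cop_def atLeast0AtMost[symmetric] One_nat_def by (rule sum.atLeast_Suc_atMost) simp
  also have "cl_xi 0 (n - 0) ^ (2 ^ 0) * cl_xi 1 0 = mo (v0 n)"
    using n by (simp add: cl_xi_def mo_var[simplified])
  finally have "CF cl 1 (mo (v0 n)) + mo (v0 n) = (\<Sum>k\<in>{1..n}. cl_xi 0 (n - k) ^ (2 ^ k) * cl_xi 1 k)"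
    by (simp add: add_ac)
  moreover have "cl_xi 0 (n - k) ^ (2 ^ k) * cl_xi 1 k \<in> CS {q \<in> M0. dg q < dg (v0 n)}" if k: "k \<in> {1..n}" for k
  proof (intro CS_mult_unit)
    have "cl_xi 0 (n - k) ^ (2 ^ k) = mo (if k = n then 0 else Poly_Mapping.single (Factor 0 (n - k)) (2 ^ k))"
      using k by (simp add: cl_xi_def mo_single)
    moreover have "dg (Poly_Mapping.single (Factor 0 (n - k)) (2 ^ k)) < dg (v0 n)" if "k < n"
    proof -
      have "(2::int) ^ k * (2 ^ (n - k) - 1) = 2 ^ n - 2 ^ k"
        using that by (simp add: right_diff_distrib flip: power_add)
      moreover have "(2::int) ^ k > 1" using k by simp
      ultimately show ?thesis by (simp add: mdegree_single)
    qed
    moreover have "dg (v0 n) > 0" unfolding dg_v0 using n by simp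
    moreover have "Poly_Mapping.single (Factor 0 (n - k)) (2 ^ k) \<in> M0" if "k < n"
      using that by (simp add: M0_def)
    ultimately show "cl_xi 0 (n - k) ^ (2 ^ k) \<in> CS {q \<in> M0. dg q < dg (v0 n)}"
      using k by (auto simp: CS_mo)
  qed (use k in simp)
  ultimately show ?case using n by (auto intro: CS_sum)
next
  case (add m n)
  then have MN: "m \<in> M0" "n \<in> M0" by auto
  let ?l = "\<lambda>p. CF cl 1 (mo p) + mo p"
  have m: "?l m \<in> CS {q \<in> M0. dg q < dg m}" and n: "?l n \<in> CS {q \<in> M0. dg q < dg n}"
    using add MN by auto
  have "?l (m + n) = ?l m * ?l n + (mo m * ?l n + ?l m * mo n)"
    by (simp add: mo_mult[symmetric] psubst_mult algebra_simps)
  moreover have "?l m * ?l n \<in> CS {q \<in> M0. dg q < dg (m + n)}"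
    by (rule CS_mult[OF m n]) (auto simp: mdegree_add)
  moreover have "mo m * ?l n \<in> CS {q \<in> M0. dg q < dg (m + n)}"
    by (rule CS_mult[of _ "{m}", OF _ n]) (use MN in \<open>auto simp: mdegree_add CS_mo\<close>)
  moreover have "?l m * mo n \<in> CS {q \<in> M0. dg q < dg (m + n)}"
    by (rule CS_mult[OF m, of _ "{n}"]) (use MN in \<open>auto simp: mdegree_add CS_mo\<close>)
  ultimately show ?case by (simp add: CS_add)
qed simp

lemma CF1_lower_closed:
  assumes "closed P" "p \<in> P"
  shows "CF cl 1 (mo p) + mo p \<in> CS {q \<in> P. dg q < dg p}"
proof -
  have p: "p \<in> M0" using assms by (auto simp: closed_def)
  have "CF cl 1 (mo p) + mo p \<in> CS P"
    using assms p by (intro CS_add) (auto simp: closed_def CS_mo)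
  from CS_Int[OF this CF1_lower[OF p]] show ?thesis
    by (rule CS_mono) auto
qed

lemma relabel_shift: "p \<in> M0 \<Longrightarrow> relabel (\<lambda>b. p + b) q = mo p * q"
  by (rule additive_eqI[where p = q and g = "relabel (\<lambda>b. p + b)" and h = "(*) (mo p)"])
    (auto simp: additive_def distrib_left relabel_add, auto simp: relabel_def mo_mult add.assoc part_sum)

text \<open>Multiplicative cells \<open>p B\<close>.\<close>

lemma rel_exact_mult_cells:
  assumes P: "closed P" and B: "closed B" and Q: "closed (Q \<oplus> B)" "Q \<subseteq> P"
    and unique: "\<And>p p' b b'. p \<in> P \<Longrightarrow> p' \<in> P \<Longrightarrow> b \<in> B \<Longrightarrow> b' \<in> B \<Longrightarrow> p + b = p' + b' \<Longrightarrow> p = p'"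
    and ex: "\<And>p. p \<in> P - Q \<Longrightarrow> exact dd (CK B) f (t - dg p)"
  shows "rel_exact dd (CK (Q \<oplus> B)) (CK (P \<oplus> B)) f t"
proof -
  have PM: "p \<in> M0" if "p \<in> P" for p using P that by (auto simp: closed_def)
  have BM: "b \<in> M0" if "b \<in> B" for b using B that by (auto simp: closed_def)
  have eq: "P \<oplus> B = Q \<oplus> B \<union> (\<Union>p\<in>P - Q. (\<lambda>b. p + b) ` B)"
    using Q(2) by (auto simp: splus_def)
  have "rel_exact dd (CK (Q \<oplus> B)) (CK (Q \<oplus> B \<union> (\<Union>p\<in>P - Q. (\<lambda>b. p + b) ` B))) f t"
  proof (rule rel_exact_cells[where N = dg])
    show "p + b \<in> M0 - (Q \<oplus> B)" if "p \<in> P - Q" "b \<in> B" for p b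
    proof -
      have "p + b \<noteq> q + b'" if "q \<in> Q" "b' \<in> B" for q b'
        using unique[of p q b b'] \<open>p \<in> P - Q\<close> \<open>b \<in> B\<close> that Q(2) by auto
      then have "p + b \<notin> Q \<oplus> B" by (auto simp: splus_def)
      then show ?thesis using that PM BM by simp
    qed
    show "p = p' \<and> b = b'" if "p \<in> P - Q" "p' \<in> P - Q" "b \<in> B" "b' \<in> B" "p + b = p' + b'" for p p' b b'
      using unique[of p p' b b'] that by auto
    show "finite {p \<in> P - Q. dg p \<le> t}"
      by (rule finite_subset[OF _ finite_M0_bounded[of t]]) (use PM in auto)
    show "CF cl 1 (mo (p + b)) + relabel (\<lambda>b. p + b) (CF cl 1 (mo b))
        \<in> CS (Q \<oplus> B \<union> (\<Union>p'\<in>{p' \<in> P - Q. dg p' < dg p}. (\<lambda>b. p' + b) ` B))"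
      if pb: "p \<in> P - Q" "b \<in> B" for p b
    proof -
      have "CF cl 1 (mo (p + b)) + relabel (\<lambda>b. p + b) (CF cl 1 (mo b))
          = (CF cl 1 (mo p) + mo p) * CF cl 1 (mo b)"
        using PM pb by (simp add: relabel_shift mo_mult[symmetric] psubst_mult distrib_right)
      moreover have "\<dots> \<in> CS (Q \<oplus> B \<union> (\<Union>p'\<in>{p' \<in> P - Q. dg p' < dg p}. (\<lambda>b. p' + b) ` B))"
        by (rule CS_mult[OF CF1_lower_closed[OF P], of p _ B])
          (use pb B in \<open>auto simp: closed_def splus_def\<close>)
      ultimately show ?thesis by simp
    qed
  qed (use B Q ex in \<open>auto simp: mdegree_add\<close>)
  then show ?thesis by (simp only: eq)
qed

section \<open>The vanishing lines\<close>

abbreviation ex0 :: "nat \<Rightarrow> cmon \<Rightarrow> nat" where "ex0 n m \<equiv> lookup m (Factor 0 n)"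

text \<open>Monomial bases of the kernel of \<open>Sq1\<close> and of the common kernel of \<open>Sq1\<close> and \<open>Sq2\<close>.\<close>

definition Ds :: "cmon set" where "Ds = {m \<in> M0. even (ex0 (Suc 0) m)}"
definition D1s :: "cmon set" where "D1s = {m \<in> M0. 4 dvd ex0 (Suc 0) m \<and> even (ex0 2 m)}"
text \<open>\<open>A0\<close> spans the Moore comodule.  With \<open>HZ\<close>, a comodule with cells in dimensions \<open>0\<close>, \<open>2\<close> and \<open>3\<close>, every
  monomial of \<open>\<Gamma>\<close> is uniquely one of \<open>D1\<close> times one of \<open>HZ A0\<close> or \<open>\<xi>\<^sub>1\<^sup>2 \<xi>\<^sub>2 A0\<close>.\<close>

definition A0 :: "cmon set" where "A0 = {0, v0 1}"
definition HZ :: "cmon set" where "HZ = {0, v0 1 + v0 1, v0 2}"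

text \<open>If multiplication by \<open>w\<close> undoes the operation \<open>D\<close> on the monomials with property \<open>R\<close> and kills its
  values on the others, then no monomial with property \<open>R\<close> occurs in the kernel of \<open>D\<close>.\<close>

lemma no_keys:
  assumes D: "additive D" and w: "\<And>m. m \<in> keys z \<Longrightarrow> w * D (mo m) = (if R m then mo m else 0)"
    and z: "D z = 0" "m \<in> keys z"
  shows "\<not> R m"
proof
  assume R: "R m"
  define g where "g m = (if R m then mo m else 0)" for m
  have "w * D z = lin g z"
    by (rule additive_eqI[where g = "\<lambda>z. w * D z" and p = z])
      (use D w in \<open>auto simp: additive_def additive_lin[unfolded additive_def] distrib_left g_def\<close>)
  then have "lin g z = 0" using z by simp
  moreover have "lin g z = (\<Sum>m\<in>{m \<in> keys z. R m}. mo m)"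
    by (simp add: lin_def g_def sum.inter_filter)
  ultimately have s: "(\<Sum>m\<in>{m \<in> keys z. R m}. mo m) = 0" by simp
  have "lookup (\<Sum>m\<in>A. mo m) m = (if m \<in> A then 1 else 0)" if "finite A" for A
    using that by (simp only: lookup_sum) (simp add: lookup_single when_def)
  from this[of "{m \<in> keys z. R m}"] show False using s z(2) R by simp
qed

lemma Sq1_kernel: "Sq1 z = 0 \<Longrightarrow> m \<in> keys z \<Longrightarrow> even (ex0 (Suc 0) m)"
proof -
  assume *: "Sq1 z = 0" "m \<in> keys z"
  have "xx * Sq1 (mo m) = (if odd (ex0 (Suc 0) m) then mo m else 0)" for m
  proof -
    have "vX + (m - vX) = m" if "odd (ex0 (Suc 0) m)"
      using that vX_le[of m] by (intro poly_mapping_eqI) (auto simp: lookup_add lookup_minus elim: oddE)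
    then show ?thesis by (auto simp: Sq1_def Sq1m_def pvar_def mo_mult)
  qed
  from no_keys[OF additive_Sq(1) this *] show ?thesis by simp
qed

lemma Sq12_kernel:
  assumes "Sq1 z = 0" "Sq2 z = 0" "m \<in> keys z"
  shows "4 dvd ex0 (Suc 0) m \<and> even (ex0 2 m)"
proof -
  define Q where "Q p = Sq1 (Sq2 p) + Sq2 (Sq1 p)" for p
  have Qadd: "additive Q" by (simp add: additive_def Q_def Sq1_add Sq2_add add_ac)
  have Qmult: "Q (p * q) = Q p * q + p * Q q" for p q
    by (simp add: Q_def Sq1_mult Sq2_mult Sq1_add Sq2_add algebra_simps)
  have "yy * Q (mo m) = (if odd (ex0 2 m) then mo m else 0)" for m
  proof (induction m rule: mon_induct)
    case (var v)
    have "yy * Q (pvar v) = (if v = Factor 0 2 then pvar v else 0)"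
      by (auto simp: Q_def Sq_pvar)
    then show ?case by (auto simp: mo_var[simplified] lookup_single when_def)
  next
    case (add m n)
    have "yy * Q (mo (m + n)) = (yy * Q (mo m)) * mo n + mo m * (yy * Q (mo n))"
      by (simp only: mo_mult[symmetric] Qmult) (simp add: algebra_simps)
    then show ?case by (auto simp: add lookup_add mo_mult)
  qed (simp add: Q_def)
  from no_keys[OF Qadd this, of z] have e2: "even (ex0 2 n)" if "n \<in> keys z" for n
    using assms(1,2) that by (auto simp: Q_def)
  have e1: "even (ex0 (Suc 0) n)" if "n \<in> keys z" for n using Sq1_kernel assms(1) that .
  have "(xx * xx) * Sq2 (mo n) = (if odd (ex0 (Suc 0) n choose 2) then mo n else 0)" if n: "n \<in> keys z" for n
  proof -
    have "vX + vX + (n - (vX + vX)) = n" if "odd (ex0 (Suc 0) n choose 2)"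
      using vXX_le[of n] odd_choose_two[OF that]
      by (intro poly_mapping_eqI) (simp add: lookup_add lookup_minus)
    then show ?thesis using e2[OF n] by (auto simp: Sq2_def Sq2x_def Sq2y_def pvar_def mo_mult)
  qed
  from no_keys[OF additive_Sq(2) this assms(2,3)] have "even (ex0 (Suc 0) m choose 2)" by simp
  moreover obtain k where k: "ex0 (Suc 0) m = 2 * k" using e1[OF assms(3)] by (auto elim: evenE)
  moreover have "(2 * k) choose 2 = k * (2 * k - 1)" by (simp add: choose_two)
  ultimately have "even k" by (cases k) auto
  then show ?thesis using e2[OF assms(3)] k by auto
qed

lemma CS_Ds: "z \<in> CS Ds \<Longrightarrow> Sq1 z = 0"
proof -
  assume "z \<in> CS Ds"
  then have "z \<in> sp {m. part0 m \<in> Ds}" by (simp add: CS_def)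
  then show ?thesis
  proof (induction rule: sp_induct)
    case (mo m)
    then have "even (ex0 (Suc 0) (part0 m))" by (simp add: Ds_def)
    then show ?case by (simp add: Sq1_def Sq1m_def lookup_part0 is0_def)
  qed (auto simp: Sq1_add)
qed

lemma D1s_Ds: "D1s \<subseteq> Ds"
  by (auto simp: D1s_def Ds_def)

lemma CS_D1s: "z \<in> CS D1s \<Longrightarrow> Sq2 z = 0"
proof -
  assume "z \<in> CS D1s"
  then have "z \<in> sp {m. part0 m \<in> D1s}" by (simp add: CS_def)
  then show ?thesis
  proof (induction rule: sp_induct)
    case (mo m)
    then have "4 dvd ex0 (Suc 0) m" "even (ex0 2 m)" by (auto simp: D1s_def lookup_part0 is0_def)
    moreover from this obtain k where "ex0 (Suc 0) m = 2 * (2 * k)" by (auto elim: dvdE)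
    moreover have "(2 * (2 * k)) choose 2 = 2 * k * (2 * (2 * k) - 1)" by (simp add: choose_two)
    ultimately show ?case by (simp add: Sq2_def Sq2x_def Sq2y_def)
  qed (auto simp: Sq2_add)
qed

lemma CK_Ds: "CK Ds f t = KD f t"
proof
  show "CK Ds f t \<subseteq> KD f t" by (auto simp: CK_KG KD_def CS_Ds)
  show "KD f t \<subseteq> CK Ds f t"
  proof
    fix z assume z: "z \<in> KD f t"
    have "part0 m \<in> Ds" if m: "m \<in> keys z" for m
    proof -
      have "m \<in> cmons cl (Suc f) t" using z m by (auto simp: KD_def KG_def cochains_sp sp_def)
      then have "part0 m \<in> M0" by (rule cmons_part0)
      moreover have "even (ex0 (Suc 0) m)" using z m Sq1_kernel[of z m] by (simp add: KD_def)
      ultimately show ?thesis by (simp add: Ds_def lookup_part0 is0_def)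
    qed
    then show "z \<in> CK Ds f t" using z by (auto simp: CK_KG KD_def CS_def sp_def)
  qed
qed

lemma CK_D1s: "CK D1s f t = KD1 f t"
proof
  show "CK D1s f t \<subseteq> KD1 f t"
    using CS_mono[OF _ D1s_Ds] by (auto simp: CK_KG KD1_def CS_D1s CS_Ds)
  show "KD1 f t \<subseteq> CK D1s f t"
  proof
    fix z assume z: "z \<in> KD1 f t"
    have "part0 m \<in> D1s" if m: "m \<in> keys z" for m
    proof -
      have "m \<in> cmons cl (Suc f) t" using z m by (auto simp: KD1_def KG_def cochains_sp sp_def)
      then have "part0 m \<in> M0" by (rule cmons_part0)
      moreover have "4 dvd ex0 (Suc 0) m \<and> even (ex0 2 m)" using z m Sq12_kernel[of z m] by (simp add: KD1_def)
      ultimately show ?thesis by (simp add: D1s_def lookup_part0 is0_def)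
    qed
    then show "z \<in> CK D1s f t" using z by (auto simp: CK_KG KD1_def CS_def sp_def)
  qed
qed

lemma M0_KG: "s \<in> M0 \<Longrightarrow> mo s \<in> KG 0 (dg s)"
  by (auto simp: KG_def cochains_sp cmons_def M0_def)

lemma CF1_KG: "z \<in> KG 0 t \<Longrightarrow> CF cl 1 z \<in> KG 1 t"
  using CF_cochains[OF bialg_cl, of z 1 t 1] by (simp add: KG_def)

lemma closed_Ds: "closed Ds"
proof -
  have "CF cl 1 (mo s) \<in> CS Ds" if s: "s \<in> Ds" for s
  proof -
    have "s \<in> M0" "Sq1 (mo s) = 0" using s CS_Ds[of "mo s"] by (auto simp: Ds_def CS_mo)
    then have "CF cl 1 (mo s) \<in> KD 1 (dg s)"
      using CF1_KG[OF M0_KG[of s]] by (simp add: KD_def Sq_CF)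
    then have "CF cl 1 (mo s) \<in> CK Ds 1 (dg s)" by (simp only: CK_Ds)
    then show ?thesis by (simp add: CK_KG)
  qed
  then show ?thesis by (auto simp: closed_def Ds_def)
qed

lemma closed_D1s: "closed D1s"
proof -
  have "CF cl 1 (mo s) \<in> CS D1s" if s: "s \<in> D1s" for s
  proof -
    have "s \<in> M0" "Sq1 (mo s) = 0" "Sq2 (mo s) = 0"
      using s D1s_Ds CS_Ds[of "mo s"] CS_D1s[of "mo s"] by (auto simp: D1s_def CS_mo)
    then have "CF cl 1 (mo s) \<in> KD1 1 (dg s)"
      using CF1_KG[OF M0_KG[of s]] by (simp add: KD1_def Sq_CF)
    then have "CF cl 1 (mo s) \<in> CK D1s 1 (dg s)" by (simp only: CK_D1s)
    then show ?thesis by (simp add: CK_KG)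
  qed
  then show ?thesis by (auto simp: closed_def D1s_def)
qed

abbreviation zz :: "(unit, nat) tvar fpoly" where "zz \<equiv> pvar (Factor 0 3)"
abbreviation y1 :: "(unit, nat) tvar fpoly" where "y1 \<equiv> pvar (Factor (Suc 0) 2)"
abbreviation z1 :: "(unit, nat) tvar fpoly" where "z1 \<equiv> pvar (Factor (Suc 0) 3)"

lemma CF1_gen: "CF cl (Suc 0) xx = xx + x1"
  "CF cl (Suc 0) yy = yy + xx ^ 2 * x1 + y1"
  "CF cl (Suc 0) zz = zz + yy ^ 2 * x1 + xx ^ 4 * y1 + z1"
  by (simp_all add: CF_pvar cop_def cl_xi_def numeral_eq_Suc atMost_Suc add_ac)

lemma unit_gen [simp]: "x1 \<in> CS {0}" "y1 \<in> CS {0}" "z1 \<in> CS {0}"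
  using SH_CS[of 0 xx] SH_CS[of 0 yy] SH_CS[of 0 zz] by (simp_all add: psubst_pvar)

lemma mo_v0: "mo (v0 n) = pvar (Factor 0 n)"
  by (rule mo_var)

lemma single_M0 [simp]: "n \<ge> 1 \<Longrightarrow> Poly_Mapping.single (Factor 0 n) k \<in> M0"
  by (auto simp: M0_def)

lemma pvar_CS: "n \<ge> 1 \<Longrightarrow> pvar (Factor 0 n) ^ k \<in> CS {Poly_Mapping.single (Factor 0 n) k}"
proof -
  assume "n \<ge> 1"
  then have "Poly_Mapping.single (Factor 0 n) k \<in> M0" by (auto simp: M0_def)
  then show ?thesis by (simp add: mo_single[symmetric] CS_mo)
qed

lemma pvar_CS1: "n \<ge> 1 \<Longrightarrow> v0 n \<in> S \<Longrightarrow> pvar (Factor 0 n) \<in> CS S"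
  unfolding mo_v0[symmetric] CS_mo by (subst part0_M0) simp_all

lemma closed_A0: "closed A0"
proof -
  have "CF cl 1 (mo (v0 1)) \<in> CS A0"
    unfolding mo_v0 using CF1_gen(1)
    by (auto intro!: CS_add pvar_CS1 CS_mono[OF unit_gen(1)] simp: A0_def)
  moreover have "CF cl 1 (mo 0) \<in> CS A0" using CS_mono[OF CS_1, of A0] by (simp add: A0_def)
  ultimately show ?thesis by (simp add: closed_def) (simp add: A0_def)
qed

lemma mo_XX: "mo (v0 1 + v0 1) = xx ^ 2"
  unfolding mo_mult[symmetric] mo_v0 power2_eq_square by simp

lemma closed_HZ: "closed HZ"
proof -
  have x2: "xx ^ 2 \<in> CS HZ" unfolding mo_XX[symmetric] CS_mo by (simp add: HZ_def)
  have u: "q \<in> CS HZ" if "q \<in> CS {0}" for q using CS_mono[OF that] by (simp add: HZ_def)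
  have "CF cl 1 (mo (v0 1 + v0 1)) = xx ^ 2 + x1 ^ 2"
    by (simp add: mo_XX[simplified] psubst_power CF1_gen fpoly_square_add)
  then have "CF cl 1 (mo (v0 1 + v0 1)) \<in> CS HZ"
    using CS_add[OF x2 u[OF CS_power[OF unit_gen(1), of 2]]] by simp
  moreover have "CF cl 1 (mo (v0 2)) = yy + xx ^ 2 * x1 + y1"
    using mo_v0[of 2] CF1_gen(2) by simp
  moreover have "yy + xx ^ 2 * x1 + y1 \<in> CS HZ"
    by (intro CS_add CS_mult_unit x2 u unit_gen pvar_CS1) (auto simp: HZ_def)
  moreover have "CF cl 1 (mo 0) \<in> CS HZ" using u[OF CS_1] by simp
  ultimately show ?thesis by (simp add: closed_def HZ_def)
qed

lemma add_in_splus: "s \<in> S \<Longrightarrow> t \<in> T \<Longrightarrow> s + t \<in> S \<oplus> T"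
  by (auto simp: splus_def)

lemma sub_splus: "0 \<in> T \<Longrightarrow> S \<subseteq> S \<oplus> T" "0 \<in> T \<Longrightarrow> S \<subseteq> T \<oplus> S"
  using add_in_splus[of _ S 0 T] add_in_splus[of 0 T _ S] by auto

lemma zero_in [simp]: "0 \<in> A0" "0 \<in> HZ" "0 \<in> D1s" "0 \<in> Ds"
  by (auto simp: A0_def HZ_def D1s_def Ds_def)

lemma M0_dec:
  assumes "m \<in> M0"
  obtains d r s where "m = d + Poly_Mapping.single (Factor 0 1) r + Poly_Mapping.single (Factor 0 2) s"
    "d \<in> D1s" "r = ex0 (Suc 0) m mod 4" "s = ex0 2 m mod 2"
proof -
  define r s where "r = ex0 (Suc 0) m mod 4" and "s = ex0 2 m mod 2"
  define d where "d = m - Poly_Mapping.single (Factor 0 1) r - Poly_Mapping.single (Factor 0 2) s"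
  have "m = d + Poly_Mapping.single (Factor 0 1) r + Poly_Mapping.single (Factor 0 2) s"
    by (rule poly_mapping_eqI)
      (auto simp: d_def lookup_add lookup_minus lookup_single when_def r_def s_def)
  moreover have "d \<in> M0"
    using assms by (auto simp: M0_def d_def in_keys_iff lookup_minus subset_eq)
  then have "d \<in> D1s"
    by (auto simp: D1s_def d_def lookup_minus lookup_single when_def r_def s_def dvd_minus_mod)
  ultimately show thesis using that r_def s_def by blast
qed

lemma single_2: "Poly_Mapping.single v (2::nat) = Poly_Mapping.single v 1 + Poly_Mapping.single v 1"
  by (simp only: single_add[symmetric] one_add_one)

lemma single_3: "Poly_Mapping.single v (3::nat) = Poly_Mapping.single v 1 + Poly_Mapping.single v 1 + Poly_Mapping.single v 1"
  by (simp only: single_add[symmetric]) (simp add: numeral_3_eq_3)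

lemma mem_D1A0: "m \<in> D1s \<oplus> A0 \<longleftrightarrow> m \<in> M0 \<and> even (ex0 2 m) \<and> ex0 (Suc 0) m mod 4 \<le> 1"
proof
  assume "m \<in> D1s \<oplus> A0"
  then show "m \<in> M0 \<and> even (ex0 2 m) \<and> ex0 (Suc 0) m mod 4 \<le> 1"
    by (auto simp: splus_def D1s_def A0_def lookup_add lookup_single when_def mod_Suc)
next
  assume *: "m \<in> M0 \<and> even (ex0 2 m) \<and> ex0 (Suc 0) m mod 4 \<le> 1"
  then obtain d r s where d: "m = d + Poly_Mapping.single (Factor 0 1) r + Poly_Mapping.single (Factor 0 2) s"
    "d \<in> D1s" "r = ex0 (Suc 0) m mod 4" "s = ex0 2 m mod 2" using M0_dec by blast
  then have "s = 0" "r = 0 \<or> r = 1" using * by (auto simp: even_iff_mod_2_eq_zero)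
  then have "Poly_Mapping.single (Factor 0 1) r + Poly_Mapping.single (Factor 0 2) s \<in> A0"
    by (auto simp: A0_def)
  then show "m \<in> D1s \<oplus> A0" unfolding d(1) add.assoc by (rule add_in_splus[OF d(2)])
qed

lemma mem_HZA0: "b \<in> HZ \<oplus> A0 \<longleftrightarrow> b \<in> {0, v0 1, v0 1 + v0 1, v0 1 + v0 1 + v0 1, v0 2, v0 2 + v0 1}"
proof -
  have "b \<in> HZ \<oplus> A0 \<longleftrightarrow> (\<exists>s\<in>HZ. \<exists>t\<in>A0. b = s + t)" by (auto simp: splus_def)
  then show ?thesis unfolding HZ_def A0_def by (simp add: disj_ac)
qed

lemma mem_D1HZA0: "m \<in> D1s \<oplus> (HZ \<oplus> A0) \<longleftrightarrow> m \<in> M0 \<and> \<not> (odd (ex0 2 m) \<and> ex0 (Suc 0) m mod 4 \<ge> 2)"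
proof
  assume "m \<in> D1s \<oplus> (HZ \<oplus> A0)"
  then obtain d b where db: "m = d + b" "d \<in> D1s" "b \<in> HZ \<oplus> A0" by (auto simp: splus_def[of D1s])
  obtain k where k: "ex0 (Suc 0) d = 4 * k" "d \<in> M0" "even (ex0 2 d)"
    using db(2) by (auto simp: D1s_def elim: dvdE)
  show "m \<in> M0 \<and> \<not> (odd (ex0 2 m) \<and> ex0 (Suc 0) m mod 4 \<ge> 2)"
    using db(3) k unfolding mem_HZA0 db(1)
    by (auto simp: lookup_add lookup_single when_def mod_Suc)
next
  assume *: "m \<in> M0 \<and> \<not> (odd (ex0 2 m) \<and> ex0 (Suc 0) m mod 4 \<ge> 2)"
  then obtain d r s where d: "m = d + Poly_Mapping.single (Factor 0 1) r + Poly_Mapping.single (Factor 0 2) s"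
    "d \<in> D1s" "r = ex0 (Suc 0) m mod 4" "s = ex0 2 m mod 2" using M0_dec by blast
  have "r < 4" "s < 2" "\<not> (s = 1 \<and> r \<ge> 2)" using * d(3,4) by (auto simp: odd_iff_mod_2_eq_one)
  then have "(r, s) \<in> {(0,0), (1,0), (2,0), (3,0), (0,1), (1,1)}"
    by (cases "r = 0"; cases "r = 1"; cases "r = 2"; cases "r = 3"; cases "s = 0"; cases "s = 1") auto
  then have "Poly_Mapping.single (Factor 0 1) r + Poly_Mapping.single (Factor 0 2) s \<in> HZ \<oplus> A0"
    unfolding mem_HZA0 by (auto simp: single_2 single_3 add_ac)
  then show "m \<in> D1s \<oplus> (HZ \<oplus> A0)" unfolding d(1) add.assoc by (rule add_in_splus[OF d(2)])
qed

lemma dg_split: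
  assumes "m \<in> M0"
  obtains r where "m = Poly_Mapping.single (Factor 0 1) (ex0 (Suc 0) m) + Poly_Mapping.single (Factor 0 2) (ex0 2 m)
      + Poly_Mapping.single (Factor 0 3) (ex0 3 m) + r"
    "dg m = int (ex0 (Suc 0) m) + 3 * int (ex0 2 m) + 7 * int (ex0 3 m) + dg r" "r = 0 \<or> dg r \<ge> 15"
proof -
  define s where "s = Poly_Mapping.single (Factor 0 1 :: (unit, nat) tvar) (ex0 (Suc 0) m)
      + Poly_Mapping.single (Factor 0 2) (ex0 2 m) + Poly_Mapping.single (Factor 0 3) (ex0 3 m)"
  define r where "r = m - s"
  have m: "m = s + r"
    by (rule poly_mapping_eqI) (auto simp: r_def s_def lookup_add lookup_minus lookup_single when_def)
  have rM: "r \<in> M0" using assms unfolding m by simp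
  have z: "ex0 (Suc 0) r = 0" "ex0 2 r = 0" "ex0 3 r = 0"
    by (auto simp: r_def s_def lookup_add lookup_minus lookup_single when_def)
  have "dg r \<ge> 15" if r0: "r \<noteq> 0"
  proof -
    obtain v where v: "v \<in> keys r" using r0 by fastforce
    then obtain n where n: "v = Factor 0 n" "n \<ge> 1" using rM by (auto simp: M0_def)
    have "n \<noteq> 1" "n \<noteq> 2" "n \<noteq> 3" using v z n by (auto simp: in_keys_iff)
    then have n4: "n \<ge> 4" using n by simp
    have "r = v0 n + (r - v0 n)"
      using v n by (intro poly_mapping_eqI) (auto simp: lookup_add lookup_minus lookup_single when_def in_keys_iff)
    moreover from this have "r - v0 n \<in> M0" using rM M0_add by metis
    ultimately have "dg r \<ge> dg (v0 n)" using dg_M0_nonneg mdegree_add[of "vdeg cl" "v0 n" "r - v0 n"] by fastforce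
    moreover have "(2::int) ^ n \<ge> 2 ^ 4" using n4 by (intro power_increasing) auto
    ultimately show ?thesis unfolding dg_v0 by simp
  qed
  moreover have "dg m = int (ex0 (Suc 0) m) + 3 * int (ex0 2 m) + 7 * int (ex0 3 m) + dg r"
    by (subst m) (simp add: mdegree_add s_def mdegree_single)
  ultimately show thesis using that[of r] m unfolding s_def by blast
qed

definition S1 :: "cmon set" where
  "S1 = {0, Poly_Mapping.single (Factor 0 1) 4, Poly_Mapping.single (Factor 0 2) 2, v0 3}"

lemma D1s_bounds:
  assumes "p \<in> D1s"
  shows "p \<noteq> 0 \<Longrightarrow> dg p \<ge> 4" "p \<notin> S1 \<Longrightarrow> dg p \<ge> 8"
proof -
  have p: "p \<in> M0" "4 dvd ex0 (Suc 0) p" "even (ex0 2 p)" using assms by (auto simp: D1s_def)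
  obtain r where r: "p = Poly_Mapping.single (Factor 0 1) (ex0 (Suc 0) p) + Poly_Mapping.single (Factor 0 2) (ex0 2 p)
      + Poly_Mapping.single (Factor 0 3) (ex0 3 p) + r"
    "dg p = int (ex0 (Suc 0) p) + 3 * int (ex0 2 p) + 7 * int (ex0 3 p) + dg r" "r = 0 \<or> dg r \<ge> 15"
    using dg_split[OF p(1)] by blast
  obtain a b where ab: "ex0 (Suc 0) p = 4 * a" "ex0 2 p = 2 * b" using p by (auto elim!: dvdE)
  have r0: "r = 0" if "dg p < 8" using r(2,3) that by linarith
  have dp: "dg p = int (4 * a) + 3 * int (2 * b) + 7 * int (ex0 3 p)" if "dg p < 8"
    using r(2) r0[OF that] ab by simp
  show "p \<notin> S1 \<Longrightarrow> dg p \<ge> 8"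
  proof (rule ccontr)
    assume *: "p \<notin> S1" "\<not> dg p \<ge> 8"
    then have "int (4 * a) + 3 * int (2 * b) + 7 * int (ex0 3 p) < 8" using dp by simp
    then have "(a, b, ex0 3 p) \<in> {(0,0,0), (1,0,0), (0,1,0), (0,0,1)}"
      by (cases a; cases b; cases "ex0 3 p") auto
    then have "p \<in> S1" using r(1) ab r0 *(2) by (auto simp: S1_def)
    then show False using * by simp
  qed
  show "p \<noteq> 0 \<Longrightarrow> dg p \<ge> 4"
  proof (rule ccontr)
    assume *: "p \<noteq> 0" "\<not> dg p \<ge> 4"
    then have "int (4 * a) + 3 * int (2 * b) + 7 * int (ex0 3 p) < 4" using dp by simp
    then have "a = 0" "b = 0" "ex0 3 p = 0" by linarith+
    then show False using r(1) ab r0 * by auto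
  qed
qed

text \<open>The pair \<open>(a, b)\<close> corresponds to \<open>a + \<xi>\<^sub>1 b\<close>, as \<open>D1 A0\<close> is the tensor product of \<open>D1\<close> with the Moore comodule.\<close>

lemma exact_D1A0:
  assumes "exact dA (KA KD1) f t"
  shows "exact dd (CK (D1s \<oplus> A0)) f t"
proof -
  have split: "\<exists>a\<in>KD1 f t. \<exists>b\<in>KD1 f (t - 1). z = a + xx * b" if "z \<in> CK (D1s \<oplus> A0) f t" for z
    using that unfolding CK_def
  proof (induction z rule: sp_induct)
    case zero
    have "0 \<in> KD1 f t" "0 \<in> KD1 f (t - 1)" by (simp_all add: KD1_def KG_def)
    moreover have "0 = 0 + xx * 0" by simp
    ultimately show ?case by blast
  next
    case (mo m)
    have 0: "0 \<in> KD1 f t" "0 \<in> KD1 f (t - 1)" by (simp_all add: KD1_def KG_def)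
    obtain d e where de: "part0 m = d + e" "d \<in> D1s" "e \<in> A0" using mo by (auto simp: splus_def)
    show ?case
    proof (cases "e = 0")
      case True
      then have "mo m \<in> CK D1s f t" using mo de by (simp add: CK_def)
      then show ?thesis using 0 by (intro bexI[of _ "mo m"] bexI[of _ 0]) (auto simp: CK_D1s)
    next
      case False
      then have e: "e = v0 1" using de by (simp add: A0_def)
      have dM: "d \<in> M0" using de by (simp add: D1s_def)
      have m: "m = v0 1 + (d + part1 m)" using part_sum[of m] de e by (metis add.assoc add.commute)
      have "d + part1 m \<in> cmons cl (Suc f) (t - 1)"
      proof -
        have "dg m = 1 + dg (d + part1 m)" by (subst m) (simp add: mdegree_add mdegree_single)
        moreover have "keys (d + part1 m) \<subseteq> keys m" by (subst (2) m) (auto simp: keys_add_mon)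
        ultimately show ?thesis using mo by (auto simp: cmons_def)
      qed
      then have "mo (d + part1 m) \<in> CK D1s f (t - 1)" using dM de by (simp add: CK_def part0_add)
      moreover have "mo m = 0 + xx * mo (d + part1 m)"
        by (subst m) (simp add: mo_mult[symmetric] mo_v0[simplified] mult.assoc)
      ultimately show ?thesis using 0 unfolding CK_D1s by blast
    qed
  next
    case (add p q)
    then obtain a b a' b' where "a \<in> KD1 f t" "b \<in> KD1 f (t - 1)" "p = a + xx * b"
      "a' \<in> KD1 f t" "b' \<in> KD1 f (t - 1)" "q = a' + xx * b'" by blast
    then show ?case
      by (intro bexI[of _ "a + a'"] bexI[of _ "b + b'"])
        (auto simp: KD1_def KG_add Sq1_add Sq2_add algebra_simps)
  qed
  have join: "a + xx * b \<in> CK (D1s \<oplus> A0) f' t" if "a \<in> KD1 f' t" "b \<in> KD1 f' (t - 1)" for a b f'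
  proof -
    have a: "a \<in> CK D1s f' t" "b \<in> CK D1s f' (t - 1)" using that by (simp_all only: CK_D1s)
    have "a \<in> CS (D1s \<oplus> A0)"
      by (rule CS_mono[of _ D1s]) (use a sub_splus in \<open>auto simp: CK_KG\<close>)
    moreover have "xx * b \<in> CS (D1s \<oplus> A0)"
      by (rule CS_mult[of _ "{v0 1}" _ D1s])
        (use a in \<open>auto simp: CK_KG splus_def A0_def add.commute intro!: pvar_CS1\<close>)
    moreover have "xx * b \<in> KG f' t" "a \<in> KG f' t" using that by (auto simp: KD1_def KG_def cc_xx)
    ultimately show ?thesis by (simp add: CK_KG KG_add CS_add)
  qed
  have d0: "dA f (a, b) = 0" if "Sq1 a = 0" "Sq1 b = 0" "dd f (a + xx * b) = 0" for a b
  proof -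
    have e: "(dd f a + tau b) + xx * dd f b = 0" using that(3) by (simp add: dd_add dd_xx add_ac)
    have "Sq1 (dd f a + tau b) = 0" "Sq1 (dd f b) = 0" using that by (simp_all add: Sq1_add Sq_dd Sq_tau)
    then have "Sq1 ((dd f a + tau b) + xx * dd f b) = dd f b" by (simp only: Sq_expand) simp
    then have "dd f b = 0" using e by (metis Sq_0(1))
    then show ?thesis using e by (simp add: zero_prod_def)
  qed
  show ?thesis
  proof (cases f)
    case 0
    have "z = 0" if z: "z \<in> CK (D1s \<oplus> A0) 0 t" "dd 0 z = 0" for z
    proof -
      obtain a b where ab: "a \<in> KD1 0 t" "b \<in> KD1 0 (t - 1)" "z = a + xx * b"
        using split z 0 by blast
      then have "dA 0 (a, b) = 0" using d0[of a b] z 0 by (simp add: KD1_def)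
      then have "(a, b) = 0" using assms ab unfolding 0 rel_exact_0 KA_def by blast
      then show ?thesis using ab by (simp add: zero_prod_def)
    qed
    then show ?thesis using 0 by (simp add: rel_exact_0)
  next
    case (Suc g)
    have "\<exists>y\<in>CK (D1s \<oplus> A0) g t. z - dd g y = 0"
      if z: "z \<in> CK (D1s \<oplus> A0) (Suc g) t" "dd (Suc g) z = 0" for z
    proof -
      obtain a b where ab: "a \<in> KD1 (Suc g) t" "b \<in> KD1 (Suc g) (t - 1)" "z = a + xx * b"
        using split z Suc by blast
      have "(a, b) \<in> KA KD1 (Suc g) t" "dA (Suc g) (a, b) = 0"
        using ab d0[of a b] z Suc by (auto simp: KA_def KD1_def)
      then obtain p where p: "p \<in> KA KD1 g t" "(a, b) = dA g p"
        using exact_SucD[OF assms[unfolded Suc]] by blast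
      obtain a' b' where ab': "p = (a', b')" "a' \<in> KD1 g t" "b' \<in> KD1 g (t - 1)"
        using p(1) by (auto simp: KA_def)
      have "a = dd g a' + tau b'" "b = dd g b'" using p(2) ab'(1) by simp_all
      then have "z = dd g (a' + xx * b')" using ab(3) by (simp add: dd_add dd_xx add_ac)
      then show ?thesis using join[OF ab'(2,3)] by (intro bexI[of _ "a' + xx * b'"]) auto
    qed
    then show ?thesis using Suc by (simp add: rel_exact_Suc)
  qed
qed

lemma exact_sub_CK:
  assumes "S \<subseteq> S'" "exact dd (CK S') f t" "f \<ge> 1 \<Longrightarrow> rel_exact dd (CK S) (CK S') (f - 1) t"
  shows "exact dd (CK S) f t"
proof (rule rel_exact_sub[OF additive_dd dd_dd _ _ _ assms(2,3)])
  show "{0} \<subseteq> CK S f' t" for f' by (simp add: CK_def)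
  show "CK S f' t \<subseteq> CK S' f' t" for f' using assms(1) by (rule CK_mono)
  show "y - y' \<in> CK S f' t" if "y \<in> CK S f' t" "y' \<in> CK S f' t" for f' y y'
    using CK_add[OF that] by simp
qed

lemma splus_0 [simp]: "{0} \<oplus> S = S"
  by (auto simp: splus_def)

lemma HZA0_zero: "b \<in> HZ \<oplus> A0 \<Longrightarrow> ex0 (Suc 0) b < 4 \<and> ex0 2 b < 2
    \<and> (\<forall>v. v \<noteq> Factor 0 (Suc 0) \<longrightarrow> v \<noteq> Factor 0 2 \<longrightarrow> lookup b v = 0)"
  unfolding mem_HZA0 by (auto simp: lookup_add lookup_single when_def)

lemma D1s_unique:
  assumes "p \<in> D1s" "p' \<in> D1s" "b \<in> HZ \<oplus> A0" "b' \<in> HZ \<oplus> A0" "p + b = p' + b'"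
  shows "p = p'"
proof -
  note bb = HZA0_zero[OF assms(3)] HZA0_zero[OF assms(4)]
  have eq: "lookup p v + lookup b v = lookup p' v + lookup b' v" for v
    using assms(5) by (metis lookup_add)
  have "4 dvd ex0 (Suc 0) p" "4 dvd ex0 (Suc 0) p'" "even (ex0 2 p)" "even (ex0 2 p')"
    using assms by (auto simp: D1s_def)
  then obtain i j k l where "ex0 (Suc 0) p = 4 * i" "ex0 (Suc 0) p' = 4 * j" "ex0 2 p = 2 * k" "ex0 2 p' = 2 * l"
    by (auto elim!: dvdE)
  moreover have "ex0 (Suc 0) b < 4" "ex0 (Suc 0) b' < 4" "ex0 2 b < 2" "ex0 2 b' < 2" using bb by auto
  moreover note eq[of "Factor 0 (Suc 0)"] eq[of "Factor 0 2"]
  ultimately have "ex0 (Suc 0) p = ex0 (Suc 0) p' \<and> ex0 2 p = ex0 2 p'"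
    by (intro conjI; presburger)
  then have 1: "ex0 (Suc 0) p = ex0 (Suc 0) p'" "ex0 2 p = ex0 2 p'" by auto
  show ?thesis
  proof (rule poly_mapping_eqI)
    fix v show "lookup p v = lookup p' v"
      using 1 eq[of v] bb by (cases "v = Factor 0 (Suc 0)"; cases "v = Factor 0 2") auto
  qed
qed

lemma closed_HZA0: "closed (HZ \<oplus> A0)" and closed_D1A0: "closed (D1s \<oplus> A0)"
  and closed_D1HZA0: "closed (D1s \<oplus> (HZ \<oplus> A0))"
  by (intro closed_splus closed_HZ closed_A0 closed_D1s)+

text \<open>\<open>\<Gamma>\<close> modulo \<open>D1 HZ A0\<close> is a shifted copy of \<open>D1 A0\<close>, generated by \<open>\<xi>\<^sub>1\<^sup>2 \<xi>\<^sub>2\<close>.\<close>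

lemma rel_exact_top_cell:
  assumes "exact dd (CK (D1s \<oplus> A0)) f (t - 5)"
  shows "rel_exact dd (CK (D1s \<oplus> (HZ \<oplus> A0))) (CK M0) f t"
proof -
  let ?p = "v0 1 + v0 1 + v0 2 :: cmon"
  have pM: "?p \<in> M0" by simp
  have mop: "mo ?p = xx ^ 2 * yy"
    unfolding mo_mult[symmetric] mo_v0 power2_eq_square by simp
  have "CF cl (Suc 0) (mo ?p) = (xx ^ 2 + x1 ^ 2) * (yy + xx ^ 2 * x1 + y1)"
    by (simp only: mop psubst_mult psubst_power CF1_gen fpoly_square_add)
  also have "\<dots> = xx ^ 2 * yy + (xx ^ 4 * x1 + xx ^ 2 * y1 + yy * x1 ^ 2 + xx ^ 2 * (x1 ^ 2 * x1) + 1 * (x1 ^ 2 * y1))"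
    by (simp add: algebra_simps power2_eq_square power4_eq_xxxx)
  finally have F: "CF cl (Suc 0) (mo ?p)
      = xx ^ 2 * yy + (xx ^ 4 * x1 + xx ^ 2 * y1 + yy * x1 ^ 2 + xx ^ 2 * (x1 ^ 2 * x1) + 1 * (x1 ^ 2 * y1))" .
  have CFp: "CF cl (Suc 0) (mo ?p) + mo ?p
      = xx ^ 4 * x1 + xx ^ 2 * y1 + yy * x1 ^ 2 + xx ^ 2 * (x1 ^ 2 * x1) + 1 * (x1 ^ 2 * y1)"
    by (subst F, subst mop) (simp add: add_ac)
  let ?T = "{Poly_Mapping.single (Factor 0 1) 4, Poly_Mapping.single (Factor 0 1) 2, v0 2, 0} :: cmon set"
  have x: "xx ^ 4 \<in> CS ?T" "xx ^ 2 \<in> CS ?T" "yy \<in> CS ?T" "1 \<in> CS ?T"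
    using CS_mono[OF pvar_CS[of 1 4], of ?T] CS_mono[OF pvar_CS[of 1 2], of ?T] CS_mono[OF CS_1, of ?T]
    by (auto intro!: pvar_CS1)
  have T: "CF cl (Suc 0) (mo ?p) + mo ?p \<in> CS ?T"
    unfolding CFp by (intro CS_add CS_mult_unit x unit_gen CS_power)
  have eq: "M0 = D1s \<oplus> (HZ \<oplus> A0) \<union> (\<lambda>b. ?p + b) ` (D1s \<oplus> A0)"
  proof (intro equalityI subsetI)
    fix m assume m: "m \<in> M0"
    show "m \<in> D1s \<oplus> (HZ \<oplus> A0) \<union> (\<lambda>b. ?p + b) ` (D1s \<oplus> A0)"
    proof (cases "m \<in> D1s \<oplus> (HZ \<oplus> A0)")
      case False
      then have o: "odd (ex0 2 m)" "ex0 (Suc 0) m mod 4 \<ge> 2" using m mem_D1HZA0 by auto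
      then have le: "ex0 2 m \<ge> 1" "ex0 (Suc 0) m \<ge> 2"
        by (auto elim: oddE)
      define b where "b = m - ?p"
      have b: "m = ?p + b"
        using le by (intro poly_mapping_eqI) (auto simp: b_def lookup_add lookup_minus lookup_single when_def)
      have "ex0 2 m = Suc (ex0 2 b)" "ex0 (Suc 0) m = Suc (Suc (ex0 (Suc 0) b))"
        by (subst b, simp add: lookup_add lookup_single when_def)+
      then have "even (ex0 2 b)" "ex0 (Suc 0) b mod 4 \<le> 1" using o by (auto, presburger)
      moreover have "b \<in> M0" using m b by simp
      ultimately have "b \<in> D1s \<oplus> A0" by (simp add: mem_D1A0)
      then show ?thesis using b by blast
    qed simp
  next
    fix m assume "m \<in> D1s \<oplus> (HZ \<oplus> A0) \<union> (\<lambda>b. ?p + b) ` (D1s \<oplus> A0)"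
    then show "m \<in> M0" by (auto simp: mem_D1HZA0 mem_D1A0)
  qed
  have "rel_exact dd (CK (D1s \<oplus> (HZ \<oplus> A0))) (CK (D1s \<oplus> (HZ \<oplus> A0) \<union> (\<lambda>b. ?p + b) ` (D1s \<oplus> A0))) f t"
  proof (rule rel_exact_one_cell[where N = 5])
    show "?p + b \<in> M0 - (D1s \<oplus> (HZ \<oplus> A0))" if "b \<in> D1s \<oplus> A0" for b
    proof -
      have "odd (ex0 2 (?p + b))" "ex0 (Suc 0) (?p + b) mod 4 \<ge> 2"
        using that unfolding mem_D1A0 by (auto simp: lookup_add lookup_single when_def mod_Suc)
      then show ?thesis using that by (auto simp: mem_D1HZA0 mem_D1A0)
    qed
    show "CF cl 1 (mo (?p + b)) + relabel (\<lambda>b. ?p + b) (CF cl 1 (mo b)) \<in> CS (D1s \<oplus> (HZ \<oplus> A0))"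
      if b: "b \<in> D1s \<oplus> A0" for b
    proof -
      have "CF cl 1 (mo (?p + b)) + relabel (\<lambda>b. ?p + b) (CF cl 1 (mo b))
          = (CF cl 1 (mo ?p) + mo ?p) * CF cl 1 (mo b)"
        unfolding relabel_shift[OF pM] mo_mult[symmetric, of ?p b] psubst_mult distrib_right ..
      moreover have "\<dots> \<in> CS (D1s \<oplus> (HZ \<oplus> A0))"
      proof (rule CS_mult[of _ ?T _ "D1s \<oplus> A0"])
        show "CF cl 1 (mo ?p) + mo ?p \<in> CS ?T" using T by simp
        show "CF cl 1 (mo b) \<in> CS (D1s \<oplus> A0)" using closed_D1A0 b by (simp add: closed_def)
        show "s + u \<in> D1s \<oplus> (HZ \<oplus> A0)" if "s \<in> ?T" "u \<in> D1s \<oplus> A0" for s u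
          using that unfolding mem_D1HZA0 mem_D1A0
          by (auto simp: lookup_add lookup_single when_def mod_Suc)
      qed
      ultimately show ?thesis by simp
    qed
    show "dg (?p + b) = dg b + 5" for b by (simp add: mdegree_add mdegree_single)
  qed (use assms closed_D1HZA0 closed_D1A0 in \<open>auto simp: inj_on_def\<close>)
  then show ?thesis by (simp only: eq[symmetric])
qed

text \<open>\<open>\<Gamma>\<close> is acyclic and \<open>\<Gamma> / D1 HZ A0\<close> is a copy of \<open>D1 A0\<close> shifted by \<open>5\<close>.  Moreover \<open>D1 HZ A0\<close> is built from
  \<open>HZ A0\<close> by attaching \<open>p HZ A0\<close> for the other monomials \<open>p\<close> of \<open>D1\<close>, which have degree at least \<open>4\<close>.\<close>

lemma EZ_step:
  assumes "f \<ge> 1 \<or> t \<noteq> 0" "f \<ge> 1 \<Longrightarrow> exact dA (KA KD1) (f - 1) (t - 5)"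
    "\<And>n. f \<ge> 1 \<Longrightarrow> n \<ge> 4 \<Longrightarrow> exact dd (CK (HZ \<oplus> A0)) (f - 1) (t - n)"
  shows "exact dd (CK (HZ \<oplus> A0)) f t"
proof (rule exact_sub_CK)
  show "HZ \<oplus> A0 \<subseteq> D1s \<oplus> (HZ \<oplus> A0)" by (rule sub_splus) simp
  show "exact dd (CK (D1s \<oplus> (HZ \<oplus> A0))) f t"
  proof (rule exact_sub_CK[of _ M0])
    show "D1s \<oplus> (HZ \<oplus> A0) \<subseteq> M0" by (auto simp: mem_D1HZA0)
    have "CK M0 = KG" by (simp add: fun_eq_iff CK_M0)
    then show "exact dd (CK M0) f t" using exact_KG assms(1) by simp
  qed (use assms(2) in \<open>auto intro!: rel_exact_top_cell exact_D1A0\<close>)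
  have "rel_exact dd (CK ({0} \<oplus> (HZ \<oplus> A0))) (CK (D1s \<oplus> (HZ \<oplus> A0))) (f - 1) t" if "f \<ge> 1"
  proof (rule rel_exact_mult_cells[OF closed_D1s closed_HZA0])
    show "exact dd (CK (HZ \<oplus> A0)) (f - 1) (t - dg p)" if "p \<in> D1s - {0}" for p
      using that D1s_bounds(1)[of p] by (intro assms(3) \<open>f \<ge> 1\<close>) auto
  qed (use closed_HZA0 in \<open>auto intro: D1s_unique\<close>)
  then show "f \<ge> 1 \<Longrightarrow> rel_exact dd (CK (HZ \<oplus> A0)) (CK (D1s \<oplus> (HZ \<oplus> A0))) (f - 1) t" by simp
qed

lemma EZ_line: "t < 3 * int f \<Longrightarrow> exact dd (CK (HZ \<oplus> A0)) f t"
proof (induction f arbitrary: t)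
  case 0
  then show ?case by - (rule EZ_step; simp)
next
  case (Suc f)
  show ?case
  proof (rule EZ_step)
    show "exact dA (KA KD1) (Suc f - 1) (t - 5)" using Suc.prems by (intro exact_KA_KD1_line) simp
    show "exact dd (CK (HZ \<oplus> A0)) (Suc f - 1) (t - n)" if "n \<ge> 4" for n
      using Suc.IH[of "t - n"] Suc.prems that by simp
  qed simp
qed

text \<open>One bidegree on the line itself, required for \<open>E_3\<close> in degree \<open>10\<close>.\<close>

lemma EZ_2_6: "exact dd (CK (HZ \<oplus> A0)) 2 6"
proof (rule EZ_step)
  show "exact dA (KA KD1) (2 - 1) (6 - 5)" by (rule exact_KA_KD1) auto
  show "exact dd (CK (HZ \<oplus> A0)) (2 - 1) (6 - n)" if "n \<ge> 4" for n
    using that by (intro EZ_line) simp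
qed simp

lemma v0_nonzero [simp]: "Poly_Mapping.single (Factor 0 n) (Suc 0) \<noteq> (0 :: cmon)"
  by (metis lookup_single_eq lookup_zero nat.simps(3))

lemma dg_S1: "p \<in> S1 \<Longrightarrow> p \<in> D1s"
  by (auto simp: S1_def D1s_def lookup_single when_def)

lemma mo_4X: "mo (Poly_Mapping.single (Factor 0 1) 4) = xx ^ 4"
  and mo_2Y: "mo (Poly_Mapping.single (Factor 0 2) 2) = yy ^ 2"
  by (simp_all only: mo_single One_nat_def)

lemma CF1_S1: "CF cl (Suc 0) (xx ^ 4) = xx ^ 4 + x1 ^ 4"
  "CF cl (Suc 0) (yy ^ 2) = yy ^ 2 + xx ^ 4 * x1 ^ 2 + y1 ^ 2"
proof -
  have 4: "p ^ 4 = (p ^ 2) ^ 2" for p :: "(unit, nat) tvar fpoly" by simp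
  show "CF cl (Suc 0) (xx ^ 4) = xx ^ 4 + x1 ^ 4"
    by (simp only: psubst_power CF1_gen 4 fpoly_square_add)
  show "CF cl (Suc 0) (yy ^ 2) = yy ^ 2 + xx ^ 4 * x1 ^ 2 + y1 ^ 2"
    by (simp add: psubst_power CF1_gen fpoly_square_add power_mult_distrib)
qed

lemma closed_S1: "closed S1"
proof -
  have x4: "xx ^ 4 \<in> CS S1" unfolding mo_4X[symmetric] CS_mo by (simp add: S1_def)
  have y2: "yy ^ 2 \<in> CS S1" unfolding mo_2Y[symmetric] CS_mo by (simp add: S1_def)
  have u: "q \<in> CS S1" if "q \<in> CS {0}" for q using CS_mono[OF that] by (simp add: S1_def)
  have z: "zz \<in> CS S1" by (rule pvar_CS1) (simp_all add: S1_def)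
  have "CF cl (Suc 0) (mo (Poly_Mapping.single (Factor 0 1) 4)) \<in> CS S1"
    unfolding mo_4X CF1_S1 by (intro CS_add x4 u CS_power unit_gen)
  moreover have "CF cl (Suc 0) (mo (Poly_Mapping.single (Factor 0 2) 2)) \<in> CS S1"
    unfolding mo_2Y CF1_S1 by (intro CS_add CS_mult_unit x4 y2 u CS_power unit_gen)
  moreover have "CF cl (Suc 0) (mo (v0 3)) \<in> CS S1"
    unfolding mo_v0 CF1_gen by (intro CS_add CS_mult_unit x4 y2 z u CS_power unit_gen)
  moreover have "CF cl (Suc 0) (mo 0) \<in> CS S1" using u[OF CS_1] by simp
  ultimately show ?thesis using dg_S1 by (auto simp: closed_def S1_def D1s_def)
qed

text \<open>\<open>{\<xi>\<^sub>1\<^sup>4, \<xi>\<^sub>2\<^sup>2, \<xi>\<^sub>3}\<close> is a shifted copy of \<open>HZ = {1, \<xi>\<^sub>1\<^sup>2, \<xi>\<^sub>2}\<close> modulo the unit.\<close>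

definition \<phi>HZ :: "cmon \<Rightarrow> cmon" where
  "\<phi>HZ m = (if ex0 2 m = 1 then v0 3 else if ex0 (Suc 0) m \<ge> 2 then Poly_Mapping.single (Factor 0 2) 2
     else Poly_Mapping.single (Factor 0 1) 4) + (if odd (ex0 (Suc 0) m) then v0 1 else 0)"

lemma \<phi>HZ_simps:
  "\<phi>HZ 0 = Poly_Mapping.single (Factor 0 1) 4"
  "\<phi>HZ (v0 1) = Poly_Mapping.single (Factor 0 1) 4 + v0 1"
  "\<phi>HZ (v0 1 + v0 1) = Poly_Mapping.single (Factor 0 2) 2"
  "\<phi>HZ (v0 1 + v0 1 + v0 1) = Poly_Mapping.single (Factor 0 2) 2 + v0 1"
  "\<phi>HZ (v0 2) = v0 3" "\<phi>HZ (v0 2 + v0 1) = v0 3 + v0 1"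
  by (auto simp: \<phi>HZ_def lookup_add lookup_single when_def)

lemma rel_exact_S1A0:
  assumes "exact dd (CK (HZ \<oplus> A0)) f (t - 4)"
  shows "rel_exact dd (CK A0) (CK (S1 \<oplus> A0)) f t"
proof -
  have HZA: "HZ \<oplus> A0 = {0, v0 1, v0 1 + v0 1, v0 1 + v0 1 + v0 1, v0 2, v0 2 + v0 1}"
    using mem_HZA0 by blast
  have S1A: "S1 \<oplus> A0 = A0 \<union> \<phi>HZ ` (HZ \<oplus> A0)"
  proof -
    have "x \<in> S1 \<oplus> A0 \<longleftrightarrow> (\<exists>s\<in>S1. \<exists>e\<in>A0. x = s + e)" for x by (auto simp: splus_def)
    then have "S1 \<oplus> A0 = (\<Union>s\<in>S1. {s + 0, s + v0 1})" by (simp add: set_eq_iff A0_def)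
    also have "\<dots> = A0 \<union> \<phi>HZ ` (HZ \<oplus> A0)"
      unfolding HZA image_insert image_empty \<phi>HZ_simps by (auto simp: S1_def A0_def)
    finally show ?thesis .
  qed
  have h1: "CF cl (Suc 0) (mo (\<phi>HZ c)) + relabel \<phi>HZ (CF cl (Suc 0) (mo c)) \<in> CS {0}"
    and CFc: "CF cl (Suc 0) (mo c) \<in> CS HZ" if "c \<in> HZ" for c
  proof -
    have r1: "relabel \<phi>HZ 1 = xx ^ 4"
      using relabel_M0[of 0 \<phi>HZ] \<phi>HZ_simps(1) mo_4X by simp
    have r2: "relabel \<phi>HZ (xx ^ 2) = yy ^ 2"
      using relabel_M0[of "v0 1 + v0 1" \<phi>HZ]
      by (simp only: \<phi>HZ_simps mo_XX mo_2Y M0_add M0_v0 le_refl simp_thms)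
    have r3: "relabel \<phi>HZ yy = zz"
      using relabel_M0[of "v0 2" \<phi>HZ] by (simp only: \<phi>HZ_simps mo_v0 M0_v0 one_le_numeral)
    have ru: "relabel \<phi>HZ q = xx ^ 4 * q" if "q \<in> CS {0}" for q
      using relabel_mult_unit[OF that, of \<phi>HZ 1] r1 by simp
    have "c = 0 \<or> c = v0 1 + v0 1 \<or> c = v0 2" using that unfolding HZ_def by blast
    then consider "c = 0" | "c = v0 1 + v0 1" | "c = v0 2" by blast
    then show "CF cl (Suc 0) (mo (\<phi>HZ c)) + relabel \<phi>HZ (CF cl (Suc 0) (mo c)) \<in> CS {0}"
    proof cases
      case 1
      have "CF cl (Suc 0) (mo (\<phi>HZ c)) + relabel \<phi>HZ (CF cl (Suc 0) (mo c)) = x1 ^ 4"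
        unfolding 1 \<phi>HZ_simps mo_4X CF1_S1 by (simp add: r1 add_ac)
      then show ?thesis by (simp add: CS_power)
    next
      case 2
      have "relabel \<phi>HZ (CF cl (Suc 0) (mo c)) = yy ^ 2 + xx ^ 4 * x1 ^ 2"
        unfolding 2 mo_XX psubst_power CF1_gen fpoly_square_add relabel_add r2
        by (simp add: ru CS_power)
      moreover have "CF cl (Suc 0) (mo (\<phi>HZ c)) = yy ^ 2 + xx ^ 4 * x1 ^ 2 + y1 ^ 2"
        unfolding 2 \<phi>HZ_simps mo_2Y CF1_S1 ..
      ultimately have "CF cl (Suc 0) (mo (\<phi>HZ c)) + relabel \<phi>HZ (CF cl (Suc 0) (mo c)) = y1 ^ 2"
        by (simp add: add_ac)
      then show ?thesis by (simp add: CS_power)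
    next
      case 3
      have "relabel \<phi>HZ (CF cl (Suc 0) (mo c)) = zz + yy ^ 2 * x1 + xx ^ 4 * y1"
        unfolding 3 mo_v0 CF1_gen relabel_add r3 relabel_mult_unit[OF unit_gen(1)] r2
        by (simp add: ru)
      moreover have "CF cl (Suc 0) (mo (\<phi>HZ c)) = zz + yy ^ 2 * x1 + xx ^ 4 * y1 + z1"
        unfolding 3 \<phi>HZ_simps mo_v0 CF1_gen ..
      ultimately have "CF cl (Suc 0) (mo (\<phi>HZ c)) + relabel \<phi>HZ (CF cl (Suc 0) (mo c)) = z1"
        by (simp add: add_ac)
      then show ?thesis by simp
    qed
    show "CF cl (Suc 0) (mo c) \<in> CS HZ" using closed_HZ that by (simp add: closed_def)
  qed
  have rx: "relabel \<phi>HZ (q * xx) = relabel \<phi>HZ q * xx" if "q \<in> CS HZ" for q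
    using that unfolding CS_def
  proof (induction q rule: sp_induct)
    case (mo m)
    have x: "xx = mo (v0 1)" using mo_v0[of 1] by simp
    have p: "part0 (m + v0 1) = part0 m + v0 1" "part1 (m + v0 1) = part1 m"
      by (simp_all add: part0_add part1_add)
    have "\<phi>HZ (part0 m + v0 1) = \<phi>HZ (part0 m) + v0 1"
    proof -
      have "part0 m = 0 \<or> part0 m = v0 1 + v0 1 \<or> part0 m = v0 2" using mo by (simp add: HZ_def)
      then show ?thesis using \<phi>HZ_simps by (elim disjE) (simp_all only: add_0_left add_0_right)
    qed
    then show ?case unfolding x mo_mult relabel_def lin_mo p by (simp only: mo_mult add_ac)
  qed (auto simp: relabel_add distrib_right additive_0[OF relabel_additive])
  have "rel_exact dd (CK A0) (CK (A0 \<union> \<phi>HZ ` (HZ \<oplus> A0))) f t"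
  proof (rule rel_exact_one_cell[where N = 4])
    show "\<phi>HZ b \<in> M0 - A0" if "b \<in> HZ \<oplus> A0" for b
    proof -
      have "\<phi>HZ b \<in> M0" using that unfolding HZA by (elim insertE) (simp_all only: \<phi>HZ_simps M0_add single_M0 M0_v0 le_refl one_le_numeral simp_thms empty_iff)
      moreover have "dg (\<phi>HZ b) \<ge> 4" using that unfolding HZA
        by (elim insertE) (simp_all only: \<phi>HZ_simps mdegree_add mdegree_single, simp_all)
      moreover have "dg a < 4" if "a \<in> A0" for a using that by (auto simp: A0_def mdegree_single)
      ultimately show ?thesis by fastforce
    qed
    show "dg (\<phi>HZ b) = dg b + 4" if "b \<in> HZ \<oplus> A0" for b
      using that unfolding HZA
      by (elim insertE) (simp_all only: \<phi>HZ_simps mdegree_add mdegree_single, simp_all)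
    show "inj_on \<phi>HZ (HZ \<oplus> A0)"
    proof (rule inj_onI)
      fix b b' assume b: "b \<in> HZ \<oplus> A0" "b' \<in> HZ \<oplus> A0" "\<phi>HZ b = \<phi>HZ b'"
      have *: "ex0 (Suc 0) (\<phi>HZ b) = ex0 (Suc 0) (\<phi>HZ b')" "ex0 2 (\<phi>HZ b) = ex0 2 (\<phi>HZ b')"
        "ex0 3 (\<phi>HZ b) = ex0 3 (\<phi>HZ b')" using b(3) by simp_all
      from b(1,2) * show "b = b'" unfolding HZA
        by (elim insertE; simp only: \<phi>HZ_simps lookup_add lookup_single when_def) auto
    qed
    show "CF cl 1 (mo (\<phi>HZ b)) + relabel \<phi>HZ (CF cl 1 (mo b)) \<in> CS A0" if "b \<in> HZ \<oplus> A0" for b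
    proof -
      obtain c e where ce: "b = c + e" "c \<in> HZ" "e \<in> A0" using \<open>b \<in> HZ \<oplus> A0\<close> by (auto simp: splus_def)
      have e: "e = 0 \<or> e = v0 1" using ce(3) by (simp add: A0_def)
      have ph: "\<phi>HZ b = \<phi>HZ c + e"
      proof -
        have "c = 0 \<or> c = v0 1 + v0 1 \<or> c = v0 2" using ce(2) by (simp add: HZ_def)
        then show ?thesis using e \<phi>HZ_simps unfolding ce(1)
          by (elim disjE) (simp_all only: add_0_left add_0_right)
      qed
      have re: "relabel \<phi>HZ (q * CF cl 1 (mo e)) = relabel \<phi>HZ q * CF cl 1 (mo e)" if "q \<in> CS HZ" for q
        using e
      proof
        assume "e = v0 1"
        then have "CF cl 1 (mo e) = xx + x1" using CF1_gen(1) mo_v0[of 1] by simp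
        then show ?thesis
          by (simp only: distrib_left relabel_add rx[OF that] relabel_mult_unit[OF unit_gen(1)])
      qed simp
      have "CF cl 1 (mo (\<phi>HZ b)) + relabel \<phi>HZ (CF cl 1 (mo b))
          = (CF cl 1 (mo (\<phi>HZ c)) + relabel \<phi>HZ (CF cl 1 (mo c))) * CF cl 1 (mo e)"
        unfolding ph unfolding ce(1) mo_mult[symmetric] psubst_mult
        using CFc[OF ce(2)] by (simp add: re[simplified] distrib_right)
      moreover have "\<dots> \<in> CS A0"
      proof (rule CS_mult)
        show "CF cl 1 (mo (\<phi>HZ c)) + relabel \<phi>HZ (CF cl 1 (mo c)) \<in> CS {0}" using h1[OF ce(2)] by simp
        show "CF cl 1 (mo e) \<in> CS A0" using closed_A0 ce(3) by (simp add: closed_def)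
      qed simp
      ultimately show ?thesis by simp
    qed
  qed (use assms closed_A0 closed_HZA0 in auto)
  then show ?thesis by (simp only: S1A)
qed

text \<open>\<open>D1 A0\<close> is built from \<open>A0\<close> by first attaching the part \<open>S1 A0\<close>, whose quotient by \<open>A0\<close> is a copy of \<open>HZ A0\<close>
  shifted by \<open>4\<close>, and then copies of \<open>A0\<close> in dimensions at least \<open>8\<close>.\<close>

lemma E_step:
  assumes "exact dA (KA KD1) f t" "f \<ge> 1 \<Longrightarrow> exact dd (CK (HZ \<oplus> A0)) (f - 1) (t - 4)"
    "\<And>n. f \<ge> 1 \<Longrightarrow> n \<ge> 8 \<Longrightarrow> exact dd (CK A0) (f - 1) (t - n)"
  shows "exact dd (CK A0) f t"
proof (rule exact_sub_CK)
  show "A0 \<subseteq> D1s \<oplus> A0" by (rule sub_splus) simp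
  show "exact dd (CK (D1s \<oplus> A0)) f t" using assms(1) by (rule exact_D1A0)
  show "rel_exact dd (CK A0) (CK (D1s \<oplus> A0)) (f - 1) t" if f: "f \<ge> 1"
  proof (rule rel_exact_trans[where d = dd and L = "CK A0" and M = "CK (S1 \<oplus> A0)" and K = "CK (D1s \<oplus> A0)"])
    show "rel_exact dd (CK A0) (CK (S1 \<oplus> A0)) (f - 1) t"
      using rel_exact_S1A0 assms(2) f by simp
    show "rel_exact dd (CK (S1 \<oplus> A0)) (CK (D1s \<oplus> A0)) (f - 1) t"
    proof (rule rel_exact_mult_cells[OF closed_D1s closed_A0])
      show "closed (S1 \<oplus> A0)" by (rule closed_splus[OF closed_S1 closed_A0])
      show "S1 \<subseteq> D1s" using dg_S1 by auto
      show "exact dd (CK A0) (f - 1) (t - dg p)" if "p \<in> D1s - S1" for p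
        using that D1s_bounds(2)[of p] by (intro assms(3) f) auto
      have sub: "A0 \<subseteq> HZ \<oplus> A0" by (rule sub_splus) simp
      show "p = p'" if "p \<in> D1s" "p' \<in> D1s" "b \<in> A0" "b' \<in> A0" "p + b = p' + b'" for p p' b b'
        using D1s_unique[OF that(1,2) subsetD[OF sub that(3)] subsetD[OF sub that(4)] that(5)] .
    qed
    show "CK A0 f' t \<subseteq> CK (S1 \<oplus> A0) f' t" for f'
      by (rule CK_mono, rule sub_splus) (simp add: S1_def)
    show "CK (S1 \<oplus> A0) f' t \<subseteq> CK (D1s \<oplus> A0) f' t" for f'
      by (rule CK_mono) (use dg_S1 in \<open>auto simp: splus_def\<close>)
  qed (simp_all add: additive_dd dd_dd CK_add)
qed

text \<open>In the range \<open>t \<le> 3 f\<close> all the attached cells lie in vanishing groups, so that Moore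
  coefficients give nothing more than over \<open>A(1)\<close>.\<close>

lemma E_line: "exact dA (KA KD1) f t \<Longrightarrow> t \<le> 3 * int f \<Longrightarrow> exact dd (CK A0) f t"
proof (induction f arbitrary: t)
  case 0
  then show ?case by - (rule E_step; simp)
next
  case (Suc f)
  show ?case
  proof (rule E_step)
    show "exact dd (CK (HZ \<oplus> A0)) (Suc f - 1) (t - 4)" using Suc.prems(2) by (intro EZ_line) simp
    show "exact dd (CK A0) (Suc f - 1) (t - n)" if "n \<ge> 8" for n
    proof -
      have "exact dA (KA KD1) f (t - n)" using Suc.prems(2) that by (intro exact_KA_KD1_line) simp
      then show ?thesis using Suc.IH[of "t - n"] Suc.prems(2) that by simp
    qed
  qed (rule Suc.prems(1))
qed

lemma E_3: "t \<le> 10 \<Longrightarrow> t \<noteq> 7 \<Longrightarrow> exact dd (CK A0) 3 t"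
proof -
  assume t: "t \<le> 10" "t \<noteq> 7"
  have G: "exact dA (KA KD1) 3 t" using t by - (rule exact_KA_KD1; auto)
  show ?thesis
  proof (cases "t = 10")
    case True
    show ?thesis
    proof (rule E_step[OF G])
      show "exact dd (CK (HZ \<oplus> A0)) (3 - 1) (t - 4)" using EZ_2_6 True by simp
      show "exact dd (CK A0) (3 - 1) (t - n)" if "n \<ge> 8" for n
      proof -
        have "exact dA (KA KD1) 2 (t - n)" using True that by (intro exact_KA_KD1_line) simp
        then show ?thesis using E_line[of 2 "t - n"] True that by simp
      qed
    qed
  next
    case False
    then show ?thesis using t G by (intro E_line) auto
  qed
qed

lemma E_4k: "t < 12 * int k \<Longrightarrow> exact dd (CK A0) (4 * k) t"
proof -
  assume "t < 12 * int k"
  then have "exact dA (KA KD1) (4 * k) t"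
  proof (induction k arbitrary: t)
    case 0
    then show ?case by - (rule exact_KA_KD1; auto)
  next
    case (Suc k)
    have "exact dA (KA KD1) (4 * Suc k - 4) (t - 12)" using Suc.IH[of "t - 12"] Suc.prems by simp
    then show ?case by - (rule exact_KA_KD1; auto)
  qed
  then show ?thesis using \<open>t < 12 * int k\<close> by (intro E_line) auto
qed


subsection \<open>The augmentation coideal of \<open>D\<close> is free over \<open>Sq1\<close> acting on the right\<close>

text \<open>\<open>D\<close> is built from the unit by Moore cells with bottom \<open>g \<xi>\<^sub>n\<^sup>2\<close> and top \<open>g \<xi>\<^sub>n\<^sub>+\<^sub>1\<close>, where \<open>g\<close> involves
  only variables from \<open>\<xi>\<^sub>n\<close> on and is even in \<open>\<xi>\<^sub>n\<close> and \<open>\<xi>\<^sub>n\<^sub>+\<^sub>1\<close>: this is the Koszul matching for the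
  derivation \<open>\<xi>\<^sub>n\<^sub>+\<^sub>1 \<mapsto> \<xi>\<^sub>n\<^sup>2\<close>.\<close>

definition Rn :: "nat \<Rightarrow> cmon set" where
  "Rn n = {g \<in> M0. (\<forall>j<n. ex0 j g = 0) \<and> even (ex0 n g) \<and> even (ex0 (Suc n) g)}"

definition Icell :: "(nat \<times> cmon) set" where
  "Icell = {(n, g). n \<ge> 1 \<and> g \<in> Rn n}"

definition \<phi>D :: "nat \<times> cmon \<Rightarrow> cmon \<Rightarrow> cmon" where
  "\<phi>D i b = (case i of (n, g) \<Rightarrow> if b = 0 then g + (v0 n + v0 n) else g + v0 (Suc n))"

definition ND :: "nat \<times> cmon \<Rightarrow> int" where
  "ND i = (case i of (n, g) \<Rightarrow> dg g + 2 ^ Suc n - 2)"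

lemma Rn_add: "g \<in> Rn n \<Longrightarrow> h \<in> Rn n \<Longrightarrow> g + h \<in> Rn n"
  by (auto simp: Rn_def lookup_add)

lemma v0_Rn: "j \<ge> n + 2 \<Longrightarrow> v0 j \<in> Rn n" "j \<ge> n \<Longrightarrow> j \<ge> 1 \<Longrightarrow> v0 j + v0 j \<in> Rn n"
  by (auto simp: Rn_def lookup_single when_def lookup_add M0_def keys_add_mon)

lemma Rn_induct [consumes 1, case_names zero single double]:
  assumes "m \<in> Rn n" and 0: "P 0"
    and 1: "\<And>j m. j \<ge> n + 2 \<Longrightarrow> m \<in> Rn n \<Longrightarrow> P m \<Longrightarrow> P (v0 j + m)"
    and 2: "\<And>j m. j \<ge> n \<Longrightarrow> j \<ge> 1 \<Longrightarrow> m \<in> Rn n \<Longrightarrow> P m \<Longrightarrow> P (v0 j + v0 j + m)"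
  shows "P m"
  using assms(1)
proof (induction "nat (dg m)" arbitrary: m rule: less_induct)
  case less
  have mM: "m \<in> M0" using less.prems by (simp add: Rn_def)
  show ?case
  proof (cases "m = 0")
    case False
    then obtain v where "v \<in> keys m" by fastforce
    then obtain j where j: "Factor 0 j \<in> keys m" "j \<ge> 1" using mM by (auto simp: M0_def)
    then have ej: "ex0 j m \<noteq> 0" by (simp add: in_keys_iff)
    then have jn: "j \<ge> n" using less.prems by (auto simp: Rn_def not_less[symmetric])
    have dgj: "(2::int) ^ j - 1 \<ge> 1" using j(2) power_increasing[of 1 j "2::int"] by simp
    show ?thesis
    proof (cases "j \<ge> n + 2")
      case True
      define m' where "m' = m - v0 j"
      have m: "m = v0 j + m'"
        using ej by (intro poly_mapping_eqI) (auto simp: m'_def lookup_add lookup_minus lookup_single when_def)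
      have m'M: "m' \<in> M0" using mM m by (metis M0_add)
      have "lookup m' (Factor 0 i) = ex0 i m" if "i \<noteq> j" for i
        using that by (simp add: m'_def lookup_minus lookup_single when_def)
      then have m': "m' \<in> Rn n" using less.prems m'M True by (auto simp: Rn_def)
      have "dg m = 2 ^ j - 1 + dg m'" by (subst m) (simp only: mdegree_add dg_v0)
      then have "nat (dg m') < nat (dg m)" using dgj dg_M0_nonneg[OF m'M] by simp
      then show ?thesis using 1[OF True m' less.hyps[OF _ m']] m by metis
    next
      case False
      then have jj: "j = n \<or> j = Suc n" using jn by auto
      then have "even (ex0 j m)" using less.prems by (auto simp: Rn_def)
      then have e2: "ex0 j m \<ge> 2" using ej by (auto elim: evenE)
      define m' where "m' = m - (v0 j + v0 j)"
      have m: "m = v0 j + v0 j + m'"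
        using e2 by (intro poly_mapping_eqI) (auto simp: m'_def lookup_add lookup_minus lookup_single when_def)
      have m'M: "m' \<in> M0" using mM m by (metis M0_add)
      have "lookup m' (Factor 0 i) = (if i = j then ex0 i m - 2 else ex0 i m)" for i
        by (simp add: m'_def lookup_minus lookup_single when_def lookup_add numeral_2_eq_2)
      then have m': "m' \<in> Rn n" using less.prems m'M jj by (auto simp: Rn_def)
      have "dg m = (2 ^ j - 1) + (2 ^ j - 1) + dg m'" by (subst m) (simp only: mdegree_add dg_v0)
      then have "nat (dg m') < nat (dg m)" using dgj dg_M0_nonneg[OF m'M] by simp
      then show ?thesis using 2[OF jn j(2) m' less.hyps[OF _ m']] m by metis
    qed
  qed (simp add: 0)
qed

text \<open>The coaction on a generator up to terms that drop the degree by at least three.\<close>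

lemma cop_low:
  assumes "j \<ge> 1"
  shows "cop 0 (Suc j) + pvar (Factor 0 (Suc j)) + mo (v0 j + v0 j) * x1
    \<in> CS {q \<in> M0. dg q \<le> 2 ^ Suc j - 4}"
proof -
  have "cop 0 (Suc j) = cl_xi 0 (Suc j - 0) ^ (2 ^ 0) * cl_xi (Suc 0) 0
      + (cl_xi 0 (Suc j - Suc 0) ^ (2 ^ Suc 0) * cl_xi (Suc 0) (Suc 0)
      + (\<Sum>k\<in>{2..Suc j}. cl_xi 0 (Suc j - k) ^ (2 ^ k) * cl_xi (Suc 0) k))"
    unfolding cop_def atLeast0AtMost[symmetric]
    by (subst sum.atLeast_Suc_atMost, simp, subst sum.atLeast_Suc_atMost, simp)
      (simp only: numeral_2_eq_2)
  also have "cl_xi 0 (Suc j - 0) ^ (2 ^ 0) * cl_xi (Suc 0) 0 = pvar (Factor 0 (Suc j))"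
    by (simp add: cl_xi_def)
  also have "cl_xi 0 (Suc j - Suc 0) ^ (2 ^ Suc 0) * cl_xi (Suc 0) (Suc 0) = mo (v0 j + v0 j) * x1"
    using assms unfolding mo_mult[symmetric] mo_v0 by (simp add: cl_xi_def power2_eq_square)
  finally have "cop 0 (Suc j) + pvar (Factor 0 (Suc j)) + mo (v0 j + v0 j) * x1
      = (\<Sum>k\<in>{2..Suc j}. cl_xi 0 (Suc j - k) ^ (2 ^ k) * cl_xi (Suc 0) k)"
    by (simp add: add_ac)
  note eq = this
  have mem: "cl_xi 0 (Suc j - k) ^ (2 ^ k) * cl_xi (Suc 0) k \<in> CS {q \<in> M0. dg q \<le> 2 ^ Suc j - 4}"
    if k: "k \<in> {2..Suc j}" for k
  proof (rule CS_mult_unit)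
    have "cl_xi 0 (Suc j - k) ^ (2 ^ k)
        = mo (if k = Suc j then 0 else Poly_Mapping.single (Factor 0 (Suc j - k)) (2 ^ k))"
      using k by (simp add: cl_xi_def mo_single)
    moreover have "(2::int) ^ Suc j \<ge> 2 ^ 2" by (rule power_increasing) (use assms in auto)
    moreover have "(2::int) ^ k \<ge> 2 ^ 2" by (rule power_increasing) (use k in auto)
    moreover have "(2::int) ^ k * (2 ^ (Suc j - k) - 1) = 2 ^ Suc j - 2 ^ k"
      using k by (simp add: right_diff_distrib flip: power_add del: power_Suc)
    ultimately show "cl_xi 0 (Suc j - k) ^ (2 ^ k) \<in> CS {q \<in> M0. dg q \<le> 2 ^ Suc j - 4}"
      using k by (auto simp: CS_mo mdegree_single simp del: power_Suc)
  qed simp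
  show ?thesis unfolding eq by (rule CS_sum) (rule mem)
qed

text \<open>The error terms that the coaction on \<open>g\<close> may have: after multiplication by \<open>\<xi>\<^sub>n\<^sub>+\<^sub>1\<close> they lie in the
  unit or in Moore cells of smaller dimension.\<close>

definition Lw :: "nat \<Rightarrow> cmon \<Rightarrow> cmon set" where
  "Lw n m = {q. (q \<in> Rn n \<and> dg q < dg m) \<or> (q \<in> M0 \<and> dg q \<le> dg m - 2)}"

lemma Rn_M0: "q \<in> Rn n \<Longrightarrow> q \<in> M0"
  by (simp add: Rn_def)

lemma Lw_mult:
  assumes "m \<in> Rn n" "m' \<in> Rn n" "CF cl 1 (mo m) + mo m \<in> CS (Lw n m)" "CF cl 1 (mo m') + mo m' \<in> CS (Lw n m')"
  shows "CF cl 1 (mo (m + m')) + mo (m + m') \<in> CS (Lw n (m + m'))"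
proof -
  let ?l = "\<lambda>m. CF cl 1 (mo m) + mo m"
  have eq: "?l (m + m') = ?l m * ?l m' + (mo m * ?l m' + ?l m * mo m')"
    by (simp add: mo_mult[symmetric] psubst_mult algebra_simps)
  have 1: "?l m * ?l m' \<in> CS (Lw n (m + m'))"
    by (rule CS_mult[OF assms(3,4)]) (auto simp: Lw_def mdegree_add Rn_add dest: Rn_M0)
  have 2: "mo m * ?l m' \<in> CS (Lw n (m + m'))"
    by (rule CS_mult[of _ "{m}", OF _ assms(4)])
      (use assms(1) in \<open>auto simp: Lw_def mdegree_add Rn_add CS_mo dest: Rn_M0\<close>)
  have 3: "?l m * mo m' \<in> CS (Lw n (m + m'))"
    by (rule CS_mult[OF assms(3), of _ "{m'}"])
      (use assms(2) in \<open>auto simp: Lw_def mdegree_add Rn_add CS_mo dest: Rn_M0\<close>)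
  show ?thesis unfolding eq by (intro CS_add 1 2 3)
qed

lemma CF1_Rn: "n \<ge> 1 \<Longrightarrow> m \<in> Rn n \<Longrightarrow> CF cl 1 (mo m) + mo m \<in> CS (Lw n m)"
proof -
  assume n: "n \<ge> 1" and m: "m \<in> Rn n"
  from m show ?thesis
  proof (induction m rule: Rn_induct)
    case (single j m)
    obtain i where i: "j = Suc i" "i \<ge> n + 1" using single by (cases j) auto
    have "CF cl 1 (mo (v0 j)) + mo (v0 j)
        = (cop 0 (Suc i) + pvar (Factor 0 (Suc i)) + mo (v0 i + v0 i) * x1) + mo (v0 i + v0 i) * x1"
      unfolding mo_v0 i(1) by (simp add: CF_pvar add.assoc)
    moreover have "cop 0 (Suc i) + pvar (Factor 0 (Suc i)) + mo (v0 i + v0 i) * x1 \<in> CS (Lw n (v0 j))"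
      by (rule CS_mono[OF cop_low]) (use i in \<open>auto simp: Lw_def dg_v0[simplified]\<close>)
    moreover have "mo (v0 i + v0 i) * x1 \<in> CS (Lw n (v0 j))"
    proof (rule CS_mult_unit)
      have "v0 i + v0 i \<in> Rn n" "dg (v0 i + v0 i) < dg (v0 j)"
        using v0_Rn(2)[of n i] i unfolding mdegree_add dg_v0 by auto
      then show "mo (v0 i + v0 i) \<in> CS (Lw n (v0 j))"
        using Rn_M0[of "v0 i + v0 i" n] unfolding CS_mo by (simp add: Lw_def)
    qed simp
    ultimately have "CF cl 1 (mo (v0 j)) + mo (v0 j) \<in> CS (Lw n (v0 j))" by (simp only: CS_add)
    from Lw_mult[OF v0_Rn(1)[OF single(1)] single(2) this single(3)] show ?case .
  next
    case (double j m)
    have jM: "v0 j \<in> M0" using double by simp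
    have 1: "CF cl 1 (mo (v0 j)) + mo (v0 j) \<in> CS {q \<in> M0. dg q < dg (v0 j)}" by (rule CF1_lower[OF jM])
    have "CF cl 1 (mo (v0 j + v0 j)) + mo (v0 j + v0 j) = (CF cl 1 (mo (v0 j)) + mo (v0 j)) ^ 2"
      using fpoly_square_add[of "CF cl 1 (mo (v0 j))" "mo (v0 j)"]
      unfolding mo_mult[symmetric] psubst_mult power2_eq_square by simp
    moreover have "(CF cl 1 (mo (v0 j)) + mo (v0 j)) ^ 2 \<in> CS (Lw n (v0 j + v0 j))"
    proof -
      have sq: "p ^ 2 \<in> CS {q + q | q. q \<in> A}" if "p \<in> CS A" for p A
        using that unfolding CS_def
      proof (induction p rule: sp_induct)
        case (mo m)
        have "mo m ^ 2 = mo (m + m)" by (simp add: power2_eq_square mo_mult)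
        then show ?case using mo by (auto simp: part0_add)
      qed (auto simp: fpoly_square_add sp_add)
      show ?thesis by (rule CS_mono[OF sq[OF 1]]) (auto simp: Lw_def mdegree_add)
    qed
    ultimately have "CF cl 1 (mo (v0 j + v0 j)) + mo (v0 j + v0 j) \<in> CS (Lw n (v0 j + v0 j))" by simp
    from Lw_mult[OF v0_Rn(2)[OF double(1,2)] double(3) this double(4)] show ?case .
  qed simp
qed

lemma ex0_\<phi>D: "ex0 j (\<phi>D (n, g) b) = ex0 j g + (if b = 0 then (if j = n then 2 else 0) else if j = Suc n then 1 else 0)"
  by (simp add: \<phi>D_def lookup_add lookup_single when_def)

lemma \<phi>D_unique:
  assumes "(n, g) \<in> Icell" "(n', g') \<in> Icell" "b \<in> A0" "b' \<in> A0" "\<phi>D (n, g) b = \<phi>D (n', g') b'"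
  shows "(n, g) = (n', g') \<and> b = b'"
proof -
  have e: "ex0 j g + (if b = 0 then (if j = n then 2 else 0) else if j = Suc n then 1 else 0)
      = ex0 j g' + (if b' = 0 then (if j = n' then 2 else 0) else if j = Suc n' then 1 else 0)" for j
    using assms(5) ex0_\<phi>D by metis
  have g: "\<And>j. j < n \<Longrightarrow> ex0 j g = 0" "even (ex0 n g)" "even (ex0 (Suc n) g)"
    "\<And>j. j < n' \<Longrightarrow> ex0 j g' = 0" "even (ex0 n' g')" "even (ex0 (Suc n') g')"
    using assms(1,2) by (auto simp: Icell_def Rn_def)
  have nn: "n = n' \<and> (b = 0 \<longleftrightarrow> b' = 0)"
  proof (cases "b = 0"; cases "b' = 0")
    assume b: "b = 0" "b' = 0"
    have "\<not> n < n'" using e[of n] g(4)[of n] b by auto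
    moreover have "\<not> n' < n" using e[of n'] g(1)[of n'] b by auto
    ultimately show ?thesis using b by simp
  next
    assume b: "b = 0" "b' \<noteq> 0"
    have "\<not> n < n'" using e[of n] g(4)[of n] b by auto
    moreover have "Suc n' = n" if "n' < n"
    proof (rule ccontr)
      assume "Suc n' \<noteq> n"
      then have "Suc n' < n" using that by simp
      then show False using e[of "Suc n'"] g(1)[of "Suc n'"] b by simp
    qed
    ultimately have "n = n' \<or> Suc n' = n" by linarith
    then show ?thesis
    proof
      assume "n = n'"
      then have "ex0 (Suc n) g = ex0 (Suc n) g' + 1" "even (ex0 (Suc n) g')"
        using e[of "Suc n"] g(6) b by auto
      then show ?thesis using g(3) by presburger
    next
      assume n: "Suc n' = n"
      then have "ex0 n g + 2 = ex0 n g' + 1" using e[of n] b by auto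
      moreover have "even (ex0 n g')" using g(6) unfolding n .
      ultimately show ?thesis using g(2) by presburger
    qed
  next
    assume b: "b \<noteq> 0" "b' = 0"
    have "\<not> n' < n" using e[of n'] g(1)[of n'] b by auto
    moreover have "Suc n = n'" if "n < n'"
    proof (rule ccontr)
      assume "Suc n \<noteq> n'"
      then have "Suc n < n'" using that by simp
      then show False using e[of "Suc n"] g(4)[of "Suc n"] b by simp
    qed
    ultimately have "n = n' \<or> Suc n = n'" by linarith
    then show ?thesis
    proof
      assume "n = n'"
      then have "ex0 (Suc n) g + 1 = ex0 (Suc n) g'" "even (ex0 (Suc n) g')"
        using e[of "Suc n"] g(6) b by auto
      then show ?thesis using g(3) by presburger
    next
      assume n: "Suc n = n'"
      then have "ex0 n' g + 1 = ex0 n' g' + 2" using e[of n'] b by auto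
      moreover have "even (ex0 n' g)" using g(3) unfolding n .
      ultimately show ?thesis using g(5) by presburger
    qed
  next
    assume b: "b \<noteq> 0" "b' \<noteq> 0"
    have "\<not> n < n'"
    proof
      assume n: "n < n'"
      show False
      proof (cases "Suc n = n'")
        case True
        then have "ex0 n' g + 1 = ex0 n' g'" using e[of n'] b by auto
        moreover have "even (ex0 n' g)" using g(3) unfolding True .
        ultimately show ?thesis using g(5) by presburger
      next
        case False
        then have "Suc n < n'" using n by simp
        then show ?thesis using e[of "Suc n"] g(4)[of "Suc n"] b n by simp
      qed
    qed
    moreover have "\<not> n' < n"
    proof
      assume n: "n' < n"
      show False
      proof (cases "Suc n' = n")
        case True
        then have "ex0 n g = ex0 n g' + 1" using e[of n] b by auto
        moreover have "even (ex0 n g')" using g(6) unfolding True .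
        ultimately show ?thesis using g(2) by presburger
      next
        case False
        then have "Suc n' < n" using n by simp
        then show ?thesis using e[of "Suc n'"] g(1)[of "Suc n'"] b n by simp
      qed
    qed
    ultimately show ?thesis using b by simp
  qed
  then have "b = b'" using assms(3,4) by (auto simp: A0_def)
  moreover have "g = g'" using assms(5) nn by (auto simp: \<phi>D_def split: if_splits)
  ultimately show ?thesis using nn by simp
qed

lemma \<phi>D_Ds:
  assumes "(n, g) \<in> Icell" "b \<in> A0"
  shows "\<phi>D (n, g) b \<in> Ds" "\<phi>D (n, g) b \<noteq> 0" "dg (\<phi>D (n, g) b) = dg b + ND (n, g)"
proof -
  have g: "n \<ge> 1" "g \<in> M0" "\<And>j. j < n \<Longrightarrow> ex0 j g = 0" "even (ex0 n g)"
    using assms(1) by (auto simp: Icell_def Rn_def)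
  have "even (ex0 (Suc 0) g)" using g by (cases "n = Suc 0") auto
  then have "even (ex0 (Suc 0) (\<phi>D (n, g) b))" using g(1) unfolding ex0_\<phi>D by auto
  moreover have "\<phi>D (n, g) b \<in> M0" using g by (simp add: \<phi>D_def)
  ultimately show "\<phi>D (n, g) b \<in> Ds" by (simp add: Ds_def)
  have "ex0 n (\<phi>D (n, g) b) \<noteq> 0 \<or> ex0 (Suc n) (\<phi>D (n, g) b) \<noteq> 0" unfolding ex0_\<phi>D by simp
  then show "\<phi>D (n, g) b \<noteq> 0" by auto
  have "b = 0 \<or> b = v0 1" using assms(2) by (simp add: A0_def)
  moreover have "(v0 1 :: cmon) \<noteq> 0" by simp
  ultimately show "dg (\<phi>D (n, g) b) = dg b + ND (n, g)"
    unfolding \<phi>D_def ND_def prod.case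
    by (elim disjE) (simp_all only: if_True if_False simp_thms mdegree_add dg_v0 mdegree_0, simp_all)
qed

lemma Ds_cover: "Ds = {0} \<union> (\<Union>i\<in>Icell. \<phi>D i ` A0)"
proof (intro equalityI subsetI)
  fix m assume "m \<in> {0} \<union> (\<Union>i\<in>Icell. \<phi>D i ` A0)"
  then show "m \<in> Ds" using \<phi>D_Ds(1) by auto
next
  fix m assume m: "m \<in> Ds"
  show "m \<in> {0} \<union> (\<Union>i\<in>Icell. \<phi>D i ` A0)"
  proof (cases "m = 0")
    case False
    have mM: "m \<in> M0" "even (ex0 (Suc 0) m)" using m by (auto simp: Ds_def)
    obtain v where "v \<in> keys m" using False by fastforce
    then obtain j where "Factor 0 j \<in> keys m" using mM by (auto simp: M0_def)
    then have "ex0 j m \<noteq> 0" by (simp add: in_keys_iff)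
    then have ex: "\<exists>k. ex0 k m \<noteq> 0" by blast
    define k where "k = (LEAST k. ex0 k m \<noteq> 0)"
    have k: "ex0 k m \<noteq> 0" "\<And>j. j < k \<Longrightarrow> ex0 j m = 0"
      using LeastI_ex[OF ex] not_less_Least[of _ "\<lambda>k. ex0 k m \<noteq> 0"] unfolding k_def by blast+
    have "Factor 0 k \<in> keys m" using k by (simp add: in_keys_iff)
    then have k1: "k \<ge> 1" using mM by (auto simp: M0_def)
    have sub: "m = (m - u) + u \<and> m - u \<in> M0" if "\<And>v. lookup u v \<le> lookup m v" for u
    proof -
      have "m = (m - u) + u"
        using that by (intro poly_mapping_eqI) (simp add: lookup_add lookup_minus)
      then show ?thesis using mM(1) by (metis M0_add)
    qed
    have found: ?thesis if "(n, m - u) \<in> Icell" "b \<in> A0" "m = \<phi>D (n, m - u) b" for n u b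
      using that by blast
    show ?thesis
    proof (cases "even (ex0 k m)")
      case True
      show ?thesis
      proof (cases "even (ex0 (Suc k) m)")
        case ev: True
        have le: "lookup (v0 k + v0 k) v \<le> lookup m v" for v
          using k(1) True by (auto simp: lookup_add lookup_single when_def elim!: evenE)
        have "(k, m - (v0 k + v0 k)) \<in> Icell"
          using k k1 True ev sub[OF le]
          by (auto simp: Icell_def Rn_def lookup_minus lookup_add lookup_single when_def)
        then show ?thesis using sub[OF le] by (intro found[of k _ 0]) (auto simp: \<phi>D_def)
      next
        case od: False
        have le: "lookup (v0 (Suc k)) v \<le> lookup m v" for v
          using od by (auto simp: lookup_single when_def elim!: oddE)
        have "(k, m - v0 (Suc k)) \<in> Icell"
          using k k1 True od sub[OF le]
          by (auto simp: Icell_def Rn_def lookup_minus lookup_single when_def)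
        then show ?thesis using sub[OF le] by (intro found[of k _ "v0 1"]) (auto simp: \<phi>D_def A0_def)
      qed
    next
      case False
      have "k \<noteq> Suc 0" using False mM(2) by auto
      then obtain n where n: "k = Suc n" "n \<ge> 1" using k1 by (cases k) auto
      have le: "lookup (v0 k) v \<le> lookup m v" for v
        using False by (auto simp: lookup_single when_def elim!: oddE)
      have "(n, m - v0 k) \<in> Icell"
        using k n False sub[OF le]
        by (auto simp: Icell_def Rn_def lookup_minus lookup_single when_def)
      then show ?thesis using sub[OF le] n by (intro found[of n _ "v0 1"]) (auto simp: \<phi>D_def A0_def)
    qed
  qed simp
qed

text \<open>Attaching all Moore cells of \<open>D\<close> to the unit, in order of their dimensions.  The dimension is
  \<open>2\<close> for \<open>n = 1\<close>, \<open>g = 1\<close>, and \<open>5\<close> does not occur, because \<open>\<xi>\<^sub>1\<^sup>2 g\<close> would need \<open>g\<close> of degree \<open>3\<close> with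
  even exponents of \<open>\<xi>\<^sub>1\<close> and \<open>\<xi>\<^sub>2\<close>.\<close>

lemma rel_exact_unit_D:
  assumes E: "\<And>N. N \<ge> 2 \<Longrightarrow> N \<noteq> 5 \<Longrightarrow> exact dd (CK A0) f (t - N)"
  shows "rel_exact dd (CK {0}) (CK Ds) f t"
proof -
  let ?low = "\<lambda>N. {0} \<union> (\<Union>j\<in>{j \<in> Icell. ND j < N}. \<phi>D j ` A0)"
  have low: "{q \<in> Ds. dg q < N} \<subseteq> ?low N" for N
  proof
    fix q assume q: "q \<in> {q \<in> Ds. dg q < N}"
    show "q \<in> ?low N"
    proof (cases "q = 0")
      case False
      then obtain i b where ib: "i \<in> Icell" "b \<in> A0" "q = \<phi>D i b" using q Ds_cover by auto
      have "dg b \<ge> 0" using ib(2) by (auto simp: A0_def mdegree_single)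
      then have "ND i < N" using q ib \<phi>D_Ds(3)[of "fst i" "snd i" b] by simp
      then show ?thesis using ib by blast
    qed simp
  qed
  have "rel_exact dd (CK {0}) (CK ({0} \<union> (\<Union>i\<in>Icell. \<phi>D i ` A0))) f t"
  proof (rule rel_exact_cells[where N = ND])
    fix i assume i: "i \<in> Icell"
    obtain n g where ng: "i = (n, g)" by (cases i)
    have g: "n \<ge> 1" "g \<in> Rn n" "g \<in> M0" using i ng by (auto simp: Icell_def Rn_def)
    show "\<phi>D i b \<in> M0 - {0}" if "b \<in> A0" for b
      using \<phi>D_Ds[of n g b] that i ng by (auto simp: Ds_def)
    show "dg (\<phi>D i b) = dg b + ND i" if "b \<in> A0" for b
      using \<phi>D_Ds[of n g b] that i ng by simp
    show "exact dd (CK A0) f (t - ND i)"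
    proof (rule E)
      have g0: "dg g \<ge> 0" using g by (intro dg_M0_nonneg)
      have p: "(2::int) ^ Suc n \<ge> 2 ^ Suc 1" using g(1) by (intro power_increasing) auto
      show "ND i \<ge> 2" using g0 p by (simp add: ND_def ng)
      show "ND i \<noteq> 5"
      proof (cases "n = 1")
        case True
        obtain r where r: "dg g = int (ex0 (Suc 0) g) + 3 * int (ex0 2 g) + 7 * int (ex0 3 g) + dg r" "r = 0 \<or> dg r \<ge> 15"
          using dg_split[OF g(3)] by metis
        have "even (ex0 (Suc 0) g)" "even (ex0 2 g)" using g(2) True by (auto simp: Rn_def numeral_2_eq_2)
        then obtain a b where ab: "ex0 (Suc 0) g = 2 * a" "ex0 2 g = 2 * b" by (auto elim!: evenE)
        have "dg g \<noteq> 3"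
        proof
          assume 3: "dg g = 3"
          then have "dg r = 0" using r by auto
          then have "3 = int (2 * a) + 3 * int (2 * b) + 7 * int (ex0 3 g)" using r(1) 3 ab by simp
          then show False by (cases b; cases "ex0 3 g") (simp_all, presburger?)
        qed
        then show ?thesis using True by (simp add: ND_def ng)
      next
        case False
        then have "(2::int) ^ Suc n \<ge> 2 ^ Suc 2" using g(1) by (intro power_increasing) auto
        then show ?thesis using g0 by (simp add: ND_def ng)
      qed
    qed
    show "CF cl 1 (mo (\<phi>D i b)) + relabel (\<phi>D i) (CF cl 1 (mo b)) \<in> CS (?low (ND i))" if b: "b \<in> A0" for b
    proof (cases "b = 0")
      case True
      have r1: "relabel (\<phi>D i) 1 = mo (\<phi>D i 0)" using relabel_M0[of 0] by simp
      have in_Ds: "\<phi>D i 0 \<in> Ds" "dg (\<phi>D i 0) = ND i" using \<phi>D_Ds[of n g 0] i ng by simp_all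
      have "CF cl 1 (mo (\<phi>D i 0)) + mo (\<phi>D i 0) \<in> CS {q \<in> Ds. dg q < dg (\<phi>D i 0)}"
        by (rule CF1_lower_closed[OF closed_Ds in_Ds(1)])
      then have "CF cl 1 (mo (\<phi>D i 0)) + mo (\<phi>D i 0) \<in> CS (?low (ND i))"
        unfolding in_Ds(2) by (rule CS_mono[OF _ low])
      then show ?thesis using True r1 by simp
    next
      case False
      then have b1: "b = v0 1" using b by (simp add: A0_def)
      let ?g = "mo g" and ?\<xi> = "pvar (Factor 0 (Suc n))" and ?q = "mo (v0 n + v0 n)"
      let ?l = "CF cl 1 ?g + ?g" and ?l' = "cop 0 (Suc n) + ?\<xi> + ?q * x1"
      have top: "mo (\<phi>D i b) = ?g * ?\<xi>" and bot: "mo (\<phi>D i 0) = ?g * ?q"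
        using False mo_v0[of "Suc n"] by (simp_all add: \<phi>D_def ng mo_mult[symmetric])
      have rel: "relabel (\<phi>D i) (CF cl 1 (mo b)) = ?g * ?\<xi> + ?g * ?q * x1"
      proof -
        have "CF cl 1 (mo b) = mo b + 1 * x1" using CF1_gen(1) mo_v0[of 1] unfolding b1 by simp
        then have "relabel (\<phi>D i) (CF cl 1 (mo b)) = mo (\<phi>D i b) + mo (\<phi>D i 0) * x1"
          using relabel_M0[of b "\<phi>D i"] relabel_M0[of 0 "\<phi>D i"] b1
          by (simp only: relabel_add relabel_mult_unit[OF unit_gen(1)] mo_0[symmetric] M0_v0 M0_0 le_refl)
        then show ?thesis by (simp only: top bot)
      qed
      have C: "CF cl 1 (mo (\<phi>D i b)) = CF cl 1 ?g * cop 0 (Suc n)"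
        unfolding top psubst_mult by (simp add: CF_pvar)
      have co: "cop 0 (Suc n) = ?\<xi> + ?q * x1 + ?l'"
        by (simp add: add_ac)
      have eq: "CF cl 1 (mo (\<phi>D i b)) + relabel (\<phi>D i) (CF cl 1 (mo b))
          = ?l * ?\<xi> + ?l * ?q * x1 + CF cl 1 ?g * ?l'"
        unfolding C rel by (subst (1) co) (simp add: distrib_left distrib_right mult.assoc add_ac)
      let ?T = "{q. (\<exists>q'\<in>Rn n. q = q' + v0 (Suc n) \<and> dg q' < dg g) \<or> (q \<in> M0 \<and> dg q < ND i)}"
      have NDi: "ND i = dg g + 2 ^ Suc n - 2" by (simp add: ND_def ng)
      have l: "?l \<in> CS (Lw n g)" by (rule CF1_Rn[OF g(1,2)])
      have l2: "?l \<in> CS {q \<in> M0. dg q < dg g}" by (rule CF1_lower[OF g(3)])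
      have t1: "?l * ?\<xi> \<in> CS ?T"
        by (rule CS_mult[OF l pvar_CS1[of _ "{v0 (Suc n)}"]])
          (auto simp: Lw_def NDi mdegree_add dg_v0[simplified] simp del: power_Suc)
      have t2: "?l * ?q * x1 \<in> CS ?T"
      proof (rule CS_mult_unit[OF CS_mult[OF l2]])
        show "?q \<in> CS {v0 n + v0 n}" using g(1) by (simp add: CS_mo part0_add)
        show "s + u \<in> ?T" if "s \<in> {q \<in> M0. dg q < dg g}" "u \<in> {v0 n + v0 n}" for s u
        proof -
          have "dg u = 2 ^ Suc n - 2" using that(2) by (simp only: singleton_iff mdegree_add dg_v0) simp
          then show ?thesis using that g(1) by (auto simp: NDi mdegree_add)
        qed
      qed simp
      have t3: "CF cl 1 ?g * ?l' \<in> CS ?T"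
      proof (rule CS_mult[OF _ cop_low[OF g(1)]])
        have "?l + ?g \<in> CS {q \<in> M0. dg q \<le> dg g}"
          by (rule CS_add[OF CS_mono[OF l2]]) (use g(3) in \<open>auto simp: CS_mo\<close>)
        then show "CF cl 1 ?g \<in> CS {q \<in> M0. dg q \<le> dg g}" by (simp add: add.assoc)
      qed (auto simp: NDi mdegree_add simp del: power_Suc)
      have T: "CF cl 1 (mo (\<phi>D i b)) + relabel (\<phi>D i) (CF cl 1 (mo b)) \<in> CS ?T"
        unfolding eq by (intro CS_add t1 t2 t3)
      have in_Ds: "\<phi>D i b \<in> Ds" "\<phi>D i 0 \<in> Ds" using \<phi>D_Ds(1)[of n g] i ng b by simp_all
      have "CF cl 1 (mo (\<phi>D i b)) + relabel (\<phi>D i) (CF cl 1 (mo b)) \<in> CS Ds"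
      proof (rule CS_add)
        show "CF cl 1 (mo (\<phi>D i b)) \<in> CS Ds" using closed_Ds in_Ds by (simp add: closed_def)
        have "mo (\<phi>D i b) \<in> CS Ds" "mo (\<phi>D i 0) \<in> CS Ds"
          using in_Ds by (simp_all add: CS_mo Ds_def)
        then show "relabel (\<phi>D i) (CF cl 1 (mo b)) \<in> CS Ds"
          unfolding rel top bot by (rule CS_add[OF _ CS_mult_unit[OF _ unit_gen(1)]])
      qed
      from CS_Int[OF this T] show ?thesis
      proof (rule CS_mono)
        have "q' + v0 (Suc n) \<in> ?low (ND i)" if "q' \<in> Rn n" "dg q' < dg g" for q'
        proof -
          have "(n, q') \<in> Icell" "ND (n, q') < ND i" "q' + v0 (Suc n) = \<phi>D (n, q') (v0 1)" "v0 1 \<in> A0"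
            using that g(1) by (auto simp: Icell_def ND_def ng \<phi>D_def A0_def)
          then show ?thesis by blast
        qed
        then show "Ds \<inter> ?T \<subseteq> ?low (ND i)" using low[of "ND i"] by blast
      qed
    qed
  next
    show "i = j \<and> b = b'" if "i \<in> Icell" "j \<in> Icell" "b \<in> A0" "b' \<in> A0" "\<phi>D i b = \<phi>D j b'" for i j b b'
      using \<phi>D_unique[of "fst i" "snd i" "fst j" "snd j" b b'] that by simp
    have "inj_on (\<lambda>i. \<phi>D i 0) {i \<in> Icell. ND i \<le> t}"
      by (rule inj_onI) (use \<phi>D_unique[of _ _ _ _ 0 0] in auto)
    moreover have "(\<lambda>i. \<phi>D i 0) ` {i \<in> Icell. ND i \<le> t} \<subseteq> {m \<in> M0. dg m \<le> t}"
      using \<phi>D_Ds[of _ _ 0] by (auto simp: Ds_def)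
    ultimately show "finite {i \<in> Icell. ND i \<le> t}"
      by (rule inj_on_finite[OF _ _ finite_M0_bounded])
  qed (rule closed_0 closed_A0)+
  then show ?thesis by (simp only: Ds_cover[symmetric])
qed

text \<open>Descent from \<open>D\<close>, whose cohomology is known, to the unit.\<close>

lemma H_exact:
  assumes "t \<noteq> int f" "\<And>N. f \<ge> 1 \<Longrightarrow> N \<ge> 2 \<Longrightarrow> N \<noteq> 5 \<Longrightarrow> exact dd (CK A0) (f - 1) (t - N)"
  shows "exact dd (CK {0}) f t"
proof (rule exact_sub_CK)
  show "{0} \<subseteq> Ds" by simp
  have "CK Ds = KD" by (simp add: fun_eq_iff CK_Ds)
  then show "exact dd (CK Ds) f t" using exact_KD[OF assms(1)] by simp
qed (use assms(2) in \<open>auto intro!: rel_exact_unit_D\<close>)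

text \<open>The vanishing of the cohomology of the Steenrod algebra above a line of slope one half, and in
  some bidegrees next to it where the vanishing over \<open>A(1)\<close> is better than the line.\<close>

lemma H_line: "f \<ge> 1 \<Longrightarrow> t < 3 * int f - 3 \<Longrightarrow> t \<noteq> int f \<Longrightarrow> exact dd (CK {0}) f t"
proof (rule H_exact)
  fix N :: int assume *: "f \<ge> 1" "t < 3 * int f - 3" "N \<ge> 2"
  then show "exact dd (CK A0) (f - 1) (t - N)"
    by (intro E_line exact_KA_KD1_line) (auto simp: of_nat_diff)
qed

lemma H_edge: "t \<le> 12 * int k + 1 \<Longrightarrow> t \<noteq> 4 * int k + 1 \<Longrightarrow> exact dd (CK {0}) (4 * k + 1) t"
  by (rule H_exact) (auto intro!: E_4k)

lemma H_4_12: "exact dd (CK {0}) 4 12"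
  by (rule H_exact) (auto intro!: E_3)

section \<open>Cocycles, coboundaries and exactness of the unit comodule\<close>

lemma counit_SH [simp]: "counit (SH (Suc 0) z) = z"
proof (rule rhom_eqI[OF rhom_comp[OF rhom_psubst rhom_psubst] rhom_id])
  show "counit (SH (Suc 0) (pvar v)) = pvar v" for v :: "(unit, nat) tvar"
    by (cases v) (auto simp: psubst_pvar)
qed

lemma counit_CS_0:
  assumes "z \<in> CS {0}"
  shows "SH (Suc 0) (counit z) = z"
proof (rule rhom_eq_on[OF rhom_comp[OF rhom_psubst rhom_psubst] rhom_id])
  have "keys m \<subseteq> {v. \<not> is0 v}" if "part0 m = 0" for m :: cmon
  proof
    fix v assume "v \<in> keys m"
    then have "lookup m v \<noteq> 0" by (simp add: in_keys_iff)
    then show "v \<in> {v. \<not> is0 v}" using lookup_part0[of m v] that by (cases "is0 v") auto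
  qed
  then show "z \<in> vars_in {v. \<not> is0 v}"
    using assms by (auto simp: CS_def vars_in_sp sp_def)
  fix v :: "(unit, nat) tvar" assume "v \<in> {v. \<not> is0 v}"
  then show "SH (Suc 0) (counit (pvar v)) = pvar v"
  proof (cases v)
    case (Factor p n)
    with \<open>v \<in> _\<close> obtain p' where "p = Suc p'" by (cases p) (auto simp: is0_def)
    with Factor show ?thesis by (simp add: psubst_pvar)
  qed (simp add: psubst_pvar)
qed

lemma dd_SH: "dd f (SH (Suc 0) x) = SH (Suc 0) (cobar_d cl f x)"
proof -
  have "dd f (CF cl 0 x) = (\<Sum>i\<in>{..Suc f}. CF cl (Suc i) (CF cl 0 x))"
    unfolding dd_def DD_def atLeast0AtMost[symmetric] One_nat_def
    by (subst sum.atLeast_Suc_atMost_Suc_shift) simp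
  also have "\<dots> = CF cl 0 (cobar_d cl f x)"
    using CF_CF[OF bialg_cl, of 0] by (simp only: cobar_d_def psubst_sum Suc_eq_plus1 le0)
  finally show ?thesis by (simp add: CF_0)
qed

lemma SH_CK: "x \<in> cc f t \<Longrightarrow> SH (Suc 0) x \<in> CK {0} f t"
  using SH_cochains[of x cl f t 1 "Suc f"] SH_CS[of 0 x] by (simp add: CK_KG KG_def)

lemma SH_KD1: "x \<in> cc f t \<Longrightarrow> SH (Suc 0) x \<in> KD1 f t"
  using SH_cochains[of x cl f t 1 "Suc f"] by (simp add: KD1_def KG_def)

text \<open>Trivial coefficients sit in the cobar complex as the elements that are constant in the
  leading factor, so exactness there says that every cocycle is a coboundary.\<close>

lemma exact_unit_bdry:
  assumes ex: "exact dd (CK {0}) f t" and x: "x \<in> cc f t" "cobar_d cl f x = 0"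
  shows "bdry cl f t x"
proof (cases f)
  case 0
  have "SH (Suc 0) x \<in> CK {0} 0 t" "dd 0 (SH (Suc 0) x) = 0" using SH_CK[OF x(1)] dd_SH x(2) 0 by simp_all
  then have "SH (Suc 0) x = 0" using ex unfolding 0 rel_exact_0 by blast
  then have "counit (SH (Suc 0) x) = 0" by (simp only: psubst_0)
  then show ?thesis by (simp add: bdry_def 0)
next
  case (Suc e)
  have "SH (Suc 0) x \<in> CK {0} (Suc e) t" "dd (Suc e) (SH (Suc 0) x) = 0"
    using SH_CK[OF x(1)] dd_SH x(2) Suc by simp_all
  then obtain y where y: "y \<in> CK {0} e t" "SH (Suc 0) x = dd e y"
    using exact_SucD[OF ex[unfolded Suc]] by blast
  have "y = SH (Suc 0) (counit y)" using counit_CS_0 y(1) by (simp add: CK_KG)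
  then have "SH (Suc 0) x = SH (Suc 0) (cobar_d cl e (counit y))" using y(2) dd_SH by metis
  then have "counit (SH (Suc 0) x) = counit (SH (Suc 0) (cobar_d cl e (counit y)))" by (rule arg_cong)
  then have "x = cobar_d cl e (counit y)" by (simp only: counit_SH)
  moreover have "counit y \<in> cc e t" using counit_cc y(1) by (simp add: CK_KG KG_def)
  ultimately show ?thesis unfolding Suc using bdry_d by metis
qed


section \<open>Reversal of the tensor factors\<close>

text \<open>Composition of additive power series \<open>\<Sum>\<^sub>n f\<^sub>n x\<^bsup>2^n\<^esup>\<close>: the dual Steenrod algebra
  represents their substitution group, and the antipode is the inverse series.\<close>

definition conv :: "(nat \<Rightarrow> 'v fpoly) \<Rightarrow> (nat \<Rightarrow> 'v fpoly) \<Rightarrow> nat \<Rightarrow> 'v fpoly" where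
  "conv f g n = (\<Sum>k\<le>n. f (n - k) ^ (2 ^ k) * g k)"

abbreviation conv_unit :: "nat \<Rightarrow> 'v fpoly" where
  "conv_unit n \<equiv> (if n = 0 then 1 else 0)"

lemma conv_assoc: "conv (conv f g) h n = conv f (conv g h) n"
proof -
  let ?g = "\<lambda>k j. f (n - k - j) ^ (2 ^ (j + k)) * g j ^ (2 ^ k) * h k"
  have "conv (conv f g) h n = (\<Sum>k\<le>n. \<Sum>j\<le>n - k. ?g k j)"
    by (simp add: conv_def fpoly_frobenius_sum sum_distrib_right power_mult_distrib
        power_mult[symmetric] power_add)
  also have "\<dots> = (\<Sum>m\<le>n. \<Sum>k\<le>m. ?g k (m - k))"
    by (rule triangle_sum)
  also have "\<dots> = conv f (conv g h) n"
    by (simp add: conv_def sum_distrib_left mult.assoc)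
  finally show ?thesis .
qed

lemma conv_unit_left: "conv conv_unit g n = g n"
proof -
  have "conv conv_unit g n = (\<Sum>k\<le>n. if k = n then g k else 0)"
    unfolding conv_def by (rule sum.cong) (auto simp: power_0_left)
  then show ?thesis by simp
qed

lemma conv_cancel:
  assumes "f 0 = 1" "\<And>n. conv f g n = conv f h n"
  shows "g n = h n"
proof (induction n rule: less_induct)
  case (less n)
  have "conv f g' n = (\<Sum>k<n. f (n - k) ^ (2 ^ k) * g' k) + g' n" for g'
    using assms(1) by (simp add: conv_def lessThan_Suc_atMost[symmetric])
  then show ?case using assms(2)[of n] less by simp
qed

context
  notes sum.cong [fundef_cong]
begin

text \<open>The conjugate of the generator \<open>n\<close>, in the tensor factor \<open>q\<close>.\<close>

fun chi :: "nat \<Rightarrow> nat \<Rightarrow> (unit, nat) tvar fpoly" where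
  "chi q n = (if n = 0 then 1 else \<Sum>k<n. cl_xi q (n - k) ^ (2 ^ k) * chi q k)"

end

declare chi.simps [simp del]

lemma chi_0 [simp]: "chi q 0 = 1"
  by (simp add: chi.simps)

lemma chi_1: "chi q (Suc 0) = pvar (Factor q (Suc 0))"
  by (simp add: chi.simps cl_xi_def)

lemma conv_xi_chi: "conv (cl_xi q) (chi q) n = conv_unit n"
  by (cases n) (simp_all add: conv_def chi.simps[of q "Suc _"] lessThan_Suc_atMost[symmetric])

lemma conv_cong: "(\<And>n. f n = f' n) \<Longrightarrow> (\<And>n. g n = g' n) \<Longrightarrow> conv f g n = conv f' g' n"
  by (simp add: conv_def)

text \<open>The antipode is an anti-homomorphism of coalgebras: both sides are inverse to the composite of
  the generic series in the factors \<open>q\<close> and \<open>q + 1\<close>.\<close>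

lemma CF_chi: "CF cl (Suc q) (chi q n) = (\<Sum>k\<le>n. chi (Suc q) (n - k) ^ (2 ^ k) * chi q k)"
proof -
  have cop: "cop q n = conv (cl_xi q) (cl_xi (Suc q)) n" for n by (simp add: cop_def conv_def)
  have "CF cl (Suc q) (chi q n) = conv (chi (Suc q)) (chi q) n"
  proof (rule conv_cancel[of "cop q"])
    fix n
    have "conv (cop q) (\<lambda>n. CF cl (Suc q) (chi q n)) n = CF cl (Suc q) (conv (cl_xi q) (chi q) n)"
      by (simp add: conv_def psubst_sum psubst_mult psubst_power CF_xi)
    also have "\<dots> = conv_unit n" by (simp add: conv_xi_chi)
    finally have 1: "conv (cop q) (\<lambda>n. CF cl (Suc q) (chi q n)) n = conv_unit n" .
    have "conv (cop q) (conv (chi (Suc q)) (chi q)) n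
        = conv (conv (cl_xi q) (cl_xi (Suc q))) (conv (chi (Suc q)) (chi q)) n"
      by (rule conv_cong) (simp_all add: cop)
    also have "\<dots> = conv (cl_xi q) (conv (cl_xi (Suc q)) (conv (chi (Suc q)) (chi q))) n"
      by (rule conv_assoc)
    also have "\<dots> = conv (cl_xi q) (chi q) n"
    proof (rule conv_cong)
      show "conv (cl_xi (Suc q)) (conv (chi (Suc q)) (chi q)) m = chi q m" for m
        unfolding conv_assoc[symmetric]
        using conv_cong[of "conv (cl_xi (Suc q)) (chi (Suc q))" conv_unit "chi q" "chi q" m]
        by (simp add: conv_xi_chi conv_unit_left)
    qed simp
    finally show "conv (cop q) (\<lambda>n. CF cl (Suc q) (chi q n)) n
        = conv (cop q) (conv (chi (Suc q)) (chi q)) n" using 1 conv_xi_chi by simp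
  qed simp
  then show ?thesis by (simp add: conv_def)
qed

lemma CF_chi_other: "i \<noteq> Suc q \<Longrightarrow> CF cl i (chi q n) = chi (if Suc q < i then q else Suc q) n"
proof (induction n rule: less_induct)
  case (less n)
  then show ?case
    by (cases "n = 0") (auto simp: chi.simps[of _ n] psubst_sum psubst_mult psubst_power CF_xi)
qed

lemma SH_chi: "SH p (chi q n) = chi (p + q) n"
proof (induction n rule: less_induct)
  case (less n)
  then show ?case
    by (cases "n = 0") (auto simp: chi.simps[of _ n] psubst_sum psubst_mult psubst_power)
qed

lemma chi_cochain: "q < f \<Longrightarrow> chi q n \<in> cc f (2 ^ n - 1)"
proof (induction n rule: less_induct)
  case (less n)
  show ?case
  proof (cases "n = 0")
    case False
    have "(\<Sum>k<n. cl_xi q (n - k) ^ (2 ^ k) * chi q k) \<in> cc f (2 ^ n - 1)"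
    proof (rule cochains_sum)
      fix k assume k: "k \<in> {..<n}"
      have "cl_xi q (n - k) ^ (2 ^ k) * chi q k \<in> cc f (int (2 ^ k) * (2 ^ (n - k) - 1) + (2 ^ k - 1))"
        using less k by (intro cochains_mult cc_power cl_xi_cochain) auto
      moreover have "int (2 ^ k) * (2 ^ (n - k) - 1) + (2 ^ k - 1) = 2 ^ n - 1"
        using k by (simp add: right_diff_distrib flip: power_add)
      ultimately show "cl_xi q (n - k) ^ (2 ^ k) * chi q k \<in> cc f (2 ^ n - 1)" by metis
    qed
    then show ?thesis using False by (simp add: chi.simps[of _ n])
  qed simp
qed

fun flip_var :: "nat \<Rightarrow> (unit, nat) tvar \<Rightarrow> (unit, nat) tvar fpoly" where
  "flip_var f (Scalar s) = pvar (Scalar s)"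
| "flip_var f (Factor p n) = chi (f - Suc p) n"

text \<open>Reversing the order of the tensor factors and conjugating each of them is an
  anti-automorphism of the cobar complex.\<close>

abbreviation "flip f \<equiv> psubst (flip_var f)"

lemma flip_cc: "x \<in> cc f t \<Longrightarrow> flip f x \<in> cc f t"
  by (rule rhom_cochains[OF rhom_psubst, where D = "\<lambda>t. t"]) (auto simp: psubst_pvar chi_cochain)

lemma flip_xi: "flip f (cl_xi p n) = chi (f - Suc p) n"
  by (simp add: cl_xi_def psubst_pvar)

lemma flip_CF:
  assumes "z \<in> cc f t" "i \<le> Suc f"
  shows "flip (Suc f) (CF cl i z) = CF cl (Suc f - i) (flip f z)"
proof (rule rhom_eq_on[OF rhom_comp[OF rhom_psubst rhom_psubst] rhom_comp[OF rhom_psubst rhom_psubst]])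
  show "z \<in> vars_in {Factor p n | p n. p < f \<and> n \<ge> 1}" by (rule cc_vars[OF assms(1)])
  fix v :: "(unit, nat) tvar" assume "v \<in> {Factor p n | p n. p < f \<and> n \<ge> 1}"
  then obtain p n where v: "v = Factor p n" "p < f" "n \<ge> 1" by blast
  show "flip (Suc f) (CF cl i (pvar v)) = CF cl (Suc f - i) (flip f (pvar v))"
  proof (cases "p + 1 = i")
    case True
    have e: "Suc f - i = Suc (f - Suc p)" "f - p = Suc (f - Suc p)" using True v(2) by auto
    have "flip (Suc f) (cop p n) = (\<Sum>k\<le>n. chi (f - p) (n - k) ^ (2 ^ k) * chi (f - Suc p) k)"
      by (simp add: cop_def psubst_sum psubst_mult psubst_power flip_xi)
    then show ?thesis using True v(1) unfolding e by (simp add: CF_pvar psubst_pvar[of "flip_var _"] CF_chi e)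
  next
    case False
    then have "Suc f - i \<noteq> Suc (f - Suc p)" using v(2) assms(2) by linarith
    then show ?thesis using False v assms(2)
      by (auto simp: CF_pvar psubst_pvar[of "flip_var _"] CF_chi_other Suc_diff_Suc intro!: arg_cong[of _ _ "\<lambda>q. chi q n"])
  qed
qed

lemma flip_d:
  assumes "z \<in> cc f t"
  shows "flip (Suc f) (cobar_d cl f z) = cobar_d cl f (flip f z)"
proof -
  have "flip (Suc f) (cobar_d cl f z) = (\<Sum>i\<le>Suc f. CF cl (Suc f - i) (flip f z))"
    unfolding cobar_d_def psubst_sum by (rule sum.cong) (auto simp: flip_CF[OF assms])
  also have "\<dots> = (\<Sum>i\<le>Suc f. CF cl i (flip f z))"
    by (rule sum.reindex_bij_witness[of _ "\<lambda>i. Suc f - i" "\<lambda>i. Suc f - i"]) auto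
  finally show ?thesis by (simp add: cobar_d_def)
qed

lemma flip_cup:
  assumes "x \<in> cc f s" "y \<in> cc g t"
  shows "flip (f + g) (cup f x y) = cup g (flip g y) (flip f x)"
proof -
  have "flip (f + g) x = SH g (flip f x)"
  proof (rule rhom_eq_on[OF rhom_psubst rhom_comp[OF rhom_psubst rhom_psubst] cc_vars[OF assms(1)]])
    fix v :: "(unit, nat) tvar" assume "v \<in> {Factor p n | p n. p < f \<and> n \<ge> 1}"
    then obtain p n where v: "v = Factor p n" "p < f" by blast
    then have "f + g - Suc p = g + (f - Suc p)" by simp
    then show "flip (f + g) (pvar v) = SH g (flip f (pvar v))"
      by (simp add: v psubst_pvar[of "flip_var _"] SH_chi)
  qed
  moreover have "flip (f + g) (SH f y) = flip g y"
  proof (rule rhom_eq_on[OF rhom_comp[OF rhom_psubst rhom_psubst] rhom_psubst cc_vars[OF assms(2)]])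
    fix v :: "(unit, nat) tvar" assume "v \<in> {Factor p n | p n. p < g \<and> n \<ge> 1}"
    then show "flip (f + g) (SH f (pvar v)) = flip g (pvar v)" by (auto simp: psubst_pvar)
  qed
  ultimately show ?thesis by (simp add: cup_def psubst_mult mult.commute)
qed

section \<open>The periodicity class over the subalgebra generated by Sq1 and Sq2\<close>

definition h04 :: "(unit, nat) tvar fpoly" where
  "h04 = cup (Suc 0) xx (cup (Suc 0) xx (cup (Suc 0) xx xx))"

lemma xx_cc: "xx ^ n \<in> cc (Suc 0) (int n)" "xx \<in> cc (Suc 0) 1"
  using cc_power[of xx "Suc 0" 1 n] cochains_pvar[of 0 "Suc 0" "Suc 0" cl] by simp_all

lemma CF1_xx_power: "CF cl (Suc 0) (xx ^ (2 ^ j)) = xx ^ (2 ^ j) + x1 ^ (2 ^ j)"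
  by (simp add: psubst_power CF1_gen fpoly_frobenius)

lemma xx_closed: "cobar_d cl (Suc 0) (xx ^ (2 ^ j)) = 0"
proof -
  have "cobar_d cl (Suc 0) (xx ^ (2 ^ j))
      = CF cl 0 (xx ^ (2 ^ j)) + CF cl (Suc 0) (xx ^ (2 ^ j)) + CF cl 2 (xx ^ (2 ^ j))"
    by (simp add: cobar_d_def numeral_2_eq_2)
  also have "\<dots> = 0"
    unfolding CF1_xx_power by (simp add: psubst_power CF_pvar add_ac)
  finally show ?thesis .
qed

lemma xx_closed_2: "cobar_d cl (Suc 0) (xx ^ 2) = 0" and xx_closed_8: "cobar_d cl (Suc 0) (xx ^ 8) = 0"
  using xx_closed[of 1] xx_closed[of 3] by simp_all

lemma h04_cc: "h04 \<in> cc 4 4" and h04_closed: "cobar_d cl 4 h04 = 0"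
proof -
  have d1: "cobar_d cl (Suc 0) xx = 0" using xx_closed[of 0] by simp
  have 2: "cup (Suc 0) xx xx \<in> cc (Suc 0 + Suc 0) (1 + 1)"
    by (intro cup_cochains xx_cc)
  have 3: "cup (Suc 0) xx (cup (Suc 0) xx xx) \<in> cc (Suc 0 + (Suc 0 + Suc 0)) (1 + (1 + 1))"
    by (intro cup_cochains[OF xx_cc(2) 2])
  have "h04 \<in> cc (Suc 0 + (Suc 0 + (Suc 0 + Suc 0))) (1 + (1 + (1 + 1)))"
    unfolding h04_def by (intro cup_cochains[OF xx_cc(2) 3])
  then show "h04 \<in> cc 4 4" by (simp add: eval_nat_numeral)
  have d2: "cobar_d cl (Suc 0 + Suc 0) (cup (Suc 0) xx xx) = 0"
    by (rule cup_cocycle[OF xx_cc(2) d1 d1])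
  have d3: "cobar_d cl (Suc 0 + (Suc 0 + Suc 0)) (cup (Suc 0) xx (cup (Suc 0) xx xx)) = 0"
    by (rule cup_cocycle[OF xx_cc(2) d1 d2])
  have "cobar_d cl (Suc 0 + (Suc 0 + (Suc 0 + Suc 0))) h04 = 0"
    unfolding h04_def by (rule cup_cocycle[OF xx_cc(2) d1 d3])
  then show "cobar_d cl 4 h04 = 0" by (simp add: eval_nat_numeral)
qed

lemma flip_xx: "flip (Suc 0) (xx ^ n) = xx ^ n"
  by (simp add: psubst_power psubst_pvar chi_1)

lemma flip_h04: "flip 4 h04 = h04"
proof -
  have f1: "flip (Suc 0) xx = xx" using flip_xx[of 1] by simp
  have 2: "cup (Suc 0) xx xx \<in> cc (Suc 0 + Suc 0) (1 + 1)"
    by (intro cup_cochains xx_cc)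
  have 3: "cup (Suc 0) xx (cup (Suc 0) xx xx) \<in> cc (Suc 0 + (Suc 0 + Suc 0)) (1 + (1 + 1))"
    by (intro cup_cochains[OF xx_cc(2) 2])
  have "flip (Suc 0 + (Suc 0 + (Suc 0 + Suc 0))) h04 = cup (Suc 0 + (Suc 0 + Suc 0))
      (cup (Suc 0 + Suc 0) (cup (Suc 0) xx xx) xx) xx"
    unfolding h04_def
    by (simp only: flip_cup[OF xx_cc(2) 3] flip_cup[OF xx_cc(2) 2] flip_cup[OF xx_cc(2) xx_cc(2)] f1)
  also have "\<dots> = h04" by (simp only: cup_assoc h04_def)
  finally show ?thesis by (simp add: eval_nat_numeral)
qed

lemma Sq_cup: "Sq1 (cup (Suc p) a c) = cup (Suc p) (Sq1 a) c"
  "Sq2 (cup (Suc p) a c) = cup (Suc p) (Sq2 a) c"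
  by (simp_all add: cup_def Sq1_mult Sq2_mult)

lemma KG_cup: "a \<in> KG f t \<Longrightarrow> c \<in> cc g u \<Longrightarrow> cup (Suc f) a c \<in> KG (f + g) (t + u)"
  using cup_cochains[of a cl "Suc f" t c g u] by (simp add: KG_def)

lemma KD_cup: "a \<in> KD f t \<Longrightarrow> c \<in> cc g u \<Longrightarrow> cup (Suc f) a c \<in> KD (f + g) (t + u)"
  by (simp add: KD_def KG_cup Sq_cup)

lemma KD1_cup: "a \<in> KD1 f t \<Longrightarrow> c \<in> cc g u \<Longrightarrow> cup (Suc f) a c \<in> KD1 (f + g) (t + u)"
  by (simp add: KD1_def KG_cup Sq_cup)

lemma dd_cup:
  assumes "a \<in> KG f t"
  shows "dd (f + g) (cup (Suc f) a c) = cup (Suc (Suc f)) (dd f a) c + cup (Suc f) a (cobar_d cl g c)"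
  using DD_cup[OF cochains_below[OF assms[unfolded KG_def]], of 1 cl g c] by (simp add: dd_def)

lemma KD_KG: "z \<in> KD f t \<Longrightarrow> z \<in> KG f t" and KD1_KD: "z \<in> KD1 f t \<Longrightarrow> z \<in> KD f t"
  by (simp_all add: KD_def KD1_def)

lemma xx_8_KD1: "xx ^ 8 \<in> KD1 0 8"
proof -
  have "xx ^ 8 = (xx ^ 4) ^ 2" and 4: "xx ^ 4 = (xx ^ 2) ^ 2" by (simp_all flip: power_mult)
  then have "Sq1 (xx ^ 8) = 0" "Sq2 (xx ^ 8) = Sq1 (xx ^ 4) ^ 2" using Sq_square by metis+
  moreover have "Sq1 (xx ^ 4) = 0" unfolding 4 by (rule Sq_square)
  ultimately show ?thesis using xx_cc(1)[of 8] by (simp add: KD1_def KG_def)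
qed

lemma dd_xx_power: "dd 0 (xx ^ (2 ^ j)) = SH (Suc 0) (xx ^ (2 ^ j))"
proof -
  have "dd 0 (xx ^ (2 ^ j)) = CF cl (Suc 0) (xx ^ (2 ^ j)) + CF cl (Suc (Suc 0)) (xx ^ (2 ^ j))"
    by (simp add: dd_def DD_def)
  also have "\<dots> = SH (Suc 0) (xx ^ (2 ^ j))"
    unfolding CF1_xx_power by (simp add: psubst_power CF_pvar psubst_pvar add_ac)
  finally show ?thesis .
qed

lemma dd_xx_2: "dd 0 (xx ^ 2) = SH (Suc 0) (xx ^ 2)" and dd_xx_8: "dd 0 (xx ^ 8) = SH (Suc 0) (xx ^ 8)"
  using dd_xx_power[of 1] dd_xx_power[of 3] by simp_all

lemma SH_cup: "SH (Suc 0) (cup f a c) = cup (Suc f) (SH (Suc 0) a) c"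
  by (simp add: cup_def psubst_mult SH_SH)

lemma dd_xx_8_cup:
  assumes "c \<in> cc g t"
  shows "dd g (cup (Suc 0) (xx ^ 8) c)
    = SH (Suc 0) (cup (Suc 0) (xx ^ 8) c) + cup (Suc 0) (xx ^ 8) (cobar_d cl g c)"
  using dd_cup[OF KD_KG[OF KD1_KD[OF xx_8_KD1]], of g c] by (simp only: dd_xx_8 SH_cup add_0)

text \<open>If \<open>q\<close> is a null homotopy of \<open>h\<^sub>3 h\<^sub>0\<^sup>4\<close>, then \<open>\<xi>\<^sub>1\<^sup>8 h\<^sub>0\<^sup>4 + q\<close> is a cocycle with coefficients
  in the extension; it represents the periodicity generator of stem 8 and filtration 4.\<close>

definition period :: "(unit, nat) tvar fpoly \<Rightarrow> (unit, nat) tvar fpoly" where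
  "period q = cup (Suc 0) (xx ^ 8) h04 + SH (Suc 0) q"

lemma period_KD1: "q \<in> cc 4 12 \<Longrightarrow> period q \<in> KD1 4 12"
  using KD1_cup[OF xx_8_KD1 h04_cc] SH_KD1[of q 4 12]
  by (simp add: period_def KD1_def KG_add Sq1_add Sq2_add)

lemma dd_period:
  assumes "cobar_d cl 4 q = cup (Suc 0) (xx ^ 8) h04"
  shows "dd 4 (period q) = 0"
  by (simp add: period_def dd_add dd_SH dd_xx_8_cup[OF h04_cc] h04_closed assms)

subsection \<open>The periodicity class is not a boundary\<close>

text \<open>The proof pairs with the functional that is dual to the monomial
  \<open>\<xi>\<^sub>1\<^sup>8 \<otimes> \<xi>\<^sub>1 \<otimes> \<xi>\<^sub>1 \<otimes> \<xi>\<^sub>1 \<otimes> \<xi>\<^sub>1\<close>.  It kills boundaries because \<open>Sq1 Sq1 = 0\<close> and because \<open>D1\<close> contains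
  no element of degree \<open>9\<close>.\<close>

definition coef8 :: "(unit, nat) tvar fpoly \<Rightarrow> (unit, nat) tvar fpoly" where
  "coef8 = lin (\<lambda>m. if part0 m = Poly_Mapping.single (Factor 0 1) 8 then counit (mo (part1 m)) else 0)"

lemma additive_coef8: "additive coef8"
  unfolding coef8_def by (rule additive_lin)

lemmas coef8_add = additiveD[OF additive_coef8]

lemma coef8_mult:
  assumes "q \<in> CS {0}"
  shows "coef8 (p * q) = coef8 p * counit q"
proof -
  have "coef8 (mo m * q) = coef8 (mo m) * counit q" for m
  proof (rule additive_eqI[of "\<lambda>q. coef8 (mo m * q)" "\<lambda>q. coef8 (mo m) * counit q"])
    show "coef8 (mo m * mo r) = coef8 (mo m) * counit (mo r)" if "r \<in> keys q" for r
    proof -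
      have r: "part0 r = 0" using that assms by (auto simp: CS_def sp_def)
      then have r1: "part1 r = r" by (rule part1_unit)
      have "counit (mo (part1 m + r)) = counit (mo (part1 m)) * counit (mo r)"
        by (simp only: mo_mult[symmetric] psubst_mult)
      moreover have "coef8 (mo n) = (if part0 n = Poly_Mapping.single (Factor 0 1) 8
          then counit (mo (part1 n)) else 0)" for n by (simp add: coef8_def)
      ultimately show ?thesis
        unfolding mo_mult part0_add part1_add r r1 add_0_right
        by (cases "part0 m = Poly_Mapping.single (Factor 0 1) 8")
          (simp_all only: part0_add part1_add r r1 add_0_right refl simp_thms if_True if_False mult_zero_left)
    qed
  qed (simp_all add: additive_def coef8_add distrib_left psubst_add)
  moreover have "additive (\<lambda>p. coef8 (p * q))" "additive (\<lambda>p. coef8 p * counit q)"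
    by (simp_all add: additive_def coef8_add distrib_right)
  ultimately show ?thesis
    using additive_eqI[of "\<lambda>p. coef8 (p * q)" "\<lambda>p. coef8 p * counit q" p] by blast
qed

lemma coef8_SH: "coef8 (p * SH (Suc 0) q) = coef8 p * q"
  by (simp add: coef8_mult SH_CS)

lemma coef8_M0: "a \<in> M0 \<Longrightarrow> coef8 (mo a) = (if a = Poly_Mapping.single (Factor 0 1) 8 then 1 else 0)"
  by (simp add: coef8_def)

lemma coef8_period: "coef8 (period q) = h04"
proof -
  have "coef8 (xx ^ 8) = 1"
    using coef8_M0[of "Poly_Mapping.single (Factor 0 1) 8"] by (simp add: mo_single)
  moreover have "coef8 1 = 0" using coef8_M0[of 0] lookup_single_eq[of "Factor 0 1" "8::nat"]
    by (auto simp: poly_mapping_eq_iff fun_eq_iff lookup_single when_def split: if_splits)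
  ultimately show ?thesis
    using coef8_SH[of 1 q] by (simp add: period_def coef8_add cup_def coef8_SH)
qed

lemma coef8_CF:
  assumes "z \<in> KG f t" "i \<ge> 1"
  shows "coef8 (CF cl (Suc i) z) = CF cl i (coef8 z)"
proof (rule additive_eqI[of "\<lambda>z. coef8 (CF cl (Suc i) z)" "\<lambda>z. CF cl i (coef8 z)"])
  fix m assume "m \<in> keys z"
  then have m: "part0 m \<in> M0" using assms(1) cmons_part0 by (auto simp: KG_def cochains_sp sp_def)
  have u: "CF cl (Suc i) (mo (part1 m)) \<in> CS {0}" by (rule CF_unit) simp_all
  have "coef8 (CF cl (Suc i) (mo m)) = coef8 (mo (part0 m) * CF cl (Suc i) (mo (part1 m)))"
    using assms(2) by (subst mo_parts) (simp add: psubst_mult CF_M0[OF m])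
  also have "\<dots> = coef8 (mo (part0 m)) * CF cl i (counit (mo (part1 m)))"
    using assms(2) by (simp add: coef8_mult[OF u] counit_CF)
  also have "\<dots> = CF cl i (coef8 (mo (part0 m)) * counit (mo (part1 m)))"
    by (simp add: coef8_M0[OF m])
  also have "\<dots> = CF cl i (coef8 (mo m))"
    by (subst (3) mo_parts) (simp add: coef8_mult CS_mo)
  finally show "coef8 (CF cl (Suc i) (mo m)) = CF cl i (coef8 (mo m))" .
qed (simp_all add: additive_def coef8_add psubst_add)

lemma coef8_cc:
  assumes "z \<in> KG f t"
  shows "coef8 z \<in> cc f (t - 8)"
  unfolding cochains_sp
proof (rule sp_additive[OF additive_coef8 assms[unfolded KG_def cochains_sp]])
  fix m assume m: "m \<in> cmons cl (Suc f) t"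
  have "counit (mo (part1 m)) \<in> cc f (t - 8)" if p: "part0 m = Poly_Mapping.single (Factor 0 1) 8"
  proof (rule counit_cc)
    have "dg (part0 m) = 8" unfolding p by (simp add: mdegree_single)
    then show "mo (part1 m) \<in> cc (Suc f) (t - 8)"
      using m dg_parts[of m] keys_parts(2)[of m] by (auto simp: cochains_sp cmons_def)
  qed
  then show "coef8 (mo m) \<in> sp (cmons cl f (t - 8))"
    by (simp add: coef8_def cochains_sp)
qed

text \<open>Pairing of the leading factor with \<open>Sq1\<close>.\<close>

definition ev :: "(unit, nat) tvar fpoly \<Rightarrow> (unit, nat) tvar fpoly" where
  "ev z = counit (Sq1 z)"

lemma ev_add: "ev (p + q) = ev p + ev q" and ev_0 [simp]: "ev 0 = 0"
  by (simp_all add: ev_def Sq1_add psubst_add)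

lemma ev_xx: "ev (xx * SH (Suc 0) z) = z"
  by (simp add: ev_def Sq1_mult Sq_pvar)

lemma ev_cc: "z \<in> cc (Suc f) t \<Longrightarrow> ev z \<in> cc f (t - 1)"
  unfolding ev_def by (rule counit_cc) (rule Sq_cochains, simp_all)

lemma ev_CF: "i \<ge> 1 \<Longrightarrow> ev (CF cl (Suc i) z) = CF cl i (ev z)"
  by (simp add: ev_def Sq_CF counit_CF)

text \<open>Two pairings against the two parts of a coproduct amount to one pairing with \<open>Sq1 Sq1\<close>.\<close>

lemma ev_ev_CF1:
  assumes "z \<in> cc (Suc f) t"
  shows "ev (ev (CF cl (Suc 0) z)) = 0"
proof -
  have "ev (CF cl (Suc 0) z) = Sq1 z"
    using counit_CF1[OF Sq_cochains(1)[OF assms]] by (simp add: ev_def Sq_CF)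
  then show ?thesis by (simp add: ev_def)
qed

lemma cc_no_factors: "z \<in> cc 0 t \<Longrightarrow> t \<noteq> 0 \<Longrightarrow> z = 0"
proof -
  assume "z \<in> cc 0 t" "t \<noteq> 0"
  moreover have "cmons cl 0 t = {}" if "t \<noteq> 0" using that by (auto simp: cmons_def)
  ultimately show "z = 0" by (simp add: cochains_sp sp_empty)
qed

lemma D1s_9: "a \<in> D1s \<Longrightarrow> dg a \<noteq> 9"
proof
  assume a: "a \<in> D1s" "dg a = 9"
  then obtain r where r: "dg a = int (ex0 (Suc 0) a) + 3 * int (ex0 2 a) + 7 * int (ex0 3 a) + dg r"
    "r = 0 \<or> dg r \<ge> 15"
    using dg_split[of a] by (auto simp: D1s_def)
  moreover have "dg r = 0" using r a(2) by auto
  ultimately have "9 = ex0 (Suc 0) a + 3 * ex0 2 a + 7 * ex0 3 a" using a(2) by linarith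
  moreover have "4 dvd ex0 (Suc 0) a" "even (ex0 2 a)" using a(1) by (auto simp: D1s_def)
  ultimately show False by presburger
qed

text \<open>The pairing only sees leading factors of degree \<open>8 + 1\<close>, and \<open>D1\<close> has none.\<close>

lemma ev_coef8_CF1:
  assumes "v \<in> KD1 f t"
  shows "ev (coef8 (CF cl (Suc 0) v)) = 0"
proof (rule additive_eqI[of "\<lambda>v. ev (coef8 (CF cl (Suc 0) v))" "\<lambda>_. 0"])
  fix m assume "m \<in> keys v"
  then have m: "m \<in> cmons cl (Suc f) t" "part0 m \<in> D1s" "part0 m \<in> M0"
    using assms unfolding CK_D1s[symmetric] by (auto simp: CK_def sp_def D1s_def)
  let ?b = "mo (part1 m)" and ?p = "coef8 (CF cl (Suc 0) (mo (part0 m)))"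
  have b: "?b \<in> CS {0}" "CF cl (Suc 0) ?b \<in> CS {0}" using CF_unit[of "part1 m" "Suc 0"] by (simp_all add: CS_mo)
  have "?b \<in> cc (Suc f) (dg (part1 m))"
    using m(1) keys_parts(2)[of m] by (auto simp: cochains_sp cmons_def)
  then have cb: "counit (CF cl (Suc 0) ?b) = ?b" using counit_CF1 by simp
  have S: "Sq1 ?b = 0" using counit_CS_0[OF b(1)] Sq_SH(1)[of 0] by metis
  have "mo (part0 m) \<in> KG 0 (dg (part0 m))" by (rule M0_KG[OF m(3)])
  then have "?p \<in> cc (Suc 0) (dg (part0 m) - 8)" using CF1_KG coef8_cc by force
  then have "ev ?p \<in> cc 0 (dg (part0 m) - 8 - 1)" by (rule ev_cc)
  then have "ev ?p = 0" using cc_no_factors[of _ "dg (part0 m) - 8 - 1"] D1s_9[OF m(2)] by auto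
  moreover have "coef8 (CF cl (Suc 0) (mo m)) = ?p * ?b"
    by (subst mo_parts) (simp add: psubst_mult coef8_mult[OF b(2)] cb[simplified])
  ultimately show "ev (coef8 (CF cl (Suc 0) (mo m))) = 0"
    by (simp add: ev_def Sq1_mult S psubst_mult)
qed (simp_all add: additive_def coef8_add ev_add psubst_add)

lemma period_not_bdry:
  assumes "v \<in> KD1 3 12"
  shows "dd 3 v \<noteq> period q"
proof
  assume eq: "dd 3 v = period q"
  let ?u = "coef8 v"
  have v: "v \<in> KG 3 12" using assms by (simp add: KD1_def)
  have u: "?u \<in> cc (Suc (Suc (Suc 0))) 4" using coef8_cc[OF v] by (simp add: numeral_3_eq_3)
  have eu: "ev ?u \<in> cc (Suc (Suc 0)) 3" using ev_cc[OF u] by simp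
  have eeu: "ev (ev ?u) \<in> cc (Suc 0) 2" using ev_cc[OF eu] by simp
  have eeeu: "ev (ev (ev ?u)) = 0" using ev_cc[OF eeu] cc_no_factors[of _ 1] by simp
  have "dd 3 v = CF cl (Suc 0) v + CF cl (Suc (Suc 0)) v + CF cl (Suc (Suc (Suc 0))) v
      + CF cl (Suc (Suc (Suc (Suc 0)))) v + CF cl (Suc (Suc (Suc (Suc (Suc 0))))) v"
    by (simp add: dd_def DD_def numeral_3_eq_3 add_ac)
  then have "h04 = coef8 (CF cl (Suc 0) v) + CF cl (Suc 0) ?u + CF cl (Suc (Suc 0)) ?u
      + CF cl (Suc (Suc (Suc 0))) ?u + CF cl (Suc (Suc (Suc (Suc 0)))) ?u"
    using arg_cong[OF eq, of coef8] by (simp add: coef8_period coef8_add coef8_CF[OF v])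
  then have "ev (ev (ev (ev h04))) = ev (ev (ev (ev (coef8 (CF cl (Suc 0) v) + CF cl (Suc 0) ?u
      + CF cl (Suc (Suc 0)) ?u + CF cl (Suc (Suc (Suc 0))) ?u + CF cl (Suc (Suc (Suc (Suc 0)))) ?u))))"
    by (rule arg_cong)
  also have "\<dots> = 0"
    by (simp add: ev_add ev_coef8_CF1[OF assms] ev_CF ev_ev_CF1[OF u] ev_ev_CF1[OF eu] ev_ev_CF1[OF eeu] eeeu)
  finally have "ev (ev (ev (ev h04))) = 0" .
  moreover have "ev (ev (ev (ev h04))) = 1"
    using ev_xx[of 1] by (simp add: h04_def cup_def ev_xx)
  ultimately show False by simp
qed

subsection \<open>Multiplication by the periodicity class\<close>

lemma cc_degree_0:
  assumes "z \<in> cc f 0"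
  shows "z = 0 \<or> z = 1"
proof -
  have "m = 0" if m: "m \<in> cmons cl f 0" for m
  proof -
    have "(\<Sum>_<lookup m v. vdeg cl v) = 0" if v: "v \<in> keys m" for v
    proof -
      have nn: "0 \<le> (\<Sum>_<lookup m v. vdeg cl v)" if "v \<in> keys m" for v
        using m that by (intro sum_nonneg) (auto simp: cmons_def dest!: subsetD)
      moreover have "(\<Sum>v\<in>keys m. \<Sum>_<lookup m v. vdeg cl v) = 0"
        using m by (simp add: cmons_def mdegree_def)
      ultimately show ?thesis using v sum_nonneg_eq_0_iff[of "keys m" "\<lambda>v. \<Sum>_<lookup m v. vdeg cl v"] by simp
    qed
    moreover have "vdeg cl v \<ge> 1" if v: "v \<in> keys m" for v
    proof -
      obtain p n where "v = Factor p n" "n \<ge> 1" using m v by (auto simp: cmons_def)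
      moreover have "(2::int) ^ n \<ge> 2 ^ 1" using \<open>n \<ge> 1\<close> by (intro power_increasing) auto
      ultimately show ?thesis by simp
    qed
    ultimately have "v \<notin> keys m" for v by (force simp: in_keys_iff)
    then show ?thesis by (simp add: poly_mapping_eqI in_keys_iff)
  qed
  then have "keys z \<subseteq> {0}" using assms by (auto simp: cochains_sp sp_def)
  then have "keys z = {} \<or> keys z = {0}" by blast
  then show ?thesis using fpoly_keys_eqI[of z "mo 0"] fpoly_keys_eqI[of z 0] by auto
qed

lemma KG_exactD:
  assumes "z \<in> KG (Suc f) t" "dd (Suc f) z = 0"
  obtains y where "y \<in> KG f t" "z = dd f y"
  using exact_SucD[OF exact_KG assms] by auto

lemma KD_exactD:
  assumes "z \<in> KD (Suc f) t" "dd (Suc f) z = 0" "t \<noteq> int (Suc f)"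
  obtains y where "y \<in> KD f t" "z = dd f y"
  using exact_SucD[OF exact_KD[OF assms(3)] assms(1,2)] by auto

text \<open>Splicing the four short exact sequences through which \<open>KD1\<close> is periodic, the periodicity
  class corresponds to the unit.\<close>

lemma period_zigzag:
  assumes q: "q \<in> cc 4 12" "cobar_d cl 4 q = cup (Suc 0) (xx ^ 8) h04"
  obtains y0 y2 y4 y6 where "y0 \<in> KD 3 12" "period q = dd 3 y0"
    "y2 \<in> KG 2 10" "Sq2 y0 = dd 2 y2" "y4 \<in> KG 1 8" "Sq2 y2 = dd 1 y4"
    "y6 \<in> KD 0 5" "Sq1 (Sq2 y4) = dd 0 y6" "Sq2 (Sq1 (Sq2 y6)) = 1"
proof -
  let ?w = "period q"
  have w: "?w \<in> KD 4 12" "Sq2 ?w = 0" "dd 4 ?w = 0"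
    using period_KD1[OF q(1)] dd_period[OF q(2)] by (simp_all add: KD1_def KD_def)
  obtain y0 where y0: "y0 \<in> KD 3 12" "?w = dd 3 y0"
    using KD_exactD[of ?w 3 12] w by auto
  have "Sq2 y0 \<in> KG (Suc 2) 10" "dd (Suc 2) (Sq2 y0) = 0"
    using F.G_s(2)[OF KD_KG[OF y0(1)]] Sq_dd(2)[of 3 y0] y0(2) w(2) by simp_all
  then obtain y2 where y2: "y2 \<in> KG 2 10" "Sq2 y0 = dd 2 y2" using KG_exactD by blast
  have S0: "Sq1 y0 = 0" using y0(1) by (simp add: KD_def)
  have "Sq2 y2 \<in> KG (Suc 1) 8" "dd (Suc 1) (Sq2 y2) = 0"
    using F.G_s(2)[OF y2(1)] Sq_dd(2)[of 2 y2] y2(2) Sq2_Sq2[of y0] S0 by (simp_all add: numeral_2_eq_2)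
  then obtain y4 where y4: "y4 \<in> KG 1 8" "Sq2 y2 = dd 1 y4" using KG_exactD by blast
  have "Sq1 (Sq2 y4) \<in> KD (Suc 0) 5" "dd (Suc 0) (Sq1 (Sq2 y4)) = 0"
    using F.G_s(1)[OF F.G_s(2)[OF y4(1)]] arg_cong[OF y4(2), of "\<lambda>z. Sq1 (Sq2 z)"] Sq2_Sq2[of y2]
    by (simp_all add: KD_def Sq_dd)
  then obtain y6 where y6: "y6 \<in> KD 0 5" "Sq1 (Sq2 y4) = dd 0 y6" using KD_exactD[of _ 0 5] by auto
  have "Sq2 (Sq1 (Sq2 y6)) \<in> KG 0 0"
    using F.G_s(2)[OF F.G_s(1)[OF F.G_s(2)[OF KD_KG[OF y6(1)]]]] by simp
  then have "Sq2 (Sq1 (Sq2 y6)) = 0 \<or> Sq2 (Sq1 (Sq2 y6)) = 1" using cc_degree_0 by (simp add: KG_def)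
  moreover have "Sq2 (Sq1 (Sq2 y6)) \<noteq> 0"
  \<comment> \<open>Otherwise the chain of choices can be corrected so that \<open>y0\<close> lies in \<open>KD1\<close>.\<close>
  proof
    assume "Sq2 (Sq1 (Sq2 y6)) = 0"
    then obtain g where g: "g \<in> KG 0 8" "Sq1 (Sq2 g) = y6"
      using F.pre3[OF KD_KG[OF y6(1)]] y6(1) by (auto simp: KD_def)
    have "Sq1 (Sq2 (y4 + dd 0 g)) = 0" by (simp add: Sq2_add Sq1_add Sq_dd g(2) y6(2))
    moreover have "y4 + dd 0 g \<in> KG 1 8" using KG_add[OF y4(1)] KG_dd[OF g(1)] by simp
    ultimately obtain g' where g': "g' \<in> KG 1 10" "Sq2 g' = y4 + dd 0 g"
      using F.pre2'[of "y4 + dd 0 g" 1 8] by auto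
    have "Sq2 (y2 + dd 1 g') = 0"
      using dd_dd[of 0 g] by (simp add: Sq2_add Sq_dd g'(2) y4(2) dd_add)
    moreover have "y2 + dd 1 g' \<in> KG 2 10" using KG_add[OF y2(1)] KG_dd[OF g'(1)] by (simp add: numeral_2_eq_2)
    ultimately obtain g'' where g'': "g'' \<in> KG 2 12" "Sq1 g'' = 0" "Sq2 g'' = y2 + dd 1 g'"
      using F.pre2[of "y2 + dd 1 g'" 2 10] by auto
    have "y0 + dd 2 g'' \<in> KG 3 12" using KG_add[OF KD_KG[OF y0(1)]] KG_dd[OF g''(1)] by (simp add: numeral_3_eq_3)
    then have "y0 + dd 2 g'' \<in> KD1 3 12"
      using dd_dd[of 1 g'] by (simp add: KD1_def Sq1_add Sq2_add Sq_dd S0 g'' y2(2) dd_add numeral_2_eq_2)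
    moreover have "dd 3 (y0 + dd 2 g'') = ?w"
      using dd_dd[of 2 g''] y0(2) by (simp add: dd_add numeral_3_eq_3 numeral_2_eq_2)
    ultimately show False using period_not_bdry by blast
  qed
  ultimately show ?thesis using that y0 y2 y4 y6 by blast
qed

text \<open>Hence the connecting homomorphisms of these sequences undo the multiplication by the
  periodicity class.\<close>

lemma period_mult_injective:
  assumes q: "q \<in> cc 4 12" "cobar_d cl 4 q = cup (Suc 0) (xx ^ 8) h04"
    and c: "c \<in> cc (Suc e) t" "cobar_d cl (Suc e) c = 0" and t: "t + 12 \<noteq> int e + 4" "t + 5 \<noteq> int e + 1"
    and y: "y \<in> KD1 (Suc (Suc (Suc (Suc e)))) (t + 12)" "cup 5 (period q) c = dd (Suc (Suc (Suc (Suc e)))) y"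
  shows "\<exists>v\<in>KD1 e t. SH (Suc 0) c = dd e v"
proof -
  obtain y0 y2 y4 y6 where z: "y0 \<in> KD 3 12" "period q = dd 3 y0"
    "y2 \<in> KG 2 10" "Sq2 y0 = dd 2 y2" "y4 \<in> KG 1 8" "Sq2 y2 = dd 1 y4"
    "y6 \<in> KD 0 5" "Sq1 (Sq2 y4) = dd 0 y6" "Sq2 (Sq1 (Sq2 y6)) = 1"
    using period_zigzag[OF q] by blast
  have d: "dd (Suc (f + e)) (cup (Suc f) a c) = cup (Suc (Suc f)) (dd f a) c" if "a \<in> KG f u" for f a u
    using dd_cup[OF that, of "Suc e" c] by (simp add: c(2))
  have d3: "dd (Suc (Suc (Suc (Suc e)))) (cup 4 y0 c) = cup 5 (period q) c"
    using d[OF KD_KG[OF z(1)]] by (simp add: z(2) eval_nat_numeral)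
  have d2: "dd (Suc (Suc (Suc e))) (cup 3 y2 c) = cup 4 (Sq2 y0) c"
    using d[OF z(3)] by (simp add: z(4) eval_nat_numeral)
  have d1: "dd (Suc (Suc e)) (cup 2 y4 c) = cup 3 (Sq2 y2) c"
    using d[OF z(5)] by (simp add: z(6) eval_nat_numeral)
  have d0: "dd (Suc e) (cup 1 y6 c) = cup 2 (Sq1 (Sq2 y4)) c"
    using d[OF KD_KG[OF z(7)]] by (simp add: z(8) eval_nat_numeral)
  have k3: "cup 4 y0 c \<in> KD (Suc (Suc (Suc (Suc e)))) (t + 12)"
    using KD_cup[OF z(1) c(1)] by (simp add: eval_nat_numeral add.commute)
  have k2: "cup 3 y2 c \<in> KG (Suc (Suc (Suc e))) (t + 10)"
    using KG_cup[OF z(3) c(1)] by (simp add: eval_nat_numeral add.commute)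
  have k1: "cup 2 y4 c \<in> KG (Suc (Suc e)) (t + 8)"
    using KG_cup[OF z(5) c(1)] by (simp add: eval_nat_numeral add.commute)
  have k0: "cup 1 y6 c \<in> KD (Suc e) (t + 5)"
    using KD_cup[OF z(7) c(1)] by (simp add: add.commute)
  have Sc: "Sq1 (cup n a c) = cup n (Sq1 a) c" "Sq2 (cup n a c) = cup n (Sq2 a) c" if "n \<ge> 1" for n a
    using Sq_cup[of "n - 1"] that by simp_all
  have "y + cup 4 y0 c \<in> KD (Suc (Suc (Suc (Suc e)))) (t + 12)"
    using KD1_KD[OF y(1)] k3 by (simp add: KD_def KG_add Sq1_add)
  moreover have "dd (Suc (Suc (Suc (Suc e)))) (y + cup 4 y0 c) = 0" by (simp only: dd_add d3 y(2) fpoly_add_self)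
  moreover have "t + 12 \<noteq> int (Suc (Suc (Suc (Suc e))))" using t(1) by simp
  ultimately obtain b0 where b0: "b0 \<in> KD (Suc (Suc (Suc e))) (t + 12)" "y + cup 4 y0 c = dd (Suc (Suc (Suc e))) b0"
    by (rule KD_exactD)
  have S0: "Sq1 b0 = 0" using b0(1) by (simp add: KD_def)
  have "cup 4 (Sq2 y0) c = dd (Suc (Suc (Suc e))) (Sq2 b0)"
    using arg_cong[OF b0(2), of Sq2] y(1) by (simp add: Sq2_add Sq_dd Sc KD1_def)
  moreover have "Sq2 b0 \<in> KG (Suc (Suc (Suc e))) (t + 10)" using F.G_s(2)[OF KD_KG[OF b0(1)]] by (simp add: add.commute)
  ultimately have "Sq2 b0 + cup 3 y2 c \<in> KG (Suc (Suc (Suc e))) (t + 10)"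
    "dd (Suc (Suc (Suc e))) (Sq2 b0 + cup 3 y2 c) = 0" using k2 d2 by (simp_all add: dd_add KG_add)
  then obtain b2 where b2: "b2 \<in> KG (Suc (Suc e)) (t + 10)" "Sq2 b0 + cup 3 y2 c = dd (Suc (Suc e)) b2"
    by (rule KG_exactD)
  have "cup 3 (Sq2 y2) c = dd (Suc (Suc e)) (Sq2 b2)"
    using arg_cong[OF b2(2), of Sq2] Sq2_Sq2[of b0] S0 by (simp add: Sq2_add Sq_dd Sc)
  moreover have "Sq2 b2 \<in> KG (Suc (Suc e)) (t + 8)" using F.G_s(2)[OF b2(1)] by (simp add: add.commute)
  ultimately have "Sq2 b2 + cup 2 y4 c \<in> KG (Suc (Suc e)) (t + 8)"
    "dd (Suc (Suc e)) (Sq2 b2 + cup 2 y4 c) = 0" using k1 d1 by (simp_all add: dd_add KG_add)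
  then obtain b4 where b4: "b4 \<in> KG (Suc e) (t + 8)" "Sq2 b2 + cup 2 y4 c = dd (Suc e) b4"
    by (rule KG_exactD)
  have "cup 2 (Sq1 (Sq2 y4)) c = dd (Suc e) (Sq1 (Sq2 b4))"
    using arg_cong[OF b4(2), of "\<lambda>z. Sq1 (Sq2 z)"] Sq2_Sq2[of b2] by (simp add: Sq1_add Sq2_add Sq_dd Sc)
  moreover have "Sq1 (Sq2 b4) \<in> KD (Suc e) (t + 5)"
    using F.G_s(1)[OF F.G_s(2)[OF b4(1)]] by (simp add: KD_def add.commute)
  ultimately have "Sq1 (Sq2 b4) + cup 1 y6 c \<in> KD (Suc e) (t + 5)"
    "dd (Suc e) (Sq1 (Sq2 b4) + cup 1 y6 c) = 0"
    using k0 d0 by (simp_all add: dd_add KG_add KD_def Sq1_add)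
  moreover have "t + 5 \<noteq> int (Suc e)" using t(2) by simp
  ultimately obtain b6 where b6: "b6 \<in> KD e (t + 5)" "Sq1 (Sq2 b4) + cup 1 y6 c = dd e b6"
    by (rule KD_exactD)
  let ?v = "Sq2 (Sq1 (Sq2 b6))"
  have "Sq2 (Sq1 (Sq2 (Sq1 (Sq2 b4)))) = 0" using F.s5_s3 by blast
  moreover have "cup 1 (1 :: (unit, nat) tvar fpoly) c = SH (Suc 0) c" by (simp add: cup_def)
  ultimately have "SH (Suc 0) c = dd e ?v"
    using arg_cong[OF b6(2), of "\<lambda>z. Sq2 (Sq1 (Sq2 z))"] by (simp add: Sq1_add Sq2_add Sq_dd Sc z(9))
  moreover have "?v \<in> KG e t" using F.G_s(2)[OF F.G_s(1)[OF F.G_s(2)[OF KD_KG[OF b6(1)]]]] by simp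
  then have "?v \<in> KD1 e t" using F.s5_D1[of b6] b6(1) by (simp add: KD1_def KD_def)
  ultimately show ?thesis by blast
qed

section \<open>The Adams periodicity operator\<close>

text \<open>Cocycles representing the iterates of \<open>P\<close> on \<open>h\<^sub>1\<close>, where \<open>q\<close> is a fixed null homotopy of \<open>h\<^sub>0\<^sup>4 h\<^sub>3\<close>
  and \<open>p\<close> one of the product with \<open>h\<^sub>0\<^sup>4\<close>.\<close>

inductive periodic :: "(unit, nat) tvar fpoly \<Rightarrow> nat \<Rightarrow> (unit, nat) tvar fpoly \<Rightarrow> bool" for q where
  zero: "periodic q 0 (xx ^ 2)"
| Suc: "periodic q k x \<Longrightarrow> p \<in> cc (4 * k + 4) (12 * int k + 6)
    \<Longrightarrow> cobar_d cl (4 * k + 4) p = cup (4 * k + 1) x h04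
    \<Longrightarrow> periodic q (Suc k) (cup (4 * k + 4) p (xx ^ 8) + cup (4 * k + 1) x q)"

lemma d_cup: "x \<in> cc f t \<Longrightarrow>
    cobar_d cl (f + g) (cup f x y) = cup (Suc f) (cobar_d cl f x) y + cup f x (cobar_d cl g y)"
  by (rule cobar_d_cup[OF cochains_below])

lemma d_0 [simp]: "cobar_d cl f 0 = 0"
  by (simp add: cobar_d_DD)

lemma d_add: "cobar_d cl f (x + y) = cobar_d cl f x + cobar_d cl f y"
  by (simp add: cobar_d_DD DD_add)

lemma bracket_cocycle:
  assumes x: "x \<in> cc f t" "cobar_d cl f x = 0"
    and p: "p \<in> cc (f + 3) (t + 4)" "cobar_d cl (f + 3) p = cup f x h04"
    and q: "q \<in> cc 4 12" "cobar_d cl 4 q = cup 4 h04 (xx ^ 8)"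
  shows "cup (f + 3) p (xx ^ 8) + cup f x q \<in> cc (f + 4) (t + 12)"
    "cobar_d cl (f + 4) (cup (f + 3) p (xx ^ 8) + cup f x q) = 0"
proof -
  have "cup (f + 3) p (xx ^ 8) \<in> cc (f + 4) (t + 12)"
    using cup_cochains[OF p(1) xx_cc(1)[of 8]] by (simp add: add.assoc add.commute[of 4 f])
  moreover have "cup f x q \<in> cc (f + 4) (t + 12)" by (rule cup_cochains[OF x(1) q(1)])
  ultimately show "cup (f + 3) p (xx ^ 8) + cup f x q \<in> cc (f + 4) (t + 12)" by (rule cochains_add)
  have "cobar_d cl (f + 3 + Suc 0) (cup (f + 3) p (xx ^ 8)) = cup (f + 4) (cup f x h04) (xx ^ 8)"
    unfolding d_cup[OF p(1)] p(2) xx_closed_8 by (simp add: add.commute)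
  moreover have "f + 3 + Suc 0 = f + 4" by simp
  ultimately have "cobar_d cl (f + 4) (cup (f + 3) p (xx ^ 8)) = cup f x (cup 4 h04 (xx ^ 8))"
    by (simp only: cup_assoc)
  then show "cobar_d cl (f + 4) (cup (f + 3) p (xx ^ 8) + cup f x q) = 0"
    by (simp add: d_add d_cup[OF x(1)] x(2) q(2))
qed

lemma periodic_cocycle:
  assumes q: "q \<in> cc 4 12" "cobar_d cl 4 q = cup 4 h04 (xx ^ 8)" and x: "periodic q k x"
  shows "x \<in> cc (4 * k + 1) (12 * int k + 2)" "cobar_d cl (4 * k + 1) x = 0"
  using x
proof induction
  case zero
  show "xx ^ 2 \<in> cc (4 * 0 + 1) (12 * int 0 + 2)" "cobar_d cl (4 * 0 + 1) (xx ^ 2) = 0"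
    using xx_cc(1)[of 2] xx_closed_2 by simp_all
next
  case (Suc k x p)
  have e: "4 * k + 1 + 3 = 4 * k + 4" "4 * k + 1 + 4 = 4 * Suc k + 1"
    "12 * int k + 2 + 4 = 12 * int k + 6" "12 * int k + 2 + 12 = 12 * int (Suc k) + 2" by simp_all
  show "cup (4 * k + 4) p (xx ^ 8) + cup (4 * k + 1) x q \<in> cc (4 * Suc k + 1) (12 * int (Suc k) + 2)"
    "cobar_d cl (4 * Suc k + 1) (cup (4 * k + 4) p (xx ^ 8) + cup (4 * k + 1) x q) = 0"
    using bracket_cocycle[OF Suc.IH _ _ q, of p, unfolded e] Suc.hyps by blast+
qed

subsection \<open>The Massey product\<close>

lemma cl_h_xx: "cl_h j = ext_class cl (Suc 0) (2 ^ j) (xx ^ (2 ^ j))"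
  by (simp add: cl_h_def cl_xi_def)

lemma cl_h0_4_h04: "cl_h0_4 = ext_class cl 4 4 h04"
proof -
  have h: "cl_h 0 = ext_class cl (Suc 0) 1 xx" by (simp add: cl_h_xx)
  have d1: "cobar_d cl (Suc 0) xx = 0" using xx_closed[of 0] by simp
  have 2: "cup (Suc 0) xx xx \<in> cc (Suc 0 + Suc 0) (1 + 1)"
    "cobar_d cl (Suc 0 + Suc 0) (cup (Suc 0) xx xx) = 0"
    by (rule cup_cochains[OF xx_cc(2) xx_cc(2)], rule cup_cocycle[OF xx_cc(2) d1 d1])
  have 3: "cup (Suc 0) xx (cup (Suc 0) xx xx) \<in> cc (Suc 0 + (Suc 0 + Suc 0)) (1 + (1 + 1))"
    "cobar_d cl (Suc 0 + (Suc 0 + Suc 0)) (cup (Suc 0) xx (cup (Suc 0) xx xx)) = 0"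
    by (rule cup_cochains[OF xx_cc(2) 2(1)], rule cup_cocycle[OF xx_cc(2) d1 2(2)])
  have "cl_h0_4 = ext_class cl (Suc 0 + (Suc 0 + (Suc 0 + Suc 0))) (1 + (1 + (1 + 1))) h04"
    unfolding cl_h0_4_def h h04_def
    by (simp only: ext_mult_class[OF bialg_cl rigid_cl rigid_cl rigid_cl xx_cc(2) d1 xx_cc(2) d1]
        ext_mult_class[OF bialg_cl rigid_cl rigid_cl rigid_cl xx_cc(2) d1 2]
        ext_mult_class[OF bialg_cl rigid_cl rigid_cl rigid_cl xx_cc(2) d1 3])
  then show ?thesis by (simp add: eval_nat_numeral)
qed

lemma null_cl [simp]: "null cl f = {0}"
  by (auto simp: null_def ideal_generated_def)

lemma bdryE:
  assumes "bdry cl (Suc f) t z"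
  obtains y where "y \<in> cc f t" "z = cobar_d cl f y"
  using assms by (auto simp: bdry_def)

text \<open>The indeterminacy of \<open>\<langle>x, h\<^sub>0\<^sup>4, h\<^sub>3\<rangle>\<close> comes from the choices of the two null homotopies, and
  these are unique up to coboundaries as soon as the two groups in question vanish.\<close>

lemma massey_unique:
  assumes x: "x \<in> cc (Suc e) t" "cobar_d cl (Suc e) x = 0"
    and p: "p \<in> cc (e + 4) (t + 4)" "cobar_d cl (e + 4) p = cup (Suc e) x h04"
    and q: "q \<in> cc 4 12" "cobar_d cl 4 q = cup 4 h04 (xx ^ 8)"
    and vanish: "\<And>r. r \<in> cc (e + 4) (t + 4) \<Longrightarrow> cobar_d cl (e + 4) r = 0 \<Longrightarrow> bdry cl (e + 4) (t + 4) r"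
      "\<And>r. r \<in> cc 4 12 \<Longrightarrow> cobar_d cl 4 r = 0 \<Longrightarrow> bdry cl 4 12 r"
  shows "massey cl (ext_class cl (Suc e) t x) cl_h0_4 (cl_h 3)
    = {ext_class cl (e + 5) (t + 12) (cup (e + 4) p (xx ^ 8) + cup (Suc e) x q)}" (is "?M = {?E}")
proof -
  have e: "Suc e + 3 = e + 4" "Suc e + 4 = e + 5" "e + 4 + Suc 0 = e + 5" "e + 3 + Suc 0 = e + 4"
    "Suc (e + 3) = e + 4" "Suc (e + 4) = e + 5" "3 + Suc 0 = (4::nat)" "4 + Suc 0 = (5::nat)" "Suc 3 = (4::nat)"
    "t + 4 + 8 = t + 12" "(4::int) + 8 = 12"
    by simp_all
  have E: "cup (e + 4) p (xx ^ 8) + cup (Suc e) x q \<in> cc (e + 5) (t + 12)"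
    using bracket_cocycle(1)[of x "Suc e" t p q] x p q unfolding e by blast
  have M: "?M = {ext_class cl (e + 5) (t + 12) (cup (e + 4) p' z' + cup (Suc e) x' q') | x' y' z' p' q'.
        bdry cl (Suc e) t (x' + x) \<and> bdry cl 4 4 (y' + h04) \<and> bdry cl (Suc 0) 8 (z' + xx ^ 8) \<and>
        p' \<in> cc (e + 4) (t + 4) \<and> cobar_d cl (e + 4) p' = cup (Suc e) x' y' \<and>
        q' \<in> cc 4 12 \<and> cobar_d cl 4 q' = cup 4 y' z'}"
  proof -
    have h3: "cl_h 3 = ext_class cl (Suc 0) 8 (xx ^ 8)" using cl_h_xx[of 3] by simp
    have e': "Suc e + 4 + Suc 0 - 1 = e + 5" "Suc e + 4 - 1 = e + 4" "4 + Suc 0 - 1 = (4::nat)"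
      "t + 4 + 8 = t + 12" "(4::int) + 8 = 12" by simp_all
    show ?thesis
      unfolding cl_h0_4_h04 h3 ext_class_rigid[OF bialg_cl rigid_cl x(1)]
        ext_class_rigid[OF bialg_cl rigid_cl h04_cc] ext_class_rigid[OF bialg_cl rigid_cl xx_cc(1)[of 8, simplified]]
        massey.simps e' null_cl mem_Collect_eq singleton_iff fpoly_diff fpoly_add_eq_0_iff ..
  qed
  have "ext_class cl (e + 5) (t + 12) (cup (e + 4) p' z' + cup (Suc e) x' q') = ?E"
    if x': "bdry cl (Suc e) t (x' + x)" and y': "bdry cl 4 4 (y' + h04)" and z': "bdry cl (Suc 0) 8 (z' + xx ^ 8)"
      and p': "p' \<in> cc (e + 4) (t + 4)" "cobar_d cl (e + 4) p' = cup (Suc e) x' y'"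
      and q': "q' \<in> cc 4 12" "cobar_d cl 4 q' = cup 4 y' z'" for x' y' z' p' q'
  proof -
    obtain a where a: "a \<in> cc e t" "x' + x = cobar_d cl e a" using bdryE[OF x'] by blast
    obtain b where b: "b \<in> cc 3 4" "y' + h04 = cobar_d cl 3 b"
      using bdryE[of 3 4 "y' + h04"] y' by auto
    obtain c where "c \<in> cc 0 8" "z' + xx ^ 8 = cobar_d cl 0 c" using bdryE[OF z'] by blast
    then have "z' + xx ^ 8 = 0" using cc_no_factors[of c 8] by simp
    then have z: "z' = xx ^ 8" by (simp add: fpoly_add_eq_0_iff)
    have xd: "x' = x + cobar_d cl e a" using a(2) by (metis add.commute fpoly_add_self_left)
    have yd: "y' = h04 + cobar_d cl 3 b" using b(2) by (metis add.commute fpoly_add_self_left)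
    have cy: "y' \<in> cc 4 4" "cobar_d cl 4 y' = 0"
      using bdry_closed[OF bialg_cl y'] bdry_cochains[OF bialg_cl y'] cochains_add[of "y' + h04" cl 4 4 h04] h04_cc
      by (simp_all add: d_add h04_closed add.assoc)
    have dxb: "cobar_d cl (e + 4) (cup (Suc e) x b) = cup (Suc e) x (cobar_d cl 3 b)"
      using d_cup[OF x(1), of 3 b] unfolding e x(2) by simp
    have day: "cobar_d cl (e + 4) (cup e a y') = cup (Suc e) (cobar_d cl e a) y'"
      using d_cup[OF a(1), of 4 y'] by (simp add: cy)
    have daq: "cobar_d cl (e + 4) (cup e a q') = cup (Suc e) (cobar_d cl e a) q' + cup e a (cup 4 y' (xx ^ 8))"
      using d_cup[OF a(1), of 4 q'] by (simp add: q'(2) z)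
    have dbz: "cobar_d cl 4 (cup 3 b (xx ^ 8)) = cup 4 (cobar_d cl 3 b) (xx ^ 8)"
      using d_cup[OF b(1), of "Suc 0" "xx ^ 8"] unfolding e xx_closed_8 by simp
    \<comment> \<open>The null homotopies \<open>p'\<close> and \<open>q'\<close>, transported back to the representatives \<open>x\<close>, \<open>h04\<close> and \<open>\<xi>\<^sub>1\<^sup>8\<close>.\<close>
    let ?p = "p' + cup e a y' + cup (Suc e) x b" and ?q = "q' + cup 3 b (xx ^ 8)"
    have cp: "?p \<in> cc (e + 4) (t + 4)"
      using p'(1) cup_cochains[OF a(1) cy(1)] cup_cochains[OF x(1) b(1)] unfolding e
      by (intro cochains_add)
    have cq: "?q \<in> cc 4 12"
      using q'(1) cup_cochains[OF b(1) xx_cc(1)[of 8]] by (simp add: cochains_add)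
    have "cobar_d cl (e + 4) (?p + p) = 0"
      unfolding d_add day dxb p'(2) p(2) xd by (simp add: cup_add yd add_ac)
    then obtain r where r: "r \<in> cc (e + 3) (t + 4)" "?p + p = cobar_d cl (e + 3) r"
      using vanish(1)[of "?p + p"] cochains_add[OF cp p(1)] bdryE[of "e + 3" "t + 4" "?p + p"]
      unfolding e by blast
    have "cobar_d cl 4 (?q + q) = 0"
      unfolding d_add dbz q'(2) q(2) z yd by (simp add: cup_add add_ac)
    then obtain s where s: "s \<in> cc 3 12" "?q + q = cobar_d cl 3 s"
      using vanish(2)[of "?q + q"] cochains_add[OF cq q(1)] bdryE[of 3 12 "?q + q"]
      unfolding e by blast
    have dr: "cobar_d cl (e + 4) (cup (e + 3) r (xx ^ 8)) = cup (e + 4) (?p + p) (xx ^ 8)"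
      using d_cup[OF r(1), of "Suc 0" "xx ^ 8"] unfolding e xx_closed_8 r(2)[symmetric] by simp
    have ds: "cobar_d cl (e + 4) (cup (Suc e) x s) = cup (Suc e) x (?q + q)"
      using d_cup[OF x(1), of 3 s] unfolding e x(2) s(2)[symmetric] by simp
    let ?Y = "cup (e + 3) r (xx ^ 8) + cup (Suc e) x s + cup e a q'"
    have as1: "cup (e + 4) (cup e a y') (xx ^ 8) = cup e a (cup 4 y' (xx ^ 8))" by (rule cup_assoc)
    have as2: "cup (e + 4) (cup (Suc e) x b) (xx ^ 8) = cup (Suc e) x (cup 3 b (xx ^ 8))"
      using cup_assoc[of "Suc e" 3 x b "xx ^ 8"] unfolding e .
    have "cup (e + 4) p' z' + cup (Suc e) x' q' + (cup (e + 4) p (xx ^ 8) + cup (Suc e) x q)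
        = cobar_d cl (e + 4) ?Y"
      unfolding d_add dr ds daq z unfolding xd cup_add as1 as2 by (simp add: add_ac)
    moreover have "?Y \<in> cc (e + 4) (t + 12)"
      using cup_cochains[OF r(1) xx_cc(1)[of 8]] cup_cochains[OF x(1) s(1)] cup_cochains[OF a(1) q'(1)]
      unfolding e of_nat_numeral by (intro cochains_add)
    ultimately have B: "bdry cl (e + 5) (t + 12)
        (cup (e + 4) p' z' + cup (Suc e) x' q' + (cup (e + 4) p (xx ^ 8) + cup (Suc e) x q))"
      using bdry_d[of ?Y cl "e + 4" "t + 12"] unfolding e by simp
    then have "cup (e + 4) p' z' + cup (Suc e) x' q' \<in> cc (e + 5) (t + 12)"
      using cochains_add[OF bdry_cochains[OF bialg_cl B] E] by (simp add: add.assoc)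
    then show ?thesis using B E by (simp add: ext_class_eq_iff[OF bialg_cl rigid_cl])
  qed
  then have "?M \<subseteq> {?E}" unfolding M by blast
  moreover have "?E \<in> ?M"
    unfolding M mem_Collect_eq
    by (rule exI[of _ x], rule exI[of _ h04], rule exI[of _ "xx ^ 8"], rule exI[of _ p], rule exI[of _ q])
      (use p q in simp)
  ultimately show ?thesis by blast
qed

lemma bdry_line:
  assumes "f \<ge> 1" "t < 3 * int f - 3" "t \<noteq> int f" "r \<in> cc f t" "cobar_d cl f r = 0"
  shows "bdry cl f t r"
  by (rule exact_unit_bdry[OF H_line assms(4,5)]) (use assms in auto)

lemma bdry_4_12: "r \<in> cc 4 12 \<Longrightarrow> cobar_d cl 4 r = 0 \<Longrightarrow> bdry cl 4 12 r"
  by (rule exact_unit_bdry[OF H_4_12])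

lemma bdry_edge:
  assumes "t \<le> 12 * int k + 1" "t \<noteq> 4 * int k + 1" "r \<in> cc (4 * k + 1) t" "cobar_d cl (4 * k + 1) r = 0"
  shows "bdry cl (4 * k + 1) t r"
  by (rule exact_unit_bdry[OF H_edge assms(3,4)]) (use assms in auto)

text \<open>The product \<open>h\<^sub>0\<^sup>4 h\<^sub>3\<close> lies in a group that vanishes.\<close>

lemma h04_h3_zero: "\<exists>q\<in>cc 4 12. cobar_d cl 4 q = cup 4 h04 (xx ^ 8)"
proof -
  have "cup 4 h04 (xx ^ 8) \<in> cc (4 * 1 + 1) 12" "cobar_d cl (4 * 1 + 1) (cup 4 h04 (xx ^ 8)) = 0"
    using cup_cochains[OF h04_cc xx_cc(1)[of 8]] cup_cocycle[OF h04_cc h04_closed xx_closed_8]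
    by simp_all
  then have "bdry cl (4 * 1 + 1) 12 (cup 4 h04 (xx ^ 8))"
    by (intro bdry_edge) simp_all
  then show ?thesis by (auto simp: bdry_def)
qed

lemma Suc45: "Suc (4 * k + 4) = 4 * k + 5"
  by simp

lemma adams_P_periodic:
  assumes q: "q \<in> cc 4 12" "cobar_d cl 4 q = cup 4 h04 (xx ^ 8)"
  shows "\<exists>x. periodic q k x \<and> (adams_P ^^ k) (cl_h 1) = ext_class cl (4 * k + 1) (12 * int k + 2) x"
proof (induction k)
  case 0
  show ?case using periodic.zero[of q] cl_h_xx[of 1] by auto
next
  case (Suc k)
  then obtain x where x: "periodic q k x" "(adams_P ^^ k) (cl_h 1) = ext_class cl (4 * k + 1) (12 * int k + 2) x"
    by blast
  have cx: "x \<in> cc (Suc (4 * k)) (12 * int k + 2)" "cobar_d cl (Suc (4 * k)) x = 0"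
    using periodic_cocycle[OF q x(1)] by simp_all
  have "cup (Suc (4 * k)) x h04 \<in> cc (4 * k + 5) (12 * int k + 6)"
    using cup_cochains[OF cx(1) h04_cc] by (simp add: add.commute)
  moreover have "cobar_d cl (4 * k + 5) (cup (Suc (4 * k)) x h04) = 0"
    using cup_cocycle[OF cx h04_closed] by (simp add: add.commute)
  ultimately have "bdry cl (4 * k + 5) (12 * int k + 6) (cup (Suc (4 * k)) x h04)"
    by (intro bdry_line) simp_all
  then obtain p where p: "p \<in> cc (4 * k + 4) (12 * int k + 6)" "cobar_d cl (4 * k + 4) p = cup (Suc (4 * k)) x h04"
    using bdryE[of "4 * k + 4" _ "cup (Suc (4 * k)) x h04"] unfolding Suc45 by metis
  let ?y = "cup (4 * k + 4) p (xx ^ 8) + cup (4 * k + 1) x q"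
  have e: "12 * int k + 2 + 4 = 12 * int k + 6" by simp
  have "massey cl (ext_class cl (Suc (4 * k)) (12 * int k + 2) x) cl_h0_4 (cl_h 3)
      = {ext_class cl (4 * k + 5) (12 * int k + 2 + 12) (cup (4 * k + 4) p (xx ^ 8) + cup (Suc (4 * k)) x q)}"
    using p bdry_line[of "4 * k + 4" "12 * int k + 6"] bdry_4_12
    by (intro massey_unique[OF cx _ _ q, unfolded e]) simp_all
  then have "adams_P ((adams_P ^^ k) (cl_h 1)) = ext_class cl (4 * Suc k + 1) (12 * int (Suc k) + 2) ?y"
    unfolding adams_P_def x(2) by (simp add: add.commute)
  moreover have "periodic q (Suc k) ?y" using periodic.Suc[OF x(1) p(1)] p(2) by simp
  ultimately show ?case by auto
qed

lemma numeral_nat_plus: "Suc (Suc (Suc (Suc (4 * k + 1)))) = 4 * k + 5" "12 * int k + 4 + 12 = 12 * int k + 16"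
  by simp_all

subsection \<open>Nonvanishing of the periodicity family\<close>

text \<open>A null homotopy of \<open>h\<^sub>1\<^sup>2\<close> over \<open>A(1)\<close> would produce an element \<open>b\<close> of \<open>D\<close> with \<open>Sq2 b = \<xi>\<^sub>1\<^sup>2\<close>, although
  \<open>Sq2 Sq2\<close> vanishes on \<open>D\<close> and \<open>Sq2\<close> takes \<open>\<xi>\<^sub>1\<^sup>2\<close> to \<open>1\<close>.\<close>

lemma h1_h1_nonzero:
  assumes "v \<in> KD1 1 4"
  shows "SH (Suc 0) (cup (Suc 0) (xx ^ 2) (xx ^ 2)) \<noteq> dd 1 v"
proof
  assume eq: "SH (Suc 0) (cup (Suc 0) (xx ^ 2) (xx ^ 2)) = dd 1 v"
  let ?c = "cup (Suc 0) (xx ^ 2) (xx ^ 2)"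
  have S: "Sq1 (xx ^ 2) = 0" "Sq2 (xx ^ 2) = 1" by (simp_all add: Sq_square Sq_pvar)
  have k: "xx ^ 2 \<in> KD 0 2" using xx_cc(1)[of 2] by (simp add: KD_def KG_def S)
  have c: "?c \<in> KD 1 4" using KD_cup[OF k xx_cc(1)[of 2]] by simp
  have "dd 1 ?c = SH (Suc 0) ?c"
    using dd_cup[OF KD_KG[OF k], of "Suc 0" "xx ^ 2"] by (simp add: dd_xx_2 SH_cup xx_closed_2)
  then have "dd (Suc 0) (v + ?c) = 0" using eq by (simp add: dd_add)
  moreover have "v + ?c \<in> KD (Suc 0) 4"
    using KD1_KD[OF assms] c by (simp add: KD_def KG_add Sq1_add)
  ultimately obtain b where b: "b \<in> KD 0 4" "v + ?c = dd 0 b" using KD_exactD[of "v + ?c" 0 4] by auto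
  have "cup (Suc 0) 1 (xx ^ 2) = dd 0 (Sq2 b)"
    using arg_cong[OF b(2), of Sq2] assms by (simp add: Sq2_add Sq_dd Sq_cup S KD1_def)
  moreover have "cup (Suc 0) 1 (xx ^ 2) = dd 0 (xx ^ 2)" by (simp add: cup_def dd_xx_2)
  ultimately have "dd 0 (Sq2 b + xx ^ 2) = 0" by (simp add: dd_add)
  moreover have "Sq2 b + xx ^ 2 \<in> KG 0 2" using KG_add F.G_s(2)[OF KD_KG[OF b(1)]] KD_KG[OF k] by simp
  moreover have "exact dd KG 0 2" by (rule exact_KG) simp
  ultimately have "Sq2 b + xx ^ 2 = 0" unfolding rel_exact_0 by simp
  then have "Sq2 b = xx ^ 2" by (simp add: fpoly_add_eq_0_iff)
  then have "Sq2 (Sq2 b) = 1" by (simp add: S)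
  then show False using Sq2_Sq2[of b] b(1) by (simp add: KD_def)
qed

text \<open>With coefficients in \<open>D1\<close> the summand \<open>h\<^sub>3 p\<close> of the reversed Massey product is homologous to
  \<open>\<xi>\<^sub>1\<^sup>8 h\<^sub>0\<^sup>4\<close> times the previous cocycle, so each step multiplies by the periodicity class.\<close>

theorem periodic_h1_nonzero:
  assumes q: "q \<in> cc 4 12" "cobar_d cl 4 q = cup 4 h04 (xx ^ 8)" and x: "periodic q k x"
    and v: "v \<in> KD1 (4 * k + 1) (12 * int k + 4)"
  shows "SH (Suc 0) (cup (4 * k + 1) (flip (4 * k + 1) x) (xx ^ 2)) \<noteq> dd (4 * k + 1) v"
  using x v
proof (induction arbitrary: v)
  case zero
  then show ?case using h1_h1_nonzero[of v] by (simp add: flip_xx[simplified])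
next
  case (Suc k x p)
  let ?q = "flip 4 q" and ?x = "flip (4 * k + 1) x" and ?p = "flip (4 * k + 4) p"
  let ?c = "cup (4 * k + 1) ?x (xx ^ 2)" and ?P = "cup (4 * k + 4) ?p (xx ^ 2)"
  note xc = periodic_cocycle[OF q Suc.hyps(1)]
  have q': "?q \<in> cc 4 12" by (rule flip_cc[OF q(1)])
  have "cobar_d cl 4 ?q = flip (4 + Suc 0) (cup 4 h04 (xx ^ 8))"
    using flip_d[OF q(1)] by (simp add: q(2))
  also have "\<dots> = cup (Suc 0) (xx ^ 8) h04"
    unfolding flip_cup[OF h04_cc xx_cc(1)] flip_xx flip_h04 ..
  finally have dq': "cobar_d cl 4 ?q = cup (Suc 0) (xx ^ 8) h04" .
  have "cobar_d cl (4 * k + 4) ?p = flip (4 * k + 1 + 4) (cup (4 * k + 1) x h04)"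
    using flip_d[OF Suc.hyps(2)] unfolding Suc.hyps(3) Suc45 by (simp add: add.commute)
  also have "\<dots> = cup 4 h04 ?x" unfolding flip_cup[OF xc(1) h04_cc] flip_h04 ..
  finally have dp: "cobar_d cl (4 * k + 4) ?p = cup 4 h04 ?x" .
  have x': "?x \<in> cc (4 * k + 1) (12 * int k + 2)" "cobar_d cl (4 * k + 1) ?x = 0"
    using flip_cc[OF xc(1)] flip_d[OF xc(1)] unfolding xc(2) by simp_all
  have p': "?p \<in> cc (4 * k + 4) (12 * int k + 6)" by (rule flip_cc[OF Suc.hyps(2)])
  have c: "?c \<in> cc (Suc (4 * k + 1)) (12 * int k + 4)" "cobar_d cl (Suc (4 * k + 1)) ?c = 0"
    using cup_cochains[OF x'(1) xx_cc(1)[of 2]] cup_cocycle[OF x' xx_closed_2] by (simp_all add: add.commute)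
  have P: "?P \<in> cc (4 * k + 5) (12 * int k + 8)"
    using cup_cochains[OF p' xx_cc(1)[of 2]] by (simp add: add.commute)
  have dP: "cobar_d cl (4 * k + 5) ?P = cup 4 h04 ?c"
  proof -
    have "cobar_d cl (4 * k + 4 + Suc 0) ?P = cup (Suc (4 * k + 4)) (cup 4 h04 ?x) (xx ^ 2)"
      unfolding d_cup[OF p'] dp xx_closed_2 by simp
    moreover have "4 * k + 4 + Suc 0 = 4 * k + 5" "Suc (4 * k + 4) = 4 + (4 * k + 1)" by simp_all
    ultimately show ?thesis by (simp only: cup_assoc)
  qed
  have fx: "flip (4 * Suc k + 1) (cup (4 * k + 4) p (xx ^ 8) + cup (4 * k + 1) x q)
      = cup (Suc 0) (xx ^ 8) ?p + cup 4 ?q ?x"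
  proof -
    have e: "4 * Suc k + 1 = 4 * k + 4 + Suc 0" "4 * Suc k + 1 = 4 * k + 1 + 4" by simp_all
    show ?thesis
      unfolding psubst_add
      using flip_cup[OF Suc.hyps(2) xx_cc(1)[of 8]] flip_cup[OF xc(1) q(1)] unfolding e(1)[symmetric] e(2)[symmetric]
      by (simp only: flip_xx)
  qed
  have cc': "cup (4 * Suc k + 1) (cup (Suc 0) (xx ^ 8) ?p + cup 4 ?q ?x) (xx ^ 2)
      = cup (Suc 0) (xx ^ 8) ?P + cup 4 ?q ?c"
  proof -
    have e: "4 * Suc k + 1 = Suc 0 + (4 * k + 4)" "4 * Suc k + 1 = 4 + (4 * k + 1)" by simp_all
    show ?thesis unfolding cup_add unfolding e(1)
      using cup_assoc[of "Suc 0" "4 * k + 4" "xx ^ 8" ?p "xx ^ 2"] cup_assoc[of 4 "4 * k + 1" ?q ?x "xx ^ 2"]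
      unfolding e(2)[symmetric] unfolding e(1) by simp
  qed
  show ?case
  proof
    assume "SH (Suc 0) (cup (4 * Suc k + 1) (flip (4 * Suc k + 1)
      (cup (4 * k + 4) p (xx ^ 8) + cup (4 * k + 1) x q)) (xx ^ 2)) = dd (4 * Suc k + 1) v"
    then have eq: "SH (Suc 0) (cup (Suc 0) (xx ^ 8) ?P) + SH (Suc 0) (cup 4 ?q ?c) = dd (4 * k + 5) v"
      unfolding fx cc' by (simp add: psubst_add add.commute[of 5 "4 * k"])
    let ?y = "cup (Suc 0) (xx ^ 8) ?P + v"
    have "cup 5 (period ?q) ?c
        = cup (Suc 0) (xx ^ 8) (cup 4 h04 ?c) + SH (Suc 0) (cup 4 ?q ?c)"
      using cup_assoc[of "Suc 0" 4 "xx ^ 8" h04 ?c] by (simp add: period_def cup_add SH_cup)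
    also have "\<dots> = dd (4 * k + 5) ?y"
      unfolding dd_add dd_xx_8_cup[OF P] dP eq[symmetric] by (simp add: add_ac)
    finally have y2: "cup 5 (period ?q) ?c = dd (4 * k + 5) ?y" .
    have "cup (Suc 0) (xx ^ 8) ?P \<in> KD1 (4 * k + 5) (12 * int k + 16)"
      using KD1_cup[OF xx_8_KD1 P] by (simp add: add.commute)
    moreover have "v \<in> KD1 (4 * k + 5) (12 * int k + 16)" using Suc.prems by (simp add: add.commute)
    ultimately have "?y \<in> KD1 (4 * k + 5) (12 * int k + 16)" by (simp add: KD1_def KG_add Sq1_add Sq2_add)
    then have "\<exists>v\<in>KD1 (4 * k + 1) (12 * int k + 4). SH (Suc 0) ?c = dd (4 * k + 1) v"
      using period_mult_injective[OF q' dq' c, where y = ?y, unfolded numeral_nat_plus] y2 by simp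
    then show False using Suc.IH by blast
  qed
qed

section \<open>The motivic cobar complex in low Chow degrees\<close>

abbreviation "mot \<equiv> mot_steenrod"
abbreviation "mc \<equiv> cochains mot"
abbreviation "chow \<equiv> psubst chow_var"

lemma mot_simps [simp]:
  "scalars mot = {()}" "gens mot = range Tau \<union> Xi ` {1..}" "sdeg mot s = (0, -1)" "gdeg mot = mot_gdeg"
  "coprod mot = mot_coprod"
  "rels mot = {mot_tau 0 n ^ 2 - pvar (Scalar ()) * mot_xi 0 (n + 1) | n. True}"
  by (simp_all add: mot_steenrod_def)

lemma chow_xi [simp]: "chow (cl_xi p n) = mot_xi p n"
  by (simp add: cl_xi_def mot_xi_def psubst_pvar)

lemma chow_cop: "chow (cop p n) = (\<Sum>k\<le>n. mot_xi p (n - k) ^ (2 ^ k) * mot_xi (Suc p) k)"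
  by (simp add: cop_def psubst_sum psubst_mult psubst_power)

lemma SH_mot [simp]: "SH q (mot_xi p n) = mot_xi (q + p) n" "SH q (mot_tau p n) = mot_tau (q + p) n"
  by (simp_all add: mot_xi_def mot_tau_def psubst_pvar)

lemma SH_chow: "SH p (chow z) = chow (SH p z)"
proof (rule rhom_eqI[OF rhom_comp[OF rhom_psubst rhom_psubst] rhom_comp[OF rhom_psubst rhom_psubst]])
  show "SH p (chow (pvar v)) = chow (SH p (pvar v))" for v :: "(unit, nat) tvar"
    by (cases v) (simp_all add: psubst_pvar)
qed

lemma cup_chow: "cup f (chow x) (chow y) = chow (cup f x y)"
  by (simp add: cup_def SH_chow psubst_mult)

lemma CF_chow: "CF mot i (chow z) = chow (CF cl i z)"
proof (rule rhom_eqI[OF rhom_comp[OF rhom_psubst rhom_psubst] rhom_comp[OF rhom_psubst rhom_psubst]])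
  fix v :: "(unit, nat) tvar"
  have "CF mot i (pvar (Factor p (Xi n))) = chow (CF cl i (pvar (Factor p n)))" for p n
    by (simp add: CF_pvar psubst_pvar chow_cop psubst_sum psubst_mult psubst_power)
  then show "CF mot i (chow (pvar v)) = chow (CF cl i (pvar v))"
    by (cases v) (simp_all add: psubst_pvar[of chow_var])
qed

lemma d_chow: "cobar_d mot f (chow z) = chow (cobar_d cl f z)"
  by (simp only: cobar_d_def CF_chow psubst_sum)

lemma chow_mc: "x \<in> cc f t \<Longrightarrow> chow x \<in> mc f (2 * t, t)"
proof (rule rhom_cochains[OF rhom_psubst, where D = "\<lambda>t. (2 * t, t)"])
  fix p a assume "p < f" "a \<in> gens cl"
  then have "pvar (Factor p (Xi a)) \<in> mc f (gdeg mot (Xi a))" by (intro cochains_pvar) auto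
  then show "chow (pvar (Factor p a)) \<in> mc f (2 * gdeg cl a, gdeg cl a)"
    by (simp add: psubst_pvar algebra_simps)
qed (auto simp: zero_prod_def)

text \<open>The coproduct of \<open>\<tau>\<^sub>n\<close> in the factor \<open>p\<close>.\<close>

definition tcop :: "nat \<Rightarrow> nat \<Rightarrow> (unit, mgen) tvar fpoly" where
  "tcop p n = mot_tau p n + (\<Sum>k\<le>n. mot_xi p (n - k) ^ (2 ^ k) * mot_tau (Suc p) k)"

lemma CF_tau: "CF mot i (mot_tau p n) = (if p + 1 < i then mot_tau p n
    else if p + 1 = i then tcop p n else mot_tau (Suc p) n)"
proof -
  have "SH p (mot_coprod (Tau n)) = tcop p n"
    by (simp add: psubst_add psubst_sum psubst_mult psubst_power tcop_def)
  then show ?thesis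
    by (simp add: mot_tau_def psubst_pvar[of "coface_var _ _"] del: mot_coprod.simps)
qed

lemma mot_xi_0 [simp]: "mot_xi p 0 = 1"
  by (simp add: mot_xi_def)

lemma CF_mot_xi: "CF mot i (mot_xi p n) = chow (CF cl i (cl_xi p n))"
  using CF_chow[of i "cl_xi p n"] by simp

lemma tcop_conv: "tcop p n = mot_tau p n + conv (mot_xi p) (mot_tau (Suc p)) n"
  by (simp add: tcop_def conv_def)

lemma tcop_coassoc: "CF mot 1 (tcop 0 n) = CF mot 2 (tcop 0 n)"
proof -
  have c: "chow (cop 0 m) = conv (mot_xi 0) (mot_xi 1) m" for m by (simp add: chow_cop conv_def)
  have "CF mot 1 (tcop 0 n) = tcop 0 n + (\<Sum>k\<le>n. chow (cop 0 (n - k)) ^ (2 ^ k) * mot_tau 2 k)"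
    by (simp add: tcop_def[of 0 n] psubst_add psubst_sum psubst_mult psubst_power CF_tau CF_mot_xi CF_xi)
      (simp add: tcop_def numeral_2_eq_2)
  also have "\<dots> = tcop 0 n + conv (conv (mot_xi 0) (mot_xi 1)) (mot_tau 2) n"
    unfolding c by (simp only: conv_def[of _ "mot_tau 2"])
  also have "\<dots> = tcop 0 n + conv (mot_xi 0) (conv (mot_xi 1) (mot_tau 2)) n"
    by (simp add: conv_assoc)
  also have "\<dots> = CF mot 2 (tcop 0 n)"
    by (simp add: tcop_def[of 0 n] psubst_add psubst_sum psubst_mult psubst_power CF_tau CF_mot_xi CF_xi)
      (simp add: tcop_conv conv_def[of _ "conv _ _"] numeral_2_eq_2 distrib_left sum.distrib add_ac)
  finally show ?thesis .
qed

lemma mot_tau_mc: "p < f \<Longrightarrow> mot_tau p n \<in> mc f (2 ^ (n + 1) - 1, 2 ^ n - 1)"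
  using cochains_pvar[of p f "Tau n" mot] by (simp add: mot_tau_def)

lemma chow_tau_mc:
  assumes "b \<in> cc f (w + 1 - 2 ^ n)" "p < f"
  shows "chow b * mot_tau p n \<in> mc f (2 * w + 1, w)"
  using cochains_mult[OF chow_mc[OF assms(1)] mot_tau_mc[OF assms(2), of n]] by (simp add: algebra_simps)

text \<open>For \<open>\<tau>\<^sub>n\<close> coassociativity is the associativity of the composition of series.\<close>

lemma bialg_mot: "bialg mot"
proof -
  have xi: "mot_coprod (Xi n) = chow (cop 0 n)" for n by (simp add: chow_cop)
  have tau: "mot_coprod (Tau n) = tcop 0 n" for n by (simp add: tcop_def)
  have cxi: "mot_coprod (Xi n) \<in> mc 2 (mot_gdeg (Xi n))" for n
    using chow_mc[OF cop_cochain[of 0 2 n]] unfolding xi by (simp add: algebra_simps)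
  have ctau: "mot_coprod (Tau n) \<in> mc 2 (mot_gdeg (Tau n))" for n
  proof -
    have "mot_xi 0 (n - k) ^ (2 ^ k) * mot_tau (Suc 0) k \<in> mc 2 (2 * (2 ^ n - 1) + 1, 2 ^ n - 1)"
      if k: "k \<le> n" for k
    proof -
      have "cl_xi 0 (n - k) ^ (2 ^ k) \<in> cc 2 (int (2 ^ k) * (2 ^ (n - k) - 1))"
        by (intro cc_power cl_xi_cochain) simp
      moreover have "int (2 ^ k) * (2 ^ (n - k) - 1) = (2 ^ n - 1) + 1 - 2 ^ k"
        using k by (simp add: right_diff_distrib flip: power_add)
      ultimately have "cl_xi 0 (n - k) ^ (2 ^ k) \<in> cc 2 ((2 ^ n - 1) + 1 - 2 ^ k)" by metis
      from chow_tau_mc[OF this, of "Suc 0"] show ?thesis by (simp add: psubst_power)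
    qed
    then have "(\<Sum>k\<le>n. mot_xi 0 (n - k) ^ (2 ^ k) * mot_tau (Suc 0) k) \<in> mc 2 (2 * (2 ^ n - 1) + 1, 2 ^ n - 1)"
      by (intro cochains_sum) simp
    then show ?thesis using mot_tau_mc[of 0 2 n] by (simp add: cochains_add)
  qed
  have "mot_coprod a \<in> vars_in (below 2)" for a
    using cochains_below[OF cxi] cochains_below[OF ctau] by (cases a) blast+
  moreover have "CF mot 1 (mot_coprod a) = CF mot 2 (mot_coprod a)" for a
  proof (cases a)
    case (Tau n)
    show ?thesis unfolding Tau tau by (rule tcop_coassoc)
  next
    case (Xi n)
    show ?thesis unfolding Xi xi CF_chow
      using cop_coassoc[of 0 n] by (simp add: numeral_2_eq_2)
  qed
  moreover have "mot_coprod a \<in> mc 2 (gdeg mot a)" for a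
    using cxi ctau by (cases a) auto
  ultimately show ?thesis unfolding bialg_def by (simp del: mot_coprod.simps)
qed

fun cdeg :: "(unit, mgen) tvar \<Rightarrow> nat" where
  "cdeg (Scalar s) = 2"
| "cdeg (Factor p (Tau n)) = 1"
| "cdeg (Factor p (Xi n)) = 0"

lemma cdeg_mdegree: "int (mdegree cdeg m) = fst (mdegree (vdeg mot) m) - 2 * snd (mdegree (vdeg mot) m)"
proof (induction m rule: mon_induct)
  case (var v)
  show ?case by (cases v rule: cdeg.cases) (auto simp: mdegree_single)
qed (auto simp: mdegree_add)

text \<open>The relations have Chow degree two, so below that the cobar complex is a complex of
  polynomials.\<close>

lemma rigid_mot:
  assumes "c < 2"
  shows "rigid mot (2 * w + c, w)"
proof -
  let ?A = "{m. 2 \<le> mdegree cdeg m}"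
  have R: "r \<in> sp ?A" if "r \<in> {SH p r | p r. p < f \<and> r \<in> rels mot}" for f r
  proof -
    obtain p n where r: "r = SH p (mot_tau 0 n ^ 2 - pvar (Scalar ()) * mot_xi 0 (n + 1))"
      using \<open>r \<in> _\<close> by auto
    have "r = mo (Poly_Mapping.single (Factor p (Tau n)) 2)
        + mo (Poly_Mapping.single (Scalar ()) 1 + Poly_Mapping.single (Factor p (Xi (n + 1))) 1)"
      unfolding r mo_mult[symmetric] mo_var mo_single
      by (simp add: psubst_add psubst_mult psubst_power mot_xi_def mot_tau_def psubst_pvar)
    moreover have "mo (Poly_Mapping.single (Factor p (Tau n)) 2) \<in> sp ?A"
      by (simp add: mdegree_single)
    moreover have "mo (Poly_Mapping.single (Scalar ()) 1 + Poly_Mapping.single (Factor p (Xi (n + 1))) 1) \<in> sp ?A"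
      by (simp add: mdegree_single mdegree_add)
    ultimately show ?thesis using sp_add by metis
  qed
  have D: "d * r \<in> sp ?A" if "r \<in> sp ?A" for d r
    by (rule sp_mult[of d UNIV, OF _ that]) (auto simp: sp_def mdegree_add)
  have "(\<Sum>r\<in>F. d r * r) \<in> sp ?A"
    if "F \<subseteq> {SH p r | p r. p < f \<and> r \<in> rels mot}" for F d f
  proof (rule sp_sum)
    fix r assume "r \<in> F"
    with that show "d r * r \<in> sp ?A" using R D by blast
  qed
  then have N: "null mot f \<subseteq> sp ?A" for f
    unfolding null_def ideal_generated_def by blast
  have "mc f (2 * w + c, w) \<subseteq> sp (- ?A)" for f
  proof -
    have "m \<in> - ?A" if "m \<in> cmons mot f (2 * w + c, w)" for m
      using cdeg_mdegree[of m] that assms by (auto simp: cmons_def)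
    then show ?thesis unfolding cochains_sp by (auto intro: sp_mono)
  qed
  then have "z \<in> sp (?A \<inter> - ?A)" if "z \<in> null mot f \<inter> mc f (2 * w + c, w)" for z f
    unfolding sp_Int using that N by blast
  then show ?thesis unfolding rigid_def by (auto simp: sp_empty)
qed

subsection \<open>Chow degree one\<close>


text \<open>A monomial of Chow degree one contains exactly one \<open>\<tau>\<^sub>n\<close>.  The following substitution
  prescribes values on the \<open>\<tau>\<^sub>n\<close> and forgets \<open>\<tau>\<close>.\<close>

fun lam_var :: "(nat \<Rightarrow> nat \<Rightarrow> (unit, nat) tvar fpoly) \<Rightarrow> (unit, mgen) tvar \<Rightarrow> (unit, nat) tvar fpoly" where
  "lam_var e (Scalar s) = 0"
| "lam_var e (Factor p (Tau n)) = e p n"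
| "lam_var e (Factor p (Xi n)) = pvar (Factor p n)"

lemma lam_chow: "b \<in> cc f u \<Longrightarrow> psubst (lam_var e) (chow b) = b"
  by (rule rhom_eq_on[OF rhom_comp[OF rhom_psubst rhom_psubst] rhom_id cc_vars]) (auto simp: psubst_pvar)

lemma kappa_cc: "z \<in> mc f t \<Longrightarrow> psubst (lam_var (\<lambda>_ _. 0)) z \<in> cc f (snd t)"
proof (rule rhom_cochains[OF rhom_psubst, where D = snd])
  fix p a assume pa: "p < f" "a \<in> gens mot"
  show "psubst (lam_var (\<lambda>_ _. 0)) (pvar (Factor p a)) \<in> cc f (snd (gdeg mot a))"
  proof (cases a)
    case (Xi n)
    then show ?thesis using pa cochains_pvar[of p f n cl] by (auto simp: psubst_pvar)
  qed (simp add: psubst_pvar)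
qed (auto simp: psubst_pvar)

lemma chow_kappa:
  assumes "mdegree cdeg r = 0"
  shows "chow (psubst (lam_var (\<lambda>_ _. 0)) (mo r)) = mo r"
proof (rule rhom_eq_on[OF rhom_comp[OF rhom_psubst rhom_psubst] rhom_id])
  show "mo r \<in> vars_in {v. cdeg v = 0}"
    using assms by (auto simp: vars_in_def mdegree_def in_keys_iff)
  show "chow (psubst (lam_var (\<lambda>_ _. 0)) (pvar v)) = pvar v" if "v \<in> {v. cdeg v = 0}" for v
    using that by (cases v rule: cdeg.cases) (auto simp: psubst_pvar)
qed

lemma chow1_mono:
  assumes m: "m \<in> cmons mot f (2 * w + 1, w)"
  obtains b p n where "p < f" "b \<in> cc f (w + 1 - 2 ^ n)" "mo m = chow b * mot_tau p n"
proof -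
  have c: "mdegree cdeg m = 1" using cdeg_mdegree[of m] m by (auto simp: cmons_def)
  have "\<exists>v\<in>keys m. cdeg v \<noteq> 0"
  proof (rule ccontr)
    assume "\<not> (\<exists>v\<in>keys m. cdeg v \<noteq> 0)"
    then have "mdegree cdeg m = 0" by (simp add: mdegree_def)
    then show False using c by simp
  qed
  then obtain v where v: "v \<in> keys m" "cdeg v \<noteq> 0" by blast
  define r where "r = m - Poly_Mapping.single v 1"
  have "lookup (Poly_Mapping.single v 1) u \<le> lookup m u" for u
    using v(1) by (auto simp: lookup_single when_def in_keys_iff)
  then have mr: "m = r + Poly_Mapping.single v 1"
    by (intro poly_mapping_eqI) (simp add: r_def lookup_add lookup_minus)
  have "mdegree cdeg r + cdeg v = 1" using c unfolding mr mdegree_add by (simp add: mdegree_single)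
  then have r0: "mdegree cdeg r = 0" and "cdeg v = 1" using v(2) by auto
  then obtain p n where pn: "v = Factor p (Tau n)" by (cases v rule: cdeg.cases) auto
  have "p < f" using m v(1) pn by (auto simp: cmons_def)
  moreover have "psubst (lam_var (\<lambda>_ _. 0)) (mo r) \<in> cc f (snd (mdegree (vdeg mot) r))"
  proof (rule kappa_cc)
    show "mo r \<in> mc f (mdegree (vdeg mot) r)"
      using m by (auto simp: cochains_sp cmons_def mr keys_add_mon)
  qed
  moreover have "snd (mdegree (vdeg mot) r) = w + 1 - 2 ^ n"
  proof -
    have "mdegree (vdeg mot) m = (2 * w + 1, w)" using m by (simp add: cmons_def)
    then have "mdegree (vdeg mot) r + mot_gdeg (Tau n) = (2 * w + 1, w)"
      unfolding mr mdegree_add pn by (simp add: mdegree_single)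
    then show ?thesis by (auto simp: plus_prod_def)
  qed
  moreover have "mo m = chow (psubst (lam_var (\<lambda>_ _. 0)) (mo r)) * mot_tau p n"
    unfolding chow_kappa[OF r0] mr mo_mult[symmetric] mo_var pn mot_tau_def ..
  ultimately show ?thesis using that by metis
qed

text \<open>Cochains of Chow degree one are sums of products of a classical cochain and one \<open>\<tau>\<^sub>n\<close>; the weight
  bounds \<open>n\<close>.\<close>

lemma chow1_induct [consumes 2, case_names zero tau add]:
  assumes "y \<in> mc f (2 * w + 1, w)" "w < int N" "P 0"
    and tau: "\<And>b p n. p < f \<Longrightarrow> n < N \<Longrightarrow> b \<in> cc f (w + 1 - 2 ^ n) \<Longrightarrow> P (chow b * mot_tau p n)"
    and "\<And>x y. P x \<Longrightarrow> P y \<Longrightarrow> P (x + y)"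
  shows "P y"
  using assms(1) unfolding cochains_sp
proof (induction rule: sp_induct)
  case (mo m)
  then obtain b p n where b: "p < f" "b \<in> cc f (w + 1 - 2 ^ n)" "mo m = chow b * mot_tau p n"
    by (rule chow1_mono)
  show ?case
  proof (cases "n < N")
    case False
    have "int n < 2 ^ n" using less_exp[of n] by (simp flip: of_nat_less_iff)
    then have "w + 1 - 2 ^ n < 0" using False assms(2) by linarith
    then have "b = 0" by (rule cc_nonneg[OF b(2)])
    then show ?thesis using b(3) assms(3) by simp
  qed (use b tau in simp)
qed (use assms in auto)

lemma less_int_nat: "w < int (nat (w + 1))"
  by simp

text \<open>The coefficient of \<open>\<tau>\<^sub>k\<close> in the factor \<open>q\<close>; the variable \<open>Scalar ()\<close> marks its place.\<close>

definition tcoef :: "nat \<Rightarrow> nat \<Rightarrow> (unit, mgen) tvar fpoly \<Rightarrow> (unit, nat) tvar fpoly" where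
  "tcoef q k z = lin (\<lambda>m. mo (m - Poly_Mapping.single (Scalar ()) 1))
     (psubst (lam_var (\<lambda>p n. if p = q \<and> n = k then pvar (Scalar ()) else 0)) z)"

lemma tcoef_add: "tcoef q k (x + y) = tcoef q k x + tcoef q k y"
  by (simp add: tcoef_def psubst_add lin_add)

lemma additive_tcoef: "additive (tcoef q k)"
  by (simp add: additive_def tcoef_add)

lemmas tcoef_0 [simp] = additive_0[OF additive_tcoef]
lemmas tcoef_sum = additive_sum[OF additive_tcoef]

lemma tcoef_tau:
  assumes "b \<in> cc f u"
  shows "tcoef q k (chow b * mot_tau p n) = (if p = q \<and> n = k then b else 0)"
proof -
  let ?E = "Poly_Mapping.single (Scalar ()) 1 :: cmon"
  have "lin (\<lambda>m. mo (m - ?E)) (b * mo ?E) = b"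
  proof (rule additive_eqI[of "\<lambda>b. lin (\<lambda>m. mo (m - ?E)) (b * mo ?E)" "\<lambda>b. b"])
    show "lin (\<lambda>m. mo (m - ?E)) (mo m * mo ?E) = mo m" for m :: cmon
      by (simp only: mo_mult lin_mo add_diff_cancel_right')
  qed (simp_all add: additive_def distrib_right lin_add)
  then have "lin (\<lambda>m. mo (m - ?E)) (b * pvar (Scalar ())) = b" by (simp only: mo_var)
  then show ?thesis
    by (simp add: tcoef_def psubst_mult lam_chow[OF assms] mot_tau_def psubst_pvar)
qed

lemma tcoef_cc:
  assumes "y \<in> mc f (2 * w + 1, w)"
  shows "tcoef q k y \<in> cc f (w + 1 - 2 ^ k)"
  using assms less_int_nat
proof (induction rule: chow1_induct)
  case (tau b p n)
  then show ?case by (auto simp: tcoef_tau[OF tau(3)])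
qed (auto simp: tcoef_add cochains_add)

lemma tcoef_range:
  assumes "y \<in> mc f (2 * w + 1, w)" "f \<le> q \<or> w < int k"
  shows "tcoef q k y = 0"
  using assms(1) less_int_nat
proof (induction rule: chow1_induct)
  case (tau b p n)
  then show ?case using assms(2) by (auto simp: tcoef_tau[OF tau(3)])
qed (auto simp: tcoef_add)

text \<open>The three summands: a coface behind the factor \<open>p\<close> of \<open>\<tau>\<^sub>n\<close>, or on that factor with the term
  \<open>\<tau>\<^sub>n \<otimes> 1\<close>, leaves it in place; the coface on that factor also moves it to the next one along
  \<open>\<xi>\<^sub>n\<^sub>-\<^sub>k\<^bsup>2^k\<^esup> \<otimes> \<tau>\<^sub>k\<close>; and an earlier coface shifts it.\<close>

lemma tcoef_CF:
  assumes b: "b \<in> cc f u" and p: "p < f"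
  shows "tcoef q k (CF mot i (chow b * mot_tau p n)) = CF cl i b *
     ((if p < i \<and> p = q \<and> n = k then 1 else 0)
      + (if Suc p = i \<and> Suc p = q \<and> k \<le> n then cl_xi p (n - k) ^ (2 ^ k) else 0)
      + (if i \<le> p \<and> Suc p = q \<and> n = k then 1 else 0))"
proof -
  let ?c = "CF cl i b"
  have c: "?c \<in> cc (Suc f) u" by (rule CF_cochains[OF bialg_cl b])
  have "tcoef q k (chow ?c * tcop p n) = (if p = q \<and> n = k then ?c else 0)
      + (if Suc p = q \<and> k \<le> n then ?c * cl_xi p (n - k) ^ (2 ^ k) else 0)"
  proof -
    have "chow ?c * tcop p n = chow ?c * mot_tau p n
        + (\<Sum>j\<le>n. chow (?c * cl_xi p (n - j) ^ (2 ^ j)) * mot_tau (Suc p) j)"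
      by (simp add: tcop_def distrib_left sum_distrib_left psubst_mult psubst_power mult.assoc)
    moreover have "tcoef q k (chow (?c * cl_xi p (n - j) ^ (2 ^ j)) * mot_tau (Suc p) j)
        = (if j = k then if Suc p = q then ?c * cl_xi p (n - k) ^ (2 ^ k) else 0 else 0)" for j
      using tcoef_tau[OF cochains_mult[OF c cc_power[OF cl_xi_cochain[of p "Suc f" "n - j"], of "2 ^ j"]]] p
      by simp
    ultimately show ?thesis by (simp add: tcoef_add tcoef_sum tcoef_tau[OF c])
  qed
  moreover have "CF mot i (chow b * mot_tau p n) = chow ?c * CF mot i (mot_tau p n)"
    by (simp add: psubst_mult CF_chow)
  ultimately show ?thesis
    by (auto simp: CF_tau tcoef_tau[OF c] distrib_left)
qed

lemma tcoef_CF_ge: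
  assumes "y \<in> mc f (2 * w + 1, w)" "q < i"
  shows "tcoef q k (CF mot i y) = CF cl i (tcoef q k y)"
  using assms(1) less_int_nat
proof (induction rule: chow1_induct)
  case (tau b p n)
  then show ?case using assms(2) by (auto simp: tcoef_CF[OF tau(3,1)] tcoef_tau[OF tau(3)])
qed (auto simp: tcoef_add psubst_add)

lemma tcoef_CF_lt:
  assumes "y \<in> mc f (2 * w + 1, w)" "i \<le> q"
  shows "tcoef (Suc q) k (CF mot i y) = CF cl i (tcoef q k y)"
  using assms(1) less_int_nat
proof (induction rule: chow1_induct)
  case (tau b p n)
  then show ?case using assms(2) by (auto simp: tcoef_CF[OF tau(3,1)] tcoef_tau[OF tau(3)])
qed (auto simp: tcoef_add psubst_add)

lemma tcoef_CF_eq: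
  assumes "y \<in> mc f (2 * w + 1, w)" "w < int N"
  shows "tcoef (Suc q) k (CF mot (Suc q) y)
    = (\<Sum>n\<in>{k..<N}. CF cl (Suc q) (tcoef q n y) * cl_xi q (n - k) ^ (2 ^ k))"
  using assms
proof (induction rule: chow1_induct)
  case (tau b p n)
  have "(\<Sum>m\<in>{k..<N}. CF cl (Suc q) (tcoef q m (chow b * mot_tau p n)) * cl_xi q (m - k) ^ (2 ^ k))
    = (\<Sum>m\<in>{k..<N}. if m = n then if p = q then CF cl (Suc q) b * cl_xi q (n - k) ^ (2 ^ k) else 0 else 0)"
    by (rule sum.cong) (auto simp: tcoef_tau[OF tau(3)])
  then show ?case using tau(2) by (auto simp: tcoef_CF[OF tau(3,1)])
qed (auto simp: tcoef_add psubst_add distrib_right sum.distrib)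

subsection \<open>Moving the exterior generator into the last factor\<close>

fun cd_var :: "nat \<Rightarrow> (unit, nat) tvar \<Rightarrow> (unit, nat) tvar fpoly" where
  "cd_var p (Scalar s) = pvar (Scalar s)"
| "cd_var p (Factor q n) = (if q < p then pvar (Factor q n) else if q = p then 0 else pvar (Factor (q - 1) n))"

text \<open>The counit, applied to the factor \<open>p\<close>.\<close>

abbreviation "codeg p \<equiv> psubst (cd_var p)"

lemma codeg_xi: "codeg p (cl_xi q n) = (if n = 0 then 1 else if q < p then cl_xi q n
    else if q = p then 0 else cl_xi (q - 1) n)"
  by (simp add: cl_xi_def psubst_pvar)

lemma codeg_cc: "z \<in> cc (Suc e) u \<Longrightarrow> p \<le> e \<Longrightarrow> codeg p z \<in> cc e u"
proof (rule rhom_cochains[OF rhom_psubst, where D = "\<lambda>t. t"])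
  fix q a assume "p \<le> e" "q < Suc e" "a \<in> gens cl"
  then show "codeg p (pvar (Factor q a)) \<in> cc e (gdeg cl a)"
    using cochains_pvar[of q e a cl] cochains_pvar[of "q - 1" e a cl] by (auto simp: psubst_pvar)
qed auto

lemma codeg_CF_same:
  assumes "z \<in> cc f u"
  shows "codeg p (CF cl (Suc p) z) = z"
proof (rule rhom_eq_on[OF rhom_comp[OF rhom_psubst rhom_psubst] rhom_id cc_vars[OF assms]])
  fix v :: "(unit, nat) tvar" assume "v \<in> {Factor p n | p n. p < f \<and> n \<ge> 1}"
  then obtain q n where v: "v = Factor q n" "n \<ge> 1" by blast
  have "codeg p (cop p n) = (\<Sum>k\<le>n. if k = n then cl_xi p n else 0)"
    unfolding cop_def psubst_sum psubst_mult psubst_power codeg_xi by (rule sum.cong) (auto simp: power_0_left)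
  then have "codeg p (cop p n) = pvar (Factor p n)" using v(2) by (simp add: cl_xi_def)
  then show "codeg p (CF cl (Suc p) (pvar v)) = pvar v"
    unfolding v(1) CF_pvar by (simp add: psubst_pvar)
qed

lemma codeg_CF:
  assumes "p < i"
  shows "codeg p (CF cl (Suc i) z) = CF cl i (codeg p z)"
proof (rule rhom_eqI[OF rhom_comp[OF rhom_psubst rhom_psubst] rhom_comp[OF rhom_psubst rhom_psubst]])
  fix v :: "(unit, nat) tvar"
  have c: "codeg p (cop (Suc q) n) = cop q n" if "p \<le> q" for q n
    unfolding cop_def psubst_sum psubst_mult psubst_power codeg_xi by (rule sum.cong) (use that in auto)
  have "codeg p (CF cl (Suc i) (pvar (Factor q n))) = CF cl i (codeg p (pvar (Factor q n)))" for q n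
  proof -
    consider "q < p" | "q = p" | q' where "q = Suc q'" "p \<le> q'"
      by (metis Suc_le_eq lessE less_Suc_eq_le linorder_cases)
    then show ?thesis
      by cases (use assms c in \<open>auto simp: CF_pvar psubst_pvar[of "cd_var _"]\<close>)
  qed
  then show "codeg p (CF cl (Suc i) (pvar v)) = CF cl i (codeg p (pvar v))"
    by (cases v) (simp_all add: psubst_pvar[of "cd_var _"])
qed

text \<open>The contraction is the counit on the factor \<open>p\<close>.\<close>

lemma DD_homotopy:
  assumes "z \<in> cc (Suc e) u" "DD cl (Suc p) (Suc e) z = 0" "p \<le> e"
  shows "DD cl (Suc p) e (codeg p z) = z"
proof -
  have "DD cl (Suc p) (Suc e) z = CF cl (Suc p) z + (\<Sum>i\<in>{Suc (Suc p)..Suc (Suc e)}. CF cl i z)"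
    unfolding DD_def using assms(3) by (intro sum.atLeast_Suc_atMost) simp
  also have "(\<Sum>i\<in>{Suc (Suc p)..Suc (Suc e)}. CF cl i z) = (\<Sum>i\<in>{Suc p..Suc e}. CF cl (Suc i) z)"
    by (rule sum.atLeast_Suc_atMost_Suc_shift[unfolded comp_def])
  finally have "0 = codeg p (CF cl (Suc p) z + (\<Sum>i\<in>{Suc p..Suc e}. CF cl (Suc i) z))"
    using assms(2) by simp
  also have "\<dots> = z + (\<Sum>i\<in>{Suc p..Suc e}. codeg p (CF cl (Suc i) z))"
    unfolding psubst_add psubst_sum codeg_CF_same[OF assms(1)] ..
  also have "(\<Sum>i\<in>{Suc p..Suc e}. codeg p (CF cl (Suc i) z)) = DD cl (Suc p) e (codeg p z)"
    unfolding DD_def by (rule sum.cong) (auto intro!: codeg_CF)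
  finally show ?thesis using fpoly_add_eq_0_iff by metis
qed

lemma tcoef_CF_0:
  assumes "y \<in> mc f (2 * w + 1, w)"
  shows "tcoef 0 k (CF mot 0 y) = 0"
  using assms less_int_nat
proof (induction rule: chow1_induct)
  case (tau b p n)
  then show ?case by (simp add: tcoef_CF[OF tau(3,1)])
qed (auto simp: tcoef_add psubst_add)

text \<open>If the \<open>\<tau>\<^sub>n\<close> occur only from the factor \<open>q\<close> on, then at \<open>q\<close> only the later cofaces contribute.\<close>

lemma tcoef_d:
  assumes y: "y \<in> mc f (2 * w + 1, w)" and q: "q \<le> f" and 0: "\<And>n p. q = Suc p \<Longrightarrow> tcoef p n y = 0"
  shows "tcoef q k (cobar_d mot f y) = DD cl (Suc q) f (tcoef q k y)"
proof -
  have low: "tcoef q k (CF mot i y) = 0" if "i \<le> q" for i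
  proof (cases q)
    case 0
    then show ?thesis using tcoef_CF_0[OF y] that by simp
  next
    case (Suc p)
    show ?thesis
    proof (cases "i = q")
      case True
      then show ?thesis using tcoef_CF_eq[OF y less_int_nat, of p k] 0[OF Suc] unfolding Suc by simp
    next
      case False
      then show ?thesis using tcoef_CF_lt[OF y, of i p k] 0[OF Suc] that unfolding Suc by simp
    qed
  qed
  have "{..f + 1} = {..q} \<union> {Suc q..Suc f}" "{..q} \<inter> {Suc q..Suc f} = {}" using q by auto
  then have "tcoef q k (cobar_d mot f y)
      = (\<Sum>i\<le>q. tcoef q k (CF mot i y)) + (\<Sum>i\<in>{Suc q..Suc f}. tcoef q k (CF mot i y))"
    unfolding cobar_d_def tcoef_sum by (simp only: sum.union_disjoint finite_atMost finite_atLeastAtMost)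
  also have "(\<Sum>i\<le>q. tcoef q k (CF mot i y)) = 0" using low by simp
  also have "(\<Sum>i\<in>{Suc q..Suc f}. tcoef q k (CF mot i y)) = DD cl (Suc q) f (tcoef q k y)"
    unfolding DD_def by (rule sum.cong) (auto intro!: tcoef_CF_ge[OF y])
  finally show ?thesis by simp
qed

lemma d_mc: "y \<in> mc f t \<Longrightarrow> cobar_d mot f y \<in> mc (Suc f) t"
  by (rule cobar_d_cochains[OF bialg_mot])

lemma mot_d_add: "cobar_d mot f (x + y) = cobar_d mot f x + cobar_d mot f y"
  by (simp add: cobar_d_DD DD_add)

text \<open>Where the \<open>\<tau>\<^sub>n\<close> first occur their coefficients are cocycles for the later cofaces, hence
  boundaries; subtracting a coboundary moves the first occurrence by one factor.\<close>

lemma push_tau: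
  assumes y: "y \<in> mc (Suc e) (2 * w + 1, w)"
    and 0: "\<And>q k. q \<le> e \<Longrightarrow> tcoef q k (cobar_d mot (Suc e) y) = 0"
    and "p \<le> e"
  shows "\<exists>y'\<in>mc (Suc e) (2 * w + 1, w). cobar_d mot (Suc e) y' = cobar_d mot (Suc e) y \<and>
    (\<forall>q<p. \<forall>k. tcoef q k y' = 0)"
  using \<open>p \<le> e\<close>
proof (induction p)
  case 0
  then show ?case using y by blast
next
  case (Suc p)
  then obtain y' where y': "y' \<in> mc (Suc e) (2 * w + 1, w)" "cobar_d mot (Suc e) y' = cobar_d mot (Suc e) y"
    "\<And>q k. q < p \<Longrightarrow> tcoef q k y' = 0" by auto
  let ?a = "\<lambda>n. codeg p (tcoef p n y')"
  define b where "b = (\<Sum>n<nat (w + 1). chow (?a n) * mot_tau p n)"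
  have a: "?a n \<in> cc e (w + 1 - 2 ^ n)" for n
    using codeg_cc[OF tcoef_cc[OF y'(1)]] Suc.prems by simp
  have b: "b \<in> mc e (2 * w + 1, w)"
    unfolding b_def using Suc.prems by (intro cochains_sum chow_tau_mc a) simp
  have tb: "tcoef q k b = (if q = p then ?a k else 0)" for q k
  proof -
    have "tcoef q k b = (\<Sum>n<nat (w + 1). if n = k then if q = p then ?a k else 0 else 0)"
      unfolding b_def tcoef_sum by (rule sum.cong) (auto simp: tcoef_tau[OF a])
    moreover have "?a k = 0" if "k \<ge> nat (w + 1)"
    proof -
      have "w < int k" using that by linarith
      then show ?thesis using tcoef_range[OF y'(1), of p k] by simp
    qed
    ultimately show ?thesis by simp
  qed
  have DDp: "DD cl (Suc p) (Suc e) (tcoef p k y') = 0" for k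
    using tcoef_d[OF y'(1), of p k] 0[of p k] y'(3) Suc.prems unfolding y'(2) by auto
  have db: "tcoef q k (cobar_d mot e b) = tcoef q k y'" if "q < Suc p" for q k
  proof -
    have "tcoef q k (cobar_d mot e b) = DD cl (Suc q) e (tcoef q k b)"
      using that Suc.prems by (intro tcoef_d[OF b]) (auto simp: tb)
    also have "\<dots> = tcoef q k y'"
      using DD_homotopy[OF tcoef_cc[OF y'(1)] DDp] Suc.prems that y'(3)[of q k] by (auto simp: tb)
    finally show ?thesis .
  qed
  show ?case
  proof (intro bexI conjI)
    show "y' + cobar_d mot e b \<in> mc (Suc e) (2 * w + 1, w)" by (rule cochains_add[OF y'(1) d_mc[OF b]])
    show "cobar_d mot (Suc e) (y' + cobar_d mot e b) = cobar_d mot (Suc e) y"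
      by (simp add: mot_d_add y'(2) cobar_d_cobar_d[OF bialg_mot])
    show "\<forall>q<Suc p. \<forall>k. tcoef q k (y' + cobar_d mot e b) = 0" by (simp add: tcoef_add db)
  qed
qed

text \<open>A cochain with all \<open>\<tau>\<^sub>n\<close> in the last factor is a cochain with coefficients in the
  exterior quotient; the differential on its coefficients is twisted by the coaction on \<open>\<tau>\<^sub>n\<close>.\<close>

lemma last_factor:
  assumes y: "y \<in> mc (Suc e) (2 * w + 1, w)" and 0: "\<And>q k. q < e \<Longrightarrow> tcoef q k y = 0"
    and d: "\<And>k. tcoef e k (cobar_d mot (Suc e) y) = 0" and N: "w < int N"
  shows "tcoef e k y \<in> cc e (w + 1 - 2 ^ k)"
    "tcoef (Suc e) k (cobar_d mot (Suc e) y) = cobar_d cl e (tcoef e k y)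
      + (\<Sum>n\<in>{Suc k..<N}. tcoef e n y * cl_xi e (n - k) ^ (2 ^ k))"
proof -
  have c: "tcoef e n y \<in> cc (Suc e) (w + 1 - 2 ^ n)" for n by (rule tcoef_cc[OF y])
  have f: "tcoef e n y \<in> cc e (w + 1 - 2 ^ n)" for n
  proof -
    have g: "codeg e (tcoef e n y) \<in> cc e (w + 1 - 2 ^ n)" by (rule codeg_cc[OF c]) simp
    have "DD cl (Suc e) (Suc e) (tcoef e n y) = 0"
      using tcoef_d[OF y, of e n] d[of n] 0 by simp
    from DD_homotopy[OF c this] have "CF cl (Suc e) (codeg e (tcoef e n y)) = tcoef e n y"
      by (simp add: DD_def)
    moreover have "CF cl (Suc e) (codeg e (tcoef e n y)) = codeg e (tcoef e n y)"
      by (rule CF_fix[OF cochains_below[OF g]]) simp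
    ultimately show ?thesis using g by simp
  qed
  have fixed: "CF cl (Suc e) (tcoef e n y) = tcoef e n y" for n
    by (rule CF_fix[OF cochains_below[OF f]]) simp
  show "tcoef e k y \<in> cc e (w + 1 - 2 ^ k)" by (rule f)
  let ?S = "\<Sum>n\<in>{Suc k..<N}. tcoef e n y * cl_xi e (n - k) ^ (2 ^ k)"
  have "(\<Sum>n\<in>{k..<N}. tcoef e n y * cl_xi e (n - k) ^ (2 ^ k)) = tcoef e k y + ?S"
  proof (cases "k < N")
    case True
    then show ?thesis by (simp add: sum.atLeast_Suc_lessThan)
  next
    case False
    then have "tcoef e k y = 0" using tcoef_range[OF y, of e k] N by simp
    then show ?thesis using False by simp
  qed
  then have top: "tcoef (Suc e) k (CF mot (Suc e) y) = tcoef e k y + ?S"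
    using tcoef_CF_eq[OF y N, of e k] by (simp add: fixed)
  have last: "tcoef (Suc e) k (CF mot (Suc (Suc e)) y) = 0"
    using tcoef_CF_ge[OF y, of "Suc e" "Suc (Suc e)" k] tcoef_range[OF y, of "Suc e" k] by simp
  have "tcoef (Suc e) k (cobar_d mot (Suc e) y) = (\<Sum>i\<le>e. tcoef (Suc e) k (CF mot i y))
      + tcoef (Suc e) k (CF mot (Suc e) y) + tcoef (Suc e) k (CF mot (Suc (Suc e)) y)"
    by (simp add: cobar_d_def tcoef_add tcoef_sum)
  also have "(\<Sum>i\<le>e. tcoef (Suc e) k (CF mot i y)) = (\<Sum>i\<le>e. CF cl i (tcoef e k y))"
    by (rule sum.cong) (auto simp: tcoef_CF_lt[OF y])
  also have "\<dots> = cobar_d cl e (tcoef e k y) + tcoef e k y"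
    by (simp add: cobar_d_def fixed)
  finally show "tcoef (Suc e) k (cobar_d mot (Suc e) y) = cobar_d cl e (tcoef e k y) + ?S"
    unfolding top last by (simp add: add_ac)
qed

text \<open>Coefficients of \<open>\<tau>\<^sub>n\<close> with \<open>n \<ge> 2\<close> can be removed one after the other, starting with the largest
  \<open>n\<close>, as the leading one is a cocycle in a group that vanishes.\<close>

lemma h0_divisible:
  assumes X: "X \<in> cc (Suc (Suc e)) w" "cobar_d cl (Suc (Suc e)) X = 0"
    and y0: "y0 \<in> mc (Suc (Suc e)) (2 * w + 1, w)"
    and eq: "cup (Suc 0) (mot_tau 0 0) (chow X) = cobar_d mot (Suc (Suc e)) y0"
    and vanish: "\<And>n z. n \<ge> 2 \<Longrightarrow> z \<in> cc (Suc e) (w + 1 - 2 ^ n) \<Longrightarrow> cobar_d cl (Suc e) z = 0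
        \<Longrightarrow> bdry cl (Suc e) (w + 1 - 2 ^ n) z"
  shows "\<exists>a\<in>cc (Suc e) w. \<exists>b\<in>cc (Suc e) (w - 1). cobar_d cl (Suc e) b = 0 \<and>
    X = cobar_d cl (Suc e) a + cup (Suc e) b xx"
proof -
  let ?F = "Suc (Suc e)" and ?t = "(2 * w + 1, w)"
  let ?R = "chow X * mot_tau ?F 0"
  have tR: "tcoef q k ?R = (if q = ?F \<and> k = 0 then X else 0)" for q k
    using tcoef_tau[OF X(1), of q k ?F 0] by auto
  have m: "mot_tau p 0 = pvar (Factor p (Tau 0))" for p by (simp add: mot_tau_def)
  let ?T = "\<Sum>p<?F. pvar (Factor p (Tau 0)) :: (unit, mgen) tvar fpoly"
  have "cobar_d mot ?F (?T * chow X) = cup (Suc 0) (mot_tau 0 0) (chow X) + cup ?F (chow X) (mot_tau 0 0)"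
    using cobar_d_primitive_sum[of mot "Tau 0" "chow X" ?F] cochains_below[OF chow_mc[OF X(1)]]
    by (simp add: d_chow X(2) m)
  then have R0: "cobar_d mot ?F (y0 + ?T * chow X) = ?R"
    unfolding mot_d_add eq[symmetric] by (simp add: cup_def)
  have "?T \<in> mc ?F (1, 0)"
    using cochains_pvar[of _ ?F "Tau 0" mot] by (intro cochains_sum) simp
  from cochains_mult[OF this chow_mc[OF X(1)]] have "?T * chow X \<in> mc ?F ?t" by (simp add: add.commute)
  then have y1: "y0 + ?T * chow X \<in> mc ?F ?t" by (rule cochains_add[OF y0])
  \<comment> \<open>Larger \<open>\<tau>\<^sub>n\<close> have too much weight; the summand \<open>2\<close> leaves room for \<open>\<tau>\<^sub>0\<close> and \<open>\<tau>\<^sub>1\<close>.\<close>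
  define N where "N = nat (w + 1) + 2"
  have N: "w < int N" "2 \<le> N" by (auto simp: N_def)
  have "\<exists>y\<in>mc ?F ?t. cobar_d mot ?F y = ?R \<and> (\<forall>q<Suc e. \<forall>k. tcoef q k y = 0) \<and>
    (\<forall>n\<ge>i. tcoef (Suc e) n y = 0)" if "2 \<le> i" "i \<le> N" for i
    using that(2,1)
  proof (induction i rule: inc_induct)
    case base
    have "\<exists>y\<in>mc ?F ?t. cobar_d mot ?F y = cobar_d mot ?F (y0 + ?T * chow X) \<and> (\<forall>q<Suc e. \<forall>k. tcoef q k y = 0)"
      by (rule push_tau[OF y1]) (simp_all only: R0 tR, simp)
    then obtain y where y: "y \<in> mc ?F ?t" "cobar_d mot ?F y = ?R" "\<forall>q<Suc e. \<forall>k. tcoef q k y = 0"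
      unfolding R0 by blast
    moreover have "\<forall>n\<ge>N. tcoef (Suc e) n y = 0" using tcoef_range[OF y(1)] N(1) by auto
    ultimately show ?case by blast
  next
    case (step i)
    then obtain y where y: "y \<in> mc ?F ?t" "cobar_d mot ?F y = ?R" "\<And>q k. q < Suc e \<Longrightarrow> tcoef q k y = 0"
      "\<And>n. n \<ge> Suc i \<Longrightarrow> tcoef (Suc e) n y = 0" by (metis le_SucI)
    let ?Y = "tcoef (Suc e) i y"
    have lf: "?Y \<in> cc (Suc e) (w + 1 - 2 ^ i)"
      "tcoef ?F i ?R = cobar_d cl (Suc e) ?Y + (\<Sum>n\<in>{Suc i..<N}. tcoef (Suc e) n y * cl_xi (Suc e) (n - i) ^ (2 ^ i))"
      using last_factor[OF y(1,3) _ N(1), of i] unfolding y(2) tR by auto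
    have "cobar_d cl (Suc e) ?Y = 0" using lf(2) step.prems y(4) unfolding tR by simp
    with lf(1) step.prems obtain z where z: "z \<in> cc e (w + 1 - 2 ^ i)" "?Y = cobar_d cl e z"
      using bdryE[OF vanish] by blast
    \<comment> \<open>Its coboundary has leading coefficient \<open>d z\<close> and cancels the one of \<open>y\<close>.\<close>
    let ?b = "chow z * mot_tau e i"
    have b: "?b \<in> mc (Suc e) ?t" by (rule chow_tau_mc[OF cochains_mono[OF z(1)]]) simp_all
    have tb: "tcoef q k ?b = (if q = e \<and> k = i then z else 0)" for q k
      using tcoef_tau[OF z(1), of q k e i] by auto
    have "DD cl (Suc e) (Suc e) z = 0"
      using CF_fix[OF cochains_below[OF z(1)], of _ cl] by (simp add: DD_def)
    then have b0: "tcoef q k (cobar_d mot (Suc e) ?b) = 0" if "q < Suc e" for q k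
      using that tcoef_d[OF b, of q k] by (auto simp: tb)
    have b1: "tcoef (Suc e) n (cobar_d mot (Suc e) ?b) = (if n = i then ?Y else 0)" if "n \<ge> i" for n
    proof -
      have "tcoef (Suc e) n (cobar_d mot (Suc e) ?b) = cobar_d cl e (tcoef e n ?b)
          + (\<Sum>m\<in>{Suc n..<N}. tcoef e m ?b * cl_xi e (m - n) ^ (2 ^ n))"
        by (rule last_factor(2)[OF b _ _ N(1)]) (auto simp: tb b0)
      moreover have "(\<Sum>m\<in>{Suc n..<N}. tcoef e m ?b * cl_xi e (m - n) ^ (2 ^ n)) = 0"
        using that by (intro sum.neutral) (auto simp: tb)
      ultimately show ?thesis by (simp add: tb z(2))
    qed
    show ?case
    proof (intro bexI conjI)
      show "y + cobar_d mot (Suc e) ?b \<in> mc ?F ?t" by (rule cochains_add[OF y(1) d_mc[OF b]])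
      show "cobar_d mot ?F (y + cobar_d mot (Suc e) ?b) = ?R"
        by (simp add: mot_d_add y(2) cobar_d_cobar_d[OF bialg_mot])
      show "\<forall>q<Suc e. \<forall>k. tcoef q k (y + cobar_d mot (Suc e) ?b) = 0"
        by (simp add: tcoef_add b0 y(3))
      show "\<forall>n\<ge>i. tcoef (Suc e) n (y + cobar_d mot (Suc e) ?b) = 0"
        using y(4) by (auto simp: tcoef_add b1)
    qed
  qed
  then obtain y where y: "y \<in> mc ?F ?t" "cobar_d mot ?F y = ?R" "\<And>q k. q < Suc e \<Longrightarrow> tcoef q k y = 0"
    "\<And>n. n \<ge> 2 \<Longrightarrow> tcoef (Suc e) n y = 0" using N(2) by (metis order_refl)
  let ?a = "tcoef (Suc e) 0 y" and ?b = "tcoef (Suc e) 1 y"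
  have lf: "tcoef (Suc e) k y \<in> cc (Suc e) (w + 1 - 2 ^ k)"
    "tcoef ?F k ?R = cobar_d cl (Suc e) (tcoef (Suc e) k y)
      + (\<Sum>n\<in>{Suc k..<N}. tcoef (Suc e) n y * cl_xi (Suc e) (n - k) ^ (2 ^ k))" for k
    using last_factor[OF y(1,3) _ N(1), of k] unfolding y(2) tR by auto
  have a: "?a \<in> cc (Suc e) w" "?b \<in> cc (Suc e) (w - 1)" using lf(1)[of 0] lf(1)[of 1] by simp_all
  have "(\<Sum>n\<in>{Suc 1..<N}. tcoef (Suc e) n y * cl_xi (Suc e) (n - 1) ^ (2 ^ 1)) = 0"
    using y(4) by (intro sum.neutral) auto
  then have db: "cobar_d cl (Suc e) ?b = 0" using lf(2)[of 1] unfolding tR by simp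
  have "{Suc 0..<N} = insert 1 {2..<N}" using N(2) by auto
  then have "(\<Sum>n\<in>{Suc 0..<N}. tcoef (Suc e) n y * cl_xi (Suc e) (n - 0) ^ (2 ^ 0))
      = ?b * cl_xi (Suc e) 1 + (\<Sum>n\<in>{2..<N}. tcoef (Suc e) n y * cl_xi (Suc e) (n - 0) ^ (2 ^ 0))"
    by simp
  also have "(\<Sum>n\<in>{2..<N}. tcoef (Suc e) n y * cl_xi (Suc e) (n - 0) ^ (2 ^ 0)) = 0"
    using y(4) by (intro sum.neutral) auto
  finally have "X = cobar_d cl (Suc e) ?a + cup (Suc e) ?b xx"
    using lf(2)[of 0] unfolding tR by (simp add: cup_def cl_xi_def psubst_pvar)
  then show ?thesis using a db by blast
qed

section \<open>The product with \<open>h\<^sub>0\<close>\<close>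

lemma bdry_chow: "bdry cl f t z \<Longrightarrow> bdry mot f (2 * t, t) (chow z)"
proof (cases f)
  case (Suc e)
  assume "bdry cl f t z"
  then obtain y where "y \<in> cc e t" "z = cobar_d cl e y" unfolding Suc by (rule bdryE)
  then show ?thesis using bdry_d[OF chow_mc[of y e t]] by (simp add: Suc d_chow)
qed (simp add: bdry_def)

lemma chow_iso_class:
  assumes x: "x \<in> cc f t"
  shows "chow_iso (ext_class cl f t x) = ext_class mot f (2 * t, t) (chow x)"
proof -
  have r: "rigid mot (2 * t, t)" using rigid_mot[of 0 t] by simp
  have "{z \<in> mc f (2 * t, t). \<exists>x'\<in>{z'. bdry cl f t (z' + x)}. z - chow x' \<in> coboundaries mot f (2 * t, t)}
      = {z'. bdry mot f (2 * t, t) (z' + chow x)}" (is "?A = ?B")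
  proof
    show "?A \<subseteq> ?B"
    proof
      fix z assume "z \<in> ?A"
      then obtain x' where x': "bdry cl f t (x' + x)" "bdry mot f (2 * t, t) (z + chow x')"
        by (auto simp: coboundaries_rigid[OF bialg_mot r])
      have "bdry mot f (2 * t, t) ((z + chow x') + (chow x' + chow x))"
        using bdry_add[OF x'(2) bdry_chow[OF x'(1)]] by (simp only: psubst_add)
      then show "z \<in> ?B" by (simp add: add.assoc)
    qed
    show "?B \<subseteq> ?A"
    proof
      fix z assume "z \<in> ?B"
      then have z: "bdry mot f (2 * t, t) (z + chow x)" by simp
      have "z + chow x + chow x \<in> mc f (2 * t, t)"
        by (rule cochains_add[OF bdry_cochains[OF bialg_mot z] chow_mc[OF x]])
      then show "z \<in> ?A" using z by (auto simp: coboundaries_rigid[OF bialg_mot r] add.assoc intro!: exI[of _ x])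
    qed
  qed
  then show ?thesis
    by (simp add: ext_class_rigid[OF bialg_cl rigid_cl x] ext_class_rigid[OF bialg_mot r chow_mc[OF x]])
qed

text \<open>After reversal, a division of \<open>h\<^sub>1\<close> times the periodicity family by \<open>h\<^sub>0\<close> would make that
  product vanish with coefficients in the extension, because the quotient lies in a group that vanishes there.\<close>

lemma not_h0_divisible:
  assumes q: "q \<in> cc 4 12" "cobar_d cl 4 q = cup 4 h04 (xx ^ 8)" and x: "periodic q k x"
    and a: "a \<in> cc (4 * k + 1) (12 * int k + 4)"
    and b: "b \<in> cc (4 * k + 1) (12 * int k + 3)" "cobar_d cl (4 * k + 1) b = 0"
  shows "cup (Suc 0) (xx ^ 2) x \<noteq> cobar_d cl (4 * k + 1) a + cup (4 * k + 1) b xx"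
proof
  assume eq: "cup (Suc 0) (xx ^ 2) x = cobar_d cl (4 * k + 1) a + cup (4 * k + 1) b xx"
  let ?f = "4 * k + 1"
  let ?a = "flip ?f a" and ?b = "flip ?f b"
  note xc = periodic_cocycle[OF q x]
  have "flip (Suc 0 + ?f) (cup (Suc 0) (xx ^ 2) x) = cup ?f (flip ?f x) (xx ^ 2)"
    unfolding flip_cup[OF xx_cc(1) xc(1)] flip_xx ..
  moreover have "flip (?f + Suc 0) (cup ?f b xx) = cup (Suc 0) xx ?b"
    unfolding flip_cup[OF b(1) xx_cc(2)] using flip_xx[of 1] by simp
  ultimately have feq: "cup ?f (flip ?f x) (xx ^ 2) = cobar_d cl ?f ?a + cup (Suc 0) xx ?b"
    using arg_cong[OF eq, of "flip (Suc ?f)"] by (simp add: psubst_add flip_d[OF a, simplified])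
  have fa: "?a \<in> cc ?f (12 * int k + 4)" and fb: "?b \<in> cc ?f (12 * int k + 3)"
    by (rule flip_cc[OF a], rule flip_cc[OF b(1)])
  have dfb: "cobar_d cl ?f ?b = 0" using flip_d[OF b(1)] unfolding b(2) by simp
  let ?T = "\<Sum>p<?f. pvar (Factor p (Suc 0)) :: (unit, nat) tvar fpoly"
  have "coprod cl (Suc 0) = pvar (Factor 0 (Suc 0)) + pvar (Factor 1 (Suc 0))"
    by (simp add: cl_xi_def)
  from cobar_d_primitive_sum[OF this cochains_below[OF fb], unfolded dfb]
  have comm: "cup (Suc 0) xx ?b = cobar_d cl ?f (?T * ?b) + cup ?f ?b xx"
    by (simp add: add_ac)
  have T: "?T * ?b \<in> cc ?f (12 * int k + 4)"
  proof -
    have "?T \<in> cc ?f 1" using cochains_pvar[of _ ?f "Suc 0" cl] by (intro cochains_sum) simp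
    from cochains_mult[OF this fb] show ?thesis by (simp add: add.commute)
  qed
  have ex: "exact dd KD1 (Suc (4 * k)) (12 * int k + 3)" using exact_KD1_stem_2[of k] by simp
  have "SH (Suc 0) ?b \<in> KD1 (Suc (4 * k)) (12 * int k + 3)" "dd (Suc (4 * k)) (SH (Suc 0) ?b) = 0"
    using SH_KD1[OF fb] dfb by (simp_all add: dd_SH)
  then obtain v where v: "v \<in> KD1 (4 * k) (12 * int k + 3)" "SH (Suc 0) ?b = dd (4 * k) v"
    by (rule exact_SucD[OF ex])
  have dv: "dd ?f (cup ?f v xx) = SH (Suc 0) (cup ?f ?b xx)"
    using dd_cup[OF KD_KG[OF KD1_KD[OF v(1)]], of "Suc 0" xx] xx_closed[of 0] by (simp add: SH_cup v(2)[symmetric])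
  have kv: "cup ?f v xx \<in> KD1 ?f (12 * int k + 4)"
    using KD1_cup[OF v(1) xx_cc(2)] by (simp add: add.commute)
  let ?w = "SH (Suc 0) (?a + ?T * ?b) + cup ?f v xx"
  have "SH (Suc 0) (cup ?f (flip ?f x) (xx ^ 2)) = dd ?f ?w"
    unfolding feq comm dd_add dd_SH dv by (simp add: psubst_add d_add add_ac)
  moreover have "?w \<in> KD1 ?f (12 * int k + 4)"
    using SH_KD1[OF cochains_add[OF fa T]] kv by (simp add: KD1_def KG_add Sq1_add Sq2_add)
  ultimately show False using periodic_h1_nonzero[OF q x] by blast
qed

theorem proposition6p9:
  fixes k :: nat
  assumes "k \<ge> 1"
  shows "mot_h 0 \<odot> mot_h 2 \<odot> mot_h2g k
           \<in> mot_ext (20 * int k + 6) (4 * k + 3) (12 * int k + 4)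
         \<and> mot_h 0 \<odot> mot_h 2 \<odot> mot_h2g k
           \<noteq> mot_zero (20 * int k + 6) (4 * k + 3) (12 * int k + 4)"
proof -
  obtain q where q: "q \<in> cc 4 12" "cobar_d cl 4 q = cup 4 h04 (xx ^ 8)" using h04_h3_zero by blast
  obtain x where x: "periodic q k x" "(adams_P ^^ k) (cl_h 1) = ext_class cl (4 * k + 1) (12 * int k + 2) x"
    using adams_P_periodic[OF q] by blast
  note xc = periodic_cocycle[OF q x(1)]
  let ?X = "cup (Suc 0) (xx ^ 2) x" and ?\<tau> = "mot_tau 0 0" and ?F = "4 * k + 2"
  let ?w = "12 * int k + 4"
  have r: "rigid mot (1, 0)" "rigid mot (4, 2)" "rigid mot (5, 2)" "rigid mot (2 * (12 * int k + 2), 12 * int k + 2)"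
    "rigid mot (24 * int k + 9, ?w)"
    using rigid_mot[of 1 0] rigid_mot[of 0 2] rigid_mot[of 1 2] rigid_mot[of 0 "12 * int k + 2"] rigid_mot[of 1 ?w]
    by (simp_all add: algebra_simps)
  have h0: "mot_h 0 = ext_class mot (Suc 0) (1, 0) ?\<tau>" by (simp add: mot_h_def)
  have h2: "mot_h 2 = ext_class mot (Suc 0) (4, 2) (chow (xx ^ 2))"
    by (simp add: mot_h_def mot_xi_def psubst_power psubst_pvar)
  have hg: "mot_h2g k = ext_class mot (4 * k + 1) (2 * (12 * int k + 2), 12 * int k + 2) (chow x)"
    unfolding mot_h2g_def x(2) by (rule chow_iso_class[OF xc(1)])
  have c0: "?\<tau> \<in> mc (Suc 0) (1, 0)" using mot_tau_mc[of 0 "Suc 0" 0] by simp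
  have d0: "cobar_d mot (Suc 0) ?\<tau> = 0"
    by (simp add: cobar_d_def CF_tau tcop_def add_ac)
  have c2: "chow (xx ^ 2) \<in> mc (Suc 0) (4, 2)" using chow_mc[OF xx_cc(1)[of 2]] by simp
  have d2: "cobar_d mot (Suc 0) (chow (xx ^ 2)) = 0" unfolding d_chow xx_closed_2 by simp
  have c02: "cup (Suc 0) ?\<tau> (chow (xx ^ 2)) \<in> mc (Suc 0 + Suc 0) (5, 2)"
    using cup_cochains[OF c0 c2] by simp
  have d02: "cobar_d mot (Suc 0 + Suc 0) (cup (Suc 0) ?\<tau> (chow (xx ^ 2))) = 0"
    by (rule cup_cocycle[OF c0 d0 d2])
  have cg: "chow x \<in> mc (4 * k + 1) (2 * (12 * int k + 2), 12 * int k + 2)" by (rule chow_mc[OF xc(1)])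
  have dg: "cobar_d mot (4 * k + 1) (chow x) = 0" unfolding d_chow xc(2) by simp
  have h02: "mot_h 0 \<odot> mot_h 2 = ext_class mot (Suc 0 + Suc 0) (5, 2) (cup (Suc 0) ?\<tau> (chow (xx ^ 2)))"
    unfolding h0 h2 using ext_mult_class[OF bialg_mot r(1,2) _ c0 d0 c2 d2] r(3) by simp
  let ?z = "cup (Suc 0 + Suc 0) (cup (Suc 0) ?\<tau> (chow (xx ^ 2))) (chow x)"
  have f: "Suc 0 + Suc 0 + (4 * k + 1) = 4 * k + 3" by simp
  have t: "(5, 2) + (2 * (12 * int k + 2), 12 * int k + 2) = (24 * int k + 9, ?w)" by simp
  have prod: "mot_h 0 \<odot> mot_h 2 \<odot> mot_h2g k = ext_class mot (4 * k + 3) (24 * int k + 9, ?w) ?z"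
    unfolding h02 hg
    using ext_mult_class[OF bialg_mot r(3,4) _ c02 d02 cg dg] r(5) unfolding t f by blast
  have cz: "?z \<in> mc (4 * k + 3) (24 * int k + 9, ?w)" using cup_cochains[OF c02 cg] unfolding t f .
  have dz: "cobar_d mot (4 * k + 3) ?z = 0" using cup_cocycle[OF c02 d02 dg] unfolding f .
  have s: "20 * int k + 6 + int (4 * k + 3) = 24 * int k + 9" by simp
  have z: "?z = cup (Suc 0) ?\<tau> (chow ?X)"
    unfolding cup_assoc cup_chow ..
  have "\<not> bdry mot (4 * k + 3) (24 * int k + 9, ?w) ?z"
  proof
    assume "bdry mot (4 * k + 3) (24 * int k + 9, ?w) ?z"
    then obtain y where y: "y \<in> mc (Suc (Suc (4 * k))) (2 * ?w + 1, ?w)"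
      "cup (Suc 0) ?\<tau> (chow ?X) = cobar_d mot (Suc (Suc (4 * k))) y"
      unfolding z by (auto simp: bdry_def numeral_3_eq_3 add.commute)
    have X: "?X \<in> cc (Suc (Suc (4 * k))) ?w" "cobar_d cl (Suc (Suc (4 * k))) ?X = 0"
      using cup_cochains[OF xx_cc(1)[of 2] xc(1)] cup_cocycle[OF xx_cc(1)[of 2] xx_closed_2 xc(2)]
      by (simp_all add: add.commute)
    have v: "bdry cl (Suc (4 * k)) (?w + 1 - 2 ^ n) u"
      if "n \<ge> 2" "u \<in> cc (Suc (4 * k)) (?w + 1 - 2 ^ n)" "cobar_d cl (Suc (4 * k)) u = 0" for n u
    proof -
      have "(2::int) ^ n \<ge> 2 ^ 2" using that(1) by (intro power_increasing) auto
      moreover have "?w + 1 - 2 ^ n \<noteq> 4 * int k + 1"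
      \<comment> \<open>\<open>8k + 4\<close> is four times an odd number greater than one, hence not a power of two.\<close>
      proof
        assume "?w + 1 - 2 ^ n = 4 * int k + 1"
        then have p: "8 * int k + 4 = 2 ^ n" by linarith
        obtain j where j: "n = 2 + j" using le_Suc_ex[OF \<open>n \<ge> 2\<close>] by blast
        have "2 * int k + 1 = 2 ^ j" using p unfolding j power_add by simp
        moreover have "j \<noteq> 0" using calculation assms by (intro notI) simp
        ultimately have "even (2 * int k + 1)" by simp
        then show False by simp
      qed
      ultimately show ?thesis using bdry_edge[of "?w + 1 - 2 ^ n" k u] that by simp
    qed
    obtain a b where "a \<in> cc (Suc (4 * k)) ?w" "b \<in> cc (Suc (4 * k)) (?w - 1)"
      "cobar_d cl (Suc (4 * k)) b = 0" "?X = cobar_d cl (Suc (4 * k)) a + cup (Suc (4 * k)) b xx"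
      using h0_divisible[OF X y v] by blast
    then show False using not_h0_divisible[OF q x(1), of a b] by (simp add: add.commute)
  qed
  then have "mot_h 0 \<odot> mot_h 2 \<odot> mot_h2g k \<noteq> mot_zero (20 * int k + 6) (4 * k + 3) ?w"
    unfolding prod mot_zero_def s using ext_class_eq_iff[OF bialg_mot r(5) cz cochains_0] by simp
  moreover have "mot_h 0 \<odot> mot_h 2 \<odot> mot_h2g k \<in> mot_ext (20 * int k + 6) (4 * k + 3) ?w"
    unfolding prod mot_ext_def ext_group_def s using cz dz by (simp add: cocycles_rigid[OF bialg_mot r(5)])
  ultimately show ?thesis by blast
qed

end
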